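(* In the cluster model with reference measure $Q$, model measure $P$ and observations $O=N+C$ described in the context, let $f$ be an arbitrary real-valued function of $(h,\eta)$, and set $$\phi(f,s)=E^Q[f(h_s,\eta_s)L(s)\mid\mathcal F_s^O],\qquad \pi(f,s)=E^P[f(h_s,\eta_s)\mid\mathcal F_s^O]=\frac{\phi(f,s)}{\phi(1,s)} .$$ With $q=1-p$ and $\alpha(h_s,\eta_s)=\mathbf 1_{\{D_s=1\}}=D_s$, for $u\in E$, $s\ge0$ let $$f_{\mathrm{new}}=[1-\alpha(\cdot,\cdot)]\,f(\cdot+\delta_{(1,s)},\cdot+\delta_{(u,s)})+\alpha(\cdot,\cdot)\bigl[p\,f(\cdot+\delta_{(0,s)},\cdot+\delta_{(u,s)})+q\,f(\cdot+\delta_{(1,s)},\cdot+\delta_{(u,s)})\bigr].$$ Then $\phi$ and $\pi$ satisfy, for all $t\ge 0$ (almost surely), the stochastic integral equations $$\phi(f,t)=\phi(f,0)-\int_{E\times[0,t]}\phi\bigl(f(\cdot,\cdot)[\lambda(u,s,\cdot,\cdot)-\lambda_Q(u,s)],s\bigr)\,\nu(du)\,ds$$ $$\qquad+\int_{E\times[0,t]}\phi\Bigl(f_{\mathrm{new}}\frac{\lambda(u,s,\cdot,\cdot)}{\lambda_Q(u,s)}-f(\cdot,\cdot),\,s-\Bigr)\frac{\lambda_Q(u,s)}{\lambda_Q(u,s)+\gamma(u,s)}\,O(du\times ds)$$ and $$\pi(f,t)=\pi(f,0)+\int_{E\times[0,t]}\frac{\pi(f_{\mathrm{new}}\lambda(u,s,\cdot,\cdot),s-)-\pi(\lambda(u,s,\cdot,\cdot),s-)\,\pi(f,s-)}{\pi(\lambda(u,s,\cdot,\cdot)+\gamma(u,s),s-)}\,O(du\times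 ds)$$ $$\qquad-\int_{E\times[0,t]}\bigl\{\pi(f(\cdot,\cdot)\lambda(u,s,\cdot,\cdot),s)-\pi(f,s)\,\pi(\lambda(u,s,\cdot,\cdot),s)\bigr\}\,\nu(du)\,ds .$$
   Context: Setting. $E$ is a measurable mark space with reference measure $\nu$; $p\in[0,1]$. On a filtered probability space $(\Omega,\mathcal F,\{\mathcal F_t\},Q)$, $N$ ("single events") and $C$ ("cluster events") are independent Poisson random measures on $E\times[0,\infty)$ with mean measures $\gamma(u,s)\nu(du)ds$ and $\lambda_Q(u,s)\nu(du)ds$, where $\gamma\ge0$ and $\lambda_Q>0$ are deterministic; both mean measures are finite on $E\times[0,t]$ for every $t$, so finitely many events occur in bounded time. $I_1,I_2,\dots$ are i.i.d. Bernoulli($p$), independent of $(N,C)$. Write $C(A,t)=C(A\times[0,t])$, and similarly for $N$ and $O$. Cluster status. $D$ is a cadlag $\{0,1\}$-valued process ($D=1$ means a cluster is active), with $D_0$ independent of $(N,C,(I_k))$. $D$ changes only at points of $C$: at the $k$-th point of $C$, occurring at time $s$, if $D_{s-}=0$ then $D_s=1$ (a new cluster is initiated), and if $D_{s-}=1$ then $D_s=1-I_k$ (the cluster dies with probability $p$). All processes are adapted to $\{\mathcal F_t\}$, and the increments of $N$ and $C$ after time $t$ are independent of $\mathcal F_t$. Histories. If $C$ has points with marks $c_i$ at times $t_i$, then $\eta_t=\sum_{i:\,t_i\le t}\delta_{(c_i,t_i)}$ and $h_t=\delta_{(D_0,0)}+\sum_{i:\,t_i\le t}\delta_{(D_{t_i},t_i)}$.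 Thus $h_t$ encodes the whole path of $D$ up to time $t$, with value $D_{t_i}$ on $[t_i,t_{i+1})$, and $D_t$ is a function of $h_t$. Functions of $(h,\eta)$ are evaluated at $(h_s,\eta_s)$ when they appear inside $\phi(\cdot,s)$ or $\pi(\cdot,s)$, and at $(h_{s-},\eta_{s-})$ inside $\phi(\cdot,s-)$ or $\pi(\cdot,s-)$ (left limits in time). Intensity and change of measure. The cluster intensity is a non-negative predictable function $\lambda(u,s,D_{s-},\eta_{s-})$, also written $\lambda(u,s,h_{s-},\eta_{s-})$, with $\int_{E\times[0,t]}\lambda(u,s,h_s,\eta_s)\nu(du)ds<\infty$ a.s. for all $t$. $L$ is determined by $$L(t)=1+\int_{E\times[0,t]}\left(\frac{\lambda(u,s,D_{s-},\eta_{s-})}{\lambda_Q(u,s)}-1\right)L(s-)\,[C(du\times ds)-\lambda_Q(u,s)\nu(du)ds],$$ and is assumed to be an $\{\mathcal F_t\}$-martingale under $Q$; $P$ is the probability measure with $dP_{|\mathcal F_t}=L(t)\,dQ_{|\mathcal F_t}$. Observations. $O(A,t)=N(A,t)+C(A,t)$ and $\mathcal F_t^O=\sigma(O(A,s):s\le t,\ A\subset E\text{ measurable})$. Given $\mathcal F^O_t$, $(h_t,\eta_t)$ takes only finitely many values up to the law of $D_0\in\{0,1\}$, so no integrability or measurability condition on $f$ is imposed. The equation for $\phi$ is understood $Q$-a.s. and that for $\pi$ $P$-a.s. *)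

theory Defs
  imports "HOL-Probability.Probability" "HOL-Library.Multiset"
begin

section \<open>Point configurations on the space of marks and times\<close>

text \<open>The space of marks, its sigma-algebra and the reference measure are all carried by one
  measure \<open>\<nu>\<close>.  The following is the measure \<open>\<nu>(du) ds\<close> on marks and times \<open>s \<ge> 0\<close>.\<close>

definition mark_time :: "'e measure \<Rightarrow> ('e \<times> real) measure" where
  "mark_time \<nu> = \<nu> \<Otimes>\<^sub>M restrict_space lborel {0..}"

text \<open>A realisation of a point process is the set of its points \<open>(mark, time)\<close>.  Finite point
  measures \<open>\<Sum>\<^sub>i \<delta>\<^bsub>x\<^sub>i\<^esub>\<close> are multisets, so that adding a unit mass is adding an element.\<close>

definition num_points :: "('e \<times> real) set \<Rightarrow> 'e set \<Rightarrow> real set \<Rightarrow> nat" where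
  "num_points X A T = card {x \<in> X. fst x \<in> A \<and> snd x \<in> T}"

definition points_upto :: "('e \<times> real) set \<Rightarrow> real \<Rightarrow> ('e \<times> real) multiset" where
  "points_upto X t = mset_set {x \<in> X. snd x \<le> t}"

definition points_before :: "('e \<times> real) set \<Rightarrow> real \<Rightarrow> ('e \<times> real) multiset" where
  "points_before X t = mset_set {x \<in> X. snd x < t}"

definition mset_space :: "'x measure \<Rightarrow> 'x multiset measure" where
  "mset_space M = sigma {X. set_mset X \<subseteq> space M}
     {{X. set_mset X \<subseteq> space M \<and> size {#x \<in># X. x \<in> A#} = n} | A n. A \<in> sets M}"

text \<open>The Poisson weights are written out because \<^const>\<open>poisson_pmf\<close> excludes rate 0.\<close>

definition poisson_random_measure :: "'w measure \<Rightarrow> 'x measure \<Rightarrow> ('w \<Rightarrow> 'x set) \<Rightarrow> bool" where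
  "poisson_random_measure M \<mu> X \<longleftrightarrow>
     (\<forall>\<omega>\<in>space M. X \<omega> \<subseteq> space \<mu>) \<and>
     (\<forall>A\<in>sets \<mu>. emeasure \<mu> A < \<infinity> \<longrightarrow>
        (AE \<omega> in M. finite (X \<omega> \<inter> A)) \<and>
        (\<lambda>\<omega>. card (X \<omega> \<inter> A)) \<in> measurable M (count_space UNIV) \<and>
        (\<forall>k. measure M {\<omega> \<in> space M. card (X \<omega> \<inter> A) = k}
                = measure \<mu> A ^ k / fact k * exp (- measure \<mu> A))) \<and>
     (\<forall>(n::nat) A. (\<forall>i<n. A i \<in> sets \<mu> \<and> emeasure \<mu> (A i) < \<infinity>) \<longrightarrow> disjoint_family_on A {..<n} \<longrightarrow>
        prob_space.indep_vars M (\<lambda>_. count_space UNIV) (\<lambda>i \<omega>. card (X \<omega> \<inter> A i)) {..<n})"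

definition count_events ::
    "'w set \<Rightarrow> 'e measure \<Rightarrow> ('w \<Rightarrow> ('e \<times> real) set) \<Rightarrow> real set set \<Rightarrow> 'w set set" where
  "count_events \<Omega> \<nu> X \<T> = {{\<omega>\<in>\<Omega>. num_points (X \<omega>) A T = n} | A T n. A \<in> sets \<nu> \<and> T \<in> \<T>}"

abbreviation all_times :: "real set set" where
  "all_times \<equiv> {{0..t} | t. 0 \<le> t}"

abbreviation increments_after :: "real \<Rightarrow> real set set" where
  "increments_after t \<equiv> {{a<..b} | a b. t \<le> a \<and> a \<le> b}"


section \<open>Paths\<close>

definition left_lim :: "(real \<Rightarrow> 'b::t2_space) \<Rightarrow> real \<Rightarrow> 'b" where
  "left_lim x t = Lim (at_left t) x"

definition cadlag :: "(real \<Rightarrow> 'b::t2_space) \<Rightarrow> bool" where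
  "cadlag x \<longleftrightarrow> (\<forall>t\<ge>0. (x \<longlongrightarrow> x t) (at_right t)) \<and> (\<forall>t>0. \<exists>l. (x \<longlongrightarrow> l) (at_left t))"


section \<open>States \<open>(h, \<eta>)\<close>\<close>

type_synonym 'e state = "(bool \<times> real) multiset \<times> ('e \<times> real) multiset"

text \<open>\<open>(h\<^sub>t, \<eta>\<^sub>t)\<close>, for a status path \<open>d\<close> and a set \<open>X\<close> of cluster points; \<open>True\<close> is the
  status 1 (a cluster is active).\<close>

definition state_at :: "(real \<Rightarrow> bool) \<Rightarrow> ('e \<times> real) set \<Rightarrow> real \<Rightarrow> 'e state" where
  "state_at d X t =
     (add_mset (d 0, 0) (image_mset (\<lambda>x. (d (snd x), snd x)) (points_upto X t)), points_upto X t)"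

definition state_space :: "'e measure \<Rightarrow> 'e state measure" where
  "state_space \<nu> =
     mset_space (count_space UNIV \<Otimes>\<^sub>M restrict_space lborel {0..}) \<Otimes>\<^sub>M mset_space (mark_time \<nu>)"

text \<open>\<open>D\<^sub>t\<close> as a function of \<open>h\<^sub>t\<close>: the status attached to the latest time.\<close>

definition status :: "(bool \<times> real) multiset \<Rightarrow> bool" where
  "status h = (THE d. \<exists>t. (d, t) \<in># h \<and> (\<forall>(d', t') \<in># h. t' \<le> t))"

definition alpha :: "'e state \<Rightarrow> real" where
  "alpha y = of_bool (status (fst y))"

definition intensity ::
    "('e \<Rightarrow> real \<Rightarrow> bool \<Rightarrow> ('e \<times> real) multiset \<Rightarrow> real) \<Rightarrow> 'e \<Rightarrow> real \<Rightarrow> 'e state \<Rightarrow> real" where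
  "intensity lam u s y = lam u s (status (fst y)) (snd y)"

definition f_new :: "real \<Rightarrow> ('e state \<Rightarrow> real) \<Rightarrow> 'e \<Rightarrow> real \<Rightarrow> 'e state \<Rightarrow> real" where
  "f_new p f u s y =
     (1 - alpha y) * f (fst y + {#(True, s)#}, snd y + {#(u, s)#})
     + alpha y * (p * f (fst y + {#(False, s)#}, snd y + {#(u, s)#})
                  + (1 - p) * f (fst y + {#(True, s)#}, snd y + {#(u, s)#}))"


section \<open>Observations and filters\<close>

definition obs :: "('w \<Rightarrow> ('e \<times> real) set) \<Rightarrow> ('w \<Rightarrow> ('e \<times> real) set) \<Rightarrow> real \<Rightarrow> 'w \<Rightarrow> ('e \<times> real) multiset" where
  "obs N C t \<omega> = points_upto (N \<omega>) t + points_upto (C \<omega>) t"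

definition obs_sigma :: "'w set \<Rightarrow> 'e measure \<Rightarrow> (real \<Rightarrow> 'w \<Rightarrow> ('e \<times> real) multiset) \<Rightarrow> real \<Rightarrow> 'w measure" where
  "obs_sigma \<Omega> \<nu> Y t = sigma \<Omega>
     {{\<omega>\<in>\<Omega>. size {#x \<in># Y s \<omega>. fst x \<in> A#} = n} | A s n. A \<in> sets \<nu> \<and> 0 \<le> s \<and> s \<le> t}"

text \<open>The finitely many states that are compatible with observed points \<open>Y\<close>: some of the points
  are cluster points, and \<open>d\<^sub>0\<close> and \<open>d\<close> are conceivable values of the status process.\<close>

definition compatible :: "('e \<times> real) multiset \<Rightarrow> 'e state set" where
  "compatible Y =
     {(add_mset (d\<^sub>0, 0) (image_mset (\<lambda>x. (d x, snd x)) \<eta>), \<eta>) | d\<^sub>0 d \<eta>. \<eta> \<subseteq># Y}"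

text \<open>A finitely supported (signed) measure on states is given by its weights \<open>w\<close>.  It integrates
  every real function, measurable or not.\<close>

definition weighted_sum :: "('e state \<Rightarrow> real) \<Rightarrow> ('e state \<Rightarrow> real) \<Rightarrow> real" where
  "weighted_sum w g = (\<Sum>y | w y \<noteq> 0. g y * w y)"

text \<open>\<open>\<Phi>\<close> is a version of \<open>g \<mapsto> E\<^sup>M[g(X\<^sub>t) W\<^sub>t | G\<^sub>t]\<close>, \<open>t \<ge> 0\<close>, that is a measure on the finitely
  many states compatible with the observations \<open>Y\<close>, with cadlag weights.  Since \<^const>\<open>real_cond_exp\<close> is
  the difference of the conditional expectations of the positive and the negative part, \<open>g\<close> need
  not be integrable.  For fixed \<open>t\<close> conditional expectations are determined up to null sets only;
  the time integrals and left limits in the filtering equations refer to such a version.\<close>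

definition is_filter ::
    "'w measure \<Rightarrow> 'e measure \<Rightarrow> (real \<Rightarrow> 'w measure) \<Rightarrow> (real \<Rightarrow> 'w \<Rightarrow> ('e \<times> real) multiset)
     \<Rightarrow> (real \<Rightarrow> 'w \<Rightarrow> 'e state) \<Rightarrow> (real \<Rightarrow> 'w \<Rightarrow> real) \<Rightarrow> (real \<Rightarrow> 'w \<Rightarrow> 'e state \<Rightarrow> real) \<Rightarrow> bool" where
  "is_filter M \<nu> G Y X W \<Phi> \<longleftrightarrow>
     (\<forall>t\<ge>0. \<forall>\<omega>\<in>space M. {y. \<Phi> t \<omega> y \<noteq> 0} \<subseteq> compatible (Y t \<omega>)) \<and>
     (\<forall>t\<ge>0. \<forall>g\<in>borel_measurable (state_space \<nu>).
        (\<lambda>\<omega>. weighted_sum (\<Phi> t \<omega>) g) \<in> borel_measurable (G t) \<and>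
        (AE \<omega> in M. weighted_sum (\<Phi> t \<omega>) g
                      = real_cond_exp M (G t) (\<lambda>\<omega>. g (X t \<omega>) * W t \<omega>) \<omega>)) \<and>
     (AE \<omega> in M. \<forall>y. cadlag (\<lambda>t. \<Phi> t \<omega> y))"

text \<open>\<open>\<phi>(g, s)\<close> and \<open>\<phi>(g, s-)\<close>; a parameter \<open>s\<close> occurring in \<open>g\<close> itself is kept fixed in the limit.\<close>

definition filt :: "(real \<Rightarrow> 'w \<Rightarrow> 'e state \<Rightarrow> real) \<Rightarrow> 'w \<Rightarrow> ('e state \<Rightarrow> real) \<Rightarrow> real \<Rightarrow> real" where
  "filt \<Phi> \<omega> g s = weighted_sum (\<Phi> s \<omega>) g"

definition filt_left :: "(real \<Rightarrow> 'w \<Rightarrow> 'e state \<Rightarrow> real) \<Rightarrow> 'w \<Rightarrow> ('e state \<Rightarrow> real) \<Rightarrow> real \<Rightarrow> real" where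
  "filt_left \<Phi> \<omega> g s = left_lim (filt \<Phi> \<omega> g) s"


section \<open>The cluster model\<close>

definition martingale :: "'w measure \<Rightarrow> (real \<Rightarrow> 'w measure) \<Rightarrow> (real \<Rightarrow> 'w \<Rightarrow> real) \<Rightarrow> bool" where
  "martingale M F X \<longleftrightarrow>
     (\<forall>t\<ge>0. X t \<in> borel_measurable (F t) \<and> integrable M (X t)) \<and>
     (\<forall>s t. 0 \<le> s \<and> s \<le> t \<longrightarrow> (AE \<omega> in M. real_cond_exp M (F s) (X t) \<omega> = X s \<omega>))"

text \<open>The parameters are \<open>\<gamma> = gam\<close>, \<open>\<lambda>\<^sub>Q = lamQ\<close> and \<open>\<lambda> = lam\<close>.  Being measurable in all its
  arguments, \<open>lam\<close> becomes predictable when the left limits \<open>D\<^bsub>s-\<^esub>\<close>, \<open>\<eta>\<^bsub>s-\<^esub>\<close> are inserted.\<close>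

locale cluster_model = prob_space Q
  for Q :: "'w measure"
    and F :: "real \<Rightarrow> 'w measure"
    and P :: "'w measure"
    and \<nu> :: "'e measure"
    and p :: real
    and gam lamQ :: "'e \<Rightarrow> real \<Rightarrow> real"
    and N C :: "'w \<Rightarrow> ('e \<times> real) set"
    and I :: "nat \<Rightarrow> 'w \<Rightarrow> bool"
    and D :: "real \<Rightarrow> 'w \<Rightarrow> bool"
    and lam :: "'e \<Rightarrow> real \<Rightarrow> bool \<Rightarrow> ('e \<times> real) multiset \<Rightarrow> real"
    and L :: "real \<Rightarrow> 'w \<Rightarrow> real" +
  assumes p: "0 \<le> p" "p \<le> 1"
    and subalgebra_F: "\<And>t. 0 \<le> t \<Longrightarrow> subalgebra Q (F t)"
    and F_mono: "\<And>s t. 0 \<le> s \<Longrightarrow> s \<le> t \<Longrightarrow> sets (F s) \<subseteq> sets (F t)"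
    and gam_measurable: "(\<lambda>(u, s). gam u s) \<in> borel_measurable (mark_time \<nu>)"
    and lamQ_measurable: "(\<lambda>(u, s). lamQ u s) \<in> borel_measurable (mark_time \<nu>)"
    and gam_nonneg: "\<And>u s. u \<in> space \<nu> \<Longrightarrow> 0 \<le> s \<Longrightarrow> 0 \<le> gam u s"
    and lamQ_pos: "\<And>u s. u \<in> space \<nu> \<Longrightarrow> 0 \<le> s \<Longrightarrow> 0 < lamQ u s"
    and gam_finite: "\<And>t. emeasure (density (mark_time \<nu>) (\<lambda>(u, s). ennreal (gam u s))) (space \<nu> \<times> {0..t}) < \<infinity>"
    and lamQ_finite: "\<And>t. emeasure (density (mark_time \<nu>) (\<lambda>(u, s). ennreal (lamQ u s))) (space \<nu> \<times> {0..t}) < \<infinity>"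
    and N_poisson: "poisson_random_measure Q (density (mark_time \<nu>) (\<lambda>(u, s). ennreal (gam u s))) N"
    and C_poisson: "poisson_random_measure Q (density (mark_time \<nu>) (\<lambda>(u, s). ennreal (lamQ u s))) C"
    and N_locally_finite: "\<And>\<omega> t. \<omega> \<in> space Q \<Longrightarrow> finite {x \<in> N \<omega>. snd x \<le> t}"
    and C_locally_finite: "\<And>\<omega> t. \<omega> \<in> space Q \<Longrightarrow> finite {x \<in> C \<omega>. snd x \<le> t}"
    and N_C_indep: "indep_set (sigma_sets (space Q) (count_events (space Q) \<nu> N all_times))
                              (sigma_sets (space Q) (count_events (space Q) \<nu> C all_times))"
    \<comment> \<open>indexed from 1; \<open>I 0\<close> is not used\<close>
    and I_iid: "indep_vars (\<lambda>_. count_space UNIV) I {1..}"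
    and I_bernoulli: "\<And>k. 1 \<le> k \<Longrightarrow> prob {\<omega> \<in> space Q. I k \<omega>} = p"
    and I_indep: "indep_set (sigma_sets (space Q) {{\<omega> \<in> space Q. I k \<omega>} | k. 1 \<le> k})
                            (sigma_sets (space Q) (count_events (space Q) \<nu> N all_times
                                                   \<union> count_events (space Q) \<nu> C all_times))"
    and D_cadlag: "\<And>\<omega>. \<omega> \<in> space Q \<Longrightarrow> cadlag (\<lambda>t. D t \<omega>)"
    and D0_indep: "indep_set (sigma_sets (space Q) {{\<omega> \<in> space Q. D 0 \<omega>}})
                             (sigma_sets (space Q) (count_events (space Q) \<nu> N all_times
                                                    \<union> count_events (space Q) \<nu> C all_times
                                                    \<union> {{\<omega> \<in> space Q. I k \<omega>} | k. 1 \<le> k}))"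
    and D_const: "\<And>\<omega> s t. \<omega> \<in> space Q \<Longrightarrow> 0 \<le> s \<Longrightarrow> s \<le> t \<Longrightarrow> (\<forall>x\<in>C \<omega>. snd x \<notin> {s<..t}) \<Longrightarrow> D t \<omega> = D s \<omega>"
    and D_update: "AE \<omega> in Q. \<forall>(u, s)\<in>C \<omega>.
          D s \<omega> = (if left_lim (\<lambda>r. D r \<omega>) s then \<not> I (card {x \<in> C \<omega>. snd x \<le> s}) \<omega> else True)"
    and N_adapted: "\<And>A t. A \<in> sets \<nu> \<Longrightarrow> 0 \<le> t \<Longrightarrow>
          (\<lambda>\<omega>. num_points (N \<omega>) A {0..t}) \<in> measurable (F t) (count_space UNIV)"
    and C_adapted: "\<And>A t. A \<in> sets \<nu> \<Longrightarrow> 0 \<le> t \<Longrightarrow>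
          (\<lambda>\<omega>. num_points (C \<omega>) A {0..t}) \<in> measurable (F t) (count_space UNIV)"
    and D_adapted: "\<And>t. 0 \<le> t \<Longrightarrow> D t \<in> measurable (F t) (count_space UNIV)"
    and increments_indep: "\<And>t. 0 \<le> t \<Longrightarrow>
          indep_set (sets (F t))
                    (sigma_sets (space Q) (count_events (space Q) \<nu> N (increments_after t)
                                           \<union> count_events (space Q) \<nu> C (increments_after t)))"
    and lam_measurable: "(\<lambda>((u, s), (d, \<eta>)). lam u s d \<eta>)
          \<in> borel_measurable (mark_time \<nu> \<Otimes>\<^sub>M (count_space UNIV \<Otimes>\<^sub>M mset_space (mark_time \<nu>)))"
    and lam_nonneg: "\<And>u s d \<eta>. u \<in> space \<nu> \<Longrightarrow> 0 \<le> s \<Longrightarrow> 0 \<le> lam u s d \<eta>"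
    and lam_integrable: "AE \<omega> in Q. \<forall>t\<ge>0.
          (\<integral>\<^sup>+x\<in>space \<nu> \<times> {0..t}. (case x of (u, s) \<Rightarrow>
              ennreal (intensity lam u s (state_at (\<lambda>r. D r \<omega>) (C \<omega>) s))) \<partial>mark_time \<nu>) < \<infinity>"
    and L_equation: "AE \<omega> in Q. cadlag (\<lambda>t. L t \<omega>) \<and> (\<forall>t\<ge>0. L t \<omega> = 1
          + (\<Sum>(u, s) \<in> {x \<in> C \<omega>. snd x \<le> t}.
               (lam u s (left_lim (\<lambda>r. D r \<omega>) s) (points_before (C \<omega>) s) / lamQ u s - 1)
               * left_lim (\<lambda>r. L r \<omega>) s)
          - (LINT x:space \<nu> \<times> {0..t}|mark_time \<nu>. (case x of (u, s) \<Rightarrow>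
               (lam u s (left_lim (\<lambda>r. D r \<omega>) s) (points_before (C \<omega>) s) / lamQ u s - 1)
               * left_lim (\<lambda>r. L r \<omega>) s * lamQ u s)))"
    and L_martingale: "martingale Q F L"
    and P_prob_space: "prob_space P"
    and sets_P: "sets P = sets Q"
    and P_density: "\<And>t. 0 \<le> t \<Longrightarrow>
          restr_to_subalg P (F t) = density (restr_to_subalg Q (F t)) (\<lambda>\<omega>. ennreal (L t \<omega>))"

text \<open>The unnormalised filter \<open>\<phi>(f, t) = E\<^sup>Q[f(h\<^sub>t, \<eta>\<^sub>t) L(t) | O]\<close> and the filter
  \<open>\<pi>(f, t) = E\<^sup>P[f(h\<^sub>t, \<eta>\<^sub>t) | O]\<close>, given the observations up to time \<open>t\<close>.\<close>

definition is_phi ::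
    "'w measure \<Rightarrow> 'e measure \<Rightarrow> ('w \<Rightarrow> ('e \<times> real) set) \<Rightarrow> ('w \<Rightarrow> ('e \<times> real) set)
     \<Rightarrow> (real \<Rightarrow> 'w \<Rightarrow> bool) \<Rightarrow> (real \<Rightarrow> 'w \<Rightarrow> real) \<Rightarrow> (real \<Rightarrow> 'w \<Rightarrow> 'e state \<Rightarrow> real) \<Rightarrow> bool" where
  "is_phi Q \<nu> N C D L \<Phi> \<longleftrightarrow>
     is_filter Q \<nu> (obs_sigma (space Q) \<nu> (obs N C)) (obs N C)
       (\<lambda>t \<omega>. state_at (\<lambda>r. D r \<omega>) (C \<omega>) t) L \<Phi>"

definition is_pi ::
    "'w measure \<Rightarrow> 'e measure \<Rightarrow> ('w \<Rightarrow> ('e \<times> real) set) \<Rightarrow> ('w \<Rightarrow> ('e \<times> real) set)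
     \<Rightarrow> (real \<Rightarrow> 'w \<Rightarrow> bool) \<Rightarrow> (real \<Rightarrow> 'w \<Rightarrow> 'e state \<Rightarrow> real) \<Rightarrow> bool" where
  "is_pi P \<nu> N C D \<Psi> \<longleftrightarrow>
     is_filter P \<nu> (obs_sigma (space P) \<nu> (obs N C)) (obs N C)
       (\<lambda>t \<omega>. state_at (\<lambda>r. D r \<omega>) (C \<omega>) t) (\<lambda>_ _. 1) \<Psi>"

end

theory Submission
  imports Defs
begin

text \<open>
  Given the observed points, only finitely many histories of the hidden state are possible: each
  observed point was a single event or a cluster event, and after a cluster event the status is 0 or
  1.  Encode a history by the initial status and a list of labels, one for each observed point.  The
  whole theorem is a computation with the finite sum over all histories of
  \<open>g (state) * prior * likelihood\<close>.

  The \<^emph>\<open>prior\<close> is the conditional law of the history under \<open>Q\<close>.  By the Mecke formula for \<open>C\<close> and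
  for \<open>N\<close>, an observed point \<open>(u, s)\<close> is a cluster event with probability
  \<open>lamQ u s / (lamQ u s + gam u s)\<close>, whatever the other points and their types are (\<open>resample\<close>,
  \<open>thinning\<close>); the independent coins then decide which clusters die (\<open>label_law\<close>).  The same formula
  shows that almost surely no two observed points are simultaneous (\<open>AE_good\<close>), so that they can be
  numbered by time.

  The \<^emph>\<open>likelihood\<close> is \<open>L\<close> as a function of the history.  Between two observed points the intensity of
  the true history is known, the integral equation for \<open>L\<close> is linear, and its solution is an
  exponential; at a cluster point \<open>L\<close> is multiplied by \<open>lam / lamQ\<close> (\<open>L_path\<close>).  Together these give the
  explicit filter \<open>phiS\<close> under \<open>Q\<close> (\<open>nn_filter_Q\<close>, \<open>phi_cond_exp\<close>) and, by the formula of Bayes, the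
  normalised filter under \<open>P\<close> (\<open>pi_cond_exp\<close>).

  Between observed points each summand solves a linear equation, and summation gives the integrand of
  the first filtering equation; at an observed point, splitting the new label into its three values gives the jump in terms of \<open>f_new\<close>
  (\<open>V_Suc\<close>).  Adding up the pieces yields the first equation (\<open>phi_equation\<close>).  The second one follows
  from the quotient rule on the pieces and from algebra at the jumps (\<open>pi_equation\<close>).  This calculus is
  pathwise, so that \<open>f\<close> may be arbitrary.  It requires a finite cumulative intensity for all histories
  of positive prior; the corresponding assumption on the true history entails it almost surely
  (\<open>AE_intok\<close>).

  Finally, any version of the filter agrees with the explicit one almost surely, at all times
  simultaneously: countably many measurable functions separate the finitely many compatible states,
  and the weights are right-continuous (\<open>filter_unique\<close>).
\<close>

section \<open>Measurability on the space of finite multisets\<close>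

text \<open>The library rule with its premises in the order that suits an induction over membership.\<close>
lemma dynkin_induct [consumes 3, case_names basic empty compl union]:
 assumes "A \<in> sigma_sets \<Omega> G" "G \<subseteq> Pow \<Omega>" "Int_stable G"
  and "\<And>A. A \<in> G ==> P A" "P {}"
  and "\<And>A. A \<in> sigma_sets \<Omega> G ==> P A ==> P (\<Omega> - A)"
  and "\<And>A. disjoint_family A ==> range A \<subseteq> sigma_sets \<Omega> G ==> (\<And>i. P (A i)) ==> P (\<Union>i::nat. A i)"
 shows "P A"
 by (rule sigma_sets_induct_disjoint[OF assms(3,2,1)]) (use assms(4-) in auto)

lemma space_mset_space: "space (mset_space M) = {X. set_mset X \<subseteq> space M}"
 by (simp add: mset_space_def space_measure_of_conv)

lemma sets_mset_space: "sets (mset_space M) = sigma_sets {X. set_mset X \<subseteq> space M}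
   {{X. set_mset X \<subseteq> space M \<and> size {#x \<in># X. x \<in> A#} = n} | A n. A \<in> sets M}"
 unfolding mset_space_def by (rule sets_measure_of) auto

lemma measurable_mset_spaceI:
 assumes sp: "\<And>s. s \<in> space S ==> set_mset (Z s) \<subseteq> space M"
  and cnt: "\<And>A. A \<in> sets M ==> (%s. size {#x \<in># Z s. x \<in> A#}) \<in> measurable S (count_space UNIV)"
 shows "Z \<in> measurable S (mset_space M)"
 unfolding mset_space_def
proof (rule measurable_measure_of)
 fix Y assume "Y \<in> {{X. set_mset X \<subseteq> space M \<and> size {#x \<in># X. x \<in> A#} = n} | A n. A \<in> sets M}"
 then obtain A n where A: "A \<in> sets M"
  and Y: "Y = {X. set_mset X \<subseteq> space M \<and> size {#x \<in># X. x \<in> A#} = n}" by blast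
 have "Z -` Y \<inter> space S = (%s. size {#x \<in># Z s. x \<in> A#}) -` {n} \<inter> space S"
  using sp by (auto simp: Y)
 then show "Z -` Y \<inter> space S \<in> sets S"
  using measurable_sets[OF cnt[OF A], of "{n}"] by simp
qed (use sp in auto)

lemma measurable_size_filter_mset:
 assumes "A \<in> sets M"
 shows "(%X. size {#x \<in># X. x \<in> A#}) \<in> measurable (mset_space M) (count_space UNIV)"
proof (rule measurableI)
 fix B :: "nat set"
 have "(%X. size {#x \<in># X. x \<in> A#}) -` B \<inter> space (mset_space M)
   = (\<Union>n\<in>B. {X. set_mset X \<subseteq> space M \<and> size {#x \<in># X. x \<in> A#} = n})"
  by (auto simp: space_mset_space)
 also have "\<dots> \<in> sets (mset_space M)"
  using assms by (intro sets.countable_UN'') (auto simp: sets_mset_space)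
 finally show "(%X. size {#x \<in># X. x \<in> A#}) -` B \<inter> space (mset_space M) \<in> sets (mset_space M)" .
qed simp

lemma sum_mset_indicator: "(\<Sum>x\<in>#X. indicator A x :: 'b::semiring_1) = of_nat (size {#x \<in># X. x \<in> A#})"
 by (induction X) (auto simp: indicator_def)

lemma suminf_sum_mset:
 fixes f :: "'a => nat => ennreal"
 shows "(\<Sum>x\<in>#X. \<Sum>i. f x i) = (\<Sum>i. \<Sum>x\<in>#X. f x i)"
 by (induction X) (auto simp: suminf_add)

lemma sum_mset_SUP:
 fixes f :: "nat => 'a => ennreal"
 assumes "incseq f"
 shows "(\<Sum>x\<in>#X. SUP i. f i x) = (SUP i. \<Sum>x\<in>#X. f i x)"
proof (induction X)
 case empty
 then show ?case by simp
next
 case (add a X)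
 have "incseq (%i. f i a)" "incseq (%i. \<Sum>x\<in>#X. f i x)"
  using assms by (auto simp: incseq_def le_fun_def intro!: sum_mset_mono)
 then show ?case using add by (simp add: ennreal_SUP_add)
qed

text \<open>Summation over the points of a random multiset preserves joint measurability.  For the indicator
of a rectangle the sum is a count, and the counts generate the sigma-algebra; the rest is a Dynkin
and a monotone class argument.  Most measurability proofs below reduce to this lemma.\<close>
lemma borel_measurable_sum_mset_ennreal:
 fixes h :: "'a \<times> 's => ennreal"
 assumes Z: "Z \<in> measurable S (mset_space M)" and h: "h \<in> borel_measurable (M \<Otimes>\<^sub>M S)"
 shows "(%s. \<Sum>x\<in>#Z s. h (x, s)) \<in> borel_measurable S"
proof -
 have Zsp: "set_mset (Z s) \<subseteq> space M" if "s \<in> space S" for s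
  using measurable_space[OF Z that] by (simp add: space_mset_space)
 have cnt: "(%s. size {#x \<in># Z s. x \<in> A#}) \<in> measurable S (count_space UNIV)" if "A \<in> sets M" for A
  using measurable_compose[OF Z measurable_size_filter_mset[OF that]] .
 have ind: "(%s. \<Sum>x\<in>#Z s. indicator A (x, s) :: ennreal) \<in> borel_measurable S" if "A \<in> sets (M \<Otimes>\<^sub>M S)" for A
 proof -
  have "A \<in> sigma_sets (space M \<times> space S) {a \<times> b |a b. a \<in> sets M \<and> b \<in> sets S}"
   using that by (simp add: sets_pair_measure)
  moreover have "{a \<times> b |a b. a \<in> sets M \<and> b \<in> sets S} \<subseteq> Pow (space M \<times> space S)"
   by (auto dest: sets.sets_into_space)
  ultimately show ?thesis using Int_stable_pair_measure_generator
  proof (induction rule: dynkin_induct)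
   case (basic A)
   then obtain a b where ab: "A = a \<times> b" "a \<in> sets M" "b \<in> sets S" by auto
   have "(\<Sum>x\<in>#Z s. indicator A (x, s) :: ennreal) = of_nat (size {#x \<in># Z s. x \<in> a#}) * indicator b s" for s
    by (cases "s \<in> b") (auto simp: ab indicator_times sum_mset_indicator)
   then show ?case using cnt[OF ab(2)] ab(3) by simp
  next
   case empty
   then show ?case by simp
  next
   case (compl A)
   have "(\<Sum>x\<in>#Z s. indicator (space M \<times> space S - A) (x, s) :: ennreal)
    = of_nat (size {#x \<in># Z s. x \<in> space M#}) - (\<Sum>x\<in>#Z s. indicator A (x, s))" if s: "s \<in> space S" for s
   proof -
    have "(\<Sum>x\<in>#Z s. indicator (space M \<times> space S - A) (x, s) :: ennreal) + (\<Sum>x\<in>#Z s. indicator A (x, s))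
     = (\<Sum>x\<in>#Z s. indicator (space M) x)"
     unfolding sum_mset.distrib[symmetric] using Zsp[OF s] s
     by (intro arg_cong[where f=sum_mset] image_mset_cong) (auto simp: indicator_def)
    moreover have "(\<Sum>x\<in>#Z s. indicator A (x, s) :: ennreal) \<noteq> \<top>"
     using sum_mset_indicator[of "{x. (x, s) \<in> A}" "Z s", where 'b=ennreal]
     by (simp add: indicator_def)
    ultimately show ?thesis
     unfolding sum_mset_indicator by (metis ennreal_add_diff_cancel_right)
   qed
   moreover have "(%s. of_nat (size {#x \<in># Z s. x \<in> space M#}) - (\<Sum>x\<in>#Z s. indicator A (x, s) :: ennreal)) \<in> borel_measurable S"
    using compl cnt[of "space M"] by simp
   ultimately show ?case by (subst measurable_cong) auto
  next
   case (union A)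
   have "(\<Sum>x\<in>#Z s. indicator (\<Union>i. A i) (x, s) :: ennreal) = (\<Sum>i. \<Sum>x\<in>#Z s. indicator (A i) (x, s))" for s
    unfolding suminf_sum_mset[symmetric] using union(1) by (simp add: suminf_indicator)
   then show ?case using union by simp
  qed
 qed
 show ?thesis using h
 proof (induction rule: borel_measurable_induct)
  case (cong f g)
  have "(\<Sum>x\<in>#Z s. f (x, s)) = (\<Sum>x\<in>#Z s. g (x, s))" if "s \<in> space S" for s
   using cong(3) Zsp[OF that] that
   by (intro arg_cong[where f=sum_mset] image_mset_cong) (auto simp: space_pair_measure)
  then show ?case using cong(4) by (subst measurable_cong) auto
 next
  case (set A)
  then show ?case by (rule ind)
 next
  case (mult u c)
  then show ?case by (simp add: sum_mset_distrib_left[symmetric])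
 next
  case (add u v)
  then show ?case by (simp add: sum_mset.distrib)
 next
  case (seq U)
  have "incseq (%i x. U i (x, s))" for s using seq(3) by (auto simp: incseq_def le_fun_def)
  then have "(\<Sum>x\<in>#Z s. (SUP i. U i) (x, s)) = (SUP i. \<Sum>x\<in>#Z s. U i (x, s))" for s
   by (simp add: sum_mset_SUP image_comp)
  moreover have "(%s. SUP i. \<Sum>x\<in>#Z s. U i (x, s)) \<in> borel_measurable S"
   by (intro borel_measurable_SUP) (use seq in auto)
  ultimately show ?case by simp
 qed
qed

lemma measurable_size_filter_mset_param:
 assumes Z: "Z \<in> measurable S (mset_space M)" and P: "Measurable.pred (M \<Otimes>\<^sub>M S) (%(x, s). P x s)"
 shows "(%s. size {#x \<in># Z s. P x s#}) \<in> measurable S (count_space UNIV)"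
proof -
 let ?f = "%s. \<Sum>x\<in>#Z s. (%(x, s). if P x s then 1 else 0 :: ennreal) (x, s)"
 have "?f \<in> borel_measurable S"
  by (rule borel_measurable_sum_mset_ennreal[OF Z]) (use P in measurable)
 moreover have "?f s = of_nat (size {#x \<in># Z s. P x s#})" for s
  using sum_mset_indicator[of "{x. P x s}" "Z s", where 'b=ennreal] by (simp add: indicator_def of_bool_def)
 ultimately have m: "(%s. of_nat (size {#x \<in># Z s. P x s#}) :: ennreal) \<in> borel_measurable S" by simp
 show ?thesis
 proof (rule measurable_count_space_eq2_countable[THEN iffD2], safe)
  fix k
  have "(%s. size {#x \<in># Z s. P x s#}) -` {k} \<inter> space S
   = (%s. of_nat (size {#x \<in># Z s. P x s#}) :: ennreal) -` {of_nat k} \<inter> space S" by auto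
  then show "(%s. size {#x \<in># Z s. P x s#}) -` {k} \<inter> space S \<in> sets S"
   using measurable_sets[OF m, of "{of_nat k}"] by simp
 qed auto
qed

lemma measurable_filter_mset:
 assumes Z: "Z \<in> measurable S (mset_space M)" and P: "Measurable.pred (M \<Otimes>\<^sub>M S) (%(x, s). P x s)"
 shows "(%s. {#x \<in># Z s. P x s#}) \<in> measurable S (mset_space M)"
proof (rule measurable_mset_spaceI)
 fix s assume "s \<in> space S" then show "set_mset {#x \<in># Z s. P x s#} \<subseteq> space M"
  using measurable_space[OF Z] by (auto simp: space_mset_space)
next
 fix A assume A: "A \<in> sets M"
 have "(%s. size {#x \<in># Z s. P x s \<and> x \<in> A#}) \<in> measurable S (count_space UNIV)"
  by (rule measurable_size_filter_mset_param[OF Z]) (use P A in measurable)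
 then show "(%s. size {#x \<in># {#x \<in># Z s. P x s#}. x \<in> A#}) \<in> measurable S (count_space UNIV)"
  by (simp add: filter_filter_mset conj_commute)
qed

lemma measurable_image_mset:
 assumes Z: "Z \<in> measurable S (mset_space M)"
  and g: "(%(x, s). g x s) \<in> measurable (M \<Otimes>\<^sub>M S) M'"
 shows "(%s. image_mset (%x. g x s) (Z s)) \<in> measurable S (mset_space M')"
proof (rule measurable_mset_spaceI)
 fix s assume "s \<in> space S" then show "set_mset (image_mset (%x. g x s) (Z s)) \<subseteq> space M'"
  using measurable_space[OF Z] measurable_space[OF g] by (auto simp: space_mset_space space_pair_measure)
next
 fix A assume A: "A \<in> sets M'"
 have "(%s. size {#x \<in># Z s. g x s \<in> A#}) \<in> measurable S (count_space UNIV)"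
  by (rule measurable_size_filter_mset_param[OF Z]) (use g A in measurable)
 then show "(%s. size {#x \<in># image_mset (%x. g x s) (Z s). x \<in> A#}) \<in> measurable S (count_space UNIV)"
  by (simp add: filter_mset_image_mset)
qed

lemma measurable_plus_mset:
 assumes [measurable]: "Z \<in> measurable S (mset_space M)" "Z' \<in> measurable S (mset_space M)"
 shows "(%s. Z s + Z' s) \<in> measurable S (mset_space M)"
proof (rule measurable_mset_spaceI)
 fix s assume "s \<in> space S" then show "set_mset (Z s + Z' s) \<subseteq> space M"
  using measurable_space[OF assms(1)] measurable_space[OF assms(2)] by (auto simp: space_mset_space)
next
 fix A assume [measurable]: "A \<in> sets M"
 note [measurable] = measurable_size_filter_mset
 show "(%s. size {#x \<in># Z s + Z' s. x \<in> A#}) \<in> measurable S (count_space UNIV)"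
  by simp
qed

lemma measurable_single_mset:
 assumes [measurable]: "g \<in> measurable S M"
 shows "(%s. {#g s#}) \<in> measurable S (mset_space M)"
proof (rule measurable_mset_spaceI)
 fix s assume "s \<in> space S" then show "set_mset {#g s#} \<subseteq> space M"
  using measurable_space[OF assms] by simp
next
 fix A assume [measurable]: "A \<in> sets M"
 have "(%s. size {#x \<in># {#g s#}. x \<in> A#}) = (%s. if g s \<in> A then 1 else 0)" by auto
 then show "(%s. size {#x \<in># {#g s#}. x \<in> A#}) \<in> measurable S (count_space UNIV)" by simp
qed

lemma measurable_add_mset:
 assumes "g \<in> measurable S M" "Z \<in> measurable S (mset_space M)"
 shows "(%s. add_mset (g s) (Z s)) \<in> measurable S (mset_space M)"
 using measurable_plus_mset[OF measurable_single_mset[OF assms(1)] assms(2)] by simp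

lemma measurable_empty_mset: "(%s. {#}) \<in> measurable S (mset_space M)"
 by (rule measurable_mset_spaceI) auto

subsection \<open>Marks and times\<close>

lemma space_mark_time: "space (mark_time \<nu>) = space \<nu> \<times> {0..}"
 by (simp add: mark_time_def space_pair_measure space_restrict_space)

lemma measurable_fst_mark_time[measurable]: "fst \<in> measurable (mark_time \<nu>) \<nu>"
 by (simp add: mark_time_def)

lemma measurable_snd_mark_time[measurable]: "snd \<in> borel_measurable (mark_time \<nu>)"
 unfolding mark_time_def
 by (rule measurable_compose[OF measurable_snd]) (simp add: measurable_restrict_space1)

lemma sets_nonneg_times: "sets (restrict_space lborel {0..}) = sigma_sets {0..} {{0..(s::real)} | s. 0 <= s}"
proof -
 have "sets (restrict_space lborel {0..}) = sets (restrict_space borel {0::real..})"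
  by (simp add: sets_restrict_space)
 also have "\<dots> = (\<inter>) {0..} ` sigma_sets UNIV (range (%a::real. {..a}))"
  by (simp add: sets_restrict_space borel_eq_atMost)
 also have "\<dots> = sigma_sets {0..} ((%A. {0..} \<inter> A) ` range (%a::real. {..a}))"
 proof (rule sigma_sets_Int)
  have "{0::real..} \<in> sets borel" by simp
  then show "{0::real..} \<in> sigma_sets UNIV (range (%a::real. {..a}))"
   by (simp add: borel_eq_atMost)
 qed auto
 also have "\<dots> = sigma_sets {0..} {{0..(s::real)} | s. 0 <= s}"
 proof (rule sigma_sets_eqI)
  fix a assume "a \<in> (%A. {0..} \<inter> A) ` range (%a::real. {..a})"
  then obtain s where a: "a = {0..s}" by (auto simp: atLeastAtMost_def)
  show "a \<in> sigma_sets {0..} {{0..(s::real)} | s. 0 <= s}"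
   by (cases "0 <= s") (auto simp: a intro: sigma_sets.Empty)
 next
  fix b assume "b \<in> {{0..(s::real)} | s. 0 <= s}"
  then show "b \<in> sigma_sets {0..} ((%A. {0..} \<inter> A) ` range (%a::real. {..a}))"
   by (auto simp: atLeastAtMost_def)
 qed
 finally show ?thesis .
qed

lemma sets_mark_time: "sets (mark_time \<nu>) = sigma_sets (space \<nu> \<times> {0..}) {A \<times> {0..s} | A s. A \<in> sets \<nu> \<and> 0 <= s}"
proof -
 have "sets (\<nu> \<Otimes>\<^sub>M restrict_space lborel {0..})
  = sets (sigma (space \<nu> \<times> space (restrict_space lborel {0..})) {a \<times> b | a b. a \<in> sets \<nu> \<and> b \<in> {{0..(s::real)} | s. 0 <= s}})"
 proof (rule sets_pair_eq)
  show "sets \<nu> \<subseteq> Pow (space \<nu>)" by (rule sets.space_closed)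
  show "sets \<nu> = sigma_sets (space \<nu>) (sets \<nu>)" by (simp add: sets.sigma_sets_eq)
  show "countable {space \<nu>}" "{space \<nu>} \<subseteq> sets \<nu>" "\<Union> {space \<nu>} = space \<nu>" by auto
  show "{{0..(s::real)} | s. 0 <= s} \<subseteq> Pow (space (restrict_space lborel {0..}))"
   by (auto simp: space_restrict_space)
  show "sets (restrict_space lborel {0..}) = sigma_sets (space (restrict_space lborel {0..})) {{0..(s::real)} | s. 0 <= s}"
   using sets_nonneg_times by (simp add: space_restrict_space)
  show "countable ((%n::nat. {0..real n}) ` UNIV)" by auto
  show "(%n::nat. {0..real n}) ` UNIV \<subseteq> {{0..(s::real)} | s. 0 <= s}" by auto
  show "\<Union> ((%n::nat. {0..real n}) ` UNIV) = space (restrict_space lborel {0..})"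
   by (auto simp: space_restrict_space) (meson real_arch_simple)
 qed
 also have "\<dots> = sigma_sets (space \<nu> \<times> {0..}) {A \<times> {0..s} | A s. A \<in> sets \<nu> \<and> 0 <= s}"
 proof (subst sets_measure_of)
  show "{a \<times> b |a b. a \<in> sets \<nu> \<and> b \<in> {{0..(s::real)} |s. 0 <= s}} \<subseteq> Pow (space \<nu> \<times> space (restrict_space lborel {0..}))"
   by (auto simp: space_restrict_space dest: sets.sets_into_space)
  have "{a \<times> b |a b. a \<in> sets \<nu> \<and> b \<in> {{0..(s::real)} |s. 0 <= s}} = {A \<times> {0..s} | A s. A \<in> sets \<nu> \<and> 0 <= s}"
   by blast
  then show "sigma_sets (space \<nu> \<times> space (restrict_space lborel {0..})) {a \<times> b |a b. a \<in> sets \<nu> \<and> b \<in> {{0..(s::real)} |s. 0 <= s}} =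
  sigma_sets (space \<nu> \<times> {0..}) {A \<times> {0..s} |A s. A \<in> sets \<nu> \<and> 0 <= s}"
   by (simp only: space_restrict_space space_lborel space_borel Int_UNIV_right)
 qed
 finally show ?thesis by (simp add: mark_time_def)
qed

text \<open>The counts of rectangles \<open>A \<times> {0..s}\<close> suffice, because these form a generator that is stable
under intersection.  Observations and adaptedness are formulated in terms of these counts.\<close>
lemma measurable_mset_mark_timeI:
 assumes sp: "\<And>w. w \<in> space S ==> set_mset (Z w) \<subseteq> space (mark_time \<nu>)"
  and cnt: "\<And>A t. A \<in> sets \<nu> ==> 0 <= t ==>
     (%w. size {#x \<in># Z w. x \<in> A \<times> {0..t}#}) \<in> measurable S (count_space UNIV)"
  and all: "(%w. size (Z w)) \<in> measurable S (count_space UNIV)"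
 shows "Z \<in> measurable S (mset_space (mark_time \<nu>))"
proof (rule measurable_mset_spaceI[OF sp])
 fix B assume "B \<in> sets (mark_time \<nu>)"
 then have "B \<in> sigma_sets (space \<nu> \<times> {0..}) {A \<times> {0..s} | A s. A \<in> sets \<nu> \<and> 0 <= s}"
  by (simp add: sets_mark_time)
 moreover have "{A \<times> {0..s} | A s. A \<in> sets \<nu> \<and> 0 <= s} \<subseteq> Pow (space \<nu> \<times> {0..})"
  by (auto dest: sets.sets_into_space)
 moreover have "Int_stable {A \<times> {0..(s::real)} | A s. A \<in> sets \<nu> \<and> 0 <= s}"
 proof (rule Int_stableI, safe)
  fix A A' s s' assume "A \<in> sets \<nu>" "A' \<in> sets \<nu>" "0 <= (s::real)" "0 <= (s'::real)"
  then show "\<exists>A'' t. A \<times> {0..s} \<inter> A' \<times> {0..s'} = A'' \<times> {0..t} \<and> A'' \<in> sets \<nu> \<and> 0 <= t"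
   by (intro exI[of _ "A \<inter> A'"] exI[of _ "min s s'"]) auto
 qed
 ultimately have "(%w. (\<Sum>x\<in>#Z w. indicator B x) :: ennreal) \<in> borel_measurable S"
 proof (induction rule: dynkin_induct)
  case (basic B)
  then obtain A s where B: "B = A \<times> {0..s}" "A \<in> sets \<nu>" "0 <= s" by auto
  show ?case unfolding sum_mset_indicator B(1) using cnt[OF B(2,3)] by simp
 next
  case empty
  then show ?case by simp
 next
  case (compl A)
  have "(\<Sum>x\<in>#Z s. indicator (space \<nu> \<times> {0..} - A) x :: ennreal)
    = of_nat (size (Z s)) - (\<Sum>x\<in>#Z s. indicator A x)" if s: "s \<in> space S" for s
  proof -
   have "(\<Sum>x\<in>#Z s. indicator (space \<nu> \<times> {0..} - A) x :: ennreal) + (\<Sum>x\<in>#Z s. indicator A x)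
     = (\<Sum>x\<in>#Z s. 1)"
    unfolding sum_mset.distrib[symmetric] using sp[OF s]
    by (intro arg_cong[where f=sum_mset] image_mset_cong) (auto simp: indicator_def space_mark_time)
   moreover have "(\<Sum>x\<in>#Z s. indicator A x :: ennreal) \<noteq> \<top>" by (simp add: sum_mset_indicator)
   moreover have "of_nat (size (Z s)) = (\<Sum>x\<in>#Z s. 1 :: ennreal)" by simp
   ultimately show ?thesis by (metis ennreal_add_diff_cancel_right)
  qed
  moreover have "(%s. of_nat (size (Z s)) - (\<Sum>x\<in>#Z s. indicator A x :: ennreal)) \<in> borel_measurable S"
   using compl all by simp
  ultimately show ?case by (subst measurable_cong) auto
 next
  case (union A)
  have "(\<Sum>x\<in>#Z s. indicator (\<Union>i. A i) x :: ennreal) = (\<Sum>i. \<Sum>x\<in>#Z s. indicator (A i) x)" for s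
    unfolding suminf_sum_mset[symmetric] using union(1) by (simp add: suminf_indicator)
  then show ?case using union by simp
 qed
 then have m: "(%w. of_nat (size {#x \<in># Z w. x \<in> B#}) :: ennreal) \<in> borel_measurable S"
  by (simp add: sum_mset_indicator)
 show "(%s. size {#x \<in># Z s. x \<in> B#}) \<in> measurable S (count_space UNIV)"
 proof (rule measurable_count_space_eq2_countable[THEN iffD2], safe)
  fix k
  have "(%s. size {#x \<in># Z s. x \<in> B#}) -` {k} \<inter> space S
   = (%s. of_nat (size {#x \<in># Z s. x \<in> B#}) :: ennreal) -` {of_nat k} \<inter> space S" by auto
  then show "(%s. size {#x \<in># Z s. x \<in> B#}) -` {k} \<inter> space S \<in> sets S"
   using measurable_sets[OF m, of "{of_nat k}"] by simp
 qed auto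
qed

section \<open>Poisson point processes and the Mecke formula\<close>

text \<open>A Poisson random measure of finite intensity, as a random multiset.  Sets in the definition of a
random measure are awkward to add points to; multisets are not.\<close>
definition poisson_multiset :: "'w measure => 'x measure => ('w => 'x multiset) => bool" where
 "poisson_multiset M \<mu> Z \<longleftrightarrow>
   Z \<in> measurable M (mset_space \<mu>) \<and>
   (\<forall>A\<in>sets \<mu>. \<forall>k. measure M {w \<in> space M. size {#x \<in># Z w. x \<in> A#} = k}
    = measure \<mu> A ^ k / fact k * exp (- measure \<mu> A)) \<and>
   (\<forall>(n::nat) A. (\<forall>i<n. A i \<in> sets \<mu>) \<longrightarrow> disjoint_family_on A {..<n} \<longrightarrow>
    prob_space.indep_vars M (%_. count_space UNIV) (%i w. size {#x \<in># Z w. x \<in> A i#}) {..<n})"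

text \<open>For passing from overlapping regions \<open>B\<close> to the atoms \<open>P j\<close> of the algebra that they generate.\<close>
lemma size_filter_mset_atoms:
 assumes "finite J" and "\<And>x. x \<in># X ==> \<exists>!j. j \<in> J \<and> x \<in> P j"
  and "\<And>x j. x \<in># X ==> j \<in> J ==> x \<in> P j ==> x \<in> B \<longleftrightarrow> j \<in> K"
 shows "size {#x \<in># X. x \<in> B#} = (\<Sum>j\<in>J \<inter> K. size {#x \<in># X. x \<in> P j#})"
 using assms(2,3)
proof (induction X)
 case empty
 then show ?case by simp
next
 case (add a X)
 have "\<exists>!j. j \<in> J \<and> a \<in> P j" by (rule add(2)) simp
 then obtain j0 where j0: "j0 \<in> J" "a \<in> P j0" "\<And>j. j \<in> J ==> a \<in> P j ==> j = j0"
  by metis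
 have aP: "a \<in> P j \<longleftrightarrow> j = j0" if "j \<in> J" for j using j0(1,2) j0(3)[OF that] by blast
 have "(\<Sum>j\<in>J \<inter> K. size {#x \<in># add_mset a X. x \<in> P j#})
  = (\<Sum>j\<in>J \<inter> K. (if j = j0 then 1 else 0) + size {#x \<in># X. x \<in> P j#})"
  by (intro sum.cong) (simp_all add: aP)
 also have "\<dots> = (if j0 \<in> K then 1 else 0) + (\<Sum>j\<in>J \<inter> K. size {#x \<in># X. x \<in> P j#})"
  using j0(1) assms(1) by (simp add: sum.distrib)
 also have "(\<Sum>j\<in>J \<inter> K. size {#x \<in># X. x \<in> P j#}) = size {#x \<in># X. x \<in> B#}"
  by (rule add(1)[symmetric]) (use add(2,3) in auto)
 also have "(if j0 \<in> K then 1 else 0) + size {#x \<in># X. x \<in> B#} = size {#x \<in># add_mset a X. x \<in> B#}"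
  using add(3)[of a j0] j0(1,2) by simp
 finally show ?case by simp
qed

text \<open>An intersection-stable generator of the sigma-algebra of point configurations.\<close>
definition count_events_finite :: "'x measure => 'x multiset set set" where
 "count_events_finite \<mu> = {{X \<in> space (mset_space \<mu>). \<forall>i<m. size {#x \<in># X. x \<in> B i#} = n i} | m B n. \<forall>i<(m::nat). B i \<in> sets \<mu>}"

lemma count_events_finiteI:
 assumes "\<And>i. i < (m::nat) ==> B i \<in> sets \<mu>"
 shows "{X \<in> space (mset_space \<mu>). \<forall>i<m. size {#x \<in># X. x \<in> B i#} = n i} \<in> count_events_finite \<mu>"
 using assms unfolding count_events_finite_def by blast

lemma count_events_finiteE:
 assumes "E \<in> count_events_finite \<mu>"
 obtains m B n where "\<forall>i<(m::nat). B i \<in> sets \<mu>"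
  "E = {X \<in> space (mset_space \<mu>). \<forall>i<m. size {#x \<in># X. x \<in> B i#} = n i}"
 using assms unfolding count_events_finite_def by blast

lemma space_in_count_events_finite: "space (mset_space \<mu>) \<in> count_events_finite \<mu>"
 using count_events_finiteI[of 0 "%_. {}" \<mu> "%_. 0"] by simp

lemma Int_stable_count_events_finite: "Int_stable (count_events_finite \<mu>)"
proof (rule Int_stableI)
 fix E E' assume a: "E \<in> count_events_finite \<mu>" "E' \<in> count_events_finite \<mu>"
 from a(1) obtain m B n where 1: "\<forall>i<(m::nat). B i \<in> sets \<mu>"
  and E: "E = {X \<in> space (mset_space \<mu>). \<forall>i<m. size {#x \<in># X. x \<in> B i#} = n i}"
  by (rule count_events_finiteE)
 from a(2) obtain m' B' n' where 2: "\<forall>i<(m'::nat). B' i \<in> sets \<mu>"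
  and E': "E' = {X \<in> space (mset_space \<mu>). \<forall>i<m'. size {#x \<in># X. x \<in> B' i#} = n' i}"
  by (rule count_events_finiteE)
 let ?B = "%i. if i < m then B i else B' (i - m)" and ?n = "%i. if i < m then n i else n' (i - m)"
 have all: "(\<forall>i<m+m'. Q (if i < m then B i else B' (i - m)) (if i < m then n i else n' (i - m)))
  \<longleftrightarrow> (\<forall>i<m. Q (B i) (n i)) \<and> (\<forall>i<m'. Q (B' i) (n' i))" (is "?l = ?r") for Q :: "'a set => nat => bool"
 proof
  assume l: ?l
  have "Q (B i) (n i)" if "i < m" for i using l that by (auto dest: spec[of _ i])
  moreover have "Q (B' i) (n' i)" if "i < m'" for i using l that by (auto dest: spec[of _ "m + i"])
  ultimately show ?r by blast
 qed auto
 have "E \<inter> E' = {X \<in> space (mset_space \<mu>). \<forall>i<m+m'. size {#x \<in># X. x \<in> ?B i#} = ?n i}"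
  unfolding E E' all[of "%B n. size {#x \<in># _. x \<in> B#} = n"] by blast
 then show "E \<inter> E' \<in> count_events_finite \<mu>"
  using count_events_finiteI[of "m+m'" ?B \<mu> ?n] 1 2 by simp
qed

lemma sets_mset_space_count_events_finite:
 "sets (mset_space \<mu>) = sigma_sets (space (mset_space \<mu>)) (count_events_finite \<mu>)"
proof -
 have 1: "sigma_sets (space (mset_space \<mu>)) (sets (mset_space \<mu>)) = sets (mset_space \<mu>)"
  by (rule sets.sigma_sets_eq)
 have sub: "count_events_finite \<mu> \<subseteq> sets (mset_space \<mu>)"
 proof
  fix E assume "E \<in> count_events_finite \<mu>"
  then obtain m B n where B: "\<forall>i<(m::nat). B i \<in> sets \<mu>"
   and E: "E = {X \<in> space (mset_space \<mu>). \<forall>i<m. size {#x \<in># X. x \<in> B i#} = n i}"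
   by (rule count_events_finiteE)
  have "E = {X \<in> space (mset_space \<mu>). \<forall>i\<in>{..<m}. size {#x \<in># X. x \<in> B i#} = n i}" by (auto simp: E)
  also have "\<dots> \<in> sets (mset_space \<mu>)"
  proof (rule sets.sets_Collect_finite_All, goal_cases)
   case (1 i)
   note [measurable] = measurable_size_filter_mset[OF B[rule_format, of i]]
   show ?case using 1 by simp
  qed simp
  finally show "E \<in> sets (mset_space \<mu>)" .
 qed
 have "sets (mset_space \<mu>) \<subseteq> sigma_sets (space (mset_space \<mu>)) (count_events_finite \<mu>)"
  unfolding sets_mset_space space_mset_space[symmetric]
 proof (rule sigma_sets_mono, safe)
  fix A n assume A: "A \<in> sets \<mu>"
  have "{X. set_mset X \<subseteq> space \<mu> \<and> size {#x \<in># X. x \<in> A#} = n}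
   = {X \<in> space (mset_space \<mu>). \<forall>i<(1::nat). size {#x \<in># X. x \<in> (%_. A) i#} = (%_. n) i}"
   by (simp add: space_mset_space)
  also have "\<dots> \<in> count_events_finite \<mu>" by (rule count_events_finiteI) (use A in simp)
  finally show "{X. set_mset X \<subseteq> space \<mu> \<and> size {#x \<in># X. x \<in> A#} = n} \<in> sigma_sets (space (mset_space \<mu>)) (count_events_finite \<mu>)"
   by (rule sigma_sets.Basic)
 qed
 moreover have "sigma_sets (space (mset_space \<mu>)) (count_events_finite \<mu>) \<subseteq> sets (mset_space \<mu>)"
  using sub by (rule sets.sigma_sets_subset)
 ultimately show ?thesis by blast
qed

lemma sets_pair_mset_space:
 "sets (\<mu> \<Otimes>\<^sub>M mset_space \<mu>) = sigma_sets (space \<mu> \<times> space (mset_space \<mu>)) {A \<times> E | A E. A \<in> sets \<mu> \<and> E \<in> count_events_finite \<mu>}"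
proof -
 have Pow: "count_events_finite \<mu> \<subseteq> Pow (space (mset_space \<mu>))"
  by (auto elim!: count_events_finiteE)
 have "sets (\<mu> \<Otimes>\<^sub>M mset_space \<mu>) = sets (sigma (space \<mu> \<times> space (mset_space \<mu>)) {A \<times> E | A E. A \<in> sets \<mu> \<and> E \<in> count_events_finite \<mu>})"
  by (rule sets_pair_eq[where Ca="{space \<mu>}" and Cb="{space (mset_space \<mu>)}"])
    (use Pow space_in_count_events_finite[of \<mu>] in \<open>simp_all add: sets.space_closed sets.sigma_sets_eq sets_mset_space_count_events_finite\<close>)
 also have "\<dots> = sigma_sets (space \<mu> \<times> space (mset_space \<mu>)) {A \<times> E | A E. A \<in> sets \<mu> \<and> E \<in> count_events_finite \<mu>}"
  by (rule sets_measure_of) (use Pow in \<open>fastforce dest: sets.sets_into_space\<close>)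
 finally show ?thesis .
qed

lemma ennreal_summand_unique: "a + b = t ==> a + c = t ==> a \<noteq> \<top> ==> b = (c::ennreal)"
 using ennreal_add_left_cancel[of a b c] by simp

context prob_space
begin

text \<open>Disjoint regions carry independent Poisson counts, and the Poisson weights satisfy
\<open>k p(k) = \<mu> p(k - 1)\<close>.  This is the Mecke formula for functions of finitely many counts.\<close>
lemma poisson_counts_shift:
 fixes Z :: "'a => 'x multiset" and A :: "nat => 'x set" and F :: "(nat => nat) => ennreal"
 assumes Z: "poisson_multiset M \<mu> Z"
  and A: "\<And>i. i < r ==> A i \<in> sets \<mu>" "disjoint_family_on A {..<r}" and j: "j < r"
  and fin: "emeasure \<mu> (A j) < \<infinity>"
 defines "v \<equiv> %w. restrict (%i. size {#x \<in># Z w. x \<in> A i#}) {..<r}"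
 shows "(\<integral>\<^sup>+w. of_nat (v w j) * F (v w) \<partial>M) = emeasure \<mu> (A j) * (\<integral>\<^sup>+w. F ((v w)(j := Suc (v w j))) \<partial>M)"
proof -
 define S :: "(nat => nat) set" where "S = PiE {..<r} (%_. UNIV)"
 have S_ext: "S = extensional {..<r}" unfolding S_def PiE_def by simp
 have S: "countable S" unfolding S_def by (rule countable_PiE) auto
 have vS: "v w \<in> S" for w by (auto simp: v_def S_def)
 have cnt: "(%w. size {#x \<in># Z w. x \<in> A i#}) \<in> measurable M (count_space UNIV)" if "i < r" for i
  using Z A(1)[OF that] measurable_compose[OF _ measurable_size_filter_mset]
  by (auto simp: poisson_multiset_def)
 define po where "po i k = measure \<mu> (A i) ^ k / fact k * exp (- measure \<mu> (A i))" for i k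
 have po_nn: "0 <= po i k" for i k by (simp add: po_def)
 have ev: "{w \<in> space M. v w = k} \<in> events \<and> prob {w \<in> space M. v w = k} = (\<Prod>i<r. po i (k i))" if k: "k \<in> S" for k
 proof -
  have eq: "{w \<in> space M. v w = k} = {w \<in> space M. \<forall>i<r. size {#x \<in># Z w. x \<in> A i#} = k i}"
  proof (safe, goal_cases)
   case (1 w i) then show ?case by (auto simp: v_def dest: fun_cong[where x=i])
  next
   case (2 w) then show ?case using k by (auto simp: v_def S_def PiE_iff extensional_def)
  qed
  have m: "{w \<in> space M. \<forall>i<r. size {#x \<in># Z w. x \<in> A i#} = k i} \<in> events"
  proof -
   have "{w \<in> space M. \<forall>i\<in>{..<r}. size {#x \<in># Z w. x \<in> A i#} = k i} \<in> events"
   proof (rule sets.sets_Collect_finite_All, goal_cases)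
    case (1 i) then show ?case using measurable_sets[OF cnt[of i], of "{k i}"]
     by (simp add: vimage_def Int_def conj_commute)
   qed simp
   then show ?thesis by (simp only: Ball_def lessThan_iff)
  qed
  have "prob {w \<in> space M. \<forall>i<r. size {#x \<in># Z w. x \<in> A i#} = k i}
    = (\<Prod>i<r. po i (k i))"
  proof (cases "r = 0")
   case True then show ?thesis by (simp add: prob_space)
  next
   case False
   have iv: "indep_vars (%_. count_space UNIV) (%i w. size {#x \<in># Z w. x \<in> A i#}) {..<r}"
    using Z A by (auto simp: poisson_multiset_def)
   have "prob (\<Inter>i\<in>{..<r}. (%w. size {#x \<in># Z w. x \<in> A i#}) -` {k i} \<inter> space M)
     = (\<Prod>i<r. prob ((%w. size {#x \<in># Z w. x \<in> A i#}) -` {k i} \<inter> space M))"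
    by (rule indep_varsD_finite[OF iv]) (use False in auto)
   also have "(\<Inter>i\<in>{..<r}. (%w. size {#x \<in># Z w. x \<in> A i#}) -` {k i} \<inter> space M)
     = {w \<in> space M. \<forall>i<r. size {#x \<in># Z w. x \<in> A i#} = k i}" using False by auto
   also have "(\<Prod>i<r. prob ((%w. size {#x \<in># Z w. x \<in> A i#}) -` {k i} \<inter> space M)) = (\<Prod>i<r. po i (k i))"
   proof (rule prod.cong[OF refl])
    fix i assume "i \<in> {..<r}"
    then have "prob {w \<in> space M. size {#x \<in># Z w. x \<in> A i#} = k i} = po i (k i)"
     using Z A(1)[of i] by (auto simp: poisson_multiset_def po_def)
    then show "prob ((%w. size {#x \<in># Z w. x \<in> A i#}) -` {k i} \<inter> space M) = po i (k i)"
     by (simp add: vimage_def Int_def conj_commute)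
   qed
   finally show ?thesis .
  qed
  with m show ?thesis unfolding eq by (rule conjI)
 qed
 \<comment> \<open>\<open>v\<close> has countably many values, so the expectation is a sum over them\<close>
 have expand: "(\<integral>\<^sup>+w. G (v w) \<partial>M) = (\<integral>\<^sup>+k. G k * ennreal (\<Prod>i<r. po i (k i)) \<partial>count_space S)" for G :: "(nat => nat) => ennreal"
 proof -
  have "(\<integral>\<^sup>+w. G (v w) \<partial>M) = (\<integral>\<^sup>+w. (\<integral>\<^sup>+k. G k * indicator {w \<in> space M. v w = k} w \<partial>count_space S) \<partial>M)"
  proof (rule nn_integral_cong)
   fix w assume w: "w \<in> space M"
   have "(\<integral>\<^sup>+k. G k * indicator {w \<in> space M. v w = k} w \<partial>count_space S)
    = (\<integral>\<^sup>+k. G (v w) * indicator {v w} k \<partial>count_space S)"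
    using w by (intro nn_integral_cong) (simp split: split_indicator)
   also have "\<dots> = G (v w) * emeasure (count_space S) {v w}"
    using vS[of w] by (intro nn_integral_cmult_indicator) simp
   also have "emeasure (count_space S) {v w} = 1" using vS[of w] by (subst emeasure_count_space_finite) auto
   also have "G (v w) * 1 = G (v w)" by simp
   finally show "G (v w) = (\<integral>\<^sup>+k. G k * indicator {w \<in> space M. v w = k} w \<partial>count_space S)" by simp
  qed
  also have "\<dots> = (\<integral>\<^sup>+k. (\<integral>\<^sup>+w. G k * indicator {w \<in> space M. v w = k} w \<partial>M) \<partial>count_space S)"
  proof -
   have "(%w. G k * indicator {w \<in> space M. v w = k} w) \<in> borel_measurable M" if "k \<in> S" for k
    using ev[OF that] by (intro borel_measurable_times_ennreal borel_measurable_const borel_measurable_indicator) blast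
   then show ?thesis by (rule nn_integral_count_space_nn_integral[OF S])
  qed
  also have "\<dots> = (\<integral>\<^sup>+k. G k * ennreal (\<Prod>i<r. po i (k i)) \<partial>count_space S)"
   using ev by (intro nn_integral_cong) (subst nn_integral_cmult_indicator, auto simp: emeasure_eq_measure)
  finally show ?thesis .
 qed
 have "(\<integral>\<^sup>+w. of_nat (v w j) * F (v w) \<partial>M)
   = (\<integral>\<^sup>+k. of_nat (k j) * F k * ennreal (\<Prod>i<r. po i (k i)) \<partial>count_space S)"
  by (rule expand)
 also have "\<dots> = (\<integral>\<^sup>+k. of_nat (k j) * F k * ennreal (\<Prod>i<r. po i (k i)) \<partial>count_space {k \<in> S. k j \<noteq> 0})"
  by (rule nn_integral_count_space_eq) auto
 also have "\<dots> = (\<integral>\<^sup>+k. of_nat ((k(j := Suc (k j))) j) * F (k(j := Suc (k j))) * ennreal (\<Prod>i<r. po i ((k(j := Suc (k j))) i)) \<partial>count_space S)"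
 proof (rule nn_integral_bij_count_space[symmetric])
  show "bij_betw (%k. k(j := Suc (k j))) S {k \<in> S. k j \<noteq> 0}"
   by (rule bij_betw_byWitness[where f'="%k. k(j := k j - 1)"])
     (use j in \<open>simp_all add: S_ext image_subset_iff extensional_def\<close>)
 qed
 also have "\<dots> = (\<integral>\<^sup>+k. emeasure \<mu> (A j) * (F (k(j := Suc (k j))) * ennreal (\<Prod>i<r. po i (k i))) \<partial>count_space S)"
 proof (rule nn_integral_cong)
  fix k :: "nat => nat"
  let ?R = "\<Prod>i\<in>{..<r} - {j}. po i (k i)"
  have 1: "(\<Prod>i<r. po i ((k(j := Suc (k j))) i)) = po j (Suc (k j)) * ?R"
   using j by (subst prod.remove[of _ j]) auto
  have 2: "(\<Prod>i<r. po i (k i)) = po j (k j) * ?R"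
   using j by (subst prod.remove[of _ j]) auto
  have 3: "real (Suc (k j)) * po j (Suc (k j)) = measure \<mu> (A j) * po j (k j)"
   by (simp add: po_def field_simps del: of_nat_Suc)
  have Rnn: "0 <= ?R" by (intro prod_nonneg ballI po_nn)
  have em: "emeasure \<mu> (A j) = ennreal (measure \<mu> (A j))"
   using fin by (simp add: emeasure_eq_ennreal_measure)
  have pos: "0 <= po j (Suc (k j)) * ?R" "0 <= po j (k j) * ?R" using Rnn po_nn by simp_all
  have "of_nat (Suc (k j)) * ennreal (po j (Suc (k j)) * ?R) = ennreal (real (Suc (k j)) * (po j (Suc (k j)) * ?R))"
   unfolding ennreal_of_nat_eq_real_of_nat by (rule ennreal_mult''[OF pos(1), symmetric])
  also have "real (Suc (k j)) * (po j (Suc (k j)) * ?R) = measure \<mu> (A j) * (po j (k j) * ?R)"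
   using 3 by (metis mult.assoc)
  also have "ennreal (measure \<mu> (A j) * (po j (k j) * ?R)) = emeasure \<mu> (A j) * ennreal (po j (k j) * ?R)"
   unfolding em by (rule ennreal_mult''[OF pos(2)])
  finally have "of_nat (Suc (k j)) * ennreal (po j (Suc (k j)) * ?R) = emeasure \<mu> (A j) * ennreal (po j (k j) * ?R)" .
  note key = this
  have "of_nat (Suc (k j)) * F (k(j := Suc (k j))) * ennreal (po j (Suc (k j)) * ?R)
   = F (k(j := Suc (k j))) * (of_nat (Suc (k j)) * ennreal (po j (Suc (k j)) * ?R))"
   by (simp only: ac_simps)
  also have "\<dots> = emeasure \<mu> (A j) * (F (k(j := Suc (k j))) * ennreal (po j (k j) * ?R))"
   unfolding key by (simp only: ac_simps)
  finally show "of_nat ((k(j := Suc (k j))) j) * F (k(j := Suc (k j))) * ennreal (\<Prod>i<r. po i ((k(j := Suc (k j))) i))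
   = emeasure \<mu> (A j) * (F (k(j := Suc (k j))) * ennreal (\<Prod>i<r. po i (k i)))"
   unfolding 1 2 by (simp only: fun_upd_same)
 qed
 also have "\<dots> = emeasure \<mu> (A j) * (\<integral>\<^sup>+k. F (k(j := Suc (k j))) * ennreal (\<Prod>i<r. po i (k i)) \<partial>count_space S)"
  by (rule nn_integral_cmult) simp
 also have "(\<integral>\<^sup>+k. F (k(j := Suc (k j))) * ennreal (\<Prod>i<r. po i (k i)) \<partial>count_space S)
  = (\<integral>\<^sup>+w. F ((v w)(j := Suc (v w j))) \<partial>M)" by (rule expand[symmetric])
 finally show ?thesis .
qed

text \<open>Removing a typical point of a Poisson process leaves a process of the same law.  For an event
about finitely many regions, pass to the atoms of these regions and apply the shift of the counts;
then extend by the Dynkin lemma and by monotone classes.\<close>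
lemma mecke:
 fixes Z :: "'a => 'x multiset"
 assumes Z: "poisson_multiset M \<mu> Z" and fin: "finite_measure \<mu>"
  and G: "G \<in> borel_measurable (\<mu> \<Otimes>\<^sub>M mset_space \<mu>)"
 shows "(\<integral>\<^sup>+w. (\<Sum>x\<in>#Z w. G (x, Z w)) \<partial>M) = (\<integral>\<^sup>+x. (\<integral>\<^sup>+w. G (x, add_mset x (Z w)) \<partial>M) \<partial>\<mu>)"
proof -
 interpret \<mu>: finite_measure \<mu> by (rule fin)
 let ?S = "mset_space \<mu>"
 have Zm[measurable]: "Z \<in> measurable M ?S" using Z by (simp add: poisson_multiset_def)
 have Zsp: "set_mset (Z w) \<subseteq> space \<mu>" if "w \<in> space M" for w
  using measurable_space[OF Zm that] by (simp add: space_mset_space)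
 have rect: "(\<integral>\<^sup>+w. (\<Sum>x\<in>#Z w. indicator (A \<times> {X \<in> space ?S. \<forall>i<m. size {#x \<in># X. x \<in> B i#} = n i}) (x, Z w)) \<partial>M)
  = (\<integral>\<^sup>+x. (\<integral>\<^sup>+w. indicator (A \<times> {X \<in> space ?S. \<forall>i<m. size {#x \<in># X. x \<in> B i#} = n i}) (x, add_mset x (Z w)) \<partial>M) \<partial>\<mu>)"
  if A: "A \<in> sets \<mu>" and B: "\<And>i. i < m ==> B i \<in> sets \<mu>" for A m B and n :: "nat => nat"
 proof -
  \<comment> \<open>\<open>A\<close> becomes the region number \<open>m\<close>, so that the atoms refine \<open>A\<close> as well\<close>
  define B' where "B' = B(m := A)"
  have B'[measurable]: "B' i \<in> sets \<mu>" if "i <= m" for i using that A B by (auto simp: B'_def)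
  obtain b r where b: "bij_betw b {..<r::nat} (Pow {..m})"
   using ex_bij_betw_nat_finite[of "Pow {..m}"] by (auto simp: atLeast0LessThan)
  define P where "P j = {x \<in> space \<mu>. {i. i <= m \<and> x \<in> B' i} = b j}" for j
  have P_eq: "P j = (\<Inter>i\<in>{..m}. (if i \<in> b j then B' i else space \<mu> - B' i)) \<inter> space \<mu>" if "j < r" for j
  proof -
   have "b j \<subseteq> {..m}" using b that by (auto simp: bij_betw_def)
   then have "{i. i <= m \<and> x \<in> B' i} = b j \<longleftrightarrow> (\<forall>i\<in>{..m}. x \<in> B' i \<longleftrightarrow> i \<in> b j)" for x
    by blast
   then have 1: "x \<in> P j \<longleftrightarrow> x \<in> space \<mu> \<and> (\<forall>i\<in>{..m}. x \<in> B' i \<longleftrightarrow> i \<in> b j)" for x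
    unfolding P_def mem_Collect_eq by (simp only:)
   have 2: "x \<in> (if i \<in> b j then B' i else space \<mu> - B' i) \<longleftrightarrow> (x \<in> B' i \<longleftrightarrow> i \<in> b j)" if "x \<in> space \<mu>" for x i
    using that by simp
   show ?thesis unfolding set_eq_iff Int_iff INT_iff 1 using 2 by blast
  qed
  have P[measurable]: "P j \<in> sets \<mu>" if "j < r" for j
   unfolding P_eq[OF that] by (intro sets.Int sets.finite_INT sets.top) auto
  have dis: "disjoint_family_on P {..<r}"
   using b by (auto simp: disjoint_family_on_def P_def bij_betw_def inj_on_def)
  have ex1: "\<exists>!j. j \<in> {..<r} \<and> x \<in> P j" if "x \<in> space \<mu>" for x
  proof -
   have "{i. i <= m \<and> x \<in> B' i} \<in> b ` {..<r}" using b by (auto simp: bij_betw_def)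
   then obtain j where "j < r" "b j = {i. i <= m \<and> x \<in> B' i}" by auto
   then show ?thesis using b that
    by (intro ex1I[of _ j]) (auto simp: P_def bij_betw_def dest: inj_onD)
  qed
  define K where "K i = {j. i \<in> b j}" for i
  have cnt: "size {#x \<in># X. x \<in> B' i#} = (\<Sum>j\<in>{..<r} \<inter> K i. size {#x \<in># X. x \<in> P j#})"
   if "set_mset X \<subseteq> space \<mu>" "i <= m" for X i
  proof (rule size_filter_mset_atoms)
   show "\<exists>!j. j \<in> {..<r} \<and> x \<in> P j" if "x \<in># X" for x
    by (rule ex1) (use that \<open>set_mset X \<subseteq> space \<mu>\<close> in blast)
   show "x \<in> B' i \<longleftrightarrow> j \<in> K i" if "x \<in> P j" for x j
    using that \<open>i <= m\<close> unfolding P_def K_def by blast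
  qed simp
  define v where "v w = restrict (%i. size {#x \<in># Z w. x \<in> P i#}) {..<r}" for w
  define F :: "(nat => nat) => ennreal" where "F k = (if \<forall>i<m. (\<Sum>j\<in>{..<r} \<inter> K i. k j) = n i then 1 else 0)" for k
  define E where "E = {X \<in> space ?S. \<forall>i<m. size {#x \<in># X. x \<in> B i#} = n i}"
  have EF: "indicator E (Z w) = F (v w)" if "w \<in> space M" for w
  proof -
   have "size {#x \<in># Z w. x \<in> B i#} = (\<Sum>j\<in>{..<r} \<inter> K i. v w j)" if "i < m" for i
    using cnt[OF Zsp[OF \<open>w \<in> space M\<close>], of i] that by (auto simp: B'_def v_def)
   then show ?thesis using Zsp[OF that] by (auto simp: E_def F_def indicator_def space_mset_space)
  qed
  have EF': "indicator E (add_mset x (Z w)) = F ((v w)(j := Suc (v w j)))"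
   if w: "w \<in> space M" and j: "j < r" "x \<in> P j" for w x j
  proof -
   have x: "x \<in> space \<mu>" using j by (auto simp: P_def)
   have xP: "x \<in> P j' \<longleftrightarrow> j' = j" if "j' < r" for j'
    using ex1[OF x] that j by (metis lessThan_iff)
   have "size {#x \<in># add_mset x (Z w). x \<in> B i#} = (\<Sum>j'\<in>{..<r} \<inter> K i. ((v w)(j := Suc (v w j))) j')" if i: "i < m" for i
   proof -
    have "size {#x \<in># add_mset x (Z w). x \<in> B' i#} = (\<Sum>j\<in>{..<r} \<inter> K i. size {#y \<in># add_mset x (Z w). y \<in> P j#})"
     by (rule cnt) (use Zsp[OF w] x i in auto)
    also have "\<dots> = (\<Sum>j'\<in>{..<r} \<inter> K i. ((v w)(j := Suc (v w j))) j')"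
     by (intro sum.cong refl) (use xP in \<open>auto simp: v_def\<close>)
    finally show ?thesis using i by (simp add: B'_def)
   qed
   then show ?thesis using Zsp[OF w] x by (auto simp: E_def F_def indicator_def space_mset_space)
  qed
  have Em[measurable]: "E \<in> sets ?S"
  proof -
   have "E = {X \<in> space ?S. \<forall>i\<in>{..<m}. size {#x \<in># X. x \<in> B i#} = n i}" by (auto simp: E_def)
   also have "\<dots> \<in> sets ?S"
   proof (rule sets.sets_Collect_finite_All, goal_cases)
    case (1 i)
    note [measurable] = measurable_size_filter_mset[OF B[of i]]
    show ?case using 1 by simp
   qed simp
   finally show ?thesis .
  qed
  have vm: "(%w. of_nat (v w j) * F (v w)) \<in> borel_measurable M" if "j < r" for j
  proof -
   note [measurable] = measurable_compose[OF Zm measurable_size_filter_mset[OF P[OF that]]]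
   have "(%w. of_nat (size {#x \<in># Z w. x \<in> P j#}) * indicator E (Z w) :: ennreal) \<in> borel_measurable M"
    by measurable
   then show ?thesis using that EF by (subst measurable_cong[where g="%w. of_nat (size {#x \<in># Z w. x \<in> P j#}) * indicator E (Z w)"]) (auto simp: v_def)
  qed
  have "(\<integral>\<^sup>+w. (\<Sum>x\<in>#Z w. indicator (A \<times> E) (x, Z w)) \<partial>M)
   = (\<integral>\<^sup>+w. (\<Sum>j\<in>{..<r} \<inter> K m. of_nat (v w j) * F (v w)) \<partial>M)"
  proof (rule nn_integral_cong)
   fix w assume w: "w \<in> space M"
   have "(\<Sum>x\<in>#Z w. indicator (A \<times> E) (x, Z w) :: ennreal) = (\<Sum>x\<in>#Z w. indicator A x * F (v w))"
    using EF[OF w] by (simp add: indicator_times)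
   also have "\<dots> = of_nat (size {#x \<in># Z w. x \<in> A#}) * F (v w)"
    by (simp add: sum_mset_distrib_right[symmetric] sum_mset_indicator)
   also have "size {#x \<in># Z w. x \<in> A#} = (\<Sum>j\<in>{..<r} \<inter> K m. v w j)"
    using cnt[OF Zsp[OF w], of m] by (auto simp: B'_def v_def)
   finally show "(\<Sum>x\<in>#Z w. indicator (A \<times> E) (x, Z w)) = (\<Sum>j\<in>{..<r} \<inter> K m. of_nat (v w j) * F (v w))"
    by (simp add: sum_distrib_right)
  qed
  also have "\<dots> = (\<Sum>j\<in>{..<r} \<inter> K m. (\<integral>\<^sup>+w. of_nat (v w j) * F (v w) \<partial>M))"
   by (rule nn_integral_sum) (use vm in auto)
  also have "\<dots> = (\<Sum>j\<in>{..<r} \<inter> K m. emeasure \<mu> (P j) * (\<integral>\<^sup>+w. F ((v w)(j := Suc (v w j))) \<partial>M))"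
   unfolding v_def using dis
   by (intro sum.cong refl poisson_counts_shift[OF Z]) (auto simp: less_top[symmetric] intro: P)
  also have "\<dots> = (\<Sum>j\<in>{..<r} \<inter> K m. (\<integral>\<^sup>+x. (\<integral>\<^sup>+w. F ((v w)(j := Suc (v w j))) \<partial>M) * indicator (P j) x \<partial>\<mu>))"
   by (intro sum.cong refl, subst nn_integral_cmult_indicator) (auto simp: mult.commute)
  also have "\<dots> = (\<integral>\<^sup>+x. (\<Sum>j\<in>{..<r} \<inter> K m. (\<integral>\<^sup>+w. F ((v w)(j := Suc (v w j))) \<partial>M) * indicator (P j) x) \<partial>\<mu>)"
   by (rule nn_integral_sum[symmetric]) auto
  also have "\<dots> = (\<integral>\<^sup>+x. (\<integral>\<^sup>+w. indicator (A \<times> E) (x, add_mset x (Z w)) \<partial>M) \<partial>\<mu>)"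
  proof (rule nn_integral_cong)
   fix x assume x: "x \<in> space \<mu>"
   from ex1[OF x] obtain j where j: "j < r" "x \<in> P j" by (metis lessThan_iff)
   have xP: "x \<in> P j' \<longleftrightarrow> j' = j" if "j' < r" for j'
    using ex1[OF x] that j by (metis lessThan_iff)
   have "m \<in> b j \<longleftrightarrow> m <= m \<and> x \<in> B' m" using j(2) unfolding P_def by blast
   then have xA: "x \<in> A \<longleftrightarrow> j \<in> K m" by (simp add: K_def B'_def)
   have "(\<Sum>j\<in>{..<r} \<inter> K m. (\<integral>\<^sup>+w. F ((v w)(j := Suc (v w j))) \<partial>M) * indicator (P j) x)
    = (\<Sum>j'\<in>{..<r} \<inter> K m. if j' = j then (\<integral>\<^sup>+w. F ((v w)(j := Suc (v w j))) \<partial>M) else 0)"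
    by (intro sum.cong refl) (simp add: xP indicator_def)
   also have "\<dots> = (if j \<in> K m then (\<integral>\<^sup>+w. F ((v w)(j := Suc (v w j))) \<partial>M) else 0)"
    using j by simp
   also have "\<dots> = (if j \<in> K m then (\<integral>\<^sup>+w. indicator E (add_mset x (Z w)) \<partial>M) else 0)"
    using EF'[OF _ j] by (simp cong: nn_integral_cong)
   also have "\<dots> = (\<integral>\<^sup>+w. indicator (A \<times> E) (x, add_mset x (Z w)) \<partial>M)"
    unfolding indicator_times by (cases "x \<in> A") (use xA in simp_all)
   finally show "(\<Sum>j\<in>{..<r} \<inter> K m. (\<integral>\<^sup>+w. F ((v w)(j := Suc (v w j))) \<partial>M) * indicator (P j) x)
    = (\<integral>\<^sup>+w. indicator (A \<times> E) (x, add_mset x (Z w)) \<partial>M)" .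
  qed
  finally show ?thesis unfolding E_def .
 qed
 \<comment> \<open>finiteness of the expected number of points is what allows to pass to complements\<close>
 have total: "(\<integral>\<^sup>+w. of_nat (size (Z w)) \<partial>M) = emeasure \<mu> (space \<mu>)"
 proof -
  have "(\<integral>\<^sup>+w. of_nat (size (Z w)) \<partial>M) = (\<integral>\<^sup>+w. (\<Sum>x\<in>#Z w. indicator (space \<mu> \<times> space ?S) (x, Z w)) \<partial>M)"
  proof (rule nn_integral_cong)
   fix w assume w: "w \<in> space M"
   have "(\<Sum>x\<in>#Z w. indicator (space \<mu> \<times> space ?S) (x, Z w) :: ennreal) = (\<Sum>x\<in>#Z w. 1)"
    using Zsp[OF w] by (intro arg_cong[where f=sum_mset] image_mset_cong) (auto simp: indicator_def space_mset_space)
   then show "of_nat (size (Z w)) = (\<Sum>x\<in>#Z w. indicator (space \<mu> \<times> space ?S) (x, Z w) :: ennreal)"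
    by simp
  qed
  also have "\<dots> = (\<integral>\<^sup>+x. (\<integral>\<^sup>+w. indicator (space \<mu> \<times> space ?S) (x, add_mset x (Z w)) \<partial>M) \<partial>\<mu>)"
   using rect[of "space \<mu>" 0 "%_. {}" "%_. 0"] by simp
  also have "\<dots> = (\<integral>\<^sup>+x. (\<integral>\<^sup>+w. 1 \<partial>M) \<partial>\<mu>)"
   using Zsp by (intro nn_integral_cong) (auto simp: indicator_def space_mset_space)
  finally show ?thesis by (simp add: emeasure_space_1)
 qed
 have addm[measurable]: "(%(x, w). add_mset x (Z w)) \<in> measurable (\<mu> \<Otimes>\<^sub>M M) ?S"
  unfolding split_beta by (rule measurable_add_mset) measurable
 have meas1: "(%w. \<Sum>x\<in>#Z w. H (x, Z w)) \<in> borel_measurable M" if [measurable]: "H \<in> borel_measurable (\<mu> \<Otimes>\<^sub>M ?S)" for H :: "_ => ennreal"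
  using borel_measurable_sum_mset_ennreal[OF Zm, of "%(x, w). H (x, Z w)"] by simp
 have meas2: "(%w. H (x, add_mset x (Z w))) \<in> borel_measurable M" if [measurable]: "H \<in> borel_measurable (\<mu> \<Otimes>\<^sub>M ?S)" and x: "x \<in> space \<mu>" for x and H :: "_ => ennreal"
  using measurable_compose[OF measurable_Pair1'[OF x] , of "%(x, w). H (x, add_mset x (Z w))" M borel] by simp
 have meas3: "(%x. \<integral>\<^sup>+w. H (x, add_mset x (Z w)) \<partial>M) \<in> borel_measurable \<mu>" if [measurable]: "H \<in> borel_measurable (\<mu> \<Otimes>\<^sub>M ?S)" for H :: "_ => ennreal"
  by measurable
 have ind: "(\<integral>\<^sup>+w. (\<Sum>x\<in>#Z w. indicator R (x, Z w)) \<partial>M) = (\<integral>\<^sup>+x. (\<integral>\<^sup>+w. indicator R (x, add_mset x (Z w)) \<partial>M) \<partial>\<mu>)"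
  if "R \<in> sets (\<mu> \<Otimes>\<^sub>M ?S)" for R
 proof -
  let ?E = "{A \<times> E | A E. A \<in> sets \<mu> \<and> E \<in> count_events_finite \<mu>}"
  have sig: "sets (\<mu> \<Otimes>\<^sub>M ?S) = sigma_sets (space \<mu> \<times> space ?S) ?E" by (rule sets_pair_mset_space)
  have R: "R \<in> sigma_sets (space \<mu> \<times> space ?S) ?E" using that sig by simp
  have Pow: "?E \<subseteq> Pow (space \<mu> \<times> space ?S)"
  proof safe
   fix A E x X assume "A \<in> sets \<mu>" "E \<in> count_events_finite \<mu>" "x \<in> A" "X \<in> E"
   then show "x \<in> space \<mu>" "X \<in> space ?S"
    using sets.sets_into_space[of A \<mu>] by (auto simp: count_events_finite_def)
  qed
  have Is: "Int_stable ?E"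
  proof (rule Int_stableI, safe)
   fix A A' E E' assume a: "A \<in> sets \<mu>" "A' \<in> sets \<mu>" "E \<in> count_events_finite \<mu>" "E' \<in> count_events_finite \<mu>"
   have "E \<inter> E' \<in> count_events_finite \<mu>"
    using Int_stable_count_events_finite a(3,4) by (auto simp: Int_stable_def)
   then show "\<exists>A'' E''. A \<times> E \<inter> A' \<times> E' = A'' \<times> E'' \<and> A'' \<in> sets \<mu> \<and> E'' \<in> count_events_finite \<mu>"
    using a(1,2) by (intro exI[of _ "A \<inter> A'"] exI[of _ "E \<inter> E'"]) (simp add: Times_Int_Times)
  qed
  show ?thesis using R Pow Is
  proof (induction rule: dynkin_induct)
   case (basic R)
   then obtain A E where R: "R = A \<times> E" "A \<in> sets \<mu>" "E \<in> count_events_finite \<mu>" by auto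
   from R(3) show ?case
   proof (rule count_events_finiteE)
    fix m B n assume "\<forall>i<(m::nat). B i \<in> sets \<mu>" "E = {X \<in> space (mset_space \<mu>). \<forall>i<m. size {#x \<in># X. x \<in> B i#} = n i}"
    then show ?thesis unfolding R(1) using rect[OF R(2)] by simp
   qed
  next
   case empty
   then show ?case by simp
  next
   case (compl R)
   let ?c = "space \<mu> \<times> space ?S - R"
   have Rm[measurable]: "R \<in> sets (\<mu> \<Otimes>\<^sub>M ?S)" using compl(1) sig by simp
   have cm[measurable]: "?c \<in> sets (\<mu> \<Otimes>\<^sub>M ?S)" using sets.compl_sets[OF Rm] by (simp add: space_pair_measure)
   let ?l = "%R. (\<integral>\<^sup>+w. (\<Sum>x\<in>#Z w. indicator R (x, Z w)) \<partial>M) :: ennreal"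
   let ?r = "%R. (\<integral>\<^sup>+x. (\<integral>\<^sup>+w. indicator R (x, add_mset x (Z w)) \<partial>M) \<partial>\<mu>) :: ennreal"
   have l: "?l R + ?l ?c = emeasure \<mu> (space \<mu>)"
   proof -
    have "?l R + ?l ?c = (\<integral>\<^sup>+w. (\<Sum>x\<in>#Z w. indicator R (x, Z w)) + (\<Sum>x\<in>#Z w. indicator ?c (x, Z w)) \<partial>M)"
     by (rule nn_integral_add[symmetric]) (rule meas1, simp)+
    also have "\<dots> = (\<integral>\<^sup>+w. of_nat (size (Z w)) \<partial>M)"
    proof (rule nn_integral_cong)
     fix w assume w: "w \<in> space M"
     have "(\<Sum>x\<in>#Z w. indicator R (x, Z w)) + (\<Sum>x\<in>#Z w. indicator ?c (x, Z w)) = (\<Sum>x\<in>#Z w. 1 :: ennreal)"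
      unfolding sum_mset.distrib[symmetric] using Zsp[OF w]
      by (intro arg_cong[where f=sum_mset] image_mset_cong) (auto simp: indicator_def space_mset_space)
     then show "(\<Sum>x\<in>#Z w. indicator R (x, Z w)) + (\<Sum>x\<in>#Z w. indicator ?c (x, Z w)) = (of_nat (size (Z w)) :: ennreal)" by simp
    qed
    finally show ?thesis using total by simp
   qed
   have r: "?r R + ?r ?c = emeasure \<mu> (space \<mu>)"
   proof -
    have "?r R + ?r ?c = (\<integral>\<^sup>+x. (\<integral>\<^sup>+w. indicator R (x, add_mset x (Z w)) \<partial>M) + (\<integral>\<^sup>+w. indicator ?c (x, add_mset x (Z w)) \<partial>M) \<partial>\<mu>)"
     by (rule nn_integral_add[symmetric]) (rule meas3, simp)+
    also have "\<dots> = (\<integral>\<^sup>+x. (\<integral>\<^sup>+w. indicator R (x, add_mset x (Z w)) + indicator ?c (x, add_mset x (Z w)) \<partial>M) \<partial>\<mu>)"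
     by (intro nn_integral_cong nn_integral_add[symmetric]) (rule meas2, simp, simp)+
    also have "\<dots> = (\<integral>\<^sup>+x. (\<integral>\<^sup>+w. 1 \<partial>M) \<partial>\<mu>)"
     using Zsp by (intro nn_integral_cong) (auto simp: indicator_def space_mset_space)
    finally show ?thesis by (simp add: emeasure_space_1)
   qed
   have "?l R \<noteq> \<top>" using l \<mu>.emeasure_finite[of "space \<mu>"] by (metis ennreal_add_eq_top infinity_ennreal_def)
   then show ?case using ennreal_summand_unique[OF l r[folded compl(2)]] by simp
  next
   case (union R)
   have Rm[measurable]: "R i \<in> sets (\<mu> \<Otimes>\<^sub>M ?S)" for i using union(2) sig by auto
   have "(\<integral>\<^sup>+w. (\<Sum>x\<in>#Z w. indicator (\<Union>i. R i) (x, Z w)) \<partial>M) = (\<integral>\<^sup>+w. (\<Sum>i. \<Sum>x\<in>#Z w. indicator (R i) (x, Z w)) \<partial>M)"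
    unfolding suminf_sum_mset[symmetric] by (simp add: suminf_indicator[OF union(1)])
   also have "\<dots> = (\<Sum>i. (\<integral>\<^sup>+x. (\<integral>\<^sup>+w. indicator (R i) (x, add_mset x (Z w)) \<partial>M) \<partial>\<mu>))"
    unfolding union(3)[symmetric] by (rule nn_integral_suminf) (rule meas1, simp)
   also have "\<dots> = (\<integral>\<^sup>+x. (\<Sum>i. (\<integral>\<^sup>+w. indicator (R i) (x, add_mset x (Z w)) \<partial>M)) \<partial>\<mu>)"
    by (rule nn_integral_suminf[symmetric]) (rule meas3, simp)
   also have "\<dots> = (\<integral>\<^sup>+x. (\<integral>\<^sup>+w. (\<Sum>i. indicator (R i) (x, add_mset x (Z w))) \<partial>M) \<partial>\<mu>)"
    by (intro nn_integral_cong nn_integral_suminf[symmetric]) (rule meas2, simp, simp)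
   finally show ?case by (simp add: suminf_indicator[OF union(1)])
  qed
 qed
 show ?thesis using G
 proof (induction rule: borel_measurable_induct)
  case (cong f g)
  have "(\<integral>\<^sup>+w. (\<Sum>x\<in>#Z w. f (x, Z w)) \<partial>M) = (\<integral>\<^sup>+w. (\<Sum>x\<in>#Z w. g (x, Z w)) \<partial>M)"
   using Zsp by (intro nn_integral_cong arg_cong[where f=sum_mset] image_mset_cong cong(3)) (auto simp: space_pair_measure space_mset_space)
  moreover have "(\<integral>\<^sup>+x. (\<integral>\<^sup>+w. f (x, add_mset x (Z w)) \<partial>M) \<partial>\<mu>) = (\<integral>\<^sup>+x. (\<integral>\<^sup>+w. g (x, add_mset x (Z w)) \<partial>M) \<partial>\<mu>)"
   using Zsp by (intro nn_integral_cong cong(3)) (auto simp: space_pair_measure space_mset_space)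
  ultimately show ?case using cong(4) by simp
 next
  case (set A)
  then show ?case by (rule ind)
 next
  case (mult u c)
  have [measurable]: "u \<in> borel_measurable (\<mu> \<Otimes>\<^sub>M ?S)" by (rule mult)
  have "(\<integral>\<^sup>+w. (\<Sum>x\<in>#Z w. c * u (x, Z w)) \<partial>M) = c * (\<integral>\<^sup>+w. (\<Sum>x\<in>#Z w. u (x, Z w)) \<partial>M)"
   unfolding sum_mset_distrib_left[symmetric] by (rule nn_integral_cmult) (rule meas1, simp)
  also have "\<dots> = (\<integral>\<^sup>+x. c * (\<integral>\<^sup>+w. u (x, add_mset x (Z w)) \<partial>M) \<partial>\<mu>)"
   unfolding mult by (rule nn_integral_cmult[symmetric]) (rule meas3, simp)
  also have "\<dots> = (\<integral>\<^sup>+x. (\<integral>\<^sup>+w. c * u (x, add_mset x (Z w)) \<partial>M) \<partial>\<mu>)"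
   by (intro nn_integral_cong nn_integral_cmult[symmetric]) (rule meas2, simp, simp)
  finally show ?case .
 next
  case (add u v)
  have [measurable]: "u \<in> borel_measurable (\<mu> \<Otimes>\<^sub>M ?S)" "v \<in> borel_measurable (\<mu> \<Otimes>\<^sub>M ?S)" by (rule add)+
  have "(\<integral>\<^sup>+w. (\<Sum>x\<in>#Z w. v (x, Z w) + u (x, Z w)) \<partial>M) = (\<integral>\<^sup>+w. (\<Sum>x\<in>#Z w. v (x, Z w)) \<partial>M) + (\<integral>\<^sup>+w. (\<Sum>x\<in>#Z w. u (x, Z w)) \<partial>M)"
   unfolding sum_mset.distrib by (rule nn_integral_add) (rule meas1, simp)+
  also have "\<dots> = (\<integral>\<^sup>+x. (\<integral>\<^sup>+w. v (x, add_mset x (Z w)) \<partial>M) + (\<integral>\<^sup>+w. u (x, add_mset x (Z w)) \<partial>M) \<partial>\<mu>)"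
   unfolding add by (rule nn_integral_add[symmetric]) (rule meas3, simp)+
  also have "\<dots> = (\<integral>\<^sup>+x. (\<integral>\<^sup>+w. v (x, add_mset x (Z w)) + u (x, add_mset x (Z w)) \<partial>M) \<partial>\<mu>)"
   by (intro nn_integral_cong nn_integral_add[symmetric]) (rule meas2, simp, simp)+
  finally show ?case .
 next
  case (seq U)
  have [measurable]: "U i \<in> borel_measurable (\<mu> \<Otimes>\<^sub>M ?S)" for i by (rule seq)
  have incU: "incseq U" by (rule seq)
  have inc: "incseq (%i x. U i (x, s))" "incseq (%i. U i y)" for s y
   using incU by (simp_all add: incseq_def le_fun_def del: split_paired_All)
  have "(\<integral>\<^sup>+w. (\<Sum>x\<in>#Z w. (SUP i. U i) (x, Z w)) \<partial>M) = (\<integral>\<^sup>+w. (SUP i. \<Sum>x\<in>#Z w. U i (x, Z w)) \<partial>M)"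
   by (simp add: sum_mset_SUP[OF inc(1), symmetric] image_comp)
  also have "\<dots> = (SUP i. (\<integral>\<^sup>+w. (\<Sum>x\<in>#Z w. U i (x, Z w)) \<partial>M))"
   by (rule nn_integral_monotone_convergence_SUP)
     (use inc(2) in \<open>auto simp: incseq_def le_fun_def intro!: sum_mset_mono meas1\<close>)
  also have "\<dots> = (SUP i. (\<integral>\<^sup>+x. (\<integral>\<^sup>+w. U i (x, add_mset x (Z w)) \<partial>M) \<partial>\<mu>))"
   using seq by simp
  also have "\<dots> = (\<integral>\<^sup>+x. (SUP i. (\<integral>\<^sup>+w. U i (x, add_mset x (Z w)) \<partial>M)) \<partial>\<mu>)"
   by (rule nn_integral_monotone_convergence_SUP[symmetric])
     (use inc(2) in \<open>auto simp: incseq_def le_fun_def intro!: nn_integral_mono meas3\<close>)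
  also have "\<dots> = (\<integral>\<^sup>+x. (\<integral>\<^sup>+w. (SUP i. U i (x, add_mset x (Z w))) \<partial>M) \<partial>\<mu>)"
   by (intro nn_integral_cong nn_integral_monotone_convergence_SUP[symmetric])
     (use inc(2) in \<open>auto simp: incseq_def le_fun_def intro!: meas2\<close>)
  finally show ?case by (simp add: image_comp)
 qed
qed

text \<open>The version needed here: the other process, independent of \<open>Z\<close>, is carried along as a parameter.\<close>
lemma mecke_indep:
 fixes Z :: "'a => 'x multiset"
 assumes Z: "poisson_multiset M \<mu> Z" and fin: "finite_measure \<mu>"
  and ind: "indep_var (mset_space \<mu>) Z W V"
  and G: "G \<in> borel_measurable (\<mu> \<Otimes>\<^sub>M (mset_space \<mu> \<Otimes>\<^sub>M W))"
 shows "(\<integral>\<^sup>+w. (\<Sum>x\<in>#Z w. G (x, Z w, V w)) \<partial>M)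
  = (\<integral>\<^sup>+x. (\<integral>\<^sup>+w. G (x, add_mset x (Z w), V w) \<partial>M) \<partial>\<mu>)"
proof -
 interpret \<mu>: finite_measure \<mu> by (rule fin)
 let ?S = "mset_space \<mu>"
 note [measurable] = G
 have Zm[measurable]: "Z \<in> measurable M ?S" and Vm[measurable]: "V \<in> measurable M W"
  using indep_var_rv1[OF ind] indep_var_rv2[OF ind] by auto
 interpret dZ: prob_space "distr M ?S Z" by (rule prob_space_distr) fact
 interpret dV: prob_space "distr M W V" by (rule prob_space_distr) fact
 interpret dZV: pair_prob_space "distr M ?S Z" "distr M W V" ..
 have joint: "(\<integral>\<^sup>+w. H (Z w, V w) \<partial>M) = (\<integral>\<^sup>+v. (\<integral>\<^sup>+w. H (Z w, v) \<partial>M) \<partial>distr M W V)"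
  if [measurable]: "H \<in> borel_measurable (?S \<Otimes>\<^sub>M W)" for H :: "_ => ennreal"
 proof -
  have "(\<integral>\<^sup>+w. H (Z w, V w) \<partial>M) = (\<integral>\<^sup>+p. H p \<partial>distr M (?S \<Otimes>\<^sub>M W) (%w. (Z w, V w)))"
   by (rule nn_integral_distr[symmetric]) measurable
  also have "distr M (?S \<Otimes>\<^sub>M W) (%w. (Z w, V w)) = distr M ?S Z \<Otimes>\<^sub>M distr M W V"
   using ind by (simp add: indep_var_distribution_eq)
  also have "(\<integral>\<^sup>+p. H p \<partial>(distr M ?S Z \<Otimes>\<^sub>M distr M W V)) = (\<integral>\<^sup>+v. (\<integral>\<^sup>+z. H (z, v) \<partial>distr M ?S Z) \<partial>distr M W V)"
   by (rule dZV.nn_integral_snd[symmetric]) measurable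
  also have "\<dots> = (\<integral>\<^sup>+v. (\<integral>\<^sup>+w. H (Z w, v) \<partial>M) \<partial>distr M W V)"
  proof (rule nn_integral_cong)
   fix v assume "v \<in> space (distr M W V)"
   then have [measurable]: "v \<in> space W" by simp
   show "(\<integral>\<^sup>+z. H (z, v) \<partial>distr M ?S Z) = (\<integral>\<^sup>+w. H (Z w, v) \<partial>M)"
    by (rule nn_integral_distr) measurable
  qed
  finally show ?thesis .
 qed
 have m1: "(%(z, v). \<Sum>x\<in>#z. G (x, z, v)) \<in> borel_measurable (?S \<Otimes>\<^sub>M W)"
  using borel_measurable_sum_mset_ennreal[of fst "?S \<Otimes>\<^sub>M W" \<mu> G] by (simp add: case_prod_beta')
 have m2: "(%(z, v). G (x, add_mset x z, v)) \<in> borel_measurable (?S \<Otimes>\<^sub>M W)" if x: "x \<in> space \<mu>" for x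
 proof -
  have "(%y. add_mset x (fst y)) \<in> measurable (?S \<Otimes>\<^sub>M W) ?S"
   by (rule measurable_add_mset) (use x in simp_all)
  then have "(%y. (x, add_mset x (fst y), snd y)) \<in> measurable (?S \<Otimes>\<^sub>M W) (\<mu> \<Otimes>\<^sub>M (?S \<Otimes>\<^sub>M W))"
   by (intro measurable_Pair) (use x in simp_all)
  from measurable_compose[OF this G] show ?thesis by (simp add: case_prod_beta')
 qed
 have am3: "(%y. add_mset (snd (fst y)) (Z (snd y))) \<in> measurable ((distr M W V \<Otimes>\<^sub>M \<mu>) \<Otimes>\<^sub>M M) ?S"
  by (rule measurable_add_mset) measurable
 have "(%y. (snd (fst y), add_mset (snd (fst y)) (Z (snd y)), fst (fst y))) \<in> measurable ((distr M W V \<Otimes>\<^sub>M \<mu>) \<Otimes>\<^sub>M M) (\<mu> \<Otimes>\<^sub>M (?S \<Otimes>\<^sub>M W))"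
  by (intro measurable_Pair am3) measurable
 from measurable_compose[OF this G]
 have "(%(y, w). G (snd y, add_mset (snd y) (Z w), fst y)) \<in> borel_measurable ((distr M W V \<Otimes>\<^sub>M \<mu>) \<Otimes>\<^sub>M M)"
  by (simp add: case_prod_beta')
 from borel_measurable_nn_integral[OF this]
 have m3: "(%(v, x). \<integral>\<^sup>+w. G (x, add_mset x (Z w), v) \<partial>M) \<in> borel_measurable (distr M W V \<Otimes>\<^sub>M \<mu>)"
  by (simp add: case_prod_beta')
 interpret pr: pair_sigma_finite "distr M W V" \<mu> ..
 have "(\<integral>\<^sup>+w. (\<Sum>x\<in>#Z w. G (x, Z w, V w)) \<partial>M)
   = (\<integral>\<^sup>+v. (\<integral>\<^sup>+w. (\<Sum>x\<in>#Z w. G (x, Z w, v)) \<partial>M) \<partial>distr M W V)"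
  using joint[OF m1] by simp
 also have "\<dots> = (\<integral>\<^sup>+v. (\<integral>\<^sup>+x. (\<integral>\<^sup>+w. G (x, add_mset x (Z w), v) \<partial>M) \<partial>\<mu>) \<partial>distr M W V)"
 proof (rule nn_integral_cong)
  fix v assume "v \<in> space (distr M W V)"
  then have [measurable]: "v \<in> space W" by simp
  have "(%(x, z). G (x, z, v)) \<in> borel_measurable (\<mu> \<Otimes>\<^sub>M ?S)" by measurable
  from mecke[OF Z fin this] show "(\<integral>\<^sup>+w. (\<Sum>x\<in>#Z w. G (x, Z w, v)) \<partial>M) = (\<integral>\<^sup>+x. (\<integral>\<^sup>+w. G (x, add_mset x (Z w), v) \<partial>M) \<partial>\<mu>)" by simp
 qed
 also have "\<dots> = (\<integral>\<^sup>+x. (\<integral>\<^sup>+v. (\<integral>\<^sup>+w. G (x, add_mset x (Z w), v) \<partial>M) \<partial>distr M W V) \<partial>\<mu>)"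
  by (rule pr.Fubini'[symmetric]) (rule m3)
 also have "\<dots> = (\<integral>\<^sup>+x. (\<integral>\<^sup>+w. G (x, add_mset x (Z w), V w) \<partial>M) \<partial>\<mu>)"
  using joint[OF m2] by (intro nn_integral_cong) simp
 finally show ?thesis .
qed

lemma poisson_multiset_restrict:
 assumes X: "poisson_random_measure M \<mu> X" and S: "S \<in> sets \<mu>" "emeasure \<mu> S < \<infinity>"
  and fin: "\<And>w. w \<in> space M ==> finite (X w \<inter> S)"
 shows "poisson_multiset M (density \<mu> (indicator S)) (%w. mset_set (X w \<inter> S))"
proof -
 have sz: "size {#x \<in># mset_set (X w \<inter> S). x \<in> A#} = card (X w \<inter> (S \<inter> A))" if "w \<in> space M" for w A
  using fin[OF that] by (simp add: filter_mset_mset_set Int_def conj_ac)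
 have SA: "S \<inter> A \<in> sets \<mu> \<and> emeasure \<mu> (S \<inter> A) < \<infinity>" if "A \<in> sets \<mu>" for A
  using S that emeasure_mono[of "S \<inter> A" S \<mu>] by (auto intro: le_less_trans)
 have ms: "measure (density \<mu> (indicator S)) A = measure \<mu> (S \<inter> A)" if "A \<in> sets \<mu>" for A
  using S that by (simp add: measure_def emeasure_density flip: indicator_inter_arith)
 have cardm: "(%w. card (X w \<inter> (S \<inter> A))) \<in> measurable M (count_space UNIV)" if "A \<in> sets \<mu>" for A
  using X SA[OF that] by (auto simp: poisson_random_measure_def)
 show ?thesis unfolding poisson_multiset_def
 proof (intro conjI ballI allI impI)
  show "(%w. mset_set (X w \<inter> S)) \<in> measurable M (mset_space (density \<mu> (indicator S)))"
  proof (rule measurable_mset_spaceI)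
   fix w assume "w \<in> space M"
   then show "set_mset (mset_set (X w \<inter> S)) \<subseteq> space (density \<mu> (indicator S))"
    using X fin by (auto simp: poisson_random_measure_def)
  next
   fix A assume "A \<in> sets (density \<mu> (indicator S))"
   then show "(%w. size {#x \<in># mset_set (X w \<inter> S). x \<in> A#}) \<in> measurable M (count_space UNIV)"
    using cardm[of A] by (subst measurable_cong[OF sz]) auto
  qed
 next
  fix A k assume A: "A \<in> sets (density \<mu> (indicator S))"
  then have A': "A \<in> sets \<mu>" by simp
  have "{w \<in> space M. size {#x \<in># mset_set (X w \<inter> S). x \<in> A#} = k} = {w \<in> space M. card (X w \<inter> (S \<inter> A)) = k}"
   using sz by auto
  then show "prob {w \<in> space M. size {#x \<in># mset_set (X w \<inter> S). x \<in> A#} = k}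
    = measure (density \<mu> (indicator S)) A ^ k / fact k * exp (- measure (density \<mu> (indicator S)) A)"
   using X SA[OF A'] by (simp add: ms[OF A'] poisson_random_measure_def)
 next
  fix n :: nat and A assume A: "\<forall>i<n. A i \<in> sets (density \<mu> (indicator S))" and dis: "disjoint_family_on A {..<n}"
  have "indep_vars (%_. count_space UNIV) (%i w. card (X w \<inter> (S \<inter> A i))) {..<n}"
  proof -
   have "\<forall>i<n. S \<inter> A i \<in> sets \<mu> \<and> emeasure \<mu> (S \<inter> A i) < \<infinity>" using A SA by auto
   moreover have "disjoint_family_on (%i. S \<inter> A i) {..<n}"
    using dis by (auto simp: disjoint_family_on_def)
   ultimately show ?thesis
    using X[unfolded poisson_random_measure_def, THEN conjunct2, THEN conjunct2, rule_format, of n "%i. S \<inter> A i"] by simp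
  qed
  then show "indep_vars (%_. count_space UNIV) (%i w. size {#x \<in># mset_set (X w \<inter> S). x \<in> A i#}) {..<n}"
   unfolding indep_vars_def2 by (simp add: measurable_cong[OF sz] vimage_inter_cong[OF sz])
 qed
qed

end

section \<open>The observed point process\<close>

lemma measurable_points_upto:
 assumes sp: "\<And>w. w \<in> space S ==> X w \<subseteq> space (mark_time \<nu>)"
  and fin: "\<And>w. w \<in> space S ==> finite {x \<in> X w. snd x <= t}"
  and cnt: "\<And>A s. A \<in> sets \<nu> ==> 0 <= s ==> s <= t ==> (%w. num_points (X w) A {0..s}) \<in> measurable S (count_space UNIV)"
  and t: "0 <= t"
 shows "(%w. points_upto (X w) t) \<in> measurable S (mset_space (mark_time \<nu>))"
proof (rule measurable_mset_mark_timeI)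
 show "set_mset (points_upto (X w) t) \<subseteq> space (mark_time \<nu>)" if "w \<in> space S" for w
  using sp[OF that] fin[OF that] by (auto simp: points_upto_def)
 have eq: "size {#x \<in># points_upto (X w) t. x \<in> A \<times> {0..s}#} = num_points (X w) A {0..min s t}"
  if "w \<in> space S" "0 <= s" for w A s
 proof -
  have "size {#x \<in># points_upto (X w) t. x \<in> A \<times> {0..s}#} = card {x \<in> X w. snd x <= t \<and> x \<in> A \<times> {0..s}}"
   using fin[OF that(1)] by (simp add: points_upto_def filter_mset_mset_set)
  also have "{x \<in> X w. snd x <= t \<and> x \<in> A \<times> {0..s}} = {x \<in> X w. fst x \<in> A \<and> snd x \<in> {0..min s t}}"
   by auto
  finally show ?thesis by (simp add: num_points_def)
 qed
 show "(%w. size {#x \<in># points_upto (X w) t. x \<in> A \<times> {0..s}#}) \<in> measurable S (count_space UNIV)"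
  if "A \<in> sets \<nu>" "0 <= s" for A s
  by (subst measurable_cong[OF eq]) (use that t cnt[of A "min s t"] in auto)
 have eq': "size (points_upto (X w) t) = num_points (X w) (space \<nu>) {0..t}" if "w \<in> space S" for w
 proof -
  have "{x \<in> X w. snd x <= t} = {x \<in> X w. fst x \<in> space \<nu> \<and> snd x \<in> {0..t}}"
   using sp[OF that] by (auto simp: space_mark_time)
  then show ?thesis using fin[OF that] by (simp add: points_upto_def num_points_def)
 qed
 show "(%w. size (points_upto (X w) t)) \<in> measurable S (count_space UNIV)"
  by (subst measurable_cong[OF eq']) (use t cnt[of "space \<nu>" t] in auto)
qed

lemma emeasure_time_slice: "emeasure (mark_time \<nu>) {x \<in> space (mark_time \<nu>). snd x = s} = 0"
proof -
 interpret sigma_finite_measure "restrict_space lborel {0::real..}"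
  by (rule sigma_finite_measure_restrict_space) (auto intro: lborel.sigma_finite_measure_axioms)
 have "{x \<in> space (mark_time \<nu>). snd x = s} = space \<nu> \<times> ({s} \<inter> {0..})" by (auto simp: space_mark_time)
 also have "emeasure (mark_time \<nu>) \<dots> = emeasure \<nu> (space \<nu>) * emeasure (restrict_space lborel {0..}) ({s} \<inter> {0..})"
  unfolding mark_time_def
  by (rule emeasure_pair_measure_Times) (simp_all add: sets_restrict_space_iff)
 also have "emeasure (restrict_space lborel {0..}) ({s} \<inter> {0..}) = emeasure lborel ({s} \<inter> {0..})"
  by (rule emeasure_restrict_space) auto
 also have "\<dots> = 0" by (cases "0 <= s") auto
 finally show ?thesis by simp
qed

text \<open>The mean measures have no atoms in time; hence fixed times and the end points of intervals
never matter.\<close>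
lemma AE_time_neq: "AE x in mark_time \<nu>. snd x \<noteq> s"
 by (rule AE_I'[of "{x \<in> space (mark_time \<nu>). snd x = s}"]) (auto simp: null_sets_def emeasure_time_slice)

context cluster_model
begin

abbreviation M0 :: "('e \<times> real) measure" where "M0 \<equiv> mark_time \<nu>"
abbreviation S0 :: "('e \<times> real) multiset measure" where "S0 \<equiv> mset_space (mark_time \<nu>)"
abbreviation Cs :: "real => 'w => ('e \<times> real) multiset" where "Cs t w \<equiv> points_upto (C w) t"
abbreviation Ns :: "real => 'w => ('e \<times> real) multiset" where "Ns t w \<equiv> points_upto (N w) t"
abbreviation Y :: "real => 'w => ('e \<times> real) multiset" where "Y \<equiv> obs N C"

lemma space_F: "0 <= t ==> space (F t) = space Q"
 and sets_F: "0 <= t ==> sets (F t) \<subseteq> sets Q"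
 using subalgebra_F by (auto simp: subalgebra_def)

lemma N_subset: "w \<in> space Q ==> N w \<subseteq> space M0"
 and C_subset: "w \<in> space Q ==> C w \<subseteq> space M0"
 using N_poisson C_poisson by (auto simp: poisson_random_measure_def)

lemma measurable_mono_F:
 assumes "0 <= s" "s <= t" "f \<in> measurable (F s) M'" shows "f \<in> measurable (F t) M'"
 using assms F_mono[of s t] space_F[of s] space_F[of t] by (auto simp: measurable_def)

lemma Cs_measurable_F: "0 <= t ==> Cs t \<in> measurable (F t) S0"
 by (rule measurable_points_upto)
   (use C_subset C_locally_finite space_F in \<open>auto intro: measurable_mono_F[OF _ _ C_adapted]\<close>)

lemma Ns_measurable_F: "0 <= t ==> Ns t \<in> measurable (F t) S0"
 by (rule measurable_points_upto)
   (use N_subset N_locally_finite space_F in \<open>auto intro: measurable_mono_F[OF _ _ N_adapted]\<close>)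

lemma Cs_measurable[measurable]: "0 <= t ==> Cs t \<in> measurable Q S0"
 and Ns_measurable[measurable]: "0 <= t ==> Ns t \<in> measurable Q S0"
 using Cs_measurable_F Ns_measurable_F measurable_from_subalg[OF subalgebra_F] by blast+

lemma Y_measurable[measurable]: "0 <= t ==> Y t \<in> measurable Q S0"
 unfolding obs_def by (intro measurable_plus_mset) measurable

lemma Et_measurable[measurable]: "space \<nu> \<times> {0..t} \<in> sets M0"
proof -
 have "space \<nu> \<times> {0..t} = {x \<in> space M0. snd x <= t}" by (auto simp: space_mark_time)
 also have "\<dots> \<in> sets M0" by measurable
 finally show ?thesis .
qed

text \<open>The mean measures of the two processes up to time \<open>t\<close>.\<close>
definition MC where "MC t = density (density M0 (%(u, s). ennreal (lamQ u s))) (indicator (space \<nu> \<times> {0..t}))"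
definition MN where "MN t = density (density M0 (%(u, s). ennreal (gam u s))) (indicator (space \<nu> \<times> {0..t}))"

lemma lamQ_meas[measurable]: "(%x. lamQ (fst x) (snd x)) \<in> borel_measurable M0"
 and gam_meas[measurable]: "(%x. gam (fst x) (snd x)) \<in> borel_measurable M0"
 using lamQ_measurable gam_measurable by (simp_all only: case_prod_beta')

lemma sets_MC[measurable_cong, simp]: "sets (MC t) = sets M0" and sets_MN[measurable_cong, simp]: "sets (MN t) = sets M0"
 and space_MC[simp]: "space (MC t) = space M0" and space_MN[simp]: "space (MN t) = space M0"
 by (simp_all add: MC_def MN_def)

lemma mset_space_MC[simp]: "mset_space (MC t) = S0" and mset_space_MN[simp]: "mset_space (MN t) = S0"
 by (simp_all add: mset_space_def)

lemma points_upto_eq: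
 "w \<in> space Q ==> Cs t w = mset_set (C w \<inter> space \<nu> \<times> {0..t})"
 "w \<in> space Q ==> Ns t w = mset_set (N w \<inter> space \<nu> \<times> {0..t})"
 using C_subset[of w] N_subset[of w] unfolding points_upto_def
 by (auto simp: space_mark_time intro!: arg_cong[where f=mset_set])

lemma poisson_multiset_cong:
 assumes "\<And>w. w \<in> space Q ==> Z w = Z' w" "poisson_multiset Q \<mu> Z"
 shows "poisson_multiset Q \<mu> Z'"
proof -
 have ZZ: "\<And>A w. w \<in> space Q ==> size {#x \<in># Z w. x \<in> A#} = size {#x \<in># Z' w. x \<in> A#}" using assms(1) by simp
 have 1: "{w \<in> space Q. size {#x \<in># Z w. x \<in> A#} = k} = {w \<in> space Q. size {#x \<in># Z' w. x \<in> A#} = k}" for A k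
  using assms(1) by auto
 show ?thesis
  using assms(2) unfolding poisson_multiset_def indep_vars_def2
  by (simp add: measurable_cong[OF assms(1)] 1 vimage_inter_cong[OF ZZ] measurable_cong[OF ZZ])
qed

lemma Cs_poisson: "0 <= t ==> poisson_multiset Q (MC t) (Cs t)"
 unfolding MC_def
 by (rule poisson_multiset_cong[OF _ poisson_multiset_restrict[OF C_poisson]])
   (use lamQ_finite C_locally_finite in \<open>auto simp: points_upto_eq[symmetric] intro: finite_subset[of _ "{x \<in> C _. snd x <= t}"]\<close>)

lemma Ns_poisson: "0 <= t ==> poisson_multiset Q (MN t) (Ns t)"
 unfolding MN_def
 by (rule poisson_multiset_cong[OF _ poisson_multiset_restrict[OF N_poisson]])
   (use gam_finite N_locally_finite in \<open>auto simp: points_upto_eq[symmetric] intro: finite_subset[of _ "{x \<in> N _. snd x <= t}"]\<close>)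

lemma finite_MC: "finite_measure (MC t)"
proof
 have "emeasure (MC t) (space (MC t)) = emeasure (density M0 (%(u, s). ennreal (lamQ u s))) (space \<nu> \<times> {0..t})"
  unfolding MC_def using sets.top[of M0]
  by (subst emeasure_restricted) (auto simp: space_mark_time Times_Int_Times Int_absorb2)
 then show "emeasure (MC t) (space (MC t)) \<noteq> \<infinity>" using lamQ_finite[of t] by auto
qed

lemma finite_MN: "finite_measure (MN t)"
proof
 have "emeasure (MN t) (space (MN t)) = emeasure (density M0 (%(u, s). ennreal (gam u s))) (space \<nu> \<times> {0..t})"
  unfolding MN_def using sets.top[of M0]
  by (subst emeasure_restricted) (auto simp: space_mark_time Times_Int_Times Int_absorb2)
 then show "emeasure (MN t) (space (MN t)) \<noteq> \<infinity>" using gam_finite[of t] by auto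
qed

lemma nn_integral_MC:
 assumes [measurable]: "g \<in> borel_measurable M0"
 shows "(\<integral>\<^sup>+x. g x \<partial>MC t) = (\<integral>\<^sup>+x. ennreal (lamQ (fst x) (snd x)) * (indicator (space \<nu> \<times> {0..t}) x * g x) \<partial>M0)"
 unfolding MC_def by (subst nn_integral_density, simp, simp, subst nn_integral_density) (simp_all add: split_beta)

lemma nn_integral_MN:
 assumes [measurable]: "g \<in> borel_measurable M0"
 shows "(\<integral>\<^sup>+x. g x \<partial>MN t) = (\<integral>\<^sup>+x. ennreal (gam (fst x) (snd x)) * (indicator (space \<nu> \<times> {0..t}) x * g x) \<partial>M0)"
 unfolding MN_def by (subst nn_integral_density, simp, simp, subst nn_integral_density) (simp_all add: split_beta)

definition sigC where "sigC = sigma_sets (space Q) (count_events (space Q) \<nu> C all_times)"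
definition sigN where "sigN = sigma_sets (space Q) (count_events (space Q) \<nu> N all_times)"

lemma count_events_Pow: "count_events \<Omega> \<nu> X T \<subseteq> Pow \<Omega>"
 by (auto simp: count_events_def)

lemma num_points_measurable_count_events:
 assumes "A \<in> sets \<nu>" "T \<in> \<T>"
 shows "(%w. num_points (X w) A T) \<in> measurable (sigma \<Omega> (count_events \<Omega> \<nu> X \<T>)) (count_space UNIV)"
proof (rule measurable_count_space_eq2_countable[THEN iffD2], safe)
 fix k
 have "(%w. num_points (X w) A T) -` {k} \<inter> space (sigma \<Omega> (count_events \<Omega> \<nu> X \<T>)) = {w \<in> \<Omega>. num_points (X w) A T = k}"
  by (auto simp: space_measure_of_conv)
 also have "\<dots> \<in> count_events \<Omega> \<nu> X \<T>" using assms by (auto simp: count_events_def)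
 finally show "(%w. num_points (X w) A T) -` {k} \<inter> space (sigma \<Omega> (count_events \<Omega> \<nu> X \<T>)) \<in> sets (sigma \<Omega> (count_events \<Omega> \<nu> X \<T>))"
  by (simp add: sets_measure_of[OF count_events_Pow] sigma_sets.Basic)
qed auto

lemma Cs_vimage: "0 <= t ==> B \<in> sets S0 ==> Cs t -` B \<inter> space Q \<in> sigC"
proof -
 assume t: "0 <= t" and B: "B \<in> sets S0"
 have "Cs t \<in> measurable (sigma (space Q) (count_events (space Q) \<nu> C all_times)) S0"
  by (rule measurable_points_upto)
    (use C_subset C_locally_finite t in \<open>auto simp: space_measure_of_conv intro!: num_points_measurable_count_events\<close>)
 from measurable_sets[OF this B] show ?thesis
  by (simp add: sigC_def sets_measure_of[OF count_events_Pow] space_measure_of_conv)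
qed

lemma Ns_vimage: "0 <= t ==> B \<in> sets S0 ==> Ns t -` B \<inter> space Q \<in> sigN"
proof -
 assume t: "0 <= t" and B: "B \<in> sets S0"
 have "Ns t \<in> measurable (sigma (space Q) (count_events (space Q) \<nu> N all_times)) S0"
  by (rule measurable_points_upto)
    (use N_subset N_locally_finite t in \<open>auto simp: space_measure_of_conv intro!: num_points_measurable_count_events\<close>)
 from measurable_sets[OF this B] show ?thesis
  by (simp add: sigN_def sets_measure_of[OF count_events_Pow] space_measure_of_conv)
qed

lemma indep_var_Ns_Cs:
 assumes t: "0 <= t" shows "indep_var S0 (Ns t) S0 (Cs t)"
 unfolding indep_var_eq
proof (intro conjI)
 have N: "sigma_sets (space Q) {Ns t -` A \<inter> space Q | A. A \<in> sets S0} \<subseteq> sigN"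
  unfolding sigN_def by (rule sigma_sets_mono) (use Ns_vimage[OF t] in \<open>auto simp: sigN_def\<close>)
 have C: "sigma_sets (space Q) {Cs t -` A \<inter> space Q | A. A \<in> sets S0} \<subseteq> sigC"
  unfolding sigC_def by (rule sigma_sets_mono) (use Cs_vimage[OF t] in \<open>auto simp: sigC_def\<close>)
 show "indep_set (sigma_sets (space Q) {Ns t -` A \<inter> space Q | A. A \<in> sets S0})
   (sigma_sets (space Q) {Cs t -` A \<inter> space Q | A. A \<in> sets S0})"
  using N_C_indep N C unfolding indep_sets2_eq sigN_def[symmetric] sigC_def[symmetric] by blast
qed (use t in auto)

lemma indep_var_Cs_Ns:
 assumes t: "0 <= t" shows "indep_var S0 (Cs t) S0 (Ns t)"
proof -
 have "indep_set B A" if "indep_set A B" for A B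
  unfolding indep_sets2_eq
 proof (intro conjI ballI)
  fix a b assume "a \<in> B" "b \<in> A"
  then have "prob (b \<inter> a) = prob b * prob a" using that unfolding indep_sets2_eq by blast
  then show "prob (a \<inter> b) = prob a * prob b" by (simp add: Int_commute mult.commute)
 qed (use that in \<open>auto simp: indep_sets2_eq\<close>)
 then show ?thesis using indep_var_Ns_Cs[OF t] unfolding indep_var_eq by blast
qed

lemma mecke_C:
 assumes t: "0 <= t" and G: "G \<in> borel_measurable (M0 \<Otimes>\<^sub>M (S0 \<Otimes>\<^sub>M S0))"
 shows "(\<integral>\<^sup>+w. (\<Sum>x\<in>#Cs t w. G (x, Cs t w, Ns t w)) \<partial>Q)
  = (\<integral>\<^sup>+x. (\<integral>\<^sup>+w. G (x, add_mset x (Cs t w), Ns t w) \<partial>Q) \<partial>MC t)"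
 using mecke_indep[OF Cs_poisson[OF t] finite_MC, of S0 "Ns t" G] indep_var_Cs_Ns[OF t] G by simp

lemma mecke_N:
 assumes t: "0 <= t" and G: "G \<in> borel_measurable (M0 \<Otimes>\<^sub>M (S0 \<Otimes>\<^sub>M S0))"
 shows "(\<integral>\<^sup>+w. (\<Sum>x\<in>#Ns t w. G (x, Ns t w, Cs t w)) \<partial>Q)
  = (\<integral>\<^sup>+x. (\<integral>\<^sup>+w. G (x, add_mset x (Ns t w), Cs t w) \<partial>Q) \<partial>MN t)"
 using mecke_indep[OF Ns_poisson[OF t] finite_MN, of S0 "Cs t" G] indep_var_Ns_Cs[OF t] G by simp

end

section \<open>Ordering the points by time\<close>

text \<open>The size counts multiplicities, so repeated points are excluded along with simultaneous ones.\<close>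
definition good :: "('e \<times> real) multiset => bool" where
 "good Y \<longleftrightarrow> (\<forall>x\<in>#Y. 0 < snd x \<and> size {#y \<in># Y. snd y = snd x#} = 1)"

definition time_rank :: "('e \<times> real) multiset => 'e \<times> real => nat" where
 "time_rank Y x = size {#y \<in># Y. snd y < snd x#}"

definition pt :: "('e \<times> real) multiset => nat => 'e \<times> real" where
 "pt Y k = (THE x. x \<in># Y \<and> time_rank Y x = k)"

lemma good_inj:
 assumes "good Y" "x \<in># Y" "y \<in># Y" "snd x = snd y" shows "x = y"
proof -
 have "size {#z \<in># Y. snd z = snd x#} = 1" using assms by (auto simp: good_def)
 then obtain a where a: "{#z \<in># Y. snd z = snd x#} = {#a#}" by (metis size_1_singleton_mset)
 have "x \<in># {#z \<in># Y. snd z = snd x#}" "y \<in># {#z \<in># Y. snd z = snd x#}" using assms by auto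
 then show ?thesis unfolding a by simp
qed

lemma good_count:
 assumes "good Y" "x \<in># Y" shows "count Y x = 1"
proof -
 have "size {#z \<in># Y. snd z = snd x#} = 1" using assms by (auto simp: good_def)
 then obtain a where a: "{#z \<in># Y. snd z = snd x#} = {#a#}" by (metis size_1_singleton_mset)
 have "count {#z \<in># Y. snd z = snd x#} x = count Y x" by simp
 moreover have "x \<in># {#z \<in># Y. snd z = snd x#}" using assms by auto
 ultimately show ?thesis unfolding a by (simp split: if_splits)
qed

lemma good_mset_set: assumes "good Y" shows "mset_set (set_mset Y) = Y"
 using good_count[OF assms] by (intro multiset_eqI) (metis count_mset_set(1,3) finite_set_mset count_eq_zero_iff)

lemma good_size: assumes "good Y" shows "size Y = card (set_mset Y)"
 using good_mset_set[OF assms] by (metis size_mset_set)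

lemma good_rank: assumes "good Y" shows "time_rank Y x = card {y \<in> set_mset Y. snd y < snd x}"
proof -
 have "time_rank Y x = size {#y \<in># mset_set (set_mset Y). snd y < snd x#}"
  unfolding good_mset_set[OF assms] by (simp add: time_rank_def)
 then show ?thesis by (simp add: filter_mset_mset_set)
qed

lemma good_rank_less:
 assumes "good Y" "x \<in># Y" shows "time_rank Y x < size Y"
 unfolding good_rank[OF assms(1)] good_size[OF assms(1)]
 by (rule psubset_card_mono) (use assms in auto)

lemma good_rank_mono:
 assumes "good Y" "x \<in># Y" "snd x < snd y" shows "time_rank Y x < time_rank Y y"
 unfolding good_rank[OF assms(1)] by (rule psubset_card_mono) (use assms in auto)

lemma good_rank_bij:
 assumes "good Y" shows "bij_betw (time_rank Y) (set_mset Y) {..<size Y}"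
proof -
 have inj: "inj_on (time_rank Y) (set_mset Y)"
 proof (rule inj_onI)
  fix x y assume *: "x \<in># Y" "y \<in># Y" "time_rank Y x = time_rank Y y"
  then have "snd x = snd y"
   using good_rank_mono[OF assms, of x y] good_rank_mono[OF assms, of y x] by (metis less_irrefl linorder_neqE)
  then show "x = y" using good_inj[OF assms] * by blast
 qed
 moreover have "time_rank Y ` set_mset Y = {..<size Y}"
 proof (rule card_subset_eq)
  show "time_rank Y ` set_mset Y \<subseteq> {..<size Y}" using good_rank_less[OF assms] by auto
  show "card (time_rank Y ` set_mset Y) = card {..<size Y}"
   using card_image[OF inj] good_size[OF assms] by simp
 qed simp
 ultimately show ?thesis by (simp add: bij_betw_def)
qed

lemma pt_rank: assumes "good Y" "x \<in># Y" shows "pt Y (time_rank Y x) = x"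
proof -
 have inj: "inj_on (time_rank Y) (set_mset Y)" using good_rank_bij[OF assms(1)] by (simp add: bij_betw_def)
 show ?thesis unfolding pt_def
 proof (rule the_equality)
  fix y assume "y \<in># Y \<and> time_rank Y y = time_rank Y x"
  then show "y = x" using inj_onD[OF inj, of y x] assms(2) by blast
 qed (use assms in simp)
qed

lemma pt_in:
 assumes "good Y" "k < size Y" shows "pt Y k \<in># Y" "time_rank Y (pt Y k) = k"
proof -
 have "k \<in> time_rank Y ` set_mset Y" using good_rank_bij[OF assms(1)] assms(2) by (simp add: bij_betw_def)
 then obtain x where x: "x \<in># Y" "k = time_rank Y x" by blast
 show "pt Y k \<in># Y" "time_rank Y (pt Y k) = k" unfolding x(2) pt_rank[OF assms(1) x(1)] by (fact x(1), rule refl)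
qed

lemma pt_inj: assumes "good Y" "k < size Y" "j < size Y" "pt Y k = pt Y j" shows "k = j"
 using pt_in(2)[OF assms(1,2)] pt_in(2)[OF assms(1,3)] assms(4) by metis

lemma pt_less:
 assumes "good Y" "k < j" "j < size Y" shows "snd (pt Y k) < snd (pt Y j)"
proof (rule ccontr)
 assume a: "\<not> snd (pt Y k) < snd (pt Y j)"
 have k: "k < size Y" using assms by simp
 note p = pt_in[OF assms(1) k] pt_in[OF assms(1,3)]
 show False
 proof (cases "snd (pt Y j) < snd (pt Y k)")
  case True
  show ?thesis using good_rank_mono[OF assms(1) p(3) True] assms(2) unfolding p(2,4) by simp
 next
  case False
  then have "pt Y j = pt Y k" using a good_inj[OF assms(1) p(3,1)] by simp
  then show ?thesis using p(2,4) assms(2) by (metis less_irrefl)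
 qed
qed

lemma pt_pos: assumes "good Y" "k < size Y" shows "0 < snd (pt Y k)"
 using pt_in[OF assms] assms(1) by (auto simp: good_def)

lemma good_eq_pts: assumes "good Y" shows "Y = image_mset (pt Y) (mset_set {..<size Y})"
proof -
 have bij: "bij_betw (pt Y) {..<size Y} (set_mset Y)"
  by (rule bij_betw_byWitness[where f'="time_rank Y"])
    (simp_all add: pt_in[OF assms] pt_rank[OF assms] good_rank_less[OF assms] image_subset_iff)
 have "image_mset (pt Y) (mset_set {..<size Y}) = mset_set (pt Y ` {..<size Y})"
  using bij by (intro image_mset_mset_set) (simp add: bij_betw_def)
 then show ?thesis using bij good_mset_set[OF assms] by (simp add: bij_betw_def)
qed

lemma sum_mset_pts: assumes "good Y" shows "(\<Sum>x\<in>#Y. f x) = (\<Sum>k<size Y. f (pt Y k))"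
 by (subst good_eq_pts[OF assms]) (simp add: sum_unfold_sum_mset image_mset.compositionality comp_def)

lemma filter_rank_eq:
 assumes "good Y" "k < size Y" shows "{#x \<in># Y. time_rank Y x = k#} = {#pt Y k#}"
proof -
 have "{#x \<in># Y. time_rank Y x = k#} = {#x \<in># mset_set (set_mset Y). time_rank Y x = k#}"
  by (simp add: good_mset_set[OF assms(1)])
 also have "\<dots> = mset_set {x \<in> set_mset Y. time_rank Y x = k}" by (simp add: filter_mset_mset_set)
 also have "{x \<in> set_mset Y. time_rank Y x = k} = {pt Y k}"
  using pt_in[OF assms] pt_rank[OF assms(1)] by auto
 finally show ?thesis by simp
qed

lemma measurable_rank:
 assumes [measurable]: "Z \<in> measurable S (mset_space (mark_time \<nu>))" "g \<in> borel_measurable S"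
 shows "(%s. size {#y \<in># Z s. snd y < g s#}) \<in> measurable S (count_space UNIV)"
  "(%s. size {#y \<in># Z s. snd y = g s#}) \<in> measurable S (count_space UNIV)"
 by (rule measurable_size_filter_mset_param[OF assms(1)], measurable)+

lemma measurable_rank_snd:
 assumes [measurable]: "Z \<in> measurable S (mset_space (mark_time \<nu>))" and g: "g \<in> measurable S (mark_time \<nu>)"
 shows "(%s. time_rank (Z s) (g s)) \<in> measurable S (count_space UNIV)"
 unfolding time_rank_def by (rule measurable_rank(1)) (use g in measurable)

lemma pred_Ball_mset:
 assumes Z: "Z \<in> measurable S (mset_space M)" and P[measurable]: "Measurable.pred (M \<Otimes>\<^sub>M S) (%(x, s). P x s)"
 shows "Measurable.pred S (%s. \<forall>x\<in>#Z s. P x s)"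
proof -
 have eq: "(%s. \<forall>x\<in>#Z s. P x s) = (%s. size {#x \<in># Z s. \<not> P x s#} = 0)"
  by (auto simp: fun_eq_iff filter_mset_eq_mempty_iff)
 have "(%s. size {#x \<in># Z s. \<not> P x s#}) \<in> measurable S (count_space UNIV)"
  by (rule measurable_size_filter_mset_param[OF Z]) measurable
 then show ?thesis unfolding eq by (rule measurable_compose) simp
qed

lemma pred_good[measurable]: "Measurable.pred (mset_space (mark_time \<nu>)) good"
 unfolding good_def
proof (rule pred_Ball_mset)
 have [measurable]: "(%p. size {#y \<in># snd p. snd y = snd (fst p)#}) \<in> measurable (mark_time \<nu> \<Otimes>\<^sub>M mset_space (mark_time \<nu>)) (count_space UNIV)"
  by (rule measurable_rank(2)) measurable
 show "Measurable.pred (mark_time \<nu> \<Otimes>\<^sub>M mset_space (mark_time \<nu>)) (%(x, Y). 0 < snd x \<and> size {#y \<in># Y. snd y = snd x#} = 1)"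
  unfolding split_beta by measurable
qed simp

lemma measurable_size_mset[measurable]: "size \<in> measurable (mset_space M) (count_space UNIV)"
 using measurable_size_filter_mset_param[of "%X. X" "mset_space M" M "%_ _. True"] by simp

text \<open>On configurations with exactly \<open>n\<close> points at distinct times, the \<open>k\<close>-th point in time is a
measurable function; functions of the observations are built from these \<open>n\<close> points.\<close>
definition good_space :: "'e measure => nat => ('e \<times> real) multiset measure" where
 "good_space \<nu> n = restrict_space (mset_space (mark_time \<nu>)) {Y. good Y \<and> size Y = n}"

lemma space_good_space: "space (good_space \<nu> n) = {Y \<in> space (mset_space (mark_time \<nu>)). good Y \<and> size Y = n}"
 by (auto simp: good_space_def space_restrict_space)

lemma measurable_good_space1: "f \<in> measurable (mset_space (mark_time \<nu>)) M' ==> f \<in> measurable (good_space \<nu> n) M'"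
 unfolding good_space_def by (rule measurable_restrict_space1)

lemma pt_measurable: assumes k: "k < n" shows "(%Y. pt Y k) \<in> measurable (good_space \<nu> n) (mark_time \<nu>)"
proof (rule measurableI)
 fix Y assume "Y \<in> space (good_space \<nu> n)"
 then show "pt Y k \<in> space (mark_time \<nu>)"
  using pt_in[of Y k] k by (auto simp: space_good_space space_mset_space)
next
 fix A assume A[measurable]: "A \<in> sets (mark_time \<nu>)"
 have [measurable]: "(%p. time_rank (snd p) (fst p)) \<in> measurable (mark_time \<nu> \<Otimes>\<^sub>M mset_space (mark_time \<nu>)) (count_space UNIV)"
  by (rule measurable_rank_snd) measurable
 have m: "(%Y. size {#x \<in># Y. time_rank Y x = k \<and> x \<in> A#}) \<in> measurable (good_space \<nu> n) (count_space UNIV)"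
  by (intro measurable_good_space1 measurable_size_filter_mset_param[where M="mark_time \<nu>"]) (simp_all add: split_beta)
 have "(%Y. pt Y k) -` A \<inter> space (good_space \<nu> n)
  = (%Y. size {#x \<in># Y. time_rank Y x = k \<and> x \<in> A#}) -` {1..} \<inter> space (good_space \<nu> n)" (is "?l = ?r")
 proof (rule set_eqI)
  fix Y
  show "Y \<in> ?l \<longleftrightarrow> Y \<in> ?r"
  proof (cases "Y \<in> space (good_space \<nu> n)")
   case True
   then have Y: "good Y" "k < size Y" using k by (auto simp: space_good_space)
   have "{#x \<in># Y. time_rank Y x = k \<and> x \<in> A#} = {#x \<in># {#x \<in># Y. time_rank Y x = k#}. x \<in> A#}"
    by (simp add: filter_filter_mset conj_commute)
   also have "\<dots> = (if pt Y k \<in> A then {#pt Y k#} else {#})" unfolding filter_rank_eq[OF Y] by simp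
   finally show ?thesis using True by simp
  qed simp
 qed
 also have "\<dots> \<in> sets (good_space \<nu> n)" by (rule measurable_sets[OF m]) simp
 finally show "(%Y. pt Y k) -` A \<inter> space (good_space \<nu> n) \<in> sets (good_space \<nu> n)" .
qed

lemma borel_measurable_good_space:
 assumes "f \<in> borel_measurable (good_space \<nu> n)"
 shows "(%Y. if good Y \<and> size Y = n then f Y else (0 :: 'b :: {topological_space, zero})) \<in> borel_measurable (mset_space (mark_time \<nu>))"
proof -
 have 1: "{Y \<in> space (mset_space (mark_time \<nu>)). good Y \<and> size Y = n} \<in> sets (mset_space (mark_time \<nu>))"
  by measurable
 show ?thesis
  by (rule measurable_If_restrict_space_iff[THEN iffD2, OF 1])
    (use assms in \<open>auto simp: good_space_def\<close>)
qed

text \<open>What is left of a configuration when the point \<open>x\<close> is disregarded.  Removing all points with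
the time of \<open>x\<close>, rather than one copy of \<open>x\<close>, makes adding \<open>x\<close> first irrelevant.\<close>
definition away :: "'e \<times> real => ('e \<times> real) multiset => ('e \<times> real) multiset" where
 "away x X = {#y \<in># X. snd y \<noteq> snd x#}"

lemma away_add_mset[simp]: "away x (add_mset x X) = away x X"
 by (simp add: away_def)

lemma measurable_away:
 assumes Z: "Z \<in> measurable S (mset_space (mark_time \<nu>))" and [measurable]: "g \<in> measurable S (mark_time \<nu>)"
 shows "(%s. away (g s) (Z s)) \<in> measurable S (mset_space (mark_time \<nu>))"
 unfolding away_def by (rule measurable_filter_mset[OF Z]) measurable

context cluster_model
begin

text \<open>The probability that an observed point at \<open>x\<close> is a cluster event (\<open>b = True\<close>) or a single event.\<close>
definition rr :: "bool => 'e \<times> real => real" where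
 "rr b x = (if b then lamQ (fst x) (snd x) else gam (fst x) (snd x)) / (lamQ (fst x) (snd x) + gam (fst x) (snd x))"

lemma rr_measurable[measurable]: "rr b \<in> borel_measurable M0"
 unfolding rr_def by measurable

lemma M0_pos: "x \<in> space M0 ==> 0 < lamQ (fst x) (snd x)" "x \<in> space M0 ==> 0 <= gam (fst x) (snd x)"
 using lamQ_pos gam_nonneg by (auto simp: space_mark_time)

lemma rr_nonneg: "x \<in> space M0 ==> 0 <= rr b x"
 using M0_pos[of x] by (auto simp: rr_def intro!: divide_nonneg_nonneg)

lemma Y_add: "Y t w = Ns t w + Cs t w" by (simp add: obs_def)

text \<open>By the Mecke formula, a point of \<open>C\<close> at \<open>x\<close> appears with density \<open>lamQ\<close> and one of \<open>N\<close> with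
density \<open>gam\<close>, and the rest of the world, described by \<open>Y\<close> and by the other cluster points, does not
tell which of the two was added.  So the type of a point can be drawn anew, given everything else.\<close>
lemma resample:
 assumes t: "0 <= t" and G[measurable]: "G \<in> borel_measurable (M0 \<Otimes>\<^sub>M (S0 \<Otimes>\<^sub>M S0))"
 shows "(\<integral>\<^sup>+w. (\<Sum>x\<in>#(if b then Cs t w else Ns t w). G (x, Y t w, away x (Cs t w))) \<partial>Q)
  = (\<integral>\<^sup>+w. (\<Sum>x\<in>#Y t w. ennreal (rr b x) * G (x, Y t w, away x (Cs t w))) \<partial>Q)"
proof -
 define I :: "('e \<times> real => ennreal) => 'e \<times> real => ennreal" where
  "I h x = (\<integral>\<^sup>+w. h x * G (x, add_mset x (Y t w), away x (Cs t w)) \<partial>Q)" for h x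
 have Gm: "(%(x, w). G (x, add_mset x (Y t w), away x (Cs t w))) \<in> borel_measurable (M0 \<Otimes>\<^sub>M Q)"
 proof -
  have "(%y. add_mset (fst y) (Y t (snd y))) \<in> measurable (M0 \<Otimes>\<^sub>M Q) S0"
   by (rule measurable_add_mset) (use t in measurable)
  moreover have "(%y. away (fst y) (Cs t (snd y))) \<in> measurable (M0 \<Otimes>\<^sub>M Q) S0"
   by (rule measurable_away) (use t in measurable)
  ultimately have "(%y. (fst y, add_mset (fst y) (Y t (snd y)), away (fst y) (Cs t (snd y)))) \<in> measurable (M0 \<Otimes>\<^sub>M Q) (M0 \<Otimes>\<^sub>M (S0 \<Otimes>\<^sub>M S0))"
   by measurable
  from measurable_compose[OF this G] show ?thesis by (simp add: split_beta)
 qed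
 have Im: "(%x. \<integral>\<^sup>+w. G (x, add_mset x (Y t w), away x (Cs t w)) \<partial>Q) \<in> borel_measurable M0"
  using borel_measurable_nn_integral[OF Gm] by simp
 have I_eq: "I h x = h x * (\<integral>\<^sup>+w. G (x, add_mset x (Y t w), away x (Cs t w)) \<partial>Q)" if "x \<in> space M0" for h x
  unfolding I_def by (rule nn_integral_cmult) (use measurable_compose[OF measurable_Pair1'[OF that] Gm] in simp)
 have ImM[measurable]: "I h \<in> borel_measurable M0" if [measurable]: "h \<in> borel_measurable M0" for h
  using Im by (subst measurable_cong[OF I_eq]) auto
 have C: "(\<integral>\<^sup>+w. (\<Sum>x\<in>#Cs t w. h x * G (x, Y t w, away x (Cs t w))) \<partial>Q) = (\<integral>\<^sup>+x. I h x \<partial>MC t)"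
  if h[measurable]: "h \<in> borel_measurable M0" for h
 proof -
  have "(%p. away (fst p) (fst (snd p))) \<in> measurable (M0 \<Otimes>\<^sub>M (S0 \<Otimes>\<^sub>M S0)) S0"
   by (rule measurable_away) measurable
  moreover have "(%p. snd (snd p) + fst (snd p)) \<in> measurable (M0 \<Otimes>\<^sub>M (S0 \<Otimes>\<^sub>M S0)) S0"
   by (rule measurable_plus_mset) measurable
  ultimately have "(%p. (fst p, snd (snd p) + fst (snd p), away (fst p) (fst (snd p)))) \<in> measurable (M0 \<Otimes>\<^sub>M (S0 \<Otimes>\<^sub>M S0)) (M0 \<Otimes>\<^sub>M (S0 \<Otimes>\<^sub>M S0))"
   by measurable
  from measurable_compose[OF this G]
  have "(%p. h (fst p) * G (fst p, snd (snd p) + fst (snd p), away (fst p) (fst (snd p)))) \<in> borel_measurable (M0 \<Otimes>\<^sub>M (S0 \<Otimes>\<^sub>M S0))"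
   by measurable
  from mecke_C[OF t this] show ?thesis by (simp add: Y_add I_def)
 qed
 have N: "(\<integral>\<^sup>+w. (\<Sum>x\<in>#Ns t w. h x * G (x, Y t w, away x (Cs t w))) \<partial>Q) = (\<integral>\<^sup>+x. I h x \<partial>MN t)"
  if h[measurable]: "h \<in> borel_measurable M0" for h
 proof -
  have "(%p. away (fst p) (snd (snd p))) \<in> measurable (M0 \<Otimes>\<^sub>M (S0 \<Otimes>\<^sub>M S0)) S0"
   by (rule measurable_away) measurable
  moreover have "(%p. fst (snd p) + snd (snd p)) \<in> measurable (M0 \<Otimes>\<^sub>M (S0 \<Otimes>\<^sub>M S0)) S0"
   by (rule measurable_plus_mset) measurable
  ultimately have "(%p. (fst p, fst (snd p) + snd (snd p), away (fst p) (snd (snd p)))) \<in> measurable (M0 \<Otimes>\<^sub>M (S0 \<Otimes>\<^sub>M S0)) (M0 \<Otimes>\<^sub>M (S0 \<Otimes>\<^sub>M S0))"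
   by measurable
  from measurable_compose[OF this G]
  have "(%p. h (fst p) * G (fst p, fst (snd p) + snd (snd p), away (fst p) (snd (snd p)))) \<in> borel_measurable (M0 \<Otimes>\<^sub>M (S0 \<Otimes>\<^sub>M S0))"
   by measurable
  from mecke_N[OF t this] show ?thesis by (simp add: Y_add I_def)
 qed
 have sm: "(%w. \<Sum>x\<in>#Z w. h x * G (x, Y t w, away x (Cs t w))) \<in> borel_measurable Q"
  if Z: "Z \<in> measurable Q S0" and [measurable]: "h \<in> borel_measurable M0" for Z and h :: "'e \<times> real => ennreal"
 proof -
  have "(%y. away (fst y) (Cs t (snd y))) \<in> measurable (M0 \<Otimes>\<^sub>M Q) S0"
   by (rule measurable_away) (use t in measurable)
  then have "(%y. (fst y, Y t (snd y), away (fst y) (Cs t (snd y)))) \<in> measurable (M0 \<Otimes>\<^sub>M Q) (M0 \<Otimes>\<^sub>M (S0 \<Otimes>\<^sub>M S0))"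
   using t by measurable
  from measurable_compose[OF this G]
  have "(%y. h (fst y) * G (fst y, Y t (snd y), away (fst y) (Cs t (snd y)))) \<in> borel_measurable (M0 \<Otimes>\<^sub>M Q)"
   by measurable
  from borel_measurable_sum_mset_ennreal[OF Z this] show ?thesis by simp
 qed
 let ?r = "%x. ennreal (rr b x)"
 have r[measurable]: "?r \<in> borel_measurable M0" by measurable
 have "(\<integral>\<^sup>+w. (\<Sum>x\<in>#Y t w. ?r x * G (x, Y t w, away x (Cs t w))) \<partial>Q)
  = (\<integral>\<^sup>+w. (\<Sum>x\<in>#Ns t w. ?r x * G (x, Y t w, away x (Cs t w))) + (\<Sum>x\<in>#Cs t w. ?r x * G (x, Y t w, away x (Cs t w))) \<partial>Q)"
  by (intro nn_integral_cong) (simp add: obs_def)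
 also have "\<dots> = (\<integral>\<^sup>+x. I ?r x \<partial>MN t) + (\<integral>\<^sup>+x. I ?r x \<partial>MC t)"
  unfolding N[OF r, symmetric] C[OF r, symmetric]
  by (rule nn_integral_add) (rule sm, use t in simp, simp)+
 also have "\<dots> = (\<integral>\<^sup>+x. ennreal (gam (fst x) (snd x)) * (indicator (space \<nu> \<times> {0..t}) x * I ?r x) \<partial>M0)
   + (\<integral>\<^sup>+x. ennreal (lamQ (fst x) (snd x)) * (indicator (space \<nu> \<times> {0..t}) x * I ?r x) \<partial>M0)"
  by (simp add: nn_integral_MC nn_integral_MN)
 also have "\<dots> = (\<integral>\<^sup>+x. ennreal (gam (fst x) (snd x)) * (indicator (space \<nu> \<times> {0..t}) x * I ?r x)
   + ennreal (lamQ (fst x) (snd x)) * (indicator (space \<nu> \<times> {0..t}) x * I ?r x) \<partial>M0)"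
  by (rule nn_integral_add[symmetric]) measurable
 also have "\<dots> = (\<integral>\<^sup>+x. ennreal (if b then lamQ (fst x) (snd x) else gam (fst x) (snd x)) * (indicator (space \<nu> \<times> {0..t}) x * I (%_. 1) x) \<partial>M0)"
 proof (rule nn_integral_cong)
  fix x assume x: "x \<in> space M0"
  let ?l = "lamQ (fst x) (snd x)" and ?g = "gam (fst x) (snd x)" and ?J = "\<integral>\<^sup>+w. G (x, add_mset x (Y t w), away x (Cs t w)) \<partial>Q"
  have "(ennreal ?g + ennreal ?l) * ennreal (rr b x) = ennreal ((?g + ?l) * rr b x)"
   using M0_pos[OF x] rr_nonneg[OF x, of b] by (simp add: ennreal_mult'' ennreal_plus)
  also have "(?g + ?l) * rr b x = (if b then ?l else ?g)"
   using M0_pos[OF x] by (simp add: rr_def add.commute)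
  finally have eq: "(ennreal ?g + ennreal ?l) * ennreal (rr b x) = ennreal (if b then ?l else ?g)" .
  have "ennreal ?g * (indicator (space \<nu> \<times> {0..t}) x * I ?r x) + ennreal ?l * (indicator (space \<nu> \<times> {0..t}) x * I ?r x)
   = (ennreal ?g + ennreal ?l) * ennreal (rr b x) * (indicator (space \<nu> \<times> {0..t}) x * ?J)"
   unfolding I_eq[OF x] distrib_right by (simp only: ac_simps)
  also have "\<dots> = ennreal (if b then ?l else ?g) * (indicator (space \<nu> \<times> {0..t}) x * I (%_. 1) x)"
   unfolding eq I_eq[OF x] by (simp only: mult_1)
  finally show "ennreal ?g * (indicator (space \<nu> \<times> {0..t}) x * I ?r x) + ennreal ?l * (indicator (space \<nu> \<times> {0..t}) x * I ?r x)
   = ennreal (if b then ?l else ?g) * (indicator (space \<nu> \<times> {0..t}) x * I (%_. 1) x)" .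
 qed
 also have "\<dots> = (\<integral>\<^sup>+x. I (%_. 1) x \<partial>(if b then MC t else MN t))"
  by (cases b) (simp_all add: nn_integral_MC nn_integral_MN)
 also have "\<dots> = (\<integral>\<^sup>+w. (\<Sum>x\<in>#(if b then Cs t w else Ns t w). G (x, Y t w, away x (Cs t w))) \<partial>Q)"
  using C[of "%_. 1"] N[of "%_. 1"] by (cases b) simp_all
 finally show ?thesis by simp
qed

lemma AE_MC: "AE x in M0. R x ==> AE x in MC t. R x" and AE_MN: "AE x in M0. R x ==> AE x in MN t. R x"
 unfolding MC_def MN_def by (subst AE_density, simp, subst AE_density, simp add: split_beta, auto)+

text \<open>By the Mecke formula, the expected number of bad points is an integral over configurations to
which one independent point is added, and the time of that point has a law without atoms.\<close>
lemma AE_good: assumes t: "0 <= t" shows "AE w in Q. good (Y t w)"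
proof -
 \<comment> \<open>indicates that \<open>x\<close> is a bad point of \<open>X\<close>\<close>
 define B where "B x X = (if snd x <= 0 \<or> size {#y \<in># X. snd y = snd x#} \<noteq> 1 then 1 else 0 :: ennreal)" for x :: "'e \<times> real" and X :: "('e \<times> real) multiset"
 have cm: "(%p. size {#y \<in># Z p. snd y = snd (fst p)#}) \<in> measurable (M0 \<Otimes>\<^sub>M S) (count_space UNIV)"
  if "Z \<in> measurable (M0 \<Otimes>\<^sub>M S) S0" for S and Z :: "('e \<times> real) \<times> 's => _"
  by (rule measurable_rank(2)) (use that in measurable)
 have Bm: "(%p. B (fst p) (Z p)) \<in> borel_measurable (M0 \<Otimes>\<^sub>M S)" if "Z \<in> measurable (M0 \<Otimes>\<^sub>M S) S0" for S and Z :: "('e \<times> real) \<times> 's => _"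
  unfolding B_def using cm[OF that] by measurable
 have key: "(\<integral>\<^sup>+x. (\<integral>\<^sup>+w. B x (add_mset x (Y t w)) \<partial>Q) \<partial>\<mu>) = 0"
  if \<mu>: "finite_measure \<mu>" "sets \<mu> = sets M0" and ae: "\<And>s. AE x in \<mu>. snd x \<noteq> s" for \<mu>
 proof -
  interpret \<mu>: finite_measure \<mu> by fact
  interpret pair_sigma_finite \<mu> Q ..
  have m: "(%(x, w). B x (add_mset x (Y t w))) \<in> borel_measurable (\<mu> \<Otimes>\<^sub>M Q)"
  proof -
   have "(%p. add_mset (fst p) (Y t (snd p))) \<in> measurable (M0 \<Otimes>\<^sub>M Q) S0"
    by (rule measurable_add_mset) (use t in measurable)
   from Bm[OF this] show ?thesis using \<mu>(2) by (simp add: split_beta cong: measurable_cong_sets)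
  qed
  have "(\<integral>\<^sup>+x. (\<integral>\<^sup>+w. B x (add_mset x (Y t w)) \<partial>Q) \<partial>\<mu>) = (\<integral>\<^sup>+w. (\<integral>\<^sup>+x. B x (add_mset x (Y t w)) \<partial>\<mu>) \<partial>Q)"
   by (rule Fubini'[symmetric]) (rule m)
  also have "\<dots> = (\<integral>\<^sup>+w. 0 \<partial>Q)"
  proof (rule nn_integral_cong)
   fix w assume w: "w \<in> space Q"
   have "AE x in \<mu>. \<forall>s\<in>insert 0 (snd ` set_mset (Y t w)). snd x \<noteq> s"
    by (rule AE_finite_allI) (use ae in auto)
   moreover have "AE x in \<mu>. 0 <= snd x"
    using \<mu>(2) sets_eq_imp_space_eq[OF \<mu>(2)] by (intro AE_I2) (auto simp: space_mark_time)
   ultimately have "AE x in \<mu>. B x (add_mset x (Y t w)) = 0"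
   proof eventually_elim
    case (elim x)
    then have "{#y \<in># Y t w. snd y = snd x#} = {#}" by (auto simp: filter_mset_eq_mempty_iff)
    then show ?case using elim by (auto simp: B_def)
   qed
   then have "(\<integral>\<^sup>+x. B x (add_mset x (Y t w)) \<partial>\<mu>) = (\<integral>\<^sup>+x. 0 \<partial>\<mu>)" by (rule nn_integral_cong_AE)
   then show "(\<integral>\<^sup>+x. B x (add_mset x (Y t w)) \<partial>\<mu>) = 0" by simp
  qed
  finally show ?thesis by simp
 qed
 have sumC: "(\<integral>\<^sup>+w. (\<Sum>x\<in>#Cs t w. B x (Y t w)) \<partial>Q) = 0"
 proof -
  have "(%p. snd (snd p) + fst (snd p)) \<in> measurable (M0 \<Otimes>\<^sub>M (S0 \<Otimes>\<^sub>M S0)) S0"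
   by (rule measurable_plus_mset) measurable
  from mecke_C[OF t Bm[OF this]] have "(\<integral>\<^sup>+w. (\<Sum>x\<in>#Cs t w. B x (Y t w)) \<partial>Q) = (\<integral>\<^sup>+x. (\<integral>\<^sup>+w. B x (add_mset x (Y t w)) \<partial>Q) \<partial>MC t)"
   by (simp add: Y_add)
  also have "\<dots> = 0" by (rule key[OF finite_MC]) (simp, rule AE_MC, rule AE_time_neq)
  finally show ?thesis .
 qed
 have sumN: "(\<integral>\<^sup>+w. (\<Sum>x\<in>#Ns t w. B x (Y t w)) \<partial>Q) = 0"
 proof -
  have "(%p. fst (snd p) + snd (snd p)) \<in> measurable (M0 \<Otimes>\<^sub>M (S0 \<Otimes>\<^sub>M S0)) S0"
   by (rule measurable_plus_mset) measurable
  from mecke_N[OF t Bm[OF this]] have "(\<integral>\<^sup>+w. (\<Sum>x\<in>#Ns t w. B x (Y t w)) \<partial>Q) = (\<integral>\<^sup>+x. (\<integral>\<^sup>+w. B x (add_mset x (Y t w)) \<partial>Q) \<partial>MN t)"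
   by (simp add: Y_add)
  also have "\<dots> = 0" by (rule key[OF finite_MN]) (simp, rule AE_MN, rule AE_time_neq)
  finally show ?thesis .
 qed
 have sm: "(%w. \<Sum>x\<in>#Z w. B x (Y t w)) \<in> borel_measurable Q" if Z: "Z \<in> measurable Q S0" for Z
 proof -
  have "(%p. Y t (snd p)) \<in> measurable (M0 \<Otimes>\<^sub>M Q) S0" using t by measurable
  from borel_measurable_sum_mset_ennreal[OF Z Bm[OF this]] show ?thesis by simp
 qed
 have "AE w in Q. (\<Sum>x\<in>#Cs t w. B x (Y t w)) = 0"
  using sumC sm[of "Cs t"] t by (subst (asm) nn_integral_0_iff_AE) auto
 moreover have "AE w in Q. (\<Sum>x\<in>#Ns t w. B x (Y t w)) = 0"
  using sumN sm[of "Ns t"] t by (subst (asm) nn_integral_0_iff_AE) auto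
 ultimately show ?thesis
 proof eventually_elim
  case (elim w)
  have "(\<Sum>x\<in>#Y t w. B x (Y t w)) = 0" using elim by (simp add: obs_def)
  then have "\<forall>x\<in>#Y t w. B x (Y t w) = 0" by simp
  then show ?case by (auto simp: good_def B_def split: if_splits)
 qed
qed

end

lemma filter_rank_subset:
 assumes "good Y" "k < size Y" "Z \<subseteq># Y"
 shows "{#x \<in># Z. time_rank Y x = k#} = (if pt Y k \<in># Z then {#pt Y k#} else {#})"
proof -
 define W where "W = {#x \<in># Z. time_rank Y x = k#}"
 have sub: "W \<subseteq># {#pt Y k#}"
  using multiset_filter_mono[OF assms(3), of "%x. time_rank Y x = k"] unfolding filter_rank_eq[OF assms(1,2)] W_def .
 have mem: "pt Y k \<in># Z \<longleftrightarrow> pt Y k \<in># W"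
  unfolding W_def using pt_in(2)[OF assms(1,2)] by simp
 have "W = (if pt Y k \<in># Z then {#pt Y k#} else {#})"
 proof (cases "W = {#}")
  case True
  then show ?thesis using mem by simp
 next
  case False
  then have "W = {#pt Y k#}" using sub by (rule nonempty_subseteq_mset_eq_single)
  then show ?thesis using mem by simp
 qed
 then show ?thesis unfolding W_def .
qed

lemma rank_subset_iff:
 assumes "good Y" "k < size Y" "Z \<subseteq># Y" "j < size Y" "k \<noteq> j"
 shows "0 < size {#x \<in># away (pt Y j) Z. time_rank Y x = k#} \<longleftrightarrow> pt Y k \<in># Z"
proof -
 have "{#x \<in># away (pt Y j) Z. time_rank Y x = k#} = {#x \<in># {#x \<in># Z. time_rank Y x = k#}. snd x \<noteq> snd (pt Y j)#}"
  by (simp add: away_def filter_filter_mset conj_commute)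
 also have "\<dots> = {#x \<in># Z. time_rank Y x = k#}"
 proof -
  have "snd (pt Y k) \<noteq> snd (pt Y j)"
   using pt_less[OF assms(1), of k j] pt_less[OF assms(1), of j k] assms(2,4,5)
   by (metis less_irrefl linorder_neqE_nat)
  then show ?thesis unfolding filter_rank_subset[OF assms(1-3)] by simp
 qed
 finally have "{#x \<in># away (pt Y j) Z. time_rank Y x = k#} = {#x \<in># Z. time_rank Y x = k#}" .
 then show ?thesis unfolding filter_rank_subset[OF assms(1-3)] by simp
qed

section \<open>Labelled histories\<close>

text \<open>The label of an observed point is \<open>None\<close> for a single event and \<open>Some d\<close> for a cluster event
 that leaves the cluster status \<open>d\<close> behind.  A history is a list of labels, latest first.\<close>

primrec labels :: "(nat => 'l) => nat => 'l list" where
 "labels f 0 = []"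
| "labels f (Suc k) = f k # labels f k"

lemma length_labels[simp]: "length (labels f k) = k" by (induction k) auto

primrec stat :: "bool => bool option list => bool" where
 "stat d0 [] = d0"
| "stat d0 (a # ls) = (case a of None => stat d0 ls | Some d => d)"

primrec num_clusters :: "bool option list => nat" where
 "num_clusters [] = 0"
| "num_clusters (a # ls) = (case a of None => num_clusters ls | Some d => Suc (num_clusters ls))"

text \<open>The transition probability from status \<open>st\<close> to status \<open>d\<close> at a cluster event.\<close>
definition tr :: "real => bool => bool => real" where
 "tr p st d = (if st then (if d then 1 - p else p) else (if d then 1 else 0))"

primrec trw :: "real => bool => bool option list => real" where
 "trw p d0 [] = 1"
| "trw p d0 (a # ls) = trw p d0 ls * (case a of None => 1 | Some d => tr p (stat d0 ls) d)"

text \<open>The coins \<open>i\<close> produce the statuses recorded in the history.  The \<open>k\<close>-th coin belongs to the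
\<open>k\<close>-th cluster event, but it is looked at only if a cluster is active then.\<close>
primrec coins_ok :: "(nat => bool) => bool => bool option list => bool" where
 "coins_ok i d0 [] = True"
| "coins_ok i d0 (a # ls) = (coins_ok i d0 ls \<and>
   (case a of None => True | Some d => (if stat d0 ls then i (Suc (num_clusters ls)) = (\<not> d) else d)))"

primrec coins_used :: "bool => bool option list => nat set" where
 "coins_used d0 [] = {}"
| "coins_used d0 (a # ls) = (case a of None => coins_used d0 ls
   | Some d => (if stat d0 ls then insert (Suc (num_clusters ls)) (coins_used d0 ls) else coins_used d0 ls))"

lemma coins_used_subset: "coins_used d0 ls \<subseteq> {1..num_clusters ls}"
proof (induction ls)
 case (Cons a ls)
 then show ?case by (cases a) (auto dest: subsetD)
qed simp

text \<open>The state \<open>(h, \<eta>)\<close> that belongs to a history when the observed points are \<open>x 0, x 1, \<dots>\<close>.\<close>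
primrec Gam :: "bool => (nat => 'e \<times> real) => bool option list => 'e state" where
 "Gam d0 x [] = ({#(d0, 0)#}, {#})"
| "Gam d0 x (a # ls) = (case a of None => Gam d0 x ls
   | Some d => (fst (Gam d0 x ls) + {#(d, snd (x (length ls)))#}, snd (Gam d0 x ls) + {#x (length ls)#}))"

text \<open>The time at which the history reaches length \<open>k\<close>, with time 0 in place of a point for \<open>k = 0\<close>.\<close>
definition tau :: "(nat => 'e \<times> real) => nat => real" where
 "tau x k = (if k = 0 then 0 else snd (x (k - 1)))"

lemma tau_0[simp]: "tau x 0 = 0" and tau_Suc[simp]: "tau x (Suc k) = snd (x k)"
 by (simp_all add: tau_def)

lemma pt_tau_less: "good Y ==> k < size Y ==> tau (pt Y) k < snd (pt Y k)"
 by (cases k) (auto simp: pt_pos intro: pt_less)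

lemma tau_mono:
 assumes "good Y" "j <= k" "k <= size Y" shows "tau (pt Y) j <= tau (pt Y) k"
 using assms(2,3)
proof (induction k rule: dec_induct)
 case (step k)
 then show ?case using pt_tau_less[OF assms(1), of k] by simp
qed simp

lemma tau_nonneg: "good Y ==> k <= size Y ==> 0 <= tau (pt Y) k"
 using tau_mono[of Y 0 k] by simp

lemma Gam_time_le:
 assumes "good Y" "length ls <= size Y" "(d, s) \<in># fst (Gam d0 (pt Y) ls)"
 shows "s <= tau (pt Y) (length ls)"
 using assms(2,3)
proof (induction ls)
 case (Cons a ls)
 have "tau (pt Y) (length ls) < snd (pt Y (length ls))"
  using Cons(2) by (intro pt_tau_less[OF assms(1)]) simp
 then show ?case using Cons by (cases a) (auto simp: less_imp_le)
qed simp

text \<open>The recorded times increase strictly, so the latest label with a status is the one of latest time.\<close>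
lemma status_Gam:
 assumes "good Y" "length ls <= size Y" shows "status (fst (Gam d0 (pt Y) ls)) = stat d0 ls"
 using assms(2)
proof (induction ls)
 case Nil
 then show ?case by (simp add: status_def)
next
 case (Cons a ls)
 show ?case
 proof (cases a)
  case None
  then show ?thesis using Cons by simp
 next
  case (Some d)
  have lt: "tau (pt Y) (length ls) < snd (pt Y (length ls))"
   using Cons(2) by (intro pt_tau_less[OF assms(1)]) simp
  have le: "s < snd (pt Y (length ls))" if "(d', s) \<in># fst (Gam d0 (pt Y) ls)" for d' s
   using Gam_time_le[OF assms(1) _ that] Cons(2) lt by simp
  let ?h = "fst (Gam d0 (pt Y) ls) + {#(d, snd (pt Y (length ls)))#}"
  have "status ?h = d" unfolding status_def
  proof (rule the_equality)
   show "\<exists>t. (d, t) \<in># ?h \<and> (\<forall>(d', t')\<in>#?h. t' <= t)"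
    using le by (intro exI[of _ "snd (pt Y (length ls))"]) (auto simp: less_imp_le)
   fix e assume "\<exists>t. (e, t) \<in># ?h \<and> (\<forall>(d', t')\<in>#?h. t' <= t)"
   then obtain t where t: "(e, t) \<in># ?h" "\<forall>(d', t')\<in>#?h. t' <= t" by blast
   have "snd (pt Y (length ls)) <= t" using t(2) by auto
   then show "e = d" using t(1) le[of e t] by auto
  qed
  then show ?thesis using Some by simp
 qed
qed

text \<open>Passing to a smaller time horizon keeps the numbering of the points.\<close>

lemma good_upto: assumes "good Y" shows "good {#x \<in># Y. snd x <= s#}"
 unfolding good_def
proof safe
 fix u r assume "(u, r) \<in># {#x \<in># Y. snd x <= s#}"
 then have *: "(u, r) \<in># Y" "r <= s" by auto
 then show "0 < snd (u, r)" using assms by (auto simp: good_def)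
 have "{#y \<in># {#x \<in># Y. snd x <= s#}. snd y = snd (u, r)#} = {#y \<in># Y. snd y = snd (u, r)#}"
  unfolding filter_filter_mset using *(2) by (intro filter_mset_cong) auto
 then show "size {#y \<in># {#x \<in># Y. snd x <= s#}. snd y = snd (u, r)#} = 1"
  using assms *(1) by (auto simp: good_def)
qed

lemma rank_upto: assumes "snd x <= s" shows "time_rank {#x \<in># Y. snd x <= s#} x = time_rank Y x"
proof -
 have "{#y \<in># {#x \<in># Y. snd x <= s#}. snd y < snd x#} = {#y \<in># Y. snd y < snd x#}"
  unfolding filter_filter_mset using assms by (intro filter_mset_cong) auto
 then show ?thesis by (simp add: time_rank_def)
qed

lemma pt_upto:
 assumes "good Y" "k < size {#x \<in># Y. snd x <= s#}" shows "pt {#x \<in># Y. snd x <= s#} k = pt Y k"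
proof -
 let ?Y = "{#x \<in># Y. snd x <= s#}"
 note p = pt_in[OF good_upto[OF assms(1)] assms(2)]
 have "pt ?Y k \<in># Y" "snd (pt ?Y k) <= s" using p(1) by auto
 then have "pt Y (time_rank Y (pt ?Y k)) = pt ?Y k" by (intro pt_rank[OF assms(1)])
 then show ?thesis using p(2) rank_upto[OF \<open>snd (pt ?Y k) <= s\<close>, of Y] by simp
qed

lemma upto_pt_iff:
 assumes "good Y" "k < size Y" shows "snd (pt Y k) <= s \<longleftrightarrow> k < size {#x \<in># Y. snd x <= s#}"
proof
 let ?Y = "{#x \<in># Y. snd x <= s#}"
 assume "snd (pt Y k) <= s"
 then have "pt Y k \<in># ?Y" using pt_in(1)[OF assms] by simp
 from good_rank_less[OF good_upto[OF assms(1)] this] show "k < size ?Y"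
  using rank_upto[OF \<open>snd (pt Y k) <= s\<close>, of Y] pt_in(2)[OF assms] by simp
next
 let ?Y = "{#x \<in># Y. snd x <= s#}"
 assume k: "k < size ?Y"
 then have "pt ?Y k \<in># ?Y" by (intro pt_in(1) good_upto assms(1))
 then show "snd (pt Y k) <= s" using pt_upto[OF assms(1) k] by simp
qed

lemma upto_tau:
 assumes "good Y" "0 <= s" shows "tau (pt Y) (size {#x \<in># Y. snd x <= s#}) <= s"
proof (cases "size {#x \<in># Y. snd x <= s#}")
 case (Suc k)
 have "size {#x \<in># Y. snd x <= s#} <= size Y" by (rule size_filter_mset_lesseq)
 then have k: "k < size Y" "k < size {#x \<in># Y. snd x <= s#}" using Suc by linarith+
 show ?thesis unfolding Suc tau_Suc by (rule upto_pt_iff[OF assms(1) k(1), THEN iffD2, OF k(2)])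
qed (simp only: tau_0 assms)

lemma upto_next:
 assumes "good Y" "size {#x \<in># Y. snd x <= s#} < size Y" shows "s < snd (pt Y (size {#x \<in># Y. snd x <= s#}))"
 using upto_pt_iff[OF assms, of s] by simp

lemma size_upto_eqI:
 assumes "good Y" "k <= size Y" "tau (pt Y) k <= s" "k < size Y ==> s < snd (pt Y k)"
 shows "size {#x \<in># Y. snd x <= s#} = k"
proof (rule antisym)
 show "size {#x \<in># Y. snd x <= s#} <= k"
 proof (cases "k < size Y")
  case True
  then show ?thesis using upto_pt_iff[OF assms(1) True, of s] assms(4) by simp
 next
  case False
  then show ?thesis using size_filter_mset_lesseq[of "%x. snd x <= s" Y] by linarith
 qed
 show "k <= size {#x \<in># Y. snd x <= s#}"
 proof (cases k)
  case (Suc j)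
  then show ?thesis using upto_pt_iff[OF assms(1), of j s] assms(2,3) by simp
 qed simp
qed

context cluster_model
begin

subsection \<open>The conditional law of the event types\<close>

lemma Cs_sub_Y: "Cs t w \<subseteq># Y t w" and Ns_sub_Y: "Ns t w \<subseteq># Y t w"
 by (simp_all add: obs_def)

lemma Ns_iff_not_Cs:
 assumes "good (Y t w)" "x \<in># Y t w" shows "x \<in># Ns t w \<longleftrightarrow> x \<notin># Cs t w"
proof -
 have "count (Ns t w) x + count (Cs t w) x = 1" using good_count[OF assms] by (simp add: obs_def)
 then show ?thesis unfolding not_in_iff count_greater_zero_iff[symmetric] by linarith
qed

text \<open>The observable factor in the thinning argument once the types of the points \<open>k < j\<close> have been
integrated out.\<close>
definition type_weight :: "(nat => bool) => nat => nat => (('e \<times> real) multiset => ennreal) => ('e \<times> real) multiset => ennreal" where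
 "type_weight c n j K X = (if good X \<and> size X = n then K X * (\<Prod>k<j. ennreal (rr (c k) (pt X k))) else 0)"

lemma type_weight_measurable:
 assumes [measurable]: "K \<in> borel_measurable S0" and "j <= n"
 shows "type_weight c n j K \<in> borel_measurable S0"
 unfolding type_weight_def
proof (rule borel_measurable_good_space)
 have [measurable]: "(%X. pt X k) \<in> measurable (good_space \<nu> n) M0" if "k < j" for k
  using that assms(2) by (intro pt_measurable) simp
 have "K \<in> borel_measurable (good_space \<nu> n)" by (rule measurable_good_space1) simp
 moreover have "(%X. \<Prod>k<j. ennreal (rr (c k) (pt X k))) \<in> borel_measurable (good_space \<nu> n)"
  by measurable
 ultimately show "(%X. K X * (\<Prod>k<j. ennreal (rr (c k) (pt X k)))) \<in> borel_measurable (good_space \<nu> n)"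
  by (rule borel_measurable_times_ennreal)
qed

text \<open>Resampling the type of the single point number \<open>j\<close> replaces the event that its type is \<open>c j\<close> by
the probability of that type.\<close>
lemma thinning_step:
 assumes t: "0 <= t" and K: "K \<in> borel_measurable S0" and j: "j < n"
 shows "(\<integral>\<^sup>+w. type_weight c n j K (Y t w) * (\<Prod>k\<in>{j..<n}. of_bool ((pt (Y t w) k \<in># Cs t w) = c k)) \<partial>Q)
  = (\<integral>\<^sup>+w. type_weight c n (Suc j) K (Y t w) * (\<Prod>k\<in>{Suc j..<n}. of_bool ((pt (Y t w) k \<in># Cs t w) = c k)) \<partial>Q)"
proof -
 \<comment> \<open>the types of the later points; disregarding the point number \<open>j\<close> does not change them\<close>
 define R :: "('e \<times> real) multiset => ('e \<times> real) multiset => ennreal" where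
  "R X Z = (\<Prod>k\<in>{Suc j..<n}. of_bool ((0 < size {#x \<in># Z. time_rank X x = k#}) = c k))" for X Z
 define G :: "('e \<times> real) \<times> ('e \<times> real) multiset \<times> ('e \<times> real) multiset => ennreal" where
  "G = (%(x, X, Z). type_weight c n j K X * (of_bool (time_rank X x = j) * R X Z))"
 have Gm: "G \<in> borel_measurable (M0 \<Otimes>\<^sub>M (S0 \<Otimes>\<^sub>M S0))"
 proof -
  have [measurable]: "(%p. time_rank (fst (snd p)) (fst p)) \<in> measurable (M0 \<Otimes>\<^sub>M (S0 \<Otimes>\<^sub>M S0)) (count_space UNIV)"
   by (rule measurable_rank_snd) measurable
  have [measurable]: "(%q. time_rank (fst (snd (snd q))) (fst q)) \<in> measurable (M0 \<Otimes>\<^sub>M (M0 \<Otimes>\<^sub>M (S0 \<Otimes>\<^sub>M S0))) (count_space UNIV)"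
   by (rule measurable_rank_snd) measurable
  have [measurable]: "(%p. size {#x \<in># snd (snd p). time_rank (fst (snd p)) x = k#}) \<in> measurable (M0 \<Otimes>\<^sub>M (S0 \<Otimes>\<^sub>M S0)) (count_space UNIV)" for k
  proof (rule measurable_size_filter_mset_param[where M=M0])
   show "(%p. snd (snd p)) \<in> measurable (M0 \<Otimes>\<^sub>M (S0 \<Otimes>\<^sub>M S0)) S0" by measurable
   show "Measurable.pred (M0 \<Otimes>\<^sub>M (M0 \<Otimes>\<^sub>M (S0 \<Otimes>\<^sub>M S0))) (%(x, p). time_rank (fst (snd p)) x = k)"
    unfolding split_beta by measurable
  qed
  have [measurable]: "type_weight c n j K \<in> borel_measurable S0" using K j by (intro type_weight_measurable) auto
  show ?thesis unfolding G_def R_def split_beta by measurable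
 qed
 have main: "(\<Sum>x\<in>#(if c j then Cs t w else Ns t w). G (x, Y t w, away x (Cs t w)))
   = type_weight c n j K (Y t w) * (\<Prod>k\<in>{j..<n}. of_bool ((pt (Y t w) k \<in># Cs t w) = c k))"
  "(\<Sum>x\<in>#Y t w. ennreal (rr (c j) x) * G (x, Y t w, away x (Cs t w)))
   = type_weight c n (Suc j) K (Y t w) * (\<Prod>k\<in>{Suc j..<n}. of_bool ((pt (Y t w) k \<in># Cs t w) = c k))" for w
 proof -
  let ?Y = "Y t w"
  have sumG: "(\<Sum>x\<in>#Z. h x * G (x, ?Y, away x (Cs t w)))
   = (if pt ?Y j \<in># Z then h (pt ?Y j) * (type_weight c n j K ?Y * (\<Prod>k\<in>{Suc j..<n}. of_bool ((pt ?Y k \<in># Cs t w) = c k))) else 0)"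
   if gd: "good ?Y" "size ?Y = n" and Z: "Z \<subseteq># ?Y" for Z and h :: "'e \<times> real => ennreal"
  proof -
   have R: "R ?Y (away (pt ?Y j) (Cs t w)) = (\<Prod>k\<in>{Suc j..<n}. of_bool ((pt ?Y k \<in># Cs t w) = c k))"
    unfolding R_def using gd j
    by (intro prod.cong refl) (subst rank_subset_iff[OF gd(1) _ Cs_sub_Y], auto)
   have "(\<Sum>x\<in>#Z. h x * G (x, ?Y, away x (Cs t w)))
    = (\<Sum>x\<in>#Z. if time_rank ?Y x = j then h x * (type_weight c n j K ?Y * R ?Y (away x (Cs t w))) else 0)"
    by (intro arg_cong[where f=sum_mset] image_mset_cong) (simp add: G_def)
   also have "\<dots> = (\<Sum>x\<in>#{#x \<in># Z. time_rank ?Y x = j#}. h x * (type_weight c n j K ?Y * R ?Y (away x (Cs t w))))"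
    by (induction Z) auto
   also have "\<dots> = (if pt ?Y j \<in># Z then h (pt ?Y j) * (type_weight c n j K ?Y * R ?Y (away (pt ?Y j) (Cs t w))) else 0)"
    using filter_rank_subset[OF gd(1) _ Z, of j] j gd(2) by simp
   finally show ?thesis unfolding R .
  qed
  have bad: "(\<Sum>x\<in>#Z. h x * G (x, ?Y, away x (Cs t w))) = 0" if "\<not> (good ?Y \<and> size ?Y = n)" for Z and h :: "'e \<times> real => ennreal"
   using that by (auto simp: G_def type_weight_def)
  have pr: "(\<Prod>k\<in>{j..<n}. of_bool ((pt ?Y k \<in># Cs t w) = c k)) =
   of_bool ((pt ?Y j \<in># Cs t w) = c j) * (\<Prod>k\<in>{Suc j..<n}. of_bool ((pt ?Y k \<in># Cs t w) = c k) :: ennreal)"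
   using j by (simp add: prod.atLeast_Suc_lessThan)
  show "(\<Sum>x\<in>#(if c j then Cs t w else Ns t w). G (x, ?Y, away x (Cs t w)))
   = type_weight c n j K ?Y * (\<Prod>k\<in>{j..<n}. of_bool ((pt ?Y k \<in># Cs t w) = c k))"
  proof (cases "good ?Y \<and> size ?Y = n")
   case True
   have "pt ?Y j \<in># (if c j then Cs t w else Ns t w) \<longleftrightarrow> (pt ?Y j \<in># Cs t w) = c j"
    using Ns_iff_not_Cs[of t w "pt ?Y j"] pt_in(1)[of ?Y j] True j by auto
   moreover have "(if c j then Cs t w else Ns t w) \<subseteq># ?Y" using Cs_sub_Y Ns_sub_Y by auto
   ultimately show ?thesis
    using sumG[of "if c j then Cs t w else Ns t w" "%_. 1"] True unfolding pr by simp
  next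
   case False
   have "type_weight c n j K ?Y = 0" unfolding type_weight_def using False by (rule if_not_P)
   then show ?thesis using bad[OF False, of "%_. 1" "if c j then Cs t w else Ns t w"] by simp
  qed
  show "(\<Sum>x\<in>#?Y. ennreal (rr (c j) x) * G (x, ?Y, away x (Cs t w)))
   = type_weight c n (Suc j) K ?Y * (\<Prod>k\<in>{Suc j..<n}. of_bool ((pt ?Y k \<in># Cs t w) = c k))"
  proof (cases "good ?Y \<and> size ?Y = n")
   case True
   then have "pt ?Y j \<in># ?Y" using pt_in(1)[of ?Y j] j by simp
   then show ?thesis
    using sumG[of ?Y "%x. ennreal (rr (c j) x)"] True by (simp add: type_weight_def ac_simps)
  next
   case False
   have "type_weight c n (Suc j) K ?Y = 0" unfolding type_weight_def using False by (rule if_not_P)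
   then show ?thesis using bad[OF False] by simp
  qed
 qed
 show ?thesis
  using resample[OF t Gm, of "c j"] by (simp only: main)
qed

lemma thinning:
 assumes t: "0 <= t" and K: "K \<in> borel_measurable S0"
 shows "(\<integral>\<^sup>+w. type_weight c n 0 K (Y t w) * (\<Prod>k<n. of_bool ((pt (Y t w) k \<in># Cs t w) = c k)) \<partial>Q)
  = (\<integral>\<^sup>+w. type_weight c n n K (Y t w) \<partial>Q)"
proof -
 have "(\<integral>\<^sup>+w. type_weight c n 0 K (Y t w) * (\<Prod>k\<in>{0..<n}. of_bool ((pt (Y t w) k \<in># Cs t w) = c k)) \<partial>Q)
  = (\<integral>\<^sup>+w. type_weight c n j K (Y t w) * (\<Prod>k\<in>{j..<n}. of_bool ((pt (Y t w) k \<in># Cs t w) = c k)) \<partial>Q)"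
  if "j <= n" for j
  using that
 proof (induction j)
  case (Suc j)
  then show ?case using thinning_step[OF t K, of j n c] by simp
 qed simp
 from this[of n] show ?thesis by (simp add: atLeast0LessThan)
qed

end

section \<open>The law of the histories\<close>

text \<open>Admissibility of the coins is a condition on each coin in use separately, so its probability is a
product of coin probabilities, which is \<open>trw\<close>.  The factor \<open>det\<close> accounts for the cluster events that
are no chance events: from status 0 the new status must be 1.\<close>
lemma coins_ok_cylinder:
 "\<exists>det b. (\<forall>i. coins_ok i d0 ls \<longleftrightarrow> det \<and> (\<forall>k\<in>coins_used d0 ls. i k = b k)) \<and>
   trw p d0 ls = (if det then (\<Prod>k\<in>coins_used d0 ls. if b k then p else 1 - p) else 0)"
proof (induction ls)
 case Nil
 show ?case by (rule exI[of _ True]) simp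
next
 case (Cons a ls)
 then obtain det b where
  IH1: "\<And>i. coins_ok i d0 ls \<longleftrightarrow> det \<and> (\<forall>k\<in>coins_used d0 ls. i k = b k)" and
  IH2: "trw p d0 ls = (if det then (\<Prod>k\<in>coins_used d0 ls. if b k then p else 1 - p) else 0)"
  by blast
 show ?case
 proof (cases a)
  case None
  then show ?thesis using IH1 IH2 by (intro exI[of _ det] exI[of _ b]) simp
 next
  case (Some d)
  let ?m = "Suc (num_clusters ls)"
  show ?thesis
  proof (cases "stat d0 ls")
   case True
   have m: "?m \<notin> coins_used d0 ls" using coins_used_subset[of d0 ls] by auto
   have fin: "finite (coins_used d0 ls)" using coins_used_subset[of d0 ls] by (rule finite_subset) simp
   let ?b = "b(?m := \<not> d)"
   have 1: "(\<forall>k\<in>coins_used d0 ls. i k = ?b k) \<longleftrightarrow> (\<forall>k\<in>coins_used d0 ls. i k = b k)" for i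
    using m by (intro ball_cong) auto
   have 2: "(\<Prod>k\<in>coins_used d0 ls. if ?b k then p else 1 - p) = (\<Prod>k\<in>coins_used d0 ls. if b k then p else 1 - p)"
    using m by (intro prod.cong) auto
   have u: "coins_used d0 (a # ls) = insert ?m (coins_used d0 ls)" using Some True by simp
   have 3: "(\<Prod>k\<in>coins_used d0 (a # ls). if ?b k then p else 1 - p) = (if \<not> d then p else 1 - p) * (\<Prod>k\<in>coins_used d0 ls. if b k then p else 1 - p)"
    unfolding u prod.insert[OF fin m] 2 by simp
   have 4: "coins_ok i d0 (a # ls) \<longleftrightarrow> det \<and> (\<forall>k\<in>coins_used d0 (a # ls). i k = ?b k)" for i
    unfolding u using 1[of i] IH1[of i] Some True by auto
   have 5: "trw p d0 (a # ls) = (if det then (\<Prod>k\<in>coins_used d0 (a # ls). if ?b k then p else 1 - p) else 0)"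
    unfolding 3 using IH2 Some True by (simp add: tr_def)
   show ?thesis using 4 5 by blast
  next
   case False
   have 4: "coins_ok i d0 (a # ls) \<longleftrightarrow> (det \<and> d) \<and> (\<forall>k\<in>coins_used d0 (a # ls). i k = b k)" for i
    using IH1[of i] Some False by auto
   have 5: "trw p d0 (a # ls) = (if det \<and> d then (\<Prod>k\<in>coins_used d0 (a # ls). if b k then p else 1 - p) else 0)"
    using IH2 Some False by (simp add: tr_def)
   show ?thesis using 4 5 by blast
  qed
 qed
qed

definition is_cluster :: "bool option list => nat => bool" where
 "is_cluster ls j \<longleftrightarrow> rev ls ! j \<noteq> None"

lemma is_cluster_Cons:
 "is_cluster (a # ls) (length ls) \<longleftrightarrow> a \<noteq> None"
 "j < length ls ==> is_cluster (a # ls) j \<longleftrightarrow> is_cluster ls j"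
 by (simp_all add: is_cluster_def nth_append)

context cluster_model
begin

definition lab :: "real => 'w => nat => bool option" where
 "lab t w k = (if pt (Y t w) k \<in># Cs t w then Some (D (snd (pt (Y t w) k)) w) else None)"

abbreviation labs :: "real => 'w => nat => bool option list" where
 "labs t w k \<equiv> labels (lab t w) k"

subsection \<open>The path of the status process\<close>

lemma Cs_iff: "w \<in> space Q ==> y \<in># Cs t w \<longleftrightarrow> y \<in> C w \<and> snd y <= t"
 using C_locally_finite by (simp add: points_upto_def)

lemma Y_upto: assumes "w \<in> space Q" "s <= t" shows "Y s w = {#x \<in># Y t w. snd x <= s#}"
  "Cs s w = {#x \<in># Cs t w. snd x <= s#}"
proof -
 have 1: "{x \<in> X. snd x <= s} = {x \<in> {x \<in> X. snd x <= t}. snd x <= s}" for X :: "('e \<times> real) set" using assms by auto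
 have "Ns s w = {#x \<in># Ns t w. snd x <= s#}" "Cs s w = {#x \<in># Cs t w. snd x <= s#}"
  unfolding points_upto_def filter_mset_mset_set[OF N_locally_finite[OF assms(1)]] filter_mset_mset_set[OF C_locally_finite[OF assms(1)]]
  using 1 by auto
 then show "Y s w = {#x \<in># Y t w. snd x <= s#}" "Cs s w = {#x \<in># Cs t w. snd x <= s#}" by (simp_all add: obs_def)
qed

lemma Cs_pt:
 assumes "good (Y t w)" "y \<in># Cs t w"
 obtains j where "j < size (Y t w)" "y = pt (Y t w) j" "time_rank (Y t w) y = j"
proof -
 have y: "y \<in># Y t w" using assms(2) by (simp add: obs_def)
 show ?thesis using good_rank_less[OF assms(1) y] pt_rank[OF assms(1) y] by (intro that[of "time_rank (Y t w) y"]) auto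
qed

lemma pt_less_iff:
 assumes "good Z" "j < size Z" "k < size Z" shows "snd (pt Z j) < snd (pt Z k) \<longleftrightarrow> j < k"
 using pt_less[OF assms(1), of j k] pt_less[OF assms(1), of k j] assms(2,3)
 by (metis less_asym less_irrefl linorder_neqE_nat)

lemma tau_less_pt_iff:
 assumes "good Z" "j < size Z" "k <= size Z" shows "tau (pt Z) k < snd (pt Z j) \<longleftrightarrow> k <= j"
proof (cases k)
 case 0
 then show ?thesis using pt_pos[OF assms(1,2)] by simp
next
 case (Suc m)
 then show ?thesis using pt_less_iff[OF assms(1), of m j] assms(2,3) by auto
qed

lemma no_cluster_between:
 assumes w: "w \<in> space Q" and g: "good (Y t w)" and k: "k <= size (Y t w)"
  and r: "r <= t" "k < size (Y t w) ==> r < snd (pt (Y t w) k)"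
  and y: "y \<in> C w"
 shows "snd y \<notin> {tau (pt (Y t w)) k<..r}"
proof
 assume a: "snd y \<in> {tau (pt (Y t w)) k<..r}"
 then have "y \<in># Cs t w" using y r(1) by (simp add: Cs_iff[OF w])
 then obtain j where j: "j < size (Y t w)" "y = pt (Y t w) j" by (rule Cs_pt[OF g])
 have "k <= j" using tau_less_pt_iff[OF g j(1) k] a j(2) by simp
 then have "r < snd (pt (Y t w) k)" using r(2) j(1) by simp
 moreover have "snd (pt (Y t w) k) <= snd (pt (Y t w) j)"
  using pt_less_iff[OF g j(1), of k] \<open>k <= j\<close> j(1) by simp
 ultimately show False using a j(2) by simp
qed

lemma D_between:
 assumes w: "w \<in> space Q" and g: "good (Y t w)" and k: "k <= size (Y t w)"
  and r: "tau (pt (Y t w)) k <= r" "r <= t" "k < size (Y t w) ==> r < snd (pt (Y t w) k)"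
 shows "D r w = D (tau (pt (Y t w)) k) w"
 using no_cluster_between[OF w g k r(2,3)]
 by (intro D_const[OF w tau_nonneg[OF g k] r(1)]) blast

lemma pt_le_horizon: assumes "w \<in> space Q" "good (Y t w)" "k < size (Y t w)" shows "snd (pt (Y t w) k) <= t"
proof -
 have "pt (Y t w) k \<in># Y t w" by (rule pt_in(1)[OF assms(2,3)])
 then show ?thesis using C_locally_finite[OF assms(1)] N_locally_finite[OF assms(1)] by (auto simp: obs_def points_upto_def)
qed

text \<open>The status is constant between cluster points and each cluster point carries its new status in its
label, so the labels determine the path of \<open>D\<close>.\<close>
lemma D_tau:
 assumes w: "w \<in> space Q" and g: "good (Y t w)" and k: "k <= size (Y t w)"
 shows "D (tau (pt (Y t w)) k) w = stat (D 0 w) (labs t w k)"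
 using k
proof (induction k)
 case (Suc k)
 let ?x = "pt (Y t w)"
 show ?case
 proof (cases "?x k \<in># Cs t w")
  case True
  then show ?thesis by (simp add: lab_def)
 next
  case False
  have "D (snd (?x k)) w = D (tau ?x k) w"
  proof (rule D_const[OF w])
   show "0 <= tau ?x k" using tau_nonneg[OF g, of k] Suc(2) by simp
   show "tau ?x k <= snd (?x k)" using pt_tau_less[OF g, of k] Suc(2) by simp
   show "\<forall>y\<in>C w. snd y \<notin> {tau ?x k<..snd (?x k)}"
   proof (intro ballI notI)
    fix y assume y: "y \<in> C w" "snd y \<in> {tau ?x k<..snd (?x k)}"
    have "y \<in># Cs t w" using y pt_le_horizon[OF w g, of k] Suc(2) by (simp add: Cs_iff[OF w])
    then obtain j where j: "j < size (Y t w)" "y = ?x j" by (rule Cs_pt[OF g])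
    have "k <= j" using tau_less_pt_iff[OF g j(1), of k] y j(2) Suc(2) by simp
    moreover have "\<not> k < j" using pt_less_iff[OF g _ j(1), of k] y j(2) Suc(2) by simp
    ultimately show False using False j(2) \<open>y \<in># Cs t w\<close> by simp
   qed
  qed
  then show ?thesis using Suc False by (simp add: lab_def)
 qed
qed simp

lemma left_lim_const:
 assumes "a < (b::real)" "\<And>r. a <= r ==> r < b ==> f r = c"
 shows "left_lim f b = c"
 unfolding left_lim_def
proof (rule tendsto_Lim)
 have "eventually (%r. f r = c) (at_left b)"
  unfolding eventually_at_left_field using assms by (intro exI[of _ a]) auto
 then show "(f \<longlongrightarrow> c) (at_left b)" by (rule tendsto_eventually)
qed simp

text \<open>At an observed point the left limit is still given by the history before that point.\<close>
lemma left_lim_D: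
 assumes w: "w \<in> space Q" and g: "good (Y t w)" and k: "k <= size (Y t w)"
  and s: "tau (pt (Y t w)) k < s" "s <= t" "k < size (Y t w) ==> s <= snd (pt (Y t w) k)"
 shows "left_lim (%r. D r w) s = stat (D 0 w) (labs t w k)"
proof (rule left_lim_const[OF s(1)])
 fix r assume r: "tau (pt (Y t w)) k <= r" "r < s"
 have "D r w = D (tau (pt (Y t w)) k) w"
  by (rule D_between[OF w g k r(1)]) (use r s in force)+
 then show "D r w = stat (D 0 w) (labs t w k)" using D_tau[OF w g k] by simp
qed

definition Cfirst :: "real => 'w => nat => ('e \<times> real) multiset" where
 "Cfirst t w k = {#y \<in># Cs t w. time_rank (Y t w) y < k#}"

lemma Cfirst_0[simp]: "Cfirst t w 0 = {#}"
 by (simp add: Cfirst_def)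

lemma Cfirst_Suc:
 assumes g: "good (Y t w)" and k: "k < size (Y t w)"
 shows "Cfirst t w (Suc k) = Cfirst t w k + (if pt (Y t w) k \<in># Cs t w then {#pt (Y t w) k#} else {#})"
proof -
 have eq: "{#y \<in># X. time_rank (Y t w) y < Suc k#} = {#y \<in># X. time_rank (Y t w) y < k#} + {#y \<in># X. time_rank (Y t w) y = k#}" for X
  by (induction X) (auto simp: less_Suc_eq)
 show ?thesis unfolding Cfirst_def by (simp only: eq filter_rank_subset[OF g k Cs_sub_Y])
qed

lemma num_clusters_labs:
 assumes g: "good (Y t w)" and k: "k <= size (Y t w)"
 shows "num_clusters (labs t w k) = size (Cfirst t w k)"
 using k
proof (induction k)
 case (Suc k)
 then show ?case using Cfirst_Suc[OF g, of k] by (simp add: lab_def)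
qed simp

lemma Gam_labs:
 assumes g: "good (Y t w)" and k: "k <= size (Y t w)"
 shows "Gam (D 0 w) (pt (Y t w)) (labs t w k)
  = (add_mset (D 0 w, 0) (image_mset (%y. (D (snd y) w, snd y)) (Cfirst t w k)), Cfirst t w k)"
 using k
proof (induction k)
 case (Suc k)
 then show ?case using Cfirst_Suc[OF g, of k] by (simp add: lab_def)
qed simp

lemma Cs_eq_Cfirst:
 assumes w: "w \<in> space Q" and g: "good (Y t w)" and s: "s <= t"
 shows "Cs s w = Cfirst t w (size (Y s w))"
 unfolding Cfirst_def Y_upto(2)[OF w s]
proof (rule filter_mset_cong[OF refl])
 fix y assume "y \<in># Cs t w"
 then obtain j where j: "j < size (Y t w)" "y = pt (Y t w) j" "time_rank (Y t w) y = j" by (rule Cs_pt[OF g])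
 show "(snd y <= s) = (time_rank (Y t w) y < size (Y s w))"
  unfolding j(3) unfolding j(2) Y_upto(1)[OF w s] by (rule upto_pt_iff[OF g j(1)])
qed

lemma state_at_eq_Gam:
 assumes w: "w \<in> space Q" and g: "good (Y t w)" and s: "s <= t"
 shows "state_at (%r. D r w) (C w) s = Gam (D 0 w) (pt (Y t w)) (labs t w (size (Y s w)))"
proof -
 have "size (Y s w) <= size (Y t w)" unfolding Y_upto(1)[OF w s] by (rule size_filter_mset_lesseq)
 from Gam_labs[OF g this] show ?thesis by (simp add: state_at_def Cs_eq_Cfirst[OF w g s, symmetric])
qed

text \<open>Splits the event that a given history is the true one into the types of the points, a matter of \<open>N\<close>
and \<open>C\<close>, and the coins with the initial status, which are independent of \<open>N\<close> and \<open>C\<close>.\<close>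
lemma labs_iff_coins:
 assumes w: "w \<in> space Q" and g: "good (Y t w)"
  and upd: "\<forall>(u, s)\<in>C w. D s w = (if left_lim (%r. D r w) s then \<not> I (card {x \<in> C w. snd x <= s}) w else True)"
  and k: "length ls <= size (Y t w)"
 shows "labs t w (length ls) = ls \<longleftrightarrow>
   (\<forall>j<length ls. (pt (Y t w) j \<in># Cs t w) = is_cluster ls j) \<and> coins_ok (%m. I m w) (D 0 w) ls"
 using k
proof (induction ls)
 case (Cons a ls)
 let ?x = "pt (Y t w)" and ?k = "length ls"
 have k: "?k < size (Y t w)" using Cons(2) by simp
 have key: "lab t w ?k = a \<longleftrightarrow> (?x ?k \<in># Cs t w) = (a \<noteq> None) \<and>
   (case a of None => True | Some d => (if stat (D 0 w) ls then I (Suc (num_clusters ls)) w = (\<not> d) else d))"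
  if l: "labs t w ?k = ls"
 proof (cases "?x ?k \<in># Cs t w")
  case False
  then show ?thesis by (cases a) (auto simp: lab_def)
 next
  case True
  let ?s = "snd (?x ?k)"
  have xC: "?x ?k \<in> C w" and st: "?s <= t" using True by (auto simp: Cs_iff[OF w])
  have ll: "left_lim (%r. D r w) ?s = stat (D 0 w) ls"
   using left_lim_D[OF w g, of ?k ?s] pt_tau_less[OF g k] k st l by simp
  have "size (Y ?s w) = Suc ?k"
   unfolding Y_upto(1)[OF w st]
   by (rule size_upto_eqI[OF g]) (use k pt_less[OF g, of ?k "Suc ?k"] in auto)
  then have "Cs ?s w = Cfirst t w (Suc ?k)" using Cs_eq_Cfirst[OF w g st] by simp
  then have "size (Cs ?s w) = Suc (num_clusters ls)"
   using num_clusters_labs[OF g, of ?k] Cfirst_Suc[OF g k] k True l by simp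
  then have "card {x \<in> C w. snd x <= ?s} = Suc (num_clusters ls)" by (simp add: points_upto_def)
  then have "D ?s w = (if stat (D 0 w) ls then \<not> I (Suc (num_clusters ls)) w else True)"
   using bspec[OF upd xC] ll by (simp add: case_prod_beta)
  then show ?thesis using True by (cases a) (auto simp: lab_def)
 qed
 have "labs t w (length (a # ls)) = a # ls \<longleftrightarrow> lab t w ?k = a \<and> labs t w ?k = ls" by simp
 also have "\<dots> \<longleftrightarrow> labs t w ?k = ls \<and> (?x ?k \<in># Cs t w) = (a \<noteq> None) \<and>
   (case a of None => True | Some d => (if stat (D 0 w) ls then I (Suc (num_clusters ls)) w = (\<not> d) else d))"
  using key by blast
 also have "\<dots> \<longleftrightarrow> ((\<forall>j<?k. (?x j \<in># Cs t w) = is_cluster ls j) \<and> coins_ok (%m. I m w) (D 0 w) ls) \<and> (?x ?k \<in># Cs t w) = (a \<noteq> None) \<and>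
   (case a of None => True | Some d => (if stat (D 0 w) ls then I (Suc (num_clusters ls)) w = (\<not> d) else d))"
  using Cons by simp
 also have "\<dots> \<longleftrightarrow> (\<forall>j<length (a # ls). (?x j \<in># Cs t w) = is_cluster (a # ls) j) \<and> coins_ok (%m. I m w) (D 0 w) (a # ls)"
  by (simp add: is_cluster_Cons All_less_Suc) (auto simp: is_cluster_Cons)
 finally show ?case .
qed simp

subsection \<open>The law of the labels\<close>

definition pD :: "bool => real" where
 "pD d0 = prob {w \<in> space Q. D 0 w = d0}"

definition sigNC where
 "sigNC = sigma_sets (space Q) (count_events (space Q) \<nu> N all_times \<union> count_events (space Q) \<nu> C all_times)"

lemma sigNC_vimage:
 assumes t: "0 <= t" and B: "B \<in> sets (S0 \<Otimes>\<^sub>M S0)"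
 shows "(%w. (Ns t w, Cs t w)) -` B \<inter> space Q \<in> sigNC"
proof -
 let ?G = "count_events (space Q) \<nu> N all_times \<union> count_events (space Q) \<nu> C all_times"
 let ?S = "sigma (space Q) ?G"
 have Pow: "?G \<subseteq> Pow (space Q)" using count_events_Pow[of "space Q"] by blast
 have sp: "space ?S = space Q" by (simp add: space_measure_of_conv)
 have st: "sets ?S = sigNC" unfolding sigNC_def by (rule sets_measure_of[OF Pow])
 have mono: "f \<in> measurable ?S M'" if "f \<in> measurable (sigma (space Q) (count_events (space Q) \<nu> X all_times)) M'" "count_events (space Q) \<nu> X all_times \<subseteq> ?G" for f X and M' :: "nat measure"
 proof -
  have "sets (sigma (space Q) (count_events (space Q) \<nu> X all_times)) \<subseteq> sets ?S"
   unfolding sets_measure_of[OF Pow] sets_measure_of[OF count_events_Pow]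
   by (rule sigma_sets_mono') (rule that(2))
  then show ?thesis using that(1) by (auto simp: measurable_def space_measure_of_conv)
 qed
 have N: "Ns t \<in> measurable ?S S0"
  by (rule measurable_points_upto)
    (use N_subset N_locally_finite t in \<open>auto simp: space_measure_of_conv intro!: mono num_points_measurable_count_events\<close>)
 have C: "Cs t \<in> measurable ?S S0"
  by (rule measurable_points_upto)
    (use C_subset C_locally_finite t in \<open>auto simp: space_measure_of_conv intro!: mono num_points_measurable_count_events\<close>)
 have "(%w. (Ns t w, Cs t w)) \<in> measurable ?S (S0 \<Otimes>\<^sub>M S0)"
  using N C by (rule measurable_Pair)
 from measurable_sets[OF this B] show ?thesis unfolding sp st .
qed

lemma coins_event:
 "{w \<in> space Q. coins_ok (%m. I m w) d0 ls} \<in> sigma_sets (space Q) {{w \<in> space Q. I k w} | k. 1 <= k}"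
  (is "_ \<in> sigma_sets _ ?G")
 and prob_coins: "prob {w \<in> space Q. coins_ok (%m. I m w) d0 ls} = trw p d0 ls"
proof -
 obtain det b where
  1: "\<And>i. coins_ok i d0 ls \<longleftrightarrow> det \<and> (\<forall>k\<in>coins_used d0 ls. i k = b k)" and
  2: "trw p d0 ls = (if det then (\<Prod>k\<in>coins_used d0 ls. if b k then p else 1 - p) else 0)"
  using coins_ok_cylinder[of d0 ls p] by blast
 let ?J = "coins_used d0 ls"
 have J: "finite ?J" "?J \<subseteq> {1..}"
  using coins_used_subset[of d0 ls] by (auto intro: finite_subset)
 have Pow: "?G \<subseteq> Pow (space Q)" by blast
 interpret G: sigma_algebra "space Q" "sigma_sets (space Q) ?G" by (rule sigma_algebra_sigma_sets[OF Pow])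
 have Ik: "{w \<in> space Q. I k w = c} \<in> sigma_sets (space Q) ?G" if "1 <= k" for k c
 proof -
  have *: "{w \<in> space Q. I k w} \<in> sigma_sets (space Q) ?G" using that by blast
  show ?thesis
  proof (cases c)
   case True then show ?thesis using * by simp
  next
   case False
   have "{w \<in> space Q. I k w = c} = space Q - {w \<in> space Q. I k w}" using False by auto
   then show ?thesis using G.compl_sets[OF *] by simp
  qed
 qed
 have Im: "{w \<in> space Q. I k w} \<in> events" if "1 <= k" for k
  using I_iid that measurable_sets[of "I k" Q "count_space UNIV" "{True}"]
  by (auto simp: indep_vars_def vimage_def Int_def conj_commute)
 have pk: "prob {w \<in> space Q. I k w = c} = (if c then p else 1 - p)" if "1 <= k" for k c
 proof (cases c)
  case True then show ?thesis using I_bernoulli[OF that] by simp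
 next
  case False
  have "{w \<in> space Q. I k w = c} = space Q - {w \<in> space Q. I k w}" using False by auto
  then show ?thesis using prob_compl[OF Im[OF that]] I_bernoulli[OF that] False by simp
 qed
 have eqn: "{w \<in> space Q. coins_ok (%m. I m w) d0 ls} = (if det then {w \<in> space Q. \<forall>k\<in>?J. I k w = b k} else {})"
  unfolding 1 by simp
 have cyl: "{w \<in> space Q. \<forall>k\<in>?J. I k w = b k} \<in> sigma_sets (space Q) ?G"
  using J(1) by (rule G.sets_Collect_finite_All[rotated]) (use Ik J(2) in auto)
 show "{w \<in> space Q. coins_ok (%m. I m w) d0 ls} \<in> sigma_sets (space Q) ?G"
  unfolding eqn using cyl by (simp add: sigma_sets.Empty)
 have "prob {w \<in> space Q. \<forall>k\<in>?J. I k w = b k} = (\<Prod>k\<in>?J. if b k then p else 1 - p)"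
 proof (cases "?J = {}")
  case True then show ?thesis by (simp add: prob_space)
 next
  case False
  have "prob (\<Inter>k\<in>?J. I k -` {b k} \<inter> space Q) = (\<Prod>k\<in>?J. prob (I k -` {b k} \<inter> space Q))"
   by (rule indep_varsD[OF I_iid]) (use False J in auto)
  also have "(\<Inter>k\<in>?J. I k -` {b k} \<inter> space Q) = {w \<in> space Q. \<forall>k\<in>?J. I k w = b k}" using False by auto
  also have "(\<Prod>k\<in>?J. prob (I k -` {b k} \<inter> space Q)) = (\<Prod>k\<in>?J. if b k then p else 1 - p)"
  proof (rule prod.cong[OF refl])
   fix k assume "k \<in> ?J"
   then have "1 <= k" using J(2) by auto
   have "I k -` {b k} \<inter> space Q = {w \<in> space Q. I k w = b k}" by auto
   then show "prob (I k -` {b k} \<inter> space Q) = (if b k then p else 1 - p)" using pk[OF \<open>1 <= k\<close>] by simp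
  qed
  finally show ?thesis .
 qed
 then show "prob {w \<in> space Q. coins_ok (%m. I m w) d0 ls} = trw p d0 ls"
  unfolding eqn 2 by simp
qed

lemma prob_init_coins:
 assumes B: "B \<in> sigNC"
 shows "{w \<in> space Q. D 0 w = d0 \<and> coins_ok (%m. I m w) d0 ls} \<in> events"
  and "B \<in> events"
  and "prob ({w \<in> space Q. D 0 w = d0 \<and> coins_ok (%m. I m w) d0 ls} \<inter> B) = pD d0 * trw p d0 ls * prob B"
proof -
 let ?GI = "{{w \<in> space Q. I k w} | k. 1 <= k}" and ?GN = "count_events (space Q) \<nu> N all_times"
  and ?GC = "count_events (space Q) \<nu> C all_times"
 let ?A = "sigma_sets (space Q) (?GN \<union> ?GC \<union> ?GI)"
 let ?c = "{w \<in> space Q. coins_ok (%m. I m w) d0 ls}" and ?d = "{w \<in> space Q. D 0 w = d0}"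
 have Pow: "?GN \<union> ?GC \<union> ?GI \<subseteq> Pow (space Q)" using count_events_Pow[of "space Q"] by blast
 interpret A: sigma_algebra "space Q" ?A by (rule sigma_algebra_sigma_sets[OF Pow])
 have cA: "?c \<in> ?A" using coins_event[of d0 ls] sigma_sets_mono'[of ?GI "?GN \<union> ?GC \<union> ?GI" "space Q"] by blast
 have BA: "B \<in> ?A" using B sigma_sets_mono'[of "?GN \<union> ?GC" "?GN \<union> ?GC \<union> ?GI" "space Q"] unfolding sigNC_def by blast
 have AQ: "?A \<subseteq> events" using D0_indep unfolding indep_sets2_eq by blast
 have dm: "?d \<in> sigma_sets (space Q) {{w \<in> space Q. D 0 w}}"
 proof (cases d0)
  case True then show ?thesis by (auto intro: sigma_sets.Basic)
 next
  case False
  have "?d = space Q - {w \<in> space Q. D 0 w}" using False by auto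
  then show ?thesis by (simp add: sigma_sets.Compl sigma_sets.Basic)
 qed
 have dQ: "?d \<in> events" using dm D0_indep unfolding indep_sets2_eq by blast
 show "B \<in> events" using BA AQ by blast
 have split: "{w \<in> space Q. D 0 w = d0 \<and> coins_ok (%m. I m w) d0 ls} = ?d \<inter> ?c" by blast
 show "{w \<in> space Q. D 0 w = d0 \<and> coins_ok (%m. I m w) d0 ls} \<in> events"
  unfolding split using dQ cA AQ by blast
 have "prob (?d \<inter> (?c \<inter> B)) = prob ?d * prob (?c \<inter> B)"
 proof -
  have "?c \<inter> B \<in> ?A" using cA BA by (rule A.Int)
  then show ?thesis using D0_indep dm unfolding indep_sets2_eq by blast
 qed
 also have "prob (?c \<inter> B) = prob ?c * prob B"
  using I_indep coins_event[of d0 ls] B unfolding indep_sets2_eq sigNC_def by blast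
 finally show "prob ({w \<in> space Q. D 0 w = d0 \<and> coins_ok (%m. I m w) d0 ls} \<inter> B) = pD d0 * trw p d0 ls * prob B"
  unfolding split Int_assoc prob_coins pD_def by simp
qed

lemma pD_nonneg: "0 <= pD d0" by (simp add: pD_def)

lemma tr_nonneg: "0 <= tr p st d" using p by (simp add: tr_def)

lemma trw_nonneg: "0 <= trw p d0 ls"
 by (induction ls) (auto simp: tr_nonneg split: option.split)

lemma nn_integral_init_coins:
 assumes t: "0 <= t" and K[measurable]: "K \<in> borel_measurable (S0 \<Otimes>\<^sub>M S0)"
 shows "(\<integral>\<^sup>+w. indicator {w \<in> space Q. D 0 w = d0 \<and> coins_ok (%m. I m w) d0 ls} w * K (Ns t w, Cs t w) \<partial>Q)
  = ennreal (pD d0 * trw p d0 ls) * (\<integral>\<^sup>+w. K (Ns t w, Cs t w) \<partial>Q)"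
proof -
 let ?E = "{w \<in> space Q. D 0 w = d0 \<and> coins_ok (%m. I m w) d0 ls}" and ?V = "%w. (Ns t w, Cs t w)"
 let ?q = "ennreal (pD d0 * trw p d0 ls)"
 have V[measurable]: "?V \<in> measurable Q (S0 \<Otimes>\<^sub>M S0)" using t by measurable
 have E[measurable]: "?E \<in> events" using prob_init_coins(1)[of "{}"] by (simp add: sigNC_def sigma_sets.Empty)
 have V'[measurable]: "?V \<in> measurable (density Q (indicator ?E)) (S0 \<Otimes>\<^sub>M S0)" by simp
 have "distr (density Q (indicator ?E)) (S0 \<Otimes>\<^sub>M S0) ?V = scale_measure ?q (distr Q (S0 \<Otimes>\<^sub>M S0) ?V)"
 proof (rule measure_eqI)
  fix A assume "A \<in> sets (distr (density Q (indicator ?E)) (S0 \<Otimes>\<^sub>M S0) ?V)"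
  then have A[measurable]: "A \<in> sets (S0 \<Otimes>\<^sub>M S0)" by simp
  let ?B = "?V -` A \<inter> space Q"
  have B: "?B \<in> sigNC" by (rule sigNC_vimage[OF t A])
  have "emeasure (distr (density Q (indicator ?E)) (S0 \<Otimes>\<^sub>M S0) ?V) A = emeasure Q (?E \<inter> ?B)"
   using measurable_sets[OF V A] by (simp add: emeasure_distr emeasure_restricted)
  also have "\<dots> = ?q * emeasure Q ?B"
   unfolding emeasure_eq_measure prob_init_coins(3)[OF B] by (simp add: ennreal_mult'')
  also have "\<dots> = emeasure (scale_measure ?q (distr Q (S0 \<Otimes>\<^sub>M S0) ?V)) A"
   by (simp add: emeasure_distr)
  finally show "emeasure (distr (density Q (indicator ?E)) (S0 \<Otimes>\<^sub>M S0) ?V) A = emeasure (scale_measure ?q (distr Q (S0 \<Otimes>\<^sub>M S0) ?V)) A" .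
 qed simp
 then have "(\<integral>\<^sup>+v. K v \<partial>distr (density Q (indicator ?E)) (S0 \<Otimes>\<^sub>M S0) ?V) = ?q * (\<integral>\<^sup>+v. K v \<partial>distr Q (S0 \<Otimes>\<^sub>M S0) ?V)"
  by (simp add: nn_integral_scale_measure)
 then show ?thesis by (simp add: nn_integral_distr nn_integral_density)
qed

text \<open>The conditional probability of the initial status \<open>d0\<close> and the labels \<open>ls\<close>, given that the observed
points are \<open>x 0, x 1, \<dots>\<close>.\<close>
primrec prior :: "bool => (nat => 'e \<times> real) => bool option list => real" where
 "prior d0 x [] = pD d0"
| "prior d0 x (a # ls) = prior d0 x ls * (case a of None => rr False (x (length ls))
   | Some d => rr True (x (length ls)) * tr p (stat d0 ls) d)"

lemma prior_eq_prod:
 "prior d0 x ls = pD d0 * trw p d0 ls * (\<Prod>k<length ls. rr (is_cluster ls k) (x k))"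
proof (induction ls)
 case (Cons a ls)
 have "(\<Prod>k<length (a # ls). rr (is_cluster (a # ls) k) (x k)) = (\<Prod>k<length ls. rr (is_cluster ls k) (x k)) * rr (a \<noteq> None) (x (length ls))"
  by (simp add: is_cluster_Cons)
 then show ?case using Cons by (cases a) simp_all
qed simp

abbreviation has_pts :: "real => nat => 'w => bool" where
 "has_pts t n w == good (Y t w) \<and> size (Y t w) = n"

definition label_event :: "real => bool => bool option list => 'w => bool" where
 "label_event t d0 ls w \<longleftrightarrow> has_pts t (length ls) w \<and> D 0 w = d0 \<and> labs t w (length ls) = ls"

text \<open>Thinning gives the law of the types, and the initial status and the coins are independent of both
point processes; the product of the two factors is \<open>prior\<close>.\<close>
lemma label_law:
 assumes t: "0 <= t" and K[measurable]: "K \<in> borel_measurable S0"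
 shows "(\<integral>\<^sup>+w. (if label_event t d0 ls w then K (Y t w) else 0) \<partial>Q)
  = (\<integral>\<^sup>+w. (if has_pts t (length ls) w then ennreal (prior d0 (pt (Y t w)) ls) * K (Y t w) else 0) \<partial>Q)"
proof -
 let ?c = "is_cluster ls" and ?n = "length ls"
 let ?E = "{w \<in> space Q. D 0 w = d0 \<and> coins_ok (%m. I m w) d0 ls}"
 define K2 :: "('e \<times> real) multiset \<times> ('e \<times> real) multiset => ennreal" where
  "K2 v = type_weight ?c ?n 0 K (fst v + snd v) * (\<Prod>k<?n. of_bool ((0 < size {#x \<in># snd v. time_rank (fst v + snd v) x = k#}) = ?c k))" for v
 have K2m: "K2 \<in> borel_measurable (S0 \<Otimes>\<^sub>M S0)"
 proof -
  have p1[measurable]: "(%v. fst v + snd v) \<in> measurable (S0 \<Otimes>\<^sub>M S0) S0" by (rule measurable_plus_mset) measurable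
  have [measurable]: "(%q. time_rank (fst (snd q) + snd (snd q)) (fst q)) \<in> measurable (M0 \<Otimes>\<^sub>M (S0 \<Otimes>\<^sub>M S0)) (count_space UNIV)"
   by (rule measurable_rank_snd[OF measurable_compose[OF measurable_snd p1]]) measurable
  have [measurable]: "(%v. size {#x \<in># snd v. time_rank (fst v + snd v) x = k#}) \<in> measurable (S0 \<Otimes>\<^sub>M S0) (count_space UNIV)" for k
  proof (rule measurable_size_filter_mset_param[where M=M0])
   show "Measurable.pred (M0 \<Otimes>\<^sub>M (S0 \<Otimes>\<^sub>M S0)) (%(x, v). time_rank (fst v + snd v) x = k)"
    unfolding split_beta by measurable
  qed simp
  have [measurable]: "type_weight ?c ?n 0 K \<in> borel_measurable S0" by (rule type_weight_measurable) simp_all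
  show ?thesis unfolding K2_def by measurable
 qed
 have K2_eq: "K2 (Ns t w, Cs t w) = type_weight ?c ?n 0 K (Y t w) * (\<Prod>k<?n. of_bool ((pt (Y t w) k \<in># Cs t w) = ?c k))" for w
 proof (cases "has_pts t ?n w")
  case True
  have "(\<Prod>k<?n. of_bool ((0 < size {#x \<in># Cs t w. time_rank (Y t w) x = k#}) = ?c k) :: ennreal)
   = (\<Prod>k<?n. of_bool ((pt (Y t w) k \<in># Cs t w) = ?c k))"
   using True by (intro prod.cong refl) (subst filter_rank_subset[OF _ _ Cs_sub_Y], auto)
  then show ?thesis unfolding K2_def by (simp add: obs_def)
 next
  case False
  have "type_weight ?c ?n 0 K (Y t w) = 0" unfolding type_weight_def using False by (rule if_not_P)
  then show ?thesis unfolding K2_def by (simp add: obs_def)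
 qed
 have "(\<integral>\<^sup>+w. (if label_event t d0 ls w then K (Y t w) else 0) \<partial>Q)
  = (\<integral>\<^sup>+w. indicator ?E w * K2 (Ns t w, Cs t w) \<partial>Q)"
 proof (rule nn_integral_cong_AE)
  show "AE w in Q. (if label_event t d0 ls w then K (Y t w) else 0) = indicator ?E w * K2 (Ns t w, Cs t w)"
   using D_update
  proof (rule AE_mp, intro AE_I2 impI)
   fix w assume w: "w \<in> space Q" and upd: "\<forall>(u, s)\<in>C w. D s w = (if left_lim (%r. D r w) s then \<not> I (card {x \<in> C w. snd x <= s}) w else True)"
   show "(if label_event t d0 ls w then K (Y t w) else 0) = indicator ?E w * K2 (Ns t w, Cs t w)"
   proof (cases "has_pts t ?n w")
    case True
    then have g: "good (Y t w)" and n: "size (Y t w) = ?n" by auto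
    have iff: "labs t w ?n = ls \<longleftrightarrow> (\<forall>j<?n. (pt (Y t w) j \<in># Cs t w) = ?c j) \<and> coins_ok (%m. I m w) (D 0 w) ls"
     by (rule labs_iff_coins[OF w g upd]) (simp add: n)
    have tw: "type_weight ?c ?n 0 K (Y t w) = K (Y t w)" unfolding type_weight_def using True by simp
    have pr: "(\<Prod>k<?n. of_bool ((pt (Y t w) k \<in># Cs t w) = ?c k)) = (of_bool (\<forall>k<?n. (pt (Y t w) k \<in># Cs t w) = ?c k) :: ennreal)"
     by (induction ?n) (auto simp: less_Suc_eq prod_zero_iff)
    have le: "label_event t d0 ls w \<longleftrightarrow> D 0 w = d0 \<and> coins_ok (%m. I m w) d0 ls \<and> (\<forall>j<?n. (pt (Y t w) j \<in># Cs t w) = ?c j)"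
     unfolding label_event_def using g n iff by blast
    show ?thesis unfolding K2_eq tw pr le using w by (auto simp: indicator_def)
   next
    case False
    have "type_weight ?c ?n 0 K (Y t w) = 0" unfolding type_weight_def using False by (rule if_not_P)
    moreover have "\<not> label_event t d0 ls w" using False unfolding label_event_def by blast
    ultimately show ?thesis unfolding K2_eq by simp
   qed
  qed
 qed
 also have "\<dots> = ennreal (pD d0 * trw p d0 ls) * (\<integral>\<^sup>+w. K2 (Ns t w, Cs t w) \<partial>Q)"
  by (rule nn_integral_init_coins[OF t K2m])
 also have "(\<integral>\<^sup>+w. K2 (Ns t w, Cs t w) \<partial>Q) = (\<integral>\<^sup>+w. type_weight ?c ?n ?n K (Y t w) \<partial>Q)"
  unfolding K2_eq by (rule thinning[OF t K])
 also have "ennreal (pD d0 * trw p d0 ls) * \<dots> = (\<integral>\<^sup>+w. ennreal (pD d0 * trw p d0 ls) * type_weight ?c ?n ?n K (Y t w) \<partial>Q)"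
  by (rule nn_integral_cmult[symmetric]) (rule measurable_compose[OF Y_measurable[OF t] type_weight_measurable], simp_all)
 also have "\<dots> = (\<integral>\<^sup>+w. (if has_pts t (length ls) w then ennreal (prior d0 (pt (Y t w)) ls) * K (Y t w) else 0) \<partial>Q)"
 proof (rule nn_integral_cong)
  fix w assume w: "w \<in> space Q"
  show "ennreal (pD d0 * trw p d0 ls) * type_weight ?c ?n ?n K (Y t w)
   = (if has_pts t (length ls) w then ennreal (prior d0 (pt (Y t w)) ls) * K (Y t w) else 0)"
  proof (cases "has_pts t ?n w")
   case True
   have nn: "0 <= rr (?c k) (pt (Y t w) k)" if "k \<in> {..<?n}" for k
   proof (rule rr_nonneg)
    have "pt (Y t w) k \<in># Y t w" using pt_in(1)[of "Y t w" k] True that by simp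
    then show "pt (Y t w) k \<in> space M0"
     using measurable_space[OF Y_measurable[OF t] w] by (auto simp: space_mset_space)
   qed
   have "type_weight ?c ?n ?n K (Y t w) = K (Y t w) * (\<Prod>k<?n. ennreal (rr (?c k) (pt (Y t w) k)))"
    unfolding type_weight_def using True by simp
   also have "(\<Prod>k<?n. ennreal (rr (?c k) (pt (Y t w) k))) = ennreal (\<Prod>k<?n. rr (?c k) (pt (Y t w) k))"
    by (rule prod_ennreal) (rule nn)
   finally have tw: "type_weight ?c ?n ?n K (Y t w) = K (Y t w) * ennreal (\<Prod>k<?n. rr (?c k) (pt (Y t w) k))" .
   have pn: "0 <= (\<Prod>k<?n. rr (?c k) (pt (Y t w) k))" using nn by (rule prod_nonneg)
   have "ennreal (prior d0 (pt (Y t w)) ls) = ennreal (pD d0 * trw p d0 ls) * ennreal (\<Prod>k<?n. rr (?c k) (pt (Y t w) k))"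
    unfolding prior_eq_prod by (rule ennreal_mult''[OF pn])
   then show ?thesis unfolding tw if_P[OF True] by (simp only: ac_simps)
  next
   case False
   have "type_weight ?c ?n ?n K (Y t w) = 0" unfolding type_weight_def using False by (rule if_not_P)
   then show ?thesis using False by auto
  qed
 qed
 finally show ?thesis .
qed

end

section \<open>Calculus of indefinite integrals over marks and times\<close>

text \<open>Half-open on the left: the pieces between observed points then fit together, and each piece sees the
intensity just before the point at its right end.\<close>
definition strip :: "'e measure => real => real => ('e \<times> real) set" where
 "strip \<nu> a b = space \<nu> \<times> {a<..b}"

text \<open>The integral extends over marks and times.  Treating it directly, rather than through a density in
time, avoids Fubini's theorem, for which \<open>\<nu>\<close> would have to be sigma-finite.\<close>
definition primitive :: "'e measure => real => real => ('e \<times> real => real) => (real => real) => bool" where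
 "primitive \<nu> a b f F \<longleftrightarrow> set_integrable (mark_time \<nu>) (strip \<nu> a b) f \<and>
   (\<forall>t\<in>{a..b}. F t = F a + (LINT x:strip \<nu> a t|mark_time \<nu>. f x))"

lemma strip_measurable[measurable]:
 assumes "0 <= a" shows "strip \<nu> a b \<in> sets (mark_time \<nu>)"
proof -
 have "strip \<nu> a b = {x \<in> space (mark_time \<nu>). a < snd x \<and> snd x <= b}"
  using assms by (auto simp: strip_def space_mark_time)
 also have "\<dots> \<in> sets (mark_time \<nu>)" by measurable
 finally show ?thesis .
qed

lemma strip_empty[simp]: "strip \<nu> a a = {}" by (auto simp: strip_def)

lemma strip_split: "a <= u ==> u <= v ==> strip \<nu> a v = strip \<nu> a u \<union> strip \<nu> u v"
 and strip_disjoint: "strip \<nu> a u \<inter> strip \<nu> u v = {}"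
 by (auto simp: strip_def)

lemma strip_mono: "a' <= a ==> b <= b' ==> strip \<nu> a b \<subseteq> strip \<nu> a' b'"
 by (auto simp: strip_def)

lemma set_integrable_strip_subset:
 fixes f :: "_ => real"
 assumes "set_integrable (mark_time \<nu>) (strip \<nu> a b) f" "0 <= a" "a <= u" "v <= b"
 shows "set_integrable (mark_time \<nu>) (strip \<nu> u v) f"
 using assms by (intro set_integrable_subset[OF assms(1)] strip_measurable strip_mono) auto

lemma set_lebesgue_integral_strip_split:
 fixes f :: "_ => real"
 assumes "set_integrable (mark_time \<nu>) (strip \<nu> a b) f" "0 <= a" "a <= u" "u <= v" "v <= b"
 shows "(LINT x:strip \<nu> a v|mark_time \<nu>. f x) = (LINT x:strip \<nu> a u|mark_time \<nu>. f x) + (LINT x:strip \<nu> u v|mark_time \<nu>. f x)"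
proof -
 have "set_integrable (mark_time \<nu>) (strip \<nu> a u) f" "set_integrable (mark_time \<nu>) (strip \<nu> u v) f"
  using assms(2-) by (intro set_integrable_strip_subset[OF assms(1,2)]; simp)+
 then show ?thesis unfolding strip_split[OF assms(3,4)] by (intro set_integral_Un strip_disjoint)
qed

lemma primitive_integrable: "primitive \<nu> a b f F ==> set_integrable (mark_time \<nu>) (strip \<nu> a b) f"
 by (simp add: primitive_def)

lemma primitiveI:
 assumes "set_integrable (mark_time \<nu>) (strip \<nu> a b) f" "\<And>t. a <= t ==> t <= b ==> F t = F a + (LINT x:strip \<nu> a t|mark_time \<nu>. f x)"
 shows "primitive \<nu> a b f F"
 unfolding primitive_def atLeastAtMost_iff Ball_def using assms by blast

lemma primitive_eq:
 assumes "primitive \<nu> a b f F" "a <= t" "t <= b"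
 shows "F t = F a + (LINT x:strip \<nu> a t|mark_time \<nu>. f x)"
 using assms(1)[unfolded primitive_def, THEN conjunct2, THEN bspec, of t] assms(2,3) by simp

lemma primitiveD:
 assumes "primitive \<nu> a b f F" "0 <= a" "a <= u" "u <= v" "v <= b"
 shows "F v - F u = (LINT x:strip \<nu> u v|mark_time \<nu>. f x)"
proof -
 have 1: "F u = F a + (LINT x:strip \<nu> a u|mark_time \<nu>. f x)" "F v = F a + (LINT x:strip \<nu> a v|mark_time \<nu>. f x)"
  by (rule primitive_eq[OF assms(1)], use assms(3-5) in linarith, use assms(3-5) in linarith)+
 have "set_integrable (mark_time \<nu>) (strip \<nu> a b) f" using assms(1) unfolding primitive_def by blast
 from set_lebesgue_integral_strip_split[OF this assms(2-)] show ?thesis using 1 by linarith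
qed

lemma primitive_subinterval:
 assumes "primitive \<nu> a b f F" "0 <= a" "a <= a'" "b' <= b" shows "primitive \<nu> a' b' f F"
proof (cases "a' <= b'")
 case True
 show ?thesis
 proof (rule primitiveI)
  show "set_integrable (mark_time \<nu>) (strip \<nu> a' b') f"
   using assms(1) unfolding primitive_def by (intro set_integrable_strip_subset[OF _ assms(2-)]) blast
  show "F t = F a' + (LINT x:strip \<nu> a' t|mark_time \<nu>. f x)" if "a' <= t" "t <= b'" for t
   using primitiveD[OF assms(1,2), of a' t] assms that by simp
 qed
next
 case False
 then have "strip \<nu> a' b' = {}" by (auto simp: strip_def)
 then show ?thesis using False by (simp add: primitive_def set_integrable_def)
qed

lemma primitive_indefinite:
 assumes "set_integrable (mark_time \<nu>) (strip \<nu> a b) f"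
 shows "primitive \<nu> a b f (%t. LINT x:strip \<nu> a t|mark_time \<nu>. f x)"
 using assms by (intro primitiveI) (simp_all add: set_lebesgue_integral_def)

lemma primitive_cong:
 assumes "primitive \<nu> a b f F" "\<And>x. x \<in> strip \<nu> a b ==> f x = g x" "\<And>t. a <= t ==> t <= b ==> F t = G t"
 shows "primitive \<nu> a b g G"
proof (rule primitiveI)
 show "set_integrable (mark_time \<nu>) (strip \<nu> a b) g"
  using primitive_integrable[OF assms(1)] unfolding set_integrable_def
  by (rule Bochner_Integration.integrable_cong[THEN iffD1, rotated 2]) (auto simp: indicator_def assms(2))
 fix t assume t: "a <= t" "t <= b"
 have "(LINT x:strip \<nu> a t|mark_time \<nu>. g x) = (LINT x:strip \<nu> a t|mark_time \<nu>. f x)"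
  unfolding set_lebesgue_integral_def
  by (intro Bochner_Integration.integral_cong refl) (use t strip_mono[of a a t b \<nu>] assms(2) in \<open>auto simp: indicator_def\<close>)
 then show "G t = G a + (LINT x:strip \<nu> a t|mark_time \<nu>. g x)"
  using primitive_eq[OF assms(1) t] assms(3)[of t] assms(3)[of a] t by simp
qed

lemma primitive_cmult:
 assumes "primitive \<nu> a b f F" shows "primitive \<nu> a b (%x. c * f x) (%t. c * F t)"
proof (rule primitiveI)
 show "set_integrable (mark_time \<nu>) (strip \<nu> a b) (%x. c * f x)"
  using primitive_integrable[OF assms] by simp
 fix t assume t: "a <= t" "t <= b"
 show "c * F t = c * F a + (LINT x:strip \<nu> a t|mark_time \<nu>. c * f x)"
  unfolding primitive_eq[OF assms t] by (simp add: distrib_left)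
qed

lemma primitive_add:
 assumes "primitive \<nu> a b f F" "primitive \<nu> a b g G" "0 <= a"
 shows "primitive \<nu> a b (%x. f x + g x) (%t. F t + G t)"
proof (rule primitiveI)
 show "set_integrable (mark_time \<nu>) (strip \<nu> a b) (%x. f x + g x)"
  using assms by (intro set_integral_add primitive_integrable)
 fix t assume t: "a <= t" "t <= b"
 have "(LINT x:strip \<nu> a t|mark_time \<nu>. f x + g x) = (LINT x:strip \<nu> a t|mark_time \<nu>. f x) + (LINT x:strip \<nu> a t|mark_time \<nu>. g x)"
  using t by (intro set_integral_add set_integrable_strip_subset[OF primitive_integrable[OF assms(1)] assms(3)]
    set_integrable_strip_subset[OF primitive_integrable[OF assms(2)] assms(3)]) auto
 then show "F t + G t = F a + G a + (LINT x:strip \<nu> a t|mark_time \<nu>. f x + g x)"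
  unfolding primitive_eq[OF assms(1) t] primitive_eq[OF assms(2) t] by simp
qed

lemma primitive_const: "primitive \<nu> a b (%_. 0) (%_. c)"
 by (rule primitiveI) (simp_all add: set_integrable_def set_lebesgue_integral_def)

lemma primitive_sum:
 assumes "finite J" "\<And>j. j \<in> J ==> primitive \<nu> a b (f j) (F j)" "0 <= a"
 shows "primitive \<nu> a b (%x. \<Sum>j\<in>J. f j x) (%t. \<Sum>j\<in>J. F j t)"
 using assms(1,2)
proof (induction J rule: finite_induct)
 case (insert j J)
 then have "primitive \<nu> a b (%x. f j x + (\<Sum>j\<in>J. f j x)) (%t. F j t + (\<Sum>j\<in>J. F j t))"
  by (intro primitive_add[OF _ _ assms(3)]) simp_all
 then show ?case using insert(1,2) by simp
qed (simp add: primitive_const)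

lemma primitive_variation:
 assumes "primitive \<nu> a b f F" "0 <= a" "a <= u" "u <= v" "v <= b"
 shows "\<bar>F v - F u\<bar> <= (LINT x:strip \<nu> u v|mark_time \<nu>. \<bar>f x\<bar>)"
 unfolding primitiveD[OF assms]
proof -
 have "set_integrable (mark_time \<nu>) (strip \<nu> u v) f"
  by (rule set_integrable_strip_subset[OF primitive_integrable[OF assms(1)] assms(2,3,5)])
 then have "norm (LINT x:strip \<nu> u v|mark_time \<nu>. f x) <= (LINT x:strip \<nu> u v|mark_time \<nu>. norm (f x))"
  by (rule set_integral_norm_bound)
 then show "\<bar>LINT x:strip \<nu> u v|mark_time \<nu>. f x\<bar> <= (LINT x:strip \<nu> u v|mark_time \<nu>. \<bar>f x\<bar>)" by simp
qed

lemma primitive_continuous: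
 assumes F: "primitive \<nu> a b f F" and a: "0 <= a" shows "continuous_on {a..b} F"
proof -
 let ?I = "%t. LINT x|mark_time \<nu>. indicator (strip \<nu> a t) x *\<^sub>R f x"
 have int: "integrable (mark_time \<nu>) (%x. indicator (strip \<nu> a b) x *\<^sub>R f x)"
  using primitive_integrable[OF F] by (simp add: set_integrable_def)
 have "continuous_on {a..b} ?I"
 proof (rule continuous_on_sequentiallyI)
  fix u t assume u: "\<forall>n. u n \<in> {a..b}" and t: "t \<in> {a..b}" and lim: "u \<longlonglongrightarrow> t"
  show "(%n. ?I (u n)) \<longlonglongrightarrow> ?I t"
  proof (rule integral_dominated_convergence[where w="%x. \<bar>indicator (strip \<nu> a b) x *\<^sub>R f x\<bar>"])
   have m: "(%x. indicator (strip \<nu> a r) x *\<^sub>R f x) \<in> borel_measurable (mark_time \<nu>)" if "r \<in> {a..b}" for r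
    using set_integrable_strip_subset[OF primitive_integrable[OF F] a, of a r] that
    by (simp add: set_integrable_def integrable_iff_bounded)
   show "(%x. indicator (strip \<nu> a t) x *\<^sub>R f x) \<in> borel_measurable (mark_time \<nu>)" by (rule m[OF t])
   show "\<And>n. (%x. indicator (strip \<nu> a (u n)) x *\<^sub>R f x) \<in> borel_measurable (mark_time \<nu>)" using m u by blast
   show "integrable (mark_time \<nu>) (%x. \<bar>indicator (strip \<nu> a b) x *\<^sub>R f x\<bar>)" using int by simp
   show "AE x in mark_time \<nu>. (%n. indicator (strip \<nu> a (u n)) x *\<^sub>R f x) \<longlonglongrightarrow> indicator (strip \<nu> a t) x *\<^sub>R f x"
    using AE_time_neq[of t \<nu>]
   proof eventually_elim
    case (elim x)
    have "eventually (%n. (snd x <= u n) = (snd x <= t)) sequentially"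
    proof (cases "snd x < t")
     case True
     from order_tendstoD(1)[OF lim True] show ?thesis by eventually_elim (use True in auto)
    next
     case False
     then have "t < snd x" using elim by simp
     from order_tendstoD(2)[OF lim this] show ?thesis by eventually_elim (use \<open>t < snd x\<close> in auto)
    qed
    then have "eventually (%n. indicator (strip \<nu> a (u n)) x *\<^sub>R f x = indicator (strip \<nu> a t) x *\<^sub>R f x) sequentially"
     by eventually_elim (auto simp: strip_def indicator_def mem_Times_iff)
    then show ?case by (rule tendsto_eventually)
   qed
   show "\<And>n. AE x in mark_time \<nu>. norm (indicator (strip \<nu> a (u n)) x *\<^sub>R f x) <= \<bar>indicator (strip \<nu> a b) x *\<^sub>R f x\<bar>"
   proof (intro AE_I2)
    fix n x
    show "norm (indicator (strip \<nu> a (u n)) x *\<^sub>R f x) <= \<bar>indicator (strip \<nu> a b) x *\<^sub>R f x\<bar>"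
     using u[rule_format, of n] by (auto simp: strip_def indicator_def mem_Times_iff)
   qed
  qed
 qed
 then have "continuous_on {a..b} (%t. F a + ?I t)" by (intro continuous_intros)
 then show ?thesis
  by (rule continuous_on_cong[THEN iffD1, rotated 2]) (simp_all only: primitive_eq[OF F, unfolded set_lebesgue_integral_def] atLeastAtMost_iff)
qed

text \<open>Replaces vanishing of the derivative.  Over a partition that is fine for the continuous function
\<open>B\<close>, the squares of its increments add up to an arbitrarily small quantity.\<close>
lemma second_order_increments_const:
 fixes Z B :: "real => real"
 assumes ab: "a <= b" and cont: "continuous_on {a..b} B" and mono: "\<And>u v. a <= u ==> u <= v ==> v <= b ==> B u <= B v"
  and Z: "\<And>u v. a <= u ==> u <= v ==> v <= b ==> \<bar>Z v - Z u\<bar> <= K * (B v - B u)\<^sup>2"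
 shows "Z b = Z a"
proof -
 have "\<bar>Z b - Z a\<bar> <= e" if e: "0 < e" for e
 proof -
  define K' where "K' = max K 1"
  have K': "0 < K'" "K <= K'" by (auto simp: K'_def)
  define e' where "e' = e / (K' * (B b - B a + 1))"
  have Bab: "0 <= B b - B a" using mono[of a b] ab by simp
  have e': "0 < e'" using e K' Bab by (simp add: e'_def)
  have "uniformly_continuous_on {a..b} B" by (rule compact_uniformly_continuous[OF cont]) simp
  then obtain d where d: "0 < d" "\<And>u v. u \<in> {a..b} ==> v \<in> {a..b} ==> dist v u < d ==> dist (B v) (B u) < e'"
   using e' unfolding uniformly_continuous_on_def by metis
  obtain n :: nat where n: "(b - a) / d < real n" using reals_Archimedean2 by blast
  have n0: "0 < n" using n ab d(1) by (cases n) (auto simp: divide_less_0_iff)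
  define u where "u i = a + (b - a) * real i / real n" for i :: nat
  have u0: "u 0 = a" "u n = b" using n0 by (simp_all add: u_def)
  have um: "u i <= u (Suc i)" for i using ab n0 by (simp add: u_def divide_right_mono mult_left_mono)
  have uab: "a <= u i \<and> u i <= b" if "i <= n" for i
  proof -
   have "(b - a) * real i / real n <= (b - a) * real n / real n" using that ab by (intro divide_right_mono mult_left_mono) auto
   then show ?thesis using n0 ab by (simp add: u_def)
  qed
  have ud: "dist (u (Suc i)) (u i) < d" for i
  proof -
   have "u (Suc i) - u i = (b - a) / real n" by (simp add: u_def diff_divide_distrib add_divide_distrib algebra_simps)
   also have "\<dots> < d" using n n0 d(1) by (simp add: field_simps)
   finally show ?thesis using um[of i] by (simp add: dist_real_def)
  qed
  have "\<bar>Z (u m) - Z (u 0)\<bar> <= K' * e' * (B (u m) - B (u 0))" if "m <= n" for m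
   using that
  proof (induction m)
   case (Suc m)
   let ?D = "B (u (Suc m)) - B (u m)"
   have D0: "0 <= ?D" using mono[of "u m" "u (Suc m)"] um[of m] uab[of m] uab[of "Suc m"] Suc(2) by simp
   have De: "?D < e'" using d(2)[of "u m" "u (Suc m)"] ud[of m] uab[of m] uab[of "Suc m"] Suc(2) D0 by (simp add: dist_real_def)
   have "\<bar>Z (u (Suc m)) - Z (u m)\<bar> <= K * ?D\<^sup>2" using Z[of "u m" "u (Suc m)"] um[of m] uab[of m] uab[of "Suc m"] Suc(2) by simp
   also have "\<dots> <= K' * ?D\<^sup>2" using K' by (intro mult_right_mono) auto
   also have "\<dots> <= K' * (e' * ?D)" using K' D0 De by (intro mult_left_mono) (auto simp: power2_eq_square intro: mult_right_mono)
   finally show ?case using Suc by (simp add: algebra_simps)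
  qed simp
  from this[of n] have "\<bar>Z b - Z a\<bar> <= K' * e' * (B b - B a)" by (simp add: u0)
  also have "\<dots> <= K' * e' * (B b - B a + 1)" using K' e' by (intro mult_left_mono) auto
  also have "\<dots> = e" using K' Bab by (simp add: e'_def)
  finally show ?thesis .
 qed
 then have "\<bar>Z b - Z a\<bar> <= 0" by (rule field_le_epsilon) simp
 then show ?thesis by simp
qed

lemma set_integral_mult_bounded:
 fixes f g :: "'e \<times> real => real"
 assumes f: "set_integrable (mark_time \<nu>) (strip \<nu> a b) f" and a: "0 <= a"
  and g: "g \<in> borel_measurable (mark_time \<nu>)" "\<And>x. x \<in> strip \<nu> a b ==> \<bar>g x\<bar> <= c"
 shows "set_integrable (mark_time \<nu>) (strip \<nu> a b) (%x. f x * g x)"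
  "\<bar>LINT x:strip \<nu> a b|mark_time \<nu>. f x * g x\<bar> <= c * (LINT x:strip \<nu> a b|mark_time \<nu>. \<bar>f x\<bar>)"
proof -
 have f': "integrable (mark_time \<nu>) (%x. indicator (strip \<nu> a b) x *\<^sub>R f x)" using f by (simp add: set_integrable_def)
 have bound: "norm (indicator (strip \<nu> a b) x *\<^sub>R (f x * g x)) <= norm (c * \<bar>indicator (strip \<nu> a b) x *\<^sub>R f x\<bar>)" for x
 proof (cases "x \<in> strip \<nu> a b")
  case True
  then have "\<bar>g x\<bar> <= \<bar>c\<bar>" using g(2)[OF True] by linarith
  then have "\<bar>f x\<bar> * \<bar>g x\<bar> <= \<bar>c\<bar> * \<bar>f x\<bar>" by (metis abs_ge_zero mult.commute mult_right_mono)
  then show ?thesis using True by (simp add: abs_mult)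
 qed simp
 have m: "(%x. indicator (strip \<nu> a b) x *\<^sub>R (f x * g x)) \<in> borel_measurable (mark_time \<nu>)"
  using borel_measurable_times[OF borel_measurable_integrable[OF f'] g(1)] by (simp add: mult.assoc)
 have i: "integrable (mark_time \<nu>) (%x. indicator (strip \<nu> a b) x *\<^sub>R (f x * g x))"
  by (rule Bochner_Integration.integrable_bound[where f="%x. c * \<bar>indicator (strip \<nu> a b) x *\<^sub>R f x\<bar>"]) (use f' m bound in auto)
 then show 1: "set_integrable (mark_time \<nu>) (strip \<nu> a b) (%x. f x * g x)" by (simp add: set_integrable_def)
 have "\<bar>LINT x:strip \<nu> a b|mark_time \<nu>. f x * g x\<bar> <= (LINT x|mark_time \<nu>. norm (indicator (strip \<nu> a b) x *\<^sub>R (f x * g x)))"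
  unfolding set_lebesgue_integral_def real_norm_def[symmetric] by (rule integral_norm_bound)
 also have "\<dots> <= (LINT x|mark_time \<nu>. c * (indicator (strip \<nu> a b) x *\<^sub>R \<bar>f x\<bar>))"
 proof (rule integral_mono)
  show "integrable (mark_time \<nu>) (%x. norm (indicator (strip \<nu> a b) x *\<^sub>R (f x * g x)))" using i by simp
  show "integrable (mark_time \<nu>) (%x. c * (indicator (strip \<nu> a b) x *\<^sub>R \<bar>f x\<bar>))"
   using set_integrable_abs[OF f] by (simp add: set_integrable_def)
  fix x
  show "norm (indicator (strip \<nu> a b) x *\<^sub>R (f x * g x)) <= c * (indicator (strip \<nu> a b) x *\<^sub>R \<bar>f x\<bar>)"
  proof (cases "x \<in> strip \<nu> a b")
   case True
   then show ?thesis using mult_right_mono[OF g(2)[OF True] abs_ge_zero[of "f x"]] by (simp add: abs_mult mult.commute)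
  qed simp
 qed
 finally show "\<bar>LINT x:strip \<nu> a b|mark_time \<nu>. f x * g x\<bar> <= c * (LINT x:strip \<nu> a b|mark_time \<nu>. \<bar>f x\<bar>)"
  by (simp add: set_lebesgue_integral_def)
qed

text \<open>A function that is continuous on \<open>[a, b]\<close> only need not be measurable; its extension by constants is.\<close>
lemma measurable_clamped:
 fixes G :: "real => real"
 assumes "continuous_on {a..b} G" "a <= b"
 shows "(%x. G (max a (min b (snd x)))) \<in> borel_measurable (mark_time \<nu>)"
proof -
 have "continuous_on UNIV (%r. G (max a (min b r)))"
  using assms by (intro continuous_on_compose2[OF assms(1)] continuous_intros) auto
 then have "(%r. G (max a (min b r))) \<in> borel_measurable borel" by (rule borel_measurable_continuous_onI)
 from measurable_compose[OF measurable_snd_mark_time this] show ?thesis .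
qed

lemma set_integral_mult_time:
 fixes f :: "'e \<times> real => real" and G :: "real => real"
 assumes f: "set_integrable (mark_time \<nu>) (strip \<nu> a b) f" and a: "0 <= a" and ab: "a <= u" "u <= v" "v <= b"
  and G: "continuous_on {a..b} G" and c: "\<And>s. u < s ==> s <= v ==> \<bar>G s\<bar> <= c"
 shows "set_integrable (mark_time \<nu>) (strip \<nu> u v) (%x. f x * G (snd x))"
  "\<bar>LINT x:strip \<nu> u v|mark_time \<nu>. f x * G (snd x)\<bar> <= c * (LINT x:strip \<nu> u v|mark_time \<nu>. \<bar>f x\<bar>)"
proof -
 let ?g = "%x::'e \<times> real. G (max a (min b (snd x)))"
 have eq: "?g x = G (snd x)" if "x \<in> strip \<nu> u v" for x
  proof -
  have "max a (min b (snd x)) = snd x" using that ab by (auto simp: strip_def)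
  then show ?thesis by simp
 qed
 have f': "set_integrable (mark_time \<nu>) (strip \<nu> u v) f" by (rule set_integrable_strip_subset[OF f a ab(1,3)])
 have gb: "\<bar>?g x\<bar> <= c" if "x \<in> strip \<nu> u v" for x
  unfolding eq[OF that] using that by (intro c) (auto simp: strip_def)
 have u: "0 <= u" and ab': "a <= b" using a ab by auto
 note * = set_integral_mult_bounded[OF f' u measurable_clamped[OF G ab'] gb]
 have "(%x. indicator (strip \<nu> u v) x *\<^sub>R (f x * ?g x)) = (%x. indicator (strip \<nu> u v) x *\<^sub>R (f x * G (snd x)))"
  using eq by (auto simp: indicator_def)
 then show "set_integrable (mark_time \<nu>) (strip \<nu> u v) (%x. f x * G (snd x))"
  "\<bar>LINT x:strip \<nu> u v|mark_time \<nu>. f x * G (snd x)\<bar> <= c * (LINT x:strip \<nu> u v|mark_time \<nu>. \<bar>f x\<bar>)"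
  using * by (simp_all add: set_integrable_def set_lebesgue_integral_def)
qed

lemma primitive_from_second_order:
 assumes ab: "a <= b" and a: "0 <= a" and h: "set_integrable (mark_time \<nu>) (strip \<nu> a b) h"
  and k: "set_integrable (mark_time \<nu>) (strip \<nu> a b) k"
  and Z: "\<And>u v. a <= u ==> u <= v ==> v <= b ==>
   \<bar>F v - F u - (LINT x:strip \<nu> u v|mark_time \<nu>. h x)\<bar> <= K * (LINT x:strip \<nu> u v|mark_time \<nu>. \<bar>k x\<bar>)\<^sup>2"
 shows "primitive \<nu> a b h F"
proof (rule primitiveI[OF h])
 fix t assume t: "a <= t" "t <= b"
 let ?H = "%t. LINT x:strip \<nu> a t|mark_time \<nu>. h x" and ?B = "%t. LINT x:strip \<nu> a t|mark_time \<nu>. \<bar>k x\<bar>"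
 have ka: "set_integrable (mark_time \<nu>) (strip \<nu> a b) (%x. \<bar>k x\<bar>)" using k by (rule set_integrable_abs)
 have H: "?H v - ?H u = (LINT x:strip \<nu> u v|mark_time \<nu>. h x)" if "a <= u" "u <= v" "v <= b" for u v
  using set_lebesgue_integral_strip_split[OF h a that] by simp
 have B: "?B v - ?B u = (LINT x:strip \<nu> u v|mark_time \<nu>. \<bar>k x\<bar>)" if "a <= u" "u <= v" "v <= b" for u v
  using set_lebesgue_integral_strip_split[OF ka a that] by simp
 have "(%t. F t - ?H t) t = (%t. F t - ?H t) a"
 proof (rule second_order_increments_const[OF t(1), where B="?B" and K=K])
  show "continuous_on {a..t} ?B"
   by (rule continuous_on_subset[OF primitive_continuous[OF primitive_indefinite[OF ka] a]]) (use t in auto)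
  show "?B u <= ?B v" if "a <= u" "u <= v" "v <= t" for u v
  proof -
   have "0 <= (LINT x:strip \<nu> u v|mark_time \<nu>. \<bar>k x\<bar>)"
    unfolding set_lebesgue_integral_def by (rule integral_nonneg_AE) (auto simp: indicator_def)
   then show ?thesis using B[of u v] that t by simp
  qed
  show "\<bar>(F v - ?H v) - (F u - ?H u)\<bar> <= K * (?B v - ?B u)\<^sup>2" if "a <= u" "u <= v" "v <= t" for u v
  proof -
   have v: "v <= b" using that t by simp
   have "(F v - ?H v) - (F u - ?H u) = F v - F u - (LINT x:strip \<nu> u v|mark_time \<nu>. h x)"
    unfolding H[OF that(1,2) v, symmetric] by simp
   then show ?thesis using Z[OF that(1,2) v] unfolding B[OF that(1,2) v] by simp
  qed
 qed
 moreover have "?H a = 0" by (simp add: set_lebesgue_integral_def)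
 ultimately show "F t = F a + ?H t" by linarith
qed

text \<open>By the mean value theorem and the Lipschitz condition on \<open>\<phi>'\<close>, both sides have the same increments
up to the square of the variation of \<open>F\<close>.\<close>
lemma primitive_chain:
 assumes F: "primitive \<nu> a b f F" and ab: "a <= b" and a: "0 <= a"
  and J: "\<And>t. t \<in> {a..b} ==> F t \<in> {l..r}"
  and \<phi>: "\<And>y. y \<in> {l..r} ==> (\<phi> has_real_derivative \<phi>' y) (at y)"
  and \<phi>': "\<And>y z. y \<in> {l..r} ==> z \<in> {l..r} ==> \<bar>\<phi>' y - \<phi>' z\<bar> <= K * \<bar>y - z\<bar>" and K: "0 <= K"
 shows "primitive \<nu> a b (%x. f x * \<phi>' (F (snd x))) (%t. \<phi> (F t))"
proof -
 have Fc: "continuous_on {a..b} F" by (rule primitive_continuous[OF F a])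
 have "continuous_on {l..r} \<phi>'"
 proof (rule continuous_onI)
  fix y e assume y: "y \<in> {l..r}" and e: "0 < (e::real)"
  show "\<exists>d>0. \<forall>z\<in>{l..r}. dist z y < d \<longrightarrow> dist (\<phi>' z) (\<phi>' y) <= e"
  proof (intro exI[of _ "e / (K + 1)"] conjI ballI impI)
   show "0 < e / (K + 1)" using e K by simp
   fix z assume z: "z \<in> {l..r}" "dist z y < e / (K + 1)"
   have "dist (\<phi>' z) (\<phi>' y) <= K * \<bar>z - y\<bar>" using \<phi>'[OF z(1) y] by (simp add: dist_real_def)
   also have "\<dots> <= (K + 1) * \<bar>z - y\<bar>" by (simp add: distrib_right)
   also have "\<dots> <= e" using z(2) K by (simp add: dist_real_def field_simps)
   finally show "dist (\<phi>' z) (\<phi>' y) <= e" .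
  qed
 qed
 then have Gc: "continuous_on {a..b} (%s. \<phi>' (F s))"
  by (rule continuous_on_compose2[OF _ Fc]) (use J in auto)
 then have "compact ((%s. \<phi>' (F s)) ` {a..b})" by (intro compact_continuous_image) auto
 then obtain c where c: "\<And>s. s \<in> {a..b} ==> \<bar>\<phi>' (F s)\<bar> <= c"
  using compact_imp_bounded bounded_real by (metis imageI)
 have fi: "set_integrable (mark_time \<nu>) (strip \<nu> a b) f" by (rule primitive_integrable[OF F])
 show ?thesis
 proof (rule primitive_from_second_order[OF ab a _ fi, where K="2 * K"])
  show "set_integrable (mark_time \<nu>) (strip \<nu> a b) (%x. f x * \<phi>' (F (snd x)))"
   by (rule set_integral_mult_time(1)[OF fi a _ _ _ Gc, where c=c]) (use ab c in auto)
  fix u v assume uv: "a <= u" "u <= v" "v <= b"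
  let ?B = "LINT x:strip \<nu> u v|mark_time \<nu>. \<bar>f x\<bar>"
  have var: "\<bar>F s - F u\<bar> <= ?B" if "u <= s" "s <= v" for s
  proof -
   have "\<bar>F s - F u\<bar> <= (LINT x:strip \<nu> u s|mark_time \<nu>. \<bar>f x\<bar>)"
    by (rule primitive_variation[OF F a]) (use uv that in auto)
   also have "\<dots> <= ?B" unfolding set_lebesgue_integral_def
   proof (rule integral_mono)
    show "integrable (mark_time \<nu>) (%x. indicator (strip \<nu> u s) x *\<^sub>R \<bar>f x\<bar>)"
     "integrable (mark_time \<nu>) (%x. indicator (strip \<nu> u v) x *\<^sub>R \<bar>f x\<bar>)"
     using set_integrable_abs[OF set_integrable_strip_subset[OF fi a, of u s]]
      set_integrable_abs[OF set_integrable_strip_subset[OF fi a, of u v]] uv that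
     by (auto simp: set_integrable_def)
    show "indicator (strip \<nu> u s) x *\<^sub>R \<bar>f x\<bar> <= indicator (strip \<nu> u v) x *\<^sub>R \<bar>f x\<bar>" for x
     using that by (auto simp: indicator_def strip_def mem_Times_iff)
   qed
   finally show ?thesis .
  qed
  have B0: "0 <= ?B" using var[of u] uv by simp
  obtain \<xi> where \<xi>: "\<phi> (F v) - \<phi> (F u) = \<phi>' \<xi> * (F v - F u)" "\<xi> \<in> {l..r}" "\<bar>\<xi> - F u\<bar> <= ?B"
  proof (cases "F u = F v")
   case True
   show ?thesis by (rule that[of "F u"]) (use True J[of u] uv B0 in simp_all)
  next
   case False
   have FJ: "F u \<in> {l..r}" "F v \<in> {l..r}" using J uv by auto
   have "\<exists>z>min (F u) (F v). z < max (F u) (F v) \<and> \<phi> (max (F u) (F v)) - \<phi> (min (F u) (F v)) = (max (F u) (F v) - min (F u) (F v)) * \<phi>' z"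
    using False FJ by (intro MVT2 \<phi>) auto
   then obtain z where z: "min (F u) (F v) < z" "z < max (F u) (F v)"
    "\<phi> (max (F u) (F v)) - \<phi> (min (F u) (F v)) = (max (F u) (F v) - min (F u) (F v)) * \<phi>' z" by blast
   have 1: "\<phi> (F v) - \<phi> (F u) = \<phi>' z * (F v - F u)"
   proof (cases "F u <= F v")
    case True
    then have "max (F u) (F v) = F v" "min (F u) (F v) = F u" by simp_all
    then show ?thesis using z(3) by (metis mult.commute)
   next
    case False
    then have *: "max (F u) (F v) = F u" "min (F u) (F v) = F v" by simp_all
    have "\<phi> (F u) - \<phi> (F v) = \<phi>' z * (F u - F v)" using z(3) unfolding * by (metis mult.commute)
    then show ?thesis by (metis minus_diff_eq mult_minus_right)
   qed
   have 2: "z \<in> {l..r}" using z(1,2) FJ by (auto simp: max_def min_def split: if_splits)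
   have 3: "\<bar>z - F u\<bar> <= \<bar>F v - F u\<bar>" using z(1,2) by (auto simp: max_def min_def split: if_splits)
   show ?thesis by (rule that[OF 1 2]) (use 3 var[of v] uv in linarith)
  qed
  have fuv: "set_integrable (mark_time \<nu>) (strip \<nu> u v) f" by (rule set_integrable_strip_subset[OF fi a uv(1,3)])
  have I1: "set_integrable (mark_time \<nu>) (strip \<nu> u v) (%x. f x * \<phi>' (F (snd x)))"
   by (rule set_integral_mult_time(1)[OF fi a _ _ _ Gc, where c=c]) (use uv c in auto)
  have "\<phi> (F v) - \<phi> (F u) - (LINT x:strip \<nu> u v|mark_time \<nu>. f x * \<phi>' (F (snd x)))
   = (LINT x:strip \<nu> u v|mark_time \<nu>. f x * (\<phi>' \<xi> - \<phi>' (F (snd x))))"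
  proof -
   have "\<phi> (F v) - \<phi> (F u) = (LINT x:strip \<nu> u v|mark_time \<nu>. f x * \<phi>' \<xi>)"
    unfolding \<xi>(1) primitiveD[OF F a uv] by (simp add: mult.commute)
   moreover have "(LINT x:strip \<nu> u v|mark_time \<nu>. f x * \<phi>' \<xi> - f x * \<phi>' (F (snd x)))
    = (LINT x:strip \<nu> u v|mark_time \<nu>. f x * \<phi>' \<xi>) - (LINT x:strip \<nu> u v|mark_time \<nu>. f x * \<phi>' (F (snd x)))"
    by (rule set_integral_diff(2)[OF _ I1]) (use fuv in simp)
   ultimately show ?thesis unfolding right_diff_distrib by linarith
  qed
  also have "\<bar>\<dots>\<bar> <= (2 * K * ?B) * ?B"
  proof (rule set_integral_mult_time(2)[OF fi a uv, where G="%s. \<phi>' \<xi> - \<phi>' (F s)"])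
   show "continuous_on {a..b} (%s. \<phi>' \<xi> - \<phi>' (F s))" by (intro continuous_intros Gc)
   fix s assume s: "u < s" "s <= v"
   have "\<bar>\<phi>' \<xi> - \<phi>' (F s)\<bar> <= K * \<bar>\<xi> - F s\<bar>" by (rule \<phi>'[OF \<xi>(2) J]) (use s uv in auto)
   also have "\<dots> <= K * (2 * ?B)" using \<xi>(3) var[of s] s K by (intro mult_left_mono) auto
   finally show "\<bar>\<phi>' \<xi> - \<phi>' (F s)\<bar> <= 2 * K * ?B" by simp
  qed
  finally show "\<bar>\<phi> (F v) - \<phi> (F u) - (LINT x:strip \<nu> u v|mark_time \<nu>. f x * \<phi>' (F (snd x)))\<bar> <= 2 * K * ?B\<^sup>2"
   by (simp add: power2_eq_square)
 qed
qed

lemma primitive_bounded: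
 assumes F: "primitive \<nu> a b f F" and a: "0 <= a"
 obtains c where "0 <= c" "\<And>t. t \<in> {a..b} ==> \<bar>F t\<bar> <= c"
proof -
 have "compact (F ` {a..b})" by (intro compact_continuous_image primitive_continuous[OF F a]) simp
 then obtain c where c: "\<And>t. t \<in> {a..b} ==> \<bar>F t\<bar> <= c"
  using compact_imp_bounded bounded_real by (metis imageI)
 have "\<bar>F t\<bar> <= \<bar>c\<bar>" if "t \<in> {a..b}" for t using c[OF that] by linarith
 then show ?thesis by (intro that[of "\<bar>c\<bar>"]) simp_all
qed

lemma primitive_square:
 assumes F: "primitive \<nu> a b f F" and ab: "a <= b" and a: "0 <= a"
 shows "primitive \<nu> a b (%x. f x * (2 * F (snd x))) (%t. (F t)\<^sup>2)"
proof -
 obtain c where c: "0 <= c" "\<And>t. t \<in> {a..b} ==> \<bar>F t\<bar> <= c" by (rule primitive_bounded[OF F a]) blast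
 show ?thesis
 proof (rule primitive_chain[OF F ab a, where l="-c" and r=c and \<phi>="%y. y\<^sup>2" and \<phi>'="%y. 2 * y" and K=2])
  show "F t \<in> {-c..c}" if "t \<in> {a..b}" for t using c(2)[OF that] by auto
  show "((%y. y\<^sup>2) has_real_derivative 2 * y) (at y)" for y :: real
   by (auto intro!: derivative_eq_intros)
  show "\<bar>2 * y - 2 * z\<bar> <= 2 * \<bar>y - z\<bar>" for y z :: real
   unfolding right_diff_distrib[symmetric] abs_mult by simp
 qed simp
qed

text \<open>By polarisation, from the chain rule for squares.\<close>
lemma primitive_mult:
 assumes F: "primitive \<nu> a b f F" and G: "primitive \<nu> a b g G" and ab: "a <= b" and a: "0 <= a"
 shows "primitive \<nu> a b (%x. f x * G (snd x) + F (snd x) * g x) (%t. F t * G t)"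
proof -
 have G': "primitive \<nu> a b (%x. (-1) * g x) (%t. (-1) * G t)" by (rule primitive_cmult[OF G])
 note sum = primitive_cmult[OF primitive_square[OF primitive_add[OF F G a] ab a], of "1/4"]
 note diff = primitive_cmult[OF primitive_square[OF primitive_add[OF F G' a] ab a], of "-1/4"]
 show ?thesis
  by (rule primitive_cong[OF primitive_add[OF sum diff a]]) (simp_all add: algebra_simps power2_eq_square)
qed

lemma exp_lipschitz:
 fixes y z r :: real assumes "y <= r" "z <= r" shows "\<bar>exp y - exp z\<bar> <= exp r * \<bar>y - z\<bar>"
proof -
 have 1: "exp y - exp z <= exp r * (y - z)" if "z <= y" "y <= r" for y z :: real
 proof -
  have "1 + (z - y) <= exp (z - y)" by (rule exp_ge_add_one_self)
  then have "exp y * (1 + (z - y)) <= exp y * exp (z - y)" by (intro mult_left_mono) auto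
  also have "exp y * exp (z - y) = exp z" by (simp add: exp_diff)
  finally have "exp y - exp z <= exp y * (y - z)" by (simp add: algebra_simps)
  also have "\<dots> <= exp r * (y - z)" using that by (intro mult_right_mono) auto
  finally show ?thesis .
 qed
 show ?thesis
 proof (cases "z <= y")
  case True
  then have "exp z <= exp y" by simp
  then show ?thesis using 1[OF True assms(1)] True by simp
 next
  case False
  then have "exp y <= exp z" by simp
  then show ?thesis using 1[of y z] assms(2) False by simp
 qed
qed

lemma primitive_exp:
 assumes F: "primitive \<nu> a b f F" and ab: "a <= b" and a: "0 <= a"
 shows "primitive \<nu> a b (%x. f x * exp (F (snd x))) (%t. exp (F t))"
proof -
 obtain c where c: "0 <= c" "\<And>t. t \<in> {a..b} ==> \<bar>F t\<bar> <= c" by (rule primitive_bounded[OF F a]) blast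
 show ?thesis
 proof (rule primitive_chain[OF F ab a, where l="-c" and r=c and \<phi>=exp and \<phi>'=exp and K="exp c"])
  show "F t \<in> {-c..c}" if "t \<in> {a..b}" for t using c(2)[OF that] by auto
  show "\<bar>exp y - exp z\<bar> <= exp c * \<bar>y - z\<bar>" if "y \<in> {-c..c}" "z \<in> {-c..c}" for y z
   by (rule exp_lipschitz) (use that in auto)
 qed (auto intro: DERIV_exp)
qed

lemma inverse_square_lipschitz:
 fixes y z l :: real assumes "0 < l" "l <= y" "l <= z"
 shows "\<bar>- (1 / y\<^sup>2) - - (1 / z\<^sup>2)\<bar> <= (2 / l ^ 3) * \<bar>y - z\<bar>"
proof -
 have y: "0 < y" and z: "0 < z" using assms by auto
 let ?S = "1 / (y * z\<^sup>2) + 1 / (y\<^sup>2 * z)"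
 have eq: "- (1 / y\<^sup>2) - - (1 / z\<^sup>2) = ?S * (y - z)"
  using y z by (simp add: field_simps power2_eq_square)
 have S0: "0 <= ?S" using y z by simp
 have "1 / (y * z\<^sup>2) <= 1 / l ^ 3"
 proof -
  have "l * l\<^sup>2 <= y * z\<^sup>2" using assms by (intro mult_mono power_mono) auto
  then show ?thesis using assms by (intro divide_left_mono) (auto simp: power3_eq_cube power2_eq_square)
 qed
 moreover have "1 / (y\<^sup>2 * z) <= 1 / l ^ 3"
 proof -
  have "l\<^sup>2 * l <= y\<^sup>2 * z" using assms by (intro mult_mono power_mono) auto
  then show ?thesis using assms by (intro divide_left_mono) (auto simp: power3_eq_cube power2_eq_square)
 qed
 ultimately have S1: "?S <= 2 / l ^ 3" by simp
 have "\<bar>- (1 / y\<^sup>2) - - (1 / z\<^sup>2)\<bar> = ?S * \<bar>y - z\<bar>"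
  unfolding eq abs_mult abs_of_nonneg[OF S0] by (rule refl)
 also have "\<dots> <= (2 / l ^ 3) * \<bar>y - z\<bar>" by (rule mult_right_mono[OF S1 abs_ge_zero])
 finally show ?thesis .
qed

lemma primitive_inverse:
 assumes G: "primitive \<nu> a b g G" and ab: "a <= b" and a: "0 <= a" and pos: "\<And>t. t \<in> {a..b} ==> 0 < G t"
 shows "primitive \<nu> a b (%x. g x * (- (1 / (G (snd x))\<^sup>2))) (%t. inverse (G t))"
proof -
 obtain c where c: "0 <= c" "\<And>t. t \<in> {a..b} ==> \<bar>G t\<bar> <= c" by (rule primitive_bounded[OF G a]) blast
 have "\<exists>m\<in>{a..b}. \<forall>t\<in>{a..b}. G m <= G t"
  by (rule continuous_attains_inf) (use primitive_continuous[OF G a] ab in auto)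
 then obtain m where m: "m \<in> {a..b}" "\<And>t. t \<in> {a..b} ==> G m <= G t" by blast
 have l: "0 < G m" by (rule pos[OF m(1)])
 show ?thesis
 proof (rule primitive_chain[OF G ab a, where l="G m" and r=c and \<phi>=inverse and \<phi>'="%y. - (1 / y\<^sup>2)" and K="2 / (G m) ^ 3"])
  show "G t \<in> {G m..c}" if "t \<in> {a..b}" for t using c(2)[OF that] m(2)[OF that] by auto
  show "(inverse has_real_derivative - (1 / y\<^sup>2)) (at y)" if "y \<in> {G m..c}" for y
  proof -
   have "y \<noteq> 0" using that l by auto
   from DERIV_inverse[OF this] show ?thesis by (simp add: power2_eq_square power_inverse divide_inverse)
  qed
  show "\<bar>- (1 / y\<^sup>2) - - (1 / z\<^sup>2)\<bar> <= 2 / G m ^ 3 * \<bar>y - z\<bar>" if "y \<in> {G m..c}" "z \<in> {G m..c}" for y z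
   by (rule inverse_square_lipschitz[OF l]) (use that in auto)
 qed (use l in simp)
qed

text \<open>The linear equation \<open>dM = - M dA\<close>: the product \<open>M exp A\<close> has the primitive of zero.\<close>
lemma primitive_exponential_unique:
 assumes A: "primitive \<nu> a b f A" and M: "primitive \<nu> a b (%x. - f x * M (snd x)) M" and ab: "a <= b" and a: "0 <= a"
 shows "M b = M a * exp (- (A b - A a))"
proof -
 note P = primitive_mult[OF M primitive_exp[OF A ab a] ab a]
 have "primitive \<nu> a b (%_. 0) (%t. M t * exp (A t))"
  by (rule primitive_cong[OF P]) simp_all
 from primitive_eq[OF this ab order_refl] have "M b * exp (A b) = M a * exp (A a)"
  by (simp add: set_lebesgue_integral_def)
 then show ?thesis by (simp add: exp_minus exp_diff field_simps)
qed

section \<open>Cadlag paths\<close>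

lemma cadlag_left_tendsto:
 fixes x :: "real => real"
 assumes "cadlag x" "0 < t" shows "(x \<longlongrightarrow> left_lim x t) (at_left t)"
proof -
 obtain l where l: "(x \<longlongrightarrow> l) (at_left t)" using assms by (auto simp: cadlag_def)
 then have "left_lim x t = l" unfolding left_lim_def by (intro tendsto_Lim) simp_all
 then show ?thesis using l by simp
qed

text \<open>The one-sided limits bound the path near each time, and such local bounds combine on a compact
interval (Bolzano's principle).\<close>
lemma cadlag_bounded:
 fixes x :: "real => real"
 assumes x: "cadlag x" and b: "0 <= b"
 obtains c where "\<And>s. 0 <= s ==> s <= b ==> \<bar>x s\<bar> <= c"
proof -
 have "\<exists>c. \<forall>s. 0 <= s \<longrightarrow> 0 <= s \<and> s <= b \<longrightarrow> \<bar>x s\<bar> <= c"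
  using b
 proof (induction rule: Bolzano[where P="%u v. \<exists>c. \<forall>s. 0 <= s \<longrightarrow> u <= s \<and> s <= v \<longrightarrow> \<bar>x s\<bar> <= c"])
  case (trans u v w)
  then obtain c c' where c: "\<forall>s. 0 <= s \<longrightarrow> u <= s \<and> s <= v \<longrightarrow> \<bar>x s\<bar> <= c" "\<forall>s. 0 <= s \<longrightarrow> v <= s \<and> s <= w \<longrightarrow> \<bar>x s\<bar> <= c'" by blast
  have "\<bar>x s\<bar> <= max c c'" if "0 <= s" "u <= s" "s <= w" for s
   using c(1)[rule_format, of s] c(2)[rule_format, of s] that by (cases "s <= v") auto
  then show ?case by blast
 next
  case (local t)
  have bnd: "eventually (%s. \<bar>x s\<bar> <= \<bar>l\<bar> + 1) F" if "(x \<longlongrightarrow> l) F" for l F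
   using tendstoD[OF that zero_less_one] by eventually_elim (auto simp: dist_real_def)
  have "(x \<longlongrightarrow> x t) (at_right t)" using x local by (auto simp: cadlag_def)
  from bnd[OF this] obtain r where r: "t < r" "\<And>s. t < s ==> s < r ==> \<bar>x s\<bar> <= \<bar>x t\<bar> + 1"
   unfolding eventually_at_right_field by blast
  obtain q c where q: "q < t" "\<And>s. 0 <= s ==> q < s ==> s < t ==> \<bar>x s\<bar> <= c"
  proof (cases "t = 0")
   case True then show ?thesis by (intro that[of "-1" 0]) auto
  next
   case False
   then have "0 < t" using local by simp
   then obtain l where "(x \<longlongrightarrow> l) (at_left t)" using x unfolding cadlag_def by blast
   from bnd[OF this] obtain q where "q < t" "\<And>s. q < s ==> s < t ==> \<bar>x s\<bar> <= \<bar>l\<bar> + 1"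
    unfolding eventually_at_left_field by blast
   then show ?thesis using that[of q "\<bar>l\<bar> + 1"] by blast
  qed
  let ?d = "min (r - t) (t - q)"
  have "\<bar>x s\<bar> <= max (\<bar>x t\<bar> + 1) c" if "u <= t" "t <= v" "v - u < ?d" "0 <= s" "u <= s" "s <= v" for u v s
  proof (cases "s < t")
   case True then show ?thesis using q(2)[of s] that by force
  next
   case False
   then show ?thesis using r(2)[of s] that by (cases "s = t") auto
  qed
  then show ?case using r(1) q(1) by (intro exI[of _ ?d]) auto
 qed
 then show ?thesis using that by blast
qed

lemma left_lim_bounded:
 fixes x :: "real => real"
 assumes x: "cadlag x" and c: "\<And>s. 0 <= s ==> s <= b ==> \<bar>x s\<bar> <= c" and t: "0 < t" "t <= b"
 shows "\<bar>left_lim x t\<bar> <= c"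
proof (rule tendsto_upperbound)
 show "((%s. \<bar>x s\<bar>) \<longlongrightarrow> \<bar>left_lim x t\<bar>) (at_left t)" by (intro tendsto_intros cadlag_left_tendsto x t)
 show "eventually (%s. \<bar>x s\<bar> <= c) (at_left t)"
  unfolding eventually_at_left_field using t c by (intro exI[of _ 0]) auto
qed simp

text \<open>The left limit is the limit of the values at grid points just before \<open>t\<close>, for ever finer grids.\<close>
lemma left_lim_measurable:
 fixes x :: "real => real"
 assumes x: "cadlag x"
 shows "(%t. if 0 < t then left_lim x t else 0) \<in> borel_measurable borel"
proof (rule borel_measurable_LIMSEQ_real)
 let ?r = "%(n::nat) t. (real_of_int \<lceil>real (Suc n) * t\<rceil> - 1) / real (Suc n)"
 show "(%t. if 0 < t then x (?r n t) else 0) \<in> borel_measurable borel" for n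
 proof -
  have "(%t. \<lceil>real (Suc n) * t\<rceil>) \<in> measurable borel (count_space UNIV)" by measurable
  then have "(%t. x ((real_of_int \<lceil>real (Suc n) * t\<rceil> - 1) / real (Suc n))) \<in> borel_measurable borel"
   by (rule measurable_compose) simp
  then show ?thesis by measurable
 qed
 fix t :: real
 show "(%n. if 0 < t then x (?r n t) else 0) \<longlonglongrightarrow> (if 0 < t then left_lim x t else 0)"
 proof (cases "0 < t")
  case True
  have lt: "?r n t < t" for n
  proof -
   have "real_of_int \<lceil>real (Suc n) * t\<rceil> - 1 < real (Suc n) * t" by linarith
   then show ?thesis by (simp add: divide_less_eq mult.commute del: of_nat_Suc)
  qed
  have ge: "t - 1 / real (Suc n) <= ?r n t" for n
  proof -
   have "real (Suc n) * t - 1 <= real_of_int \<lceil>real (Suc n) * t\<rceil> - 1" by linarith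
   then have "(real (Suc n) * t - 1) / real (Suc n) <= ?r n t" by (intro divide_right_mono) auto
   then show ?thesis by (simp add: diff_divide_distrib del: of_nat_Suc)
  qed
  have "(%n. ?r n t) \<longlonglongrightarrow> t"
  proof (rule tendsto_sandwich)
   show "eventually (%n. t - 1 / real (Suc n) <= ?r n t) sequentially" using ge by simp
   show "eventually (%n. ?r n t <= t) sequentially" using lt less_imp_le by (intro always_eventually) blast
   show "(%n. t - 1 / real (Suc n)) \<longlonglongrightarrow> t"
    using tendsto_diff[OF tendsto_const[of t] LIMSEQ_inverse_real_of_nat] by (simp add: inverse_eq_divide)
  qed simp
  then have "filterlim (%n. ?r n t) (at_left t) sequentially"
   unfolding filterlim_at using lt by (intro conjI always_eventually allI) (simp_all add: less_imp_neq del: of_nat_Suc)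
  from filterlim_compose[OF cadlag_left_tendsto[OF x True] this] show ?thesis using True by simp
 qed simp
qed

text \<open>Adding the null set of points at time 0 does not change an integral, but measurability on this
set has to be known, as integrability refers to the function itself.\<close>
lemma set_integrable_slice:
 fixes f :: "'e \<times> real => real"
 assumes f: "set_integrable (mark_time \<nu>) (strip \<nu> 0 t) f" and t: "0 <= t"
  and m: "(%x. indicator (space \<nu> \<times> {0}) x *\<^sub>R f x) \<in> borel_measurable (mark_time \<nu>)"
 shows "set_integrable (mark_time \<nu>) (space \<nu> \<times> {0..t}) f"
  "(LINT x:space \<nu> \<times> {0..t}|mark_time \<nu>. f x) = (LINT x:strip \<nu> 0 t|mark_time \<nu>. f x)"
proof -
 have ae: "AE x in mark_time \<nu>. indicator (space \<nu> \<times> {0}) x *\<^sub>R f x = 0"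
  using AE_time_neq[of 0 \<nu>] by eventually_elim (auto simp: indicator_def mem_Times_iff)
 have "integrable (mark_time \<nu>) (%x. indicator (space \<nu> \<times> {0}) x *\<^sub>R f x) \<longleftrightarrow> integrable (mark_time \<nu>) (%x. 0 :: real)"
  by (rule integrable_cong_AE) (use m ae in auto)
 then have i: "integrable (mark_time \<nu>) (%x. indicator (space \<nu> \<times> {0}) x *\<^sub>R f x)" by simp
 have z: "(LINT x|mark_time \<nu>. indicator (space \<nu> \<times> {0}) x *\<^sub>R f x) = 0"
  using integral_cong_AE[OF m _ ae] by simp
 have eq: "indicator (space \<nu> \<times> {0..t}) x *\<^sub>R f x = indicator (strip \<nu> 0 t) x *\<^sub>R f x + indicator (space \<nu> \<times> {0}) x *\<^sub>R f x" for x
  using t by (auto simp: indicator_def strip_def mem_Times_iff)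
 show "set_integrable (mark_time \<nu>) (space \<nu> \<times> {0..t}) f"
  using f i unfolding set_integrable_def eq by simp
 show "(LINT x:space \<nu> \<times> {0..t}|mark_time \<nu>. f x) = (LINT x:strip \<nu> 0 t|mark_time \<nu>. f x)"
  using f i z unfolding set_integrable_def set_lebesgue_integral_def eq by simp
qed

context cluster_model
begin

section \<open>The likelihood process\<close>

text \<open>The cluster intensity during the piece in which the history is \<open>ls\<close>.\<close>
definition lamh :: "bool => (nat => 'e \<times> real) => bool option list => 'e \<times> real => real" where
 "lamh d0 x ls z = lam (fst z) (snd z) (stat d0 ls) (snd (Gam d0 x ls))"

text \<open>The likelihood of no cluster point since the last observed point, relative to \<open>Q\<close>.  If the cumulative
intensity diverges there are infinitely many such points, whence the value 0.\<close>
definition Ex :: "bool => (nat => 'e \<times> real) => bool option list => real => real" where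
 "Ex d0 x ls b = (if set_integrable M0 (strip \<nu> (tau x (length ls)) b) (lamh d0 x ls)
   then exp (- (LINT z:strip \<nu> (tau x (length ls)) b|M0. lamh d0 x ls z - lamQ (fst z) (snd z))) else 0)"

text \<open>The likelihood at the time of the last observed point, that point included.\<close>
primrec ell :: "bool => (nat => 'e \<times> real) => bool option list => real" where
 "ell d0 x [] = 1"
| "ell d0 x (a # ls) = ell d0 x ls * Ex d0 x ls (snd (x (length ls))) * (case a of None => 1
   | Some d => lamh d0 x ls (x (length ls)) / lamQ (fst (x (length ls))) (snd (x (length ls))))"

text \<open>The likelihood \<open>L\<close> at time \<open>t\<close> if the history is \<open>ls\<close>.\<close>
definition lk :: "bool => (nat => 'e \<times> real) => bool option list => real => real" where
 "lk d0 x ls t = ell d0 x ls * Ex d0 x ls t"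

lemma Ex_nonneg: "0 <= Ex d0 x ls b" by (simp add: Ex_def)

lemma lamh_nonneg: "z \<in> space M0 ==> 0 <= lamh d0 x ls z"
 using lam_nonneg by (auto simp: lamh_def space_mark_time)

lemma Gam_space: "\<forall>k<length ls. x k \<in> space M0 ==> set_mset (snd (Gam d0 x ls)) \<subseteq> space M0"
 by (induction ls) (auto split: option.split)

lemma ell_nonneg: "\<forall>k<length ls. x k \<in> space M0 ==> 0 <= ell d0 x ls"
proof (induction ls)
 case (Cons a ls)
 have "x (length ls) \<in> space M0" using Cons(2) by simp
 then have "0 <= lamh d0 x ls (x (length ls)) / lamQ (fst (x (length ls))) (snd (x (length ls)))"
  using lamh_nonneg M0_pos(1) by (intro divide_nonneg_nonneg) (auto simp: less_imp_le)
 then show ?case using Cons Ex_nonneg by (auto split: option.split intro!: mult_nonneg_nonneg)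
qed simp

lemma lk_nonneg: "\<forall>k<length ls. x k \<in> space M0 ==> 0 <= lk d0 x ls t"
 using ell_nonneg Ex_nonneg by (simp add: lk_def)

lemma lam_fixed_measurable: "set_mset \<eta> \<subseteq> space M0 ==> (%z. lam (fst z) (snd z) d \<eta>) \<in> borel_measurable M0"
proof -
 assume "set_mset \<eta> \<subseteq> space M0"
 then have "(%z. ((fst z, snd z), (d, \<eta>))) \<in> measurable M0 (M0 \<Otimes>\<^sub>M (count_space UNIV \<Otimes>\<^sub>M S0))"
  by (intro measurable_Pair) (simp_all add: space_mset_space measurable_ident_sets)
 from measurable_compose[OF this lam_measurable] show ?thesis by (simp add: case_prod_beta)
qed

lemma lamh_measurable: "\<forall>k<length ls. x k \<in> space M0 ==> lamh d0 x ls \<in> borel_measurable M0"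
 using lam_fixed_measurable[OF Gam_space] unfolding lamh_def[abs_def] .

lemma lamQ_strip: assumes "0 <= a" shows "set_integrable M0 (strip \<nu> a b) (%z. lamQ (fst z) (snd z))"
proof -
 have "(\<integral>\<^sup>+z. ennreal (norm (indicator (strip \<nu> a b) z *\<^sub>R lamQ (fst z) (snd z))) \<partial>M0)
   <= (\<integral>\<^sup>+z. (case z of (u, s) => ennreal (lamQ u s)) * indicator (space \<nu> \<times> {0..b}) z \<partial>M0)"
  using assms M0_pos(1)
  by (intro nn_integral_mono) (auto simp: indicator_def strip_def mem_Times_iff split_beta intro!: ennreal_leI abs_le_iff[THEN iffD2] simp: abs_of_pos)
 also have "\<dots> = emeasure (density M0 (%(u, s). ennreal (lamQ u s))) (space \<nu> \<times> {0..b})"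
  by (rule emeasure_density[symmetric]) (simp_all add: case_prod_beta')
 also have "\<dots> < \<infinity>" by (rule lamQ_finite)
 finally show ?thesis unfolding set_integrable_def
  by (intro integrableI_bounded) (use assms in auto)
qed

lemma set_integrable_nonneg_iff:
 fixes f :: "'e \<times> real => real"
 assumes f: "f \<in> borel_measurable M0" "\<And>z. z \<in> space M0 ==> 0 <= f z" and a: "0 <= a"
 shows "set_integrable M0 (strip \<nu> a b) f \<longleftrightarrow> (\<integral>\<^sup>+z. indicator (strip \<nu> a b) z * ennreal (f z) \<partial>M0) < \<infinity>"
proof -
 have "(\<integral>\<^sup>+z. ennreal (norm (indicator (strip \<nu> a b) z *\<^sub>R f z)) \<partial>M0) = (\<integral>\<^sup>+z. indicator (strip \<nu> a b) z * ennreal (f z) \<partial>M0)"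
  using f(2) by (intro nn_integral_cong) (auto simp: indicator_def)
 then show ?thesis unfolding set_integrable_def integrable_iff_bounded using f(1) a by auto
qed

lemma Ex_primitive:
 assumes x: "\<forall>k<length ls. x k \<in> space M0" and a: "0 <= tau x (length ls)" "tau x (length ls) <= b"
  and int: "set_integrable M0 (strip \<nu> (tau x (length ls)) b) (lamh d0 x ls)"
 shows "primitive \<nu> (tau x (length ls)) b (%z. - (lamh d0 x ls z - lamQ (fst z) (snd z)) * Ex d0 x ls (snd z)) (Ex d0 x ls)"
  and "Ex d0 x ls (tau x (length ls)) = 1"
  and "\<And>s. tau x (length ls) <= s ==> s <= b ==> 0 < Ex d0 x ls s"
proof -
 let ?a = "tau x (length ls)"
 let ?f = "%z. - (lamh d0 x ls z - lamQ (fst z) (snd z))"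
 have isb: "set_integrable M0 (strip \<nu> ?a s) (lamh d0 x ls)" if "s <= b" for s
  using that by (intro set_integrable_strip_subset[OF int a(1) order_refl])
 have fi: "set_integrable M0 (strip \<nu> ?a s) (%z. lamh d0 x ls z - lamQ (fst z) (snd z))" if "s <= b" for s
  using isb[OF that] lamQ_strip[OF a(1)] by (rule set_integral_diff)
 have eq: "Ex d0 x ls s = exp (LINT z:strip \<nu> ?a s|M0. ?f z)" if "s <= b" for s
  using isb[OF that] set_integral_uminus[OF fi[OF that]] by (simp add: Ex_def)
 have "set_integrable M0 (strip \<nu> ?a b) ?f" using fi[of b] unfolding set_integrable_def by (subst scaleR_minus_right) simp
 from primitive_exp[OF primitive_indefinite[OF this] a(2,1)]
 show "primitive \<nu> ?a b (%z. ?f z * Ex d0 x ls (snd z)) (Ex d0 x ls)"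
  by (rule primitive_cong) (auto simp: eq strip_def)
 show "Ex d0 x ls ?a = 1" by (simp add: Ex_def set_integrable_def set_lebesgue_integral_def)
 show "0 < Ex d0 x ls s" if "?a <= s" "s <= b" for s by (simp add: eq[OF that(2)])
qed

lemma pt_space:
 assumes "w \<in> space Q" "0 <= t" "good (Y t w)" "k < size (Y t w)" shows "pt (Y t w) k \<in> space M0"
proof -
 have "pt (Y t w) k \<in># Y t w" by (rule pt_in(1)[OF assms(3,4)])
 then show ?thesis using measurable_space[OF Y_measurable[OF assms(2)] assms(1)] by (auto simp: space_mset_space)
qed

definition piece_end :: "('e \<times> real) multiset => real => nat => real" where
 "piece_end X t k = (if k < size X then snd (pt X k) else t)"

lemma tau_le_piece_end:
 assumes "w \<in> space Q" "0 <= t" "good (Y t w)" "k <= size (Y t w)"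
 shows "tau (pt (Y t w)) k <= piece_end (Y t w) t k" "piece_end (Y t w) t k <= t"
  "k < size (Y t w) ==> tau (pt (Y t w)) k < piece_end (Y t w) t k"
proof -
 show "k < size (Y t w) ==> tau (pt (Y t w)) k < piece_end (Y t w) t k"
  using pt_tau_less[OF assms(3)] by (simp add: piece_end_def)
 show "piece_end (Y t w) t k <= t" using pt_le_horizon[OF assms(1,3)] by (simp add: piece_end_def)
 show "tau (pt (Y t w)) k <= piece_end (Y t w) t k"
 proof (cases "k < size (Y t w)")
  case True
  then show ?thesis using pt_tau_less[OF assms(3) True] by (simp add: piece_end_def)
 next
  case False
  then have k: "k = size (Y t w)" using assms(4) by simp
  have "tau (pt (Y t w)) k <= t"
  proof (cases k)
   case (Suc j)
   then show ?thesis using pt_le_horizon[OF assms(1,3), of j] k by (simp del: One_nat_def)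
  qed (simp add: assms(2))
  then show ?thesis using False by (simp add: piece_end_def)
 qed
qed

text \<open>The almost sure assumptions on the intensity and on \<open>L\<close>, as properties of a single path.\<close>
definition lamint_path :: "'w => bool" where
 "lamint_path w \<longleftrightarrow> (\<forall>t\<ge>0. (\<integral>\<^sup>+x\<in>space \<nu> \<times> {0..t}. (case x of (u, s) =>
       ennreal (intensity lam u s (state_at (%r. D r w) (C w) s))) \<partial>mark_time \<nu>) < \<infinity>)"

definition Leq_path :: "'w => bool" where
 "Leq_path w \<longleftrightarrow> cadlag (%t. L t w) \<and> (\<forall>t\<ge>0. L t w = 1
     + (\<Sum>(u, s) \<in> {x \<in> C w. snd x <= t}.
        (lam u s (left_lim (%r. D r w) s) (points_before (C w) s) / lamQ u s - 1)
        * left_lim (%r. L r w) s)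
     - (LINT x:space \<nu> \<times> {0..t}|mark_time \<nu>. (case x of (u, s) =>
        (lam u s (left_lim (%r. D r w) s) (points_before (C w) s) / lamQ u s - 1)
        * left_lim (%r. L r w) s * lamQ u s)))"

lemma lamh_piece_integrable:
 assumes w: "w \<in> space Q" and t: "0 <= t" and g: "good (Y t w)" and k: "k <= size (Y t w)" and li: "lamint_path w"
 shows "set_integrable M0 (strip \<nu> (tau (pt (Y t w)) k) (piece_end (Y t w) t k)) (lamh (D 0 w) (pt (Y t w)) (labs t w k))"
proof -
 let ?x = "pt (Y t w)" and ?ls = "labs t w k" and ?e = "piece_end (Y t w) t k"
 have x: "\<forall>j<length ?ls. ?x j \<in> space M0" using pt_space[OF w t g] k by simp
 have a0: "0 <= tau ?x k" by (rule tau_nonneg[OF g k])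
 have "(\<integral>\<^sup>+z. indicator (strip \<nu> (tau ?x k) ?e) z * ennreal (lamh (D 0 w) ?x ?ls z) \<partial>M0)
  <= (\<integral>\<^sup>+x\<in>space \<nu> \<times> {0..t}. (case x of (u, s) => ennreal (intensity lam u s (state_at (%r. D r w) (C w) s))) \<partial>mark_time \<nu>)"
 proof (rule nn_integral_mono_AE)
  show "AE z in M0. indicator (strip \<nu> (tau ?x k) ?e) z * ennreal (lamh (D 0 w) ?x ?ls z)
   <= (case z of (u, s) => ennreal (intensity lam u s (state_at (%r. D r w) (C w) s))) * indicator (space \<nu> \<times> {0..t}) z"
   using AE_time_neq[of ?e \<nu>]
  proof eventually_elim
   case (elim z)
   show ?case
   proof (cases "z \<in> strip \<nu> (tau ?x k) ?e")
    case True
    obtain u s where z: "z = (u, s)" by (cases z)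
    have s: "tau ?x k < s" "s < ?e" "u \<in> space \<nu>" using True elim by (auto simp: strip_def z)
    have st: "s <= t" using s(2) tau_le_piece_end(2)[OF w t g k] by simp
    have "size (Y s w) = k" unfolding Y_upto(1)[OF w st]
     by (rule size_upto_eqI[OF g k]) (use s in \<open>auto simp: piece_end_def\<close>)
    then have "state_at (%r. D r w) (C w) s = Gam (D 0 w) ?x ?ls" using state_at_eq_Gam[OF w g st] by simp
    then have "intensity lam u s (state_at (%r. D r w) (C w) s) = lamh (D 0 w) ?x ?ls z"
     using status_Gam[OF g, of ?ls] k by (simp add: intensity_def lamh_def z)
    then show ?thesis using True s st a0 by (simp add: z)
   qed simp
  qed
 qed
 also have "\<dots> < \<infinity>" using li t unfolding lamint_path_def by blast
 finally show ?thesis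
  by (subst set_integrable_nonneg_iff[OF lamh_measurable[OF x] lamh_nonneg a0])
qed

lemma points_before_piece:
 assumes w: "w \<in> space Q" and g: "good (Y t w)" and k: "k <= size (Y t w)"
  and s: "tau (pt (Y t w)) k < s" "s <= piece_end (Y t w) t k" "s <= t"
 shows "points_before (C w) s = snd (Gam (D 0 w) (pt (Y t w)) (labs t w k))"
proof -
 have "points_before (C w) s = {#y \<in># Cs t w. snd y < s#}"
  unfolding points_before_def points_upto_def filter_mset_mset_set[OF C_locally_finite[OF w]]
  using s(3) by (intro arg_cong[where f=mset_set]) auto
 also have "\<dots> = Cfirst t w k" unfolding Cfirst_def
 proof (rule filter_mset_cong[OF refl])
  fix y assume "y \<in># Cs t w"
  then obtain j where j: "j < size (Y t w)" "y = pt (Y t w) j" "time_rank (Y t w) y = j" by (rule Cs_pt[OF g])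
  have *: "tau (pt (Y t w)) k < snd (pt (Y t w) j) \<longleftrightarrow> k <= j" by (rule tau_less_pt_iff[OF g j(1) k])
  show "(snd y < s) = (time_rank (Y t w) y < k)"
  proof (cases "k <= j")
   case True
   then have "s <= snd (pt (Y t w) k)" using s(2) j(1) by (simp add: piece_end_def)
   also have "\<dots> <= snd (pt (Y t w) j)" using pt_less_iff[OF g j(1), of k] True j(1) by simp
   finally show ?thesis unfolding j(3) using True j(2) by simp
  next
   case False
   then show ?thesis unfolding j(3) using * s(1) j(2) by simp
  qed
 qed
 finally show ?thesis using Gam_labs[OF g k] by simp
qed

text \<open>On a piece without observed points the integrand in the equation for \<open>L\<close> contains the left limit of
\<open>L\<close>.  The integral is continuous in time, so inside the piece this left limit is the value \<open>M k\<close> of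
the continuous part, which thus solves a linear equation and is an exponential.  At the right end of
the piece there is a jump if the point is a cluster point, with the factor \<open>lam / lamQ\<close>.\<close>
lemma L_path:
 assumes w: "w \<in> space Q" and t: "0 <= t" and g: "good (Y t w)" and li: "lamint_path w" and Leq: "Leq_path w"
 shows "L t w = lk (D 0 w) (pt (Y t w)) (labs t w (size (Y t w))) t"
proof -
 let ?x = "pt (Y t w)" and ?n = "size (Y t w)" and ?d = "D 0 w"
 define a where "a k = tau ?x k" for k
 define e where "e k = piece_end (Y t w) t k" for k
 define v where "v s = left_lim (%r. L r w) s" for s
 define jump where "jump z = (lam (fst z) (snd z) (left_lim (%r. D r w) (snd z)) (points_before (C w) (snd z)) / lamQ (fst z) (snd z) - 1) * v (snd z)" for z
 define h where "h z = jump z * lamQ (fst z) (snd z)" for z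
 note te = tau_le_piece_end[OF w t g, folded a_def e_def]
 have cad: "cadlag (%t. L t w)" using Leq by (simp add: Leq_path_def)
 have Leq': "L r w = 1 + (\<Sum>z\<in>{x \<in> C w. snd x <= r}. jump z) - (LINT z:space \<nu> \<times> {0..r}|M0. h z)" if "0 <= r" for r
  using Leq that by (simp add: Leq_path_def jump_def h_def v_def case_prod_beta')
 have a0: "0 <= a k" if "k <= ?n" for k unfolding a_def by (rule tau_nonneg[OF g that])
 have xs: "\<forall>j<length (labs t w k). ?x j \<in> space M0" if "k <= ?n" for k using pt_space[OF w t g] that by simp
 have hk: "h z = (lamh ?d ?x (labs t w k) z - lamQ (fst z) (snd z)) * v (snd z)" if k: "k <= ?n" and z: "z \<in> strip \<nu> (a k) (e k)" for k z
 proof -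
  have s: "a k < snd z" "snd z <= e k" and u: "fst z \<in> space \<nu>" using z by (auto simp: strip_def)
  have st: "snd z <= t" using s te(2)[OF k] by simp
  have zM: "z \<in> space M0" using s u a0[OF k] by (simp add: space_mark_time mem_Times_iff)
  have ll: "left_lim (%r. D r w) (snd z) = stat ?d (labs t w k)"
   by (rule left_lim_D[OF w g k]) (use s st in \<open>auto simp: a_def e_def piece_end_def\<close>)
  have pb: "points_before (C w) (snd z) = snd (Gam ?d ?x (labs t w k))"
   by (rule points_before_piece[OF w g k]) (use s st in \<open>auto simp: a_def e_def\<close>)
  have "h z = (lamh ?d ?x (labs t w k) z / lamQ (fst z) (snd z) - 1) * lamQ (fst z) (snd z) * v (snd z)"
   unfolding h_def jump_def ll pb lamh_def by (simp only: ac_simps)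
  also have "(lamh ?d ?x (labs t w k) z / lamQ (fst z) (snd z) - 1) * lamQ (fst z) (snd z) = lamh ?d ?x (labs t w k) z - lamQ (fst z) (snd z)"
   using M0_pos(1)[OF zM] by (simp add: left_diff_distrib)
  finally show ?thesis .
 qed
 have ik: "set_integrable M0 (strip \<nu> (a k) (e k)) (lamh ?d ?x (labs t w k))" if "k <= ?n" for k
  unfolding a_def e_def by (rule lamh_piece_integrable[OF w t g that li])
 have ik2: "set_integrable M0 (strip \<nu> (a k) (e k)) (%z. lamh ?d ?x (labs t w k) z - lamQ (fst z) (snd z))" if "k <= ?n" for k
  by (rule set_integral_diff(1)[OF ik[OF that] lamQ_strip[OF a0[OF that]]])
 obtain c where c: "\<And>s. 0 <= s ==> s <= t ==> \<bar>L s w\<bar> <= c" by (rule cadlag_bounded[OF cad t]) blast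
 let ?v = "%s. if 0 < s then v s else 0"
 have hint: "set_integrable M0 (strip \<nu> (a k) (e k)) h" if k: "k <= ?n" for k
 proof -
  have vm: "(%z. ?v (snd z)) \<in> borel_measurable M0"
   using measurable_compose[OF measurable_snd_mark_time left_lim_measurable[OF cad]] unfolding v_def .
  have vb: "\<bar>?v (snd z)\<bar> <= c" if "z \<in> strip \<nu> (a k) (e k)" for z
   using left_lim_bounded[OF cad c, of t "snd z"] that a0[OF k] te(2)[OF k] by (auto simp: v_def strip_def)
  have "set_integrable M0 (strip \<nu> (a k) (e k)) (%z. (lamh ?d ?x (labs t w k) z - lamQ (fst z) (snd z)) * ?v (snd z))"
   by (rule set_integral_mult_bounded(1)[OF ik2[OF k] a0[OF k] vm vb])
  moreover have eq: "indicator (strip \<nu> (a k) (e k)) z *\<^sub>R ((lamh ?d ?x (labs t w k) z - lamQ (fst z) (snd z)) * ?v (snd z)) = indicator (strip \<nu> (a k) (e k)) z *\<^sub>R h z" for z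
   using hk[OF k, of z] a0[OF k] by (auto simp: indicator_def strip_def)
  ultimately show ?thesis unfolding set_integrable_def by (simp only: eq)
 qed
 have e_a: "e k = a (Suc k)" if "k < ?n" for k using that by (simp add: e_def a_def piece_end_def)
 have h0: "set_integrable M0 (strip \<nu> 0 (e k)) h" if "k <= ?n" for k
  using that
 proof (induction k)
  case 0
  then show ?case using hint[of 0] by (simp add: a_def)
 next
  case (Suc k)
  have 1: "set_integrable M0 (strip \<nu> 0 (a (Suc k))) h" using Suc e_a[of k] by simp
  have 2: "strip \<nu> 0 (e (Suc k)) = strip \<nu> 0 (a (Suc k)) \<union> strip \<nu> (a (Suc k)) (e (Suc k))"
   by (rule strip_split) (use a0[of "Suc k"] te(1)[of "Suc k"] Suc(2) in auto)
  show ?case unfolding 2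
   by (rule set_integrable_Un[OF 1 hint[OF Suc(2)]]) (use a0[of "Suc k"] Suc(2) in auto)
 qed
 have hs: "(%z. indicator (space \<nu> \<times> {0}) z *\<^sub>R h z) \<in> borel_measurable M0"
 proof -
  have pb0: "points_before (C w) 0 = {#}"
  proof -
   have "{x \<in> C w. snd x < 0} = {}" using C_subset[OF w] by (auto simp: space_mark_time)
   then show ?thesis unfolding points_before_def by (simp only: mset_set.empty)
  qed
  have E0: "space \<nu> \<times> {0::real} \<in> sets M0" using Et_measurable[of 0] by simp
  have "(%z. indicator (space \<nu> \<times> {0}) z *\<^sub>R ((lam (fst z) (snd z) (left_lim (%r. D r w) 0) {#} / lamQ (fst z) (snd z) - 1) * v 0 * lamQ (fst z) (snd z))) \<in> borel_measurable M0"
   using E0 lam_fixed_measurable[of "{#}"] by simp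
  moreover have eq: "indicator (space \<nu> \<times> {0}) z *\<^sub>R ((lam (fst z) (snd z) (left_lim (%r. D r w) 0) {#} / lamQ (fst z) (snd z) - 1) * v 0 * lamQ (fst z) (snd z))
   = indicator (space \<nu> \<times> {0}) z *\<^sub>R h z" for z :: "'e \<times> real"
   using pb0 by (auto simp: indicator_def h_def jump_def)
  ultimately show ?thesis by (simp only: eq)
 qed
 have Lstrip: "L r w = 1 + (\<Sum>z\<in>{x \<in> C w. snd x <= r}. jump z) - (LINT z:strip \<nu> 0 r|M0. h z)"
  if r: "0 <= r" "r <= e k" and k: "k <= ?n" for r k
 proof -
  have "set_integrable M0 (strip \<nu> 0 r) h"
   using set_integrable_strip_subset[OF h0[OF k], of 0 r] r by simp
  from set_integrable_slice(2)[OF this r(1) hs] show ?thesis using Leq'[OF r(1)] by simp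
 qed
 have Lpiece: "L r w = L (a k) w + (\<Sum>z\<in>{x \<in> C w. a k < snd x \<and> snd x <= r}. jump z) - (LINT z:strip \<nu> (a k) r|M0. h z)"
  if k: "k <= ?n" and r: "a k <= r" "r <= e k" for k r
 proof -
  have un: "{x \<in> C w. snd x <= r} = {x \<in> C w. snd x <= a k} \<union> {x \<in> C w. a k < snd x \<and> snd x <= r}" using r by auto
  have s: "(\<Sum>z\<in>{x \<in> C w. snd x <= r}. jump z) = (\<Sum>z\<in>{x \<in> C w. snd x <= a k}. jump z) + (\<Sum>z\<in>{x \<in> C w. a k < snd x \<and> snd x <= r}. jump z)"
   unfolding un by (rule sum.union_disjoint) (auto intro: C_locally_finite[OF w] finite_subset[OF _ C_locally_finite[OF w, of r]])
  have i: "(LINT z:strip \<nu> 0 r|M0. h z) = (LINT z:strip \<nu> 0 (a k)|M0. h z) + (LINT z:strip \<nu> (a k) r|M0. h z)"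
   by (rule set_lebesgue_integral_strip_split[OF h0[OF k]]) (use a0[OF k] r in auto)
  have "L r w = 1 + (\<Sum>z\<in>{x \<in> C w. snd x <= r}. jump z) - (LINT z:strip \<nu> 0 r|M0. h z)"
   by (rule Lstrip[OF _ r(2) k]) (use a0[OF k] r in auto)
  moreover have "L (a k) w = 1 + (\<Sum>z\<in>{x \<in> C w. snd x <= a k}. jump z) - (LINT z:strip \<nu> 0 (a k)|M0. h z)"
   by (rule Lstrip[OF a0[OF k] _ k]) (use r in auto)
  ultimately show ?thesis using s i by linarith
 qed
 \<comment> \<open>the part of \<open>L\<close> on piece number \<open>k\<close> without the jump at its right end\<close>
 define M where "M k r = L (a k) w - (LINT z:strip \<nu> (a k) r|M0. h z)" for k r
 have LM: "L r w = M k r" if k: "k <= ?n" and r: "a k <= r" "r <= e k" "k < ?n ==> r < e k" for k r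
 proof -
  have emp: "{x \<in> C w. a k < snd x \<and> snd x <= r} = {}"
  proof -
   have "snd y \<notin> {tau ?x k<..r}" if "y \<in> C w" for y
    by (rule no_cluster_between[OF w g k _ _ that]) (use r te(2)[OF k] in \<open>auto simp: e_def piece_end_def\<close>)
   then show ?thesis by (auto simp: a_def)
  qed
  show ?thesis using Lpiece[OF k r(1,2)] unfolding emp M_def by simp
 qed
 have Mprim: "primitive \<nu> (a k) (e k) (%z. - h z) (M k)" if k: "k <= ?n" for k
 proof -
  have "primitive \<nu> (a k) (e k) (%z. 0 + (-1) * h z) (%t. L (a k) w + (-1) * (LINT z:strip \<nu> (a k) t|M0. h z))"
   by (intro primitive_add primitive_const primitive_cmult primitive_indefinite hint k a0)
  then show ?thesis by (rule primitive_cong) (simp_all add: M_def)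
 qed
 have vM: "v s = M k s" if k: "k <= ?n" and s: "a k < s" "s <= e k" for k s
 proof -
  have "continuous_on {a k..e k} (M k)" by (rule primitive_continuous[OF Mprim[OF k] a0[OF k]])
  then have "(M k \<longlongrightarrow> M k s) (at s within {a k..e k})" using s by (simp add: continuous_on_def)
  then have "(M k \<longlongrightarrow> M k s) (at s within {a k..<s})" by (rule tendsto_within_subset) (use s in auto)
  moreover have "at s within {a k..<s} = at_left s"
   by (rule at_within_nhd[where S="{a k<..}"]) (use s in auto)
  ultimately have 1: "(M k \<longlongrightarrow> M k s) (at_left s)" by simp
  have "eventually (%r. M k r = L r w) (at_left s)"
   unfolding eventually_at_left_field using s LM[OF k] by (intro exI[of _ "a k"]) auto
  with 1 have "((%r. L r w) \<longlongrightarrow> M k s) (at_left s)" by (rule Lim_transform_eventually)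
  then show ?thesis unfolding v_def left_lim_def by (intro tendsto_Lim) simp_all
 qed
 have Mexp: "M k r = L (a k) w * Ex ?d ?x (labs t w k) r" if k: "k <= ?n" and r: "a k <= r" "r <= e k" for k r
 proof -
  let ?f = "%z. lamh ?d ?x (labs t w k) z - lamQ (fst z) (snd z)"
  have A: "primitive \<nu> (a k) r ?f (%t. LINT z:strip \<nu> (a k) t|M0. ?f z)"
   by (rule primitive_subinterval[OF primitive_indefinite[OF ik2[OF k]] a0[OF k] order_refl r(2)])
  have "primitive \<nu> (a k) (e k) (%z. - ?f z * M k (snd z)) (M k)"
  proof (rule primitive_cong[OF Mprim[OF k]])
   fix z assume z: "z \<in> strip \<nu> (a k) (e k)"
   then have "v (snd z) = M k (snd z)" by (intro vM[OF k]) (auto simp: strip_def)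
   then show "- h z = - ?f z * M k (snd z)" unfolding hk[OF k z] by (simp only: minus_mult_left)
  qed simp
  then have B: "primitive \<nu> (a k) r (%z. - ?f z * M k (snd z)) (M k)"
   by (rule primitive_subinterval[OF _ a0[OF k] order_refl r(2)])
  have "set_integrable M0 (strip \<nu> (a k) r) (lamh ?d ?x (labs t w k))"
   by (rule set_integrable_strip_subset[OF ik[OF k] a0[OF k] order_refl r(2)])
  then have "Ex ?d ?x (labs t w k) r = exp (- (LINT z:strip \<nu> (a k) r|M0. ?f z))" by (simp add: Ex_def a_def)
  moreover have "M k (a k) = L (a k) w" by (simp add: M_def set_lebesgue_integral_def)
  ultimately show ?thesis
   using primitive_exponential_unique[OF A B r(1) a0[OF k]] by (simp add: set_lebesgue_integral_def[of _ "{}"])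
 qed
 have step: "L (a k) w = ell ?d ?x (labs t w k)" if "k <= ?n" for k
  using that
 proof (induction k)
  case 0
  have L0: "L 0 w = 1 + (\<Sum>z\<in>{x \<in> C w. snd x <= 0}. jump z) - (LINT z:strip \<nu> 0 0|M0. h z)"
   by (rule Lstrip[of _ 0]) (use te(1)[of 0] in \<open>simp_all add: a_def\<close>)
  have emp: "{x \<in> C w. snd x <= 0} = {}"
  proof -
   have "0 < snd y" if "y \<in> C w" "snd y <= 0" for y
   proof -
    have "y \<in># Y t w" using that t Cs_iff[OF w, of y t] by (simp add: obs_def)
    then show ?thesis using g by (auto simp: good_def)
   qed
   then show ?thesis by force
  qed
  show ?case using L0 unfolding emp by (simp add: a_def set_lebesgue_integral_def)
 next
  case (Suc k)
  then have k: "k < ?n" "k <= ?n" by simp_all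
  have eM: "a k < e k" by (rule te(3)[OF k(2,1)])
  let ?z = "?x k"
  have ez: "e k = snd ?z" "a (Suc k) = e k" using k by (simp_all add: e_def a_def piece_end_def)
  have set: "{x \<in> C w. a k < snd x \<and> snd x <= e k} = (if ?z \<in># Cs t w then {?z} else {})"
  proof -
   have "y = ?z \<and> ?z \<in># Cs t w" if y: "y \<in> C w" "a k < snd y" "snd y <= e k" for y
   proof -
    have yC: "y \<in># Cs t w" using y te(2)[OF k(2)] by (simp add: Cs_iff[OF w])
    then obtain j where j: "j < ?n" "y = ?x j" by (rule Cs_pt[OF g])
    have "k <= j" using tau_less_pt_iff[OF g j(1) k(2)] y(2) j(2) by (simp add: a_def)
    moreover have "\<not> k < j" using pt_less_iff[OF g k(1) j(1)] y(3) j(2) ez by simp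
    ultimately show ?thesis using j(2) yC by simp
   qed
   moreover have "?z \<in> C w \<and> a k < snd ?z \<and> snd ?z <= e k" if "?z \<in># Cs t w"
    using that eM ez by (simp add: Cs_iff[OF w])
   ultimately show ?thesis by auto
  qed
  have zs: "?z \<in> strip \<nu> (a k) (e k)" using pt_space[OF w t g k(1)] eM ez by (simp add: strip_def mem_Times_iff space_mark_time)
  have zM: "?z \<in> space M0" by (rule pt_space[OF w t g k(1)])
  have jz: "jump ?z = (lamh ?d ?x (labs t w k) ?z / lamQ (fst ?z) (snd ?z) - 1) * M k (e k)"
  proof -
   have "h ?z = (lamh ?d ?x (labs t w k) ?z - lamQ (fst ?z) (snd ?z)) * M k (e k)"
    using hk[OF k(2) zs] vM[OF k(2) eM order_refl] ez by simp
   moreover have "jump ?z = h ?z / lamQ (fst ?z) (snd ?z)" using M0_pos(1)[OF zM] by (simp add: h_def)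
   ultimately show ?thesis using M0_pos(1)[OF zM] by (simp add: diff_divide_distrib left_diff_distrib)
  qed
  have "L (e k) w = M k (e k) + (if ?z \<in># Cs t w then jump ?z else 0)"
   using Lpiece[OF k(2) less_imp_le[OF eM] order_refl] unfolding set M_def by simp
  also have "\<dots> = M k (e k) * (case lab t w k of None => 1 | Some d => lamh ?d ?x (labs t w k) ?z / lamQ (fst ?z) (snd ?z))"
   unfolding jz lab_def by (simp add: left_diff_distrib)
  also have "M k (e k) = L (a k) w * Ex ?d ?x (labs t w k) (snd ?z)" using Mexp[OF k(2) less_imp_le[OF eM] order_refl] ez by simp
  also have "L (a k) w = ell ?d ?x (labs t w k)" by (rule Suc(1)[OF k(2)])
  finally show ?case unfolding ez(2) labels.simps ell.simps length_labels .
 qed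
 have en: "e ?n = t" by (simp add: e_def piece_end_def)
 have an: "a ?n <= t" using te(1)[of ?n] en by simp
 have "L t w = M ?n t" by (rule LM) (use an en in auto)
 also have "\<dots> = L (a ?n) w * Ex ?d ?x (labs t w ?n) t" by (rule Mexp) (use an en in auto)
 also have "\<dots> = lk ?d ?x (labs t w ?n) t" using step[of ?n] by (simp add: lk_def)
 finally show ?thesis .
qed

end

section \<open>The explicit filter\<close>

text \<open>Different histories may give the same state, so the weight of a state is a sum over histories.\<close>
lemma sum_weighted_pushforward:
 fixes w :: "'i => real" and g :: "'e state => real"
 assumes J: "finite J"
 shows "weighted_sum (%y. \<Sum>i\<in>J. if G i = y then w i else 0) g = (\<Sum>i\<in>J. g (G i) * w i)"
proof -
 let ?\<phi> = "%y. \<Sum>i\<in>J. if G i = y then w i else 0"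
 have sub: "{y. ?\<phi> y \<noteq> 0} \<subseteq> G ` J"
 proof
  fix y assume y: "y \<in> {y. ?\<phi> y \<noteq> 0}"
  show "y \<in> G ` J"
  proof (rule ccontr)
   assume "y \<notin> G ` J"
   then have "?\<phi> y = 0" by (intro sum.neutral) auto
   then show False using y by simp
  qed
 qed
 have "weighted_sum ?\<phi> g = (\<Sum>y\<in>G ` J. g y * ?\<phi> y)"
  unfolding weighted_sum_def by (rule sum.mono_neutral_left) (use J sub in auto)
 also have "\<dots> = (\<Sum>y\<in>G ` J. \<Sum>i\<in>J. if G i = y then g (G i) * w i else 0)"
  unfolding sum_distrib_left by (intro sum.cong refl) auto
 also have "\<dots> = (\<Sum>i\<in>J. \<Sum>y\<in>G ` J. if G i = y then g (G i) * w i else 0)" by (rule sum.swap)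
 also have "\<dots> = (\<Sum>i\<in>J. g (G i) * w i)"
  using J by (intro sum.cong refl) (simp add: sum.delta)
 finally show ?thesis .
qed

definition hist :: "nat => (bool \<times> bool option list) set" where
 "hist n = UNIV \<times> {ls. length ls = n}"

lemma finite_hist[simp]: "finite (hist n)"
proof -
 have "finite {ls :: bool option list. length ls = n}"
  using finite_lists_length_eq[of "UNIV :: bool option set" n] by simp
 then show ?thesis by (simp add: hist_def)
qed

lemma mem_hist[simp]: "(d0, ls) \<in> hist n \<longleftrightarrow> length ls = n" by (simp add: hist_def)

lemma sum_hist_Suc:
 fixes f :: "bool => bool option list => 'b::comm_monoid_add"
 shows "(\<Sum>(d0, ls)\<in>hist (Suc n). f d0 ls) = (\<Sum>(d0, ls)\<in>hist n. f d0 (None # ls) + f d0 (Some True # ls) + f d0 (Some False # ls))"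
proof -
 have bij: "bij_betw (%((d0, ls), a). (d0, a # ls)) (hist n \<times> UNIV) (hist (Suc n))"
  by (rule bij_betw_byWitness[where f'="%(d0, ls). ((d0, tl ls), hd ls)"]) (auto simp: length_Suc_conv)
 have U: "UNIV = {None, Some True, Some False}" by (auto simp: UNIV_option_conv UNIV_bool)
 have "(\<Sum>(d0, ls)\<in>hist (Suc n). f d0 ls) = (\<Sum>((d0, ls), a)\<in>hist n \<times> UNIV. f d0 (a # ls))"
  by (subst sum.reindex_bij_betw[OF bij, symmetric]) (simp add: case_prod_beta)
 also have "\<dots> = (\<Sum>(d0, ls)\<in>hist n. \<Sum>a\<in>UNIV. f d0 (a # ls))"
  by (simp add: sum.cartesian_product case_prod_beta)
 also have "\<dots> = (\<Sum>(d0, ls)\<in>hist n. f d0 (None # ls) + f d0 (Some True # ls) + f d0 (Some False # ls))"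
  unfolding U by (intro sum.cong refl) (simp add: case_prod_beta add.assoc)
 finally show ?thesis .
qed

context cluster_model
begin

text \<open>The positive function \<open>lamQ\<close> has finite integrals over bounded time intervals; the sets on which it
exceeds \<open>1 / Suc k\<close> therefore have finite measure.\<close>
lemma sigma_finite_M0: "sigma_finite_measure M0"
proof
 let ?A = "%(n::nat, k::nat). {z \<in> space M0. snd z <= real n \<and> 1 / real (Suc k) < lamQ (fst z) (snd z)}"
 have meas: "?A (n, k) \<in> sets M0" for n k unfolding prod.case by measurable
 have fin: "emeasure M0 (?A (n, k)) \<noteq> \<infinity>" for n k
 proof -
  have "emeasure M0 (?A (n, k)) = (\<integral>\<^sup>+z. indicator (?A (n, k)) z \<partial>M0)" using meas by simp
  also have "\<dots> <= (\<integral>\<^sup>+z. ennreal (real (Suc k)) * ((case z of (u, s) => ennreal (lamQ u s)) * indicator (space \<nu> \<times> {0..real n}) z) \<partial>M0)"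
  proof (rule nn_integral_mono)
   fix z assume z: "z \<in> space M0"
   show "indicator (?A (n, k)) z <= ennreal (real (Suc k)) * ((case z of (u, s) => ennreal (lamQ u s)) * indicator (space \<nu> \<times> {0..real n}) z)"
   proof (cases "z \<in> ?A (n, k)")
    case True
    then have "1 <= real (Suc k) * lamQ (fst z) (snd z)" by (simp add: field_simps del: of_nat_Suc)
    then have "(1::ennreal) <= ennreal (real (Suc k) * lamQ (fst z) (snd z))" using ennreal_leI by fastforce
    also have "\<dots> = ennreal (real (Suc k)) * ennreal (lamQ (fst z) (snd z))" by (rule ennreal_mult') simp
    finally show ?thesis using True by (auto simp: indicator_def case_prod_beta space_mark_time mem_Times_iff)
   qed simp
  qed
  also have "\<dots> = ennreal (real (Suc k)) * (\<integral>\<^sup>+z. (case z of (u, s) => ennreal (lamQ u s)) * indicator (space \<nu> \<times> {0..real n}) z \<partial>M0)"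
   by (rule nn_integral_cmult) (simp add: case_prod_beta')
  also have "\<dots> = ennreal (real (Suc k)) * emeasure (density M0 (%(u, s). ennreal (lamQ u s))) (space \<nu> \<times> {0..real n})"
   by (subst emeasure_density) (simp_all add: case_prod_beta')
  also have "\<dots> < \<infinity>" using lamQ_finite[of "real n"] by (simp add: ennreal_mult_less_top)
  finally show ?thesis by simp
 qed
 have cover: "(\<Union>(n, k). ?A (n, k)) = space M0"
 proof (rule equalityI; rule subsetI)
  fix z assume z: "z \<in> space M0"
  obtain n :: nat where "snd z <= real n" using real_arch_simple by blast
  moreover obtain k where "1 / real (Suc k) < lamQ (fst z) (snd z)"
   using M0_pos(1)[OF z] nat_approx_posE[of "lamQ (fst z) (snd z)"] by blast
  ultimately show "z \<in> (\<Union>(n, k). ?A (n, k))" using z by auto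
 qed auto
 show "\<exists>A. countable A \<and> A \<subseteq> sets M0 \<and> \<Union> A = space M0 \<and> (\<forall>a\<in>A. emeasure M0 a \<noteq> \<infinity>)"
 proof (intro exI[of _ "range ?A"] conjI ballI)
  show "\<Union> (range ?A) = space M0" using cover by auto
  show "emeasure M0 a \<noteq> \<infinity>" if "a \<in> range ?A" for a using that fin by auto
  show "range ?A \<subseteq> sets M0" using meas by auto
 qed simp
qed

text \<open>The unnormalised weight of a history at time \<open>t\<close>.\<close>
definition wt :: "bool => (nat => 'e \<times> real) => bool option list => real => real" where
 "wt d0 x ls t = prior d0 x ls * lk d0 x ls t"

text \<open>The weights of the unnormalised filter at time \<open>t\<close> when the observations are \<open>X\<close>, and below \<open>phiS\<close>
as the integral of \<open>g\<close> with respect to them.\<close>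
definition phiX :: "real => ('e \<times> real) multiset => 'e state => real" where
 "phiX t X y = (if good X then \<Sum>(d0, ls)\<in>hist (size X). if Gam d0 (pt X) ls = y then wt d0 (pt X) ls t else 0 else 0)"

definition phiS :: "real => ('e state => real) => ('e \<times> real) multiset => real" where
 "phiS t g X = (if good X then \<Sum>(d0, ls)\<in>hist (size X). g (Gam d0 (pt X) ls) * wt d0 (pt X) ls t else 0)"

lemma weighted_sum_phiX: "weighted_sum (phiX t X) g = phiS t g X"
proof (cases "good X")
 case True
 have "phiX t X = (%y. \<Sum>i\<in>hist (size X). if Gam (fst i) (pt X) (snd i) = y then wt (fst i) (pt X) (snd i) t else 0)"
  using True by (simp add: phiX_def[abs_def] case_prod_beta')
 then show ?thesis
  using True by (simp add: sum_weighted_pushforward[OF finite_hist] phiS_def case_prod_beta')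
next
 case False
 then show ?thesis by (simp add: phiX_def[abs_def] weighted_sum_def phiS_def)
qed

lemma tau_measurable: assumes "k <= n" shows "(%X. tau (pt X) k) \<in> borel_measurable (good_space \<nu> n)"
proof (cases k)
 case (Suc j)
 then show ?thesis using measurable_compose[OF pt_measurable[of j n \<nu>] measurable_snd_mark_time] assms by simp
qed simp

lemma Gam_measurable:
 assumes "length ls <= n" shows "(%X. Gam d0 (pt X) ls) \<in> measurable (good_space \<nu> n) (state_space \<nu>)"
 using assms
proof (induction ls)
 case Nil
 have "(%X. {#(d0, 0::real)#}) \<in> measurable (good_space \<nu> n) (mset_space (count_space UNIV \<Otimes>\<^sub>M restrict_space lborel {0..}))"
  by (rule measurable_single_mset) (simp add: space_pair_measure space_restrict_space)
 then show ?case unfolding state_space_def by (simp add: measurable_Pair measurable_empty_mset)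
next
 case (Cons a ls)
 then have IH: "(%X. Gam d0 (pt X) ls) \<in> measurable (good_space \<nu> n) (state_space \<nu>)" and k: "length ls < n" by simp_all
 show ?case
 proof (cases a)
  case None then show ?thesis using IH by simp
 next
  case (Some d)
  have p: "(%X. pt X (length ls)) \<in> measurable (good_space \<nu> n) M0" by (rule pt_measurable[OF k])
  have "snd \<in> measurable M0 (restrict_space lborel {0..})" by (simp add: mark_time_def)
  from measurable_compose[OF p this]
  have s: "(%X. {#(d, snd (pt X (length ls)))#}) \<in> measurable (good_space \<nu> n) (mset_space (count_space UNIV \<Otimes>\<^sub>M restrict_space lborel {0..}))"
   by (intro measurable_single_mset measurable_Pair) simp_all
  have "(%X. (fst (Gam d0 (pt X) ls) + {#(d, snd (pt X (length ls)))#}, snd (Gam d0 (pt X) ls) + {#pt X (length ls)#})) \<in> measurable (good_space \<nu> n) (state_space \<nu>)"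
   unfolding state_space_def
   by (intro measurable_Pair measurable_plus_mset s measurable_single_mset[OF p]
     measurable_compose[OF IH[unfolded state_space_def] measurable_fst] measurable_compose[OF IH[unfolded state_space_def] measurable_snd])
  then show ?thesis using Some by simp
 qed
qed

lemma lamh_joint_measurable:
 assumes "length ls <= n" shows "(%(X, z). lamh d0 (pt X) ls z) \<in> borel_measurable (good_space \<nu> n \<Otimes>\<^sub>M M0)"
proof -
 have "(%X. snd (Gam d0 (pt X) ls)) \<in> measurable (good_space \<nu> n) S0"
  using measurable_compose[OF Gam_measurable[OF assms, unfolded state_space_def] measurable_snd] .
 then have "(%p. ((fst (snd p), snd (snd p)), (stat d0 ls, snd (Gam d0 (pt (fst p)) ls)))) \<in> measurable (good_space \<nu> n \<Otimes>\<^sub>M M0) (M0 \<Otimes>\<^sub>M (count_space UNIV \<Otimes>\<^sub>M S0))"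
  by (intro measurable_Pair measurable_const measurable_compose[OF measurable_fst]) simp_all
 from measurable_compose[OF this lam_measurable] show ?thesis by (simp add: case_prod_beta' lamh_def)
qed

lemma good_space_pt_space:
 assumes "X \<in> space (good_space \<nu> n)" "k < n" shows "pt X k \<in> space M0"
 using measurable_space[OF pt_measurable[OF assms(2)] assms(1)] .

text \<open>The exponent is a parametric integral, measurable by Fubini; finiteness of the integral of the
non-negative \<open>lamh\<close> decides about the case distinction.\<close>
lemma Ex_measurable:
 assumes ls: "length ls <= n" and b[measurable]: "b \<in> borel_measurable (good_space \<nu> n)"
 shows "(%X. Ex d0 (pt X) ls (b X)) \<in> borel_measurable (good_space \<nu> n)"
proof -
 interpret M0: sigma_finite_measure M0 by (rule sigma_finite_M0)
 let ?a = "%X. tau (pt X) (length ls)"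
 let ?S = "%X. strip \<nu> (?a X) (b X)"
 have a[measurable]: "?a \<in> borel_measurable (good_space \<nu> n)" by (rule tau_measurable[OF ls])
 have x: "\<forall>k<length ls. pt X k \<in> space M0" if "X \<in> space (good_space \<nu> n)" for X
  using good_space_pt_space[OF that] ls by simp
 have a0: "0 <= ?a X" if "X \<in> space (good_space \<nu> n)" for X
  using that ls by (intro tau_nonneg) (auto simp: space_good_space)
 have lj[measurable]: "(%p. lamh d0 (pt (fst p)) ls (snd p)) \<in> borel_measurable (good_space \<nu> n \<Otimes>\<^sub>M M0)"
  using lamh_joint_measurable[OF ls] by (simp add: case_prod_beta')
 define J where "J p = (if ?a (fst p) < snd (snd p) \<and> snd (snd p) <= b (fst p) then 1 else 0 :: real)" for p :: "('e \<times> real) multiset \<times> 'e \<times> real"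
 have Jm[measurable]: "J \<in> borel_measurable (good_space \<nu> n \<Otimes>\<^sub>M M0)" unfolding J_def by measurable
 have ind: "indicator (?S X) z = J (X, z)" if "z \<in> space M0" for X z
  using that by (auto simp: J_def strip_def indicator_def space_mark_time mem_Times_iff)
 have 1: "(%X. \<integral>\<^sup>+z. ennreal (J (X, z)) * ennreal (lamh d0 (pt X) ls z) \<partial>M0) \<in> borel_measurable (good_space \<nu> n)"
  by (rule M0.borel_measurable_nn_integral) (simp add: case_prod_beta')
 have 2: "(%X. LINT z|M0. J (X, z) * (lamh d0 (pt X) ls z - lamQ (fst z) (snd z))) \<in> borel_measurable (good_space \<nu> n)"
  by (rule M0.borel_measurable_lebesgue_integral) (simp add: case_prod_beta')
 have eq: "Ex d0 (pt X) ls (b X) = (if (\<integral>\<^sup>+z. ennreal (J (X, z)) * ennreal (lamh d0 (pt X) ls z) \<partial>M0) < \<infinity>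
   then exp (- (LINT z|M0. J (X, z) * (lamh d0 (pt X) ls z - lamQ (fst z) (snd z)))) else 0)"
  if X: "X \<in> space (good_space \<nu> n)" for X
 proof -
  have "(\<integral>\<^sup>+z. indicator (?S X) z * ennreal (lamh d0 (pt X) ls z) \<partial>M0) = (\<integral>\<^sup>+z. ennreal (J (X, z)) * ennreal (lamh d0 (pt X) ls z) \<partial>M0)"
   by (intro nn_integral_cong) (simp add: ind[symmetric] ennreal_indicator)
  moreover have "(LINT z:?S X|M0. lamh d0 (pt X) ls z - lamQ (fst z) (snd z)) = (LINT z|M0. J (X, z) * (lamh d0 (pt X) ls z - lamQ (fst z) (snd z)))"
   unfolding set_lebesgue_integral_def by (intro Bochner_Integration.integral_cong refl) (simp add: ind)
  moreover have "set_integrable M0 (?S X) (lamh d0 (pt X) ls) \<longleftrightarrow> (\<integral>\<^sup>+z. indicator (?S X) z * ennreal (lamh d0 (pt X) ls z) \<partial>M0) < \<infinity>"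
   by (rule set_integrable_nonneg_iff[OF lamh_measurable[OF x[OF X]] lamh_nonneg a0[OF X]])
  ultimately show ?thesis unfolding Ex_def by (simp only:)
 qed
 show ?thesis using 1 2 by (subst measurable_cong[OF eq]) auto
qed

lemma lamh_pt_measurable:
 assumes "length ls < n" shows "(%X. lamh d0 (pt X) ls (pt X (length ls))) \<in> borel_measurable (good_space \<nu> n)"
proof -
 have "(%X. (X, pt X (length ls))) \<in> measurable (good_space \<nu> n) (good_space \<nu> n \<Otimes>\<^sub>M M0)"
  by (intro measurable_Pair pt_measurable assms) simp
 from measurable_compose[OF this lamh_joint_measurable] show ?thesis using assms by simp
qed

lemma ell_measurable: "length ls <= n ==> (%X. ell d0 (pt X) ls) \<in> borel_measurable (good_space \<nu> n)"
proof (induction ls)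
 case (Cons a ls)
 then have k: "length ls < n" by simp
 note p = pt_measurable[OF k, of \<nu>]
 have [measurable]: "(%X. ell d0 (pt X) ls) \<in> borel_measurable (good_space \<nu> n)" using Cons by simp
 have [measurable]: "(%X. Ex d0 (pt X) ls (snd (pt X (length ls)))) \<in> borel_measurable (good_space \<nu> n)"
  by (rule Ex_measurable) (use k measurable_compose[OF p measurable_snd_mark_time] in simp_all)
 have [measurable]: "(%X. lamQ (fst (pt X (length ls))) (snd (pt X (length ls)))) \<in> borel_measurable (good_space \<nu> n)"
  using measurable_compose[OF p lamQ_meas] .
 note [measurable] = lamh_pt_measurable[OF k]
 show ?case by (cases a) simp_all
qed simp

lemma prior_measurable: "length ls <= n ==> (%X. prior d0 (pt X) ls) \<in> borel_measurable (good_space \<nu> n)"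
proof (induction ls)
 case (Cons a ls)
 then have k: "length ls < n" by simp
 have [measurable]: "(%X. rr b (pt X (length ls))) \<in> borel_measurable (good_space \<nu> n)" for b
  using measurable_compose[OF pt_measurable[OF k] rr_measurable] .
 show ?case using Cons by (cases a) simp_all
qed simp

lemma lk_measurable: "length ls <= n ==> (%X. lk d0 (pt X) ls t) \<in> borel_measurable (good_space \<nu> n)"
 unfolding lk_def using Ex_measurable[of ls n "%_. t"] ell_measurable by simp

lemma phiS_measurable:
 assumes g[measurable]: "g \<in> borel_measurable (state_space \<nu>)"
 shows "phiS t g \<in> borel_measurable S0"
proof -
 define f where "f n X = (if good X \<and> size X = n then \<Sum>(d0, ls)\<in>hist n. g (Gam d0 (pt X) ls) * wt d0 (pt X) ls t else 0)" for n X
 have fm: "f n \<in> borel_measurable S0" for n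
  unfolding f_def
 proof (rule borel_measurable_good_space)
  show "(%X. \<Sum>(d0, ls)\<in>hist n. g (Gam d0 (pt X) ls) * wt d0 (pt X) ls t) \<in> borel_measurable (good_space \<nu> n)"
  proof (rule borel_measurable_sum, safe)
   fix d0 ls assume "(d0, ls) \<in> hist n"
   then have ls: "length ls <= n" by simp
   show "(%X. g (Gam d0 (pt X) ls) * wt d0 (pt X) ls t) \<in> borel_measurable (good_space \<nu> n)"
    unfolding wt_def using measurable_compose[OF Gam_measurable[OF ls] g] prior_measurable[OF ls] lk_measurable[OF ls] by simp
  qed
 qed
 have "(%X. f (size X) X) \<in> borel_measurable S0"
  by (rule measurable_compose_countable[OF fm]) simp
 moreover have "(%X. f (size X) X) = phiS t g" by (simp add: f_def phiS_def fun_eq_iff)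
 ultimately show ?thesis by simp
qed

end

subsection \<open>Measurability of the hidden state\<close>

lemma tendsto_bool_eventually:
 fixes f :: "'a => bool" assumes "(f \<longlongrightarrow> b) F" shows "eventually (%x. f x = b) F"
proof (cases b)
 case True
 from order_tendstoD(1)[OF assms, of False] show ?thesis using True by simp
next
 case False
 from order_tendstoD(2)[OF assms, of True] show ?thesis using False by simp
qed

lemma labels_eq_iff: "labels f (length ls) = ls \<longleftrightarrow> (\<forall>j<length ls. f j = rev ls ! j)"
proof (induction ls)
 case (Cons a ls)
 have "(\<forall>j<length (a # ls). f j = rev (a # ls) ! j) \<longleftrightarrow> f (length ls) = a \<and> (\<forall>j<length ls. f j = rev ls ! j)"
  by (auto simp: All_less_Suc nth_append)
 then show ?case using Cons by simp
qed simp

context cluster_model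
begin

abbreviation XX :: "real => 'w => 'e state" where
 "XX t w \<equiv> state_at (%r. D r w) (C w) t"

abbreviation GG :: "real => 'w measure" where
 "GG t \<equiv> obs_sigma (space Q) \<nu> Y t"

text \<open>Right-continuity: evaluate \<open>D\<close> at the next point of a grid of mesh \<open>1 / Suc n\<close>, capped at \<open>t\<close> so that
only information available at time \<open>t\<close> is used.\<close>
lemma D_joint_measurable:
 assumes t: "0 <= t"
 shows "Measurable.pred (M0 \<Otimes>\<^sub>M F t) (%p. D (min (snd (fst p)) t) (snd p))"
proof -
 \<comment> \<open>the next grid point strictly after \<open>s\<close>\<close>
 let ?r = "%n p. (real_of_int \<lfloor>real (Suc n) * snd (fst p)\<rfloor> + 1) / real (Suc n)"
 have Dm: "(%p. of_bool (D r (snd p)) :: real) \<in> borel_measurable (M0 \<Otimes>\<^sub>M F t)" if "0 <= r" "r <= t" for r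
 proof -
  have "D r \<in> measurable (F t) (count_space UNIV)" by (rule measurable_mono_F[OF that D_adapted[OF that(1)]])
  from measurable_compose[OF measurable_compose[OF measurable_snd this], of "of_bool :: bool => real" borel]
  show ?thesis by simp
 qed
 have lim: "(%p. of_bool (D (min (snd (fst p)) t) (snd p)) :: real) \<in> borel_measurable (M0 \<Otimes>\<^sub>M F t)"
 proof (rule borel_measurable_LIMSEQ_real)
  fix n
  have fl: "(%p. \<lfloor>real (Suc n) * snd (fst p)\<rfloor>) \<in> measurable (M0 \<Otimes>\<^sub>M F t) (count_space UNIV)" by measurable
  show "(%p. of_bool (D (max 0 (min (?r n p) t)) (snd p)) :: real) \<in> borel_measurable (M0 \<Otimes>\<^sub>M F t)"
   by (rule measurable_compose_countable[OF _ fl, of "%i p. of_bool (D (max 0 (min ((real_of_int i + 1) / real (Suc n)) t)) (snd p))"])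
     (rule Dm, use t in auto)
 next
  fix p assume p: "p \<in> space (M0 \<Otimes>\<^sub>M F t)"
  define s where "s = snd (fst p)"
  have "fst p \<in> space M0" by (rule measurable_space[OF measurable_fst p])
  then have s: "0 <= s" unfolding s_def space_mark_time by (simp add: mem_Times_iff)
  have "snd p \<in> space (F t)" by (rule measurable_space[OF measurable_snd p])
  then have w: "snd p \<in> space Q" unfolding space_F[OF t] .
  have r1: "s < ?r n p" for n
  proof -
   have "real (Suc n) * s < real_of_int \<lfloor>real (Suc n) * s\<rfloor> + 1" by linarith
   then show ?thesis by (simp add: s_def less_divide_eq mult.commute del: of_nat_Suc)
  qed
  have r2: "?r n p <= s + 1 / real (Suc n)" for n
  proof -
   have "real_of_int \<lfloor>real (Suc n) * s\<rfloor> + 1 <= real (Suc n) * s + 1" by linarith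
   then have "?r n p <= (real (Suc n) * s + 1) / real (Suc n)" unfolding s_def by (intro divide_right_mono) auto
   also have "\<dots> = s + 1 / real (Suc n)" by (simp add: field_simps)
   finally show ?thesis .
  qed
  have "eventually (%n. D (max 0 (min (?r n p) t)) (snd p) = D (min s t) (snd p)) sequentially"
  proof (cases "s < t")
   case True
   have "(%n. ?r n p) \<longlonglongrightarrow> s"
   proof (rule tendsto_sandwich)
    show "eventually (%n. s <= ?r n p) sequentially" using r1 less_imp_le by (intro always_eventually) blast
    show "eventually (%n. ?r n p <= s + 1 / real (Suc n)) sequentially" using r2 by (intro always_eventually) blast
    show "(%n. s + 1 / real (Suc n)) \<longlonglongrightarrow> s"
     using tendsto_add[OF tendsto_const[of s] LIMSEQ_inverse_real_of_nat] by (simp add: inverse_eq_divide)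
   qed simp
   note conv = this
   have ev: "eventually (%n. ?r n p < t) sequentially" by (rule order_tendstoD(2)[OF conv True])
   have "?r n p \<in> {s<..} \<and> ?r n p \<noteq> s" for n using r1[of n] by (metis greaterThan_iff less_irrefl)
   then have "eventually (%n. ?r n p \<in> {s<..} \<and> ?r n p \<noteq> s) sequentially" by (intro always_eventually allI)
   then have lims: "filterlim (%n. ?r n p) (at_right s) sequentially"
    unfolding filterlim_at using conv by (rule conjI)
   have "((%r. D r (snd p)) \<longlongrightarrow> D s (snd p)) (at_right s)" using D_cadlag[OF w] s unfolding cadlag_def by blast
   from tendsto_bool_eventually[OF filterlim_compose[OF this lims]] ev
   show ?thesis
   proof eventually_elim
    case (elim n)
    have "max 0 (min (?r n p) t) = ?r n p" using elim(2) r1[of n] s by simp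
    moreover have "min s t = s" using True by simp
    ultimately show ?case using elim(1) by simp
   qed
  next
   case False
   have "max 0 (min (?r n p) t) = t" for n using r1[of n] False t by (simp add: min_def max_def)
   moreover have "min s t = t" using False by simp
   ultimately show ?thesis by simp
  qed
  then have "eventually (%n. of_bool (D (max 0 (min (?r n p) t)) (snd p)) = (of_bool (D (min (snd (fst p)) t) (snd p)) :: real)) sequentially"
   by eventually_elim (simp add: s_def)
  then show "(%n. of_bool (D (max 0 (min (?r n p) t)) (snd p)) :: real) \<longlonglongrightarrow> of_bool (D (min (snd (fst p)) t) (snd p))"
   by (rule tendsto_eventually)
 qed
 have eq: "(%p. D (min (snd (fst p)) t) (snd p)) = (%p. (of_bool (D (min (snd (fst p)) t) (snd p)) :: real) \<in> {1})" by auto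
 have "Measurable.pred (M0 \<Otimes>\<^sub>M F t) (%p. (of_bool (D (min (snd (fst p)) t) (snd p)) :: real) \<in> {1})"
  by (rule pred_sets1[OF _ lim]) simp
 then show ?thesis by (simp only: eq[symmetric])
qed

text \<open>With respect to \<open>F t\<close>, because \<open>P\<close> is given by a density on these sigma-algebras only.\<close>
lemma state_measurable_F:
 assumes t: "0 <= t" shows "XX t \<in> measurable (F t) (state_space \<nu>)"
proof -
 note Cm = Cs_measurable_F[OF t]
 have D0: "D 0 \<in> measurable (F t) (count_space UNIV)" by (rule measurable_mono_F[OF order_refl t D_adapted[OF order_refl]])
 have s: "snd \<in> measurable M0 (restrict_space lborel {0..})" by (simp add: mark_time_def)
 have "(%(x, w). (D (min (snd x) t) w, snd x)) \<in> measurable (M0 \<Otimes>\<^sub>M F t) (count_space UNIV \<Otimes>\<^sub>M restrict_space lborel {0..})"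
  unfolding case_prod_beta'
  by (intro measurable_Pair D_joint_measurable[OF t] measurable_compose[OF measurable_fst s])
 then have im: "(%w. image_mset (%x. (D (min (snd x) t) w, snd x)) (Cs t w)) \<in> measurable (F t) (mset_space (count_space UNIV \<Otimes>\<^sub>M restrict_space lborel {0..}))"
  by (rule measurable_image_mset[OF Cm])
 have eq: "image_mset (%x. (D (snd x) w, snd x)) (Cs t w) = image_mset (%x. (D (min (snd x) t) w, snd x)) (Cs t w)"
  if "w \<in> space (F t)" for w
  by (rule image_mset_cong) (use that space_F[OF t] Cs_iff in \<open>auto simp: min_def\<close>)
 have "(%w. image_mset (%x. (D (snd x) w, snd x)) (Cs t w)) \<in> measurable (F t) (mset_space (count_space UNIV \<Otimes>\<^sub>M restrict_space lborel {0..}))"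
  using im by (subst measurable_cong[OF eq])
 note 1 = this
 have 2: "(%w. (D 0 w, 0::real)) \<in> measurable (F t) (count_space UNIV \<Otimes>\<^sub>M restrict_space lborel {0..})"
  by (intro measurable_Pair D0) (simp add: space_restrict_space)
 show ?thesis
  unfolding state_at_def state_space_def by (rule measurable_Pair[OF measurable_add_mset[OF 2 1] Cm])
qed

lemma state_measurable_Q: "0 <= t ==> XX t \<in> measurable Q (state_space \<nu>)"
 using state_measurable_F measurable_from_subalg[OF subalgebra_F] by blast

lemma GG_Pow: "{{w\<in>space Q. size {#x \<in># Y s w. fst x \<in> A#} = n} | A s n. A \<in> sets \<nu> \<and> 0 <= s \<and> s <= t} \<subseteq> Pow (space Q)"
 by auto

lemma space_GG[simp]: "space (GG t) = space Q"
 unfolding obs_sigma_def by (rule space_measure_of[OF GG_Pow])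

lemma sets_GG: "sets (GG t) = sigma_sets (space Q) {{w\<in>space Q. size {#x \<in># Y s w. fst x \<in> A#} = n} | A s n. A \<in> sets \<nu> \<and> 0 <= s \<and> s <= t}"
 unfolding obs_sigma_def by (rule sets_measure_of[OF GG_Pow])

lemma Y_space: "w \<in> space Q ==> 0 <= t ==> set_mset (Y t w) \<subseteq> space M0"
 using measurable_space[OF Y_measurable] by (auto simp: space_mset_space)

lemma Y_measurable_G:
 assumes t: "0 <= t" shows "Y t \<in> measurable (GG t) S0"
proof (rule measurable_mset_mark_timeI)
 have gen: "(%w. size {#x \<in># Y s w. fst x \<in> A#}) \<in> measurable (GG t) (count_space UNIV)" if "A \<in> sets \<nu>" "0 <= s" "s <= t" for A s
 proof (rule measurable_count_space_eq2_countable[THEN iffD2], safe)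
  fix n
  have "(%w. size {#x \<in># Y s w. fst x \<in> A#}) -` {n} \<inter> space (GG t) = {w\<in>space Q. size {#x \<in># Y s w. fst x \<in> A#} = n}" by auto
  also have "\<dots> \<in> sets (GG t)" unfolding sets_GG using that by (intro sigma_sets.Basic) blast
  finally show "(%w. size {#x \<in># Y s w. fst x \<in> A#}) -` {n} \<inter> space (GG t) \<in> sets (GG t)" .
 qed auto
 show "set_mset (Y t w) \<subseteq> space M0" if "w \<in> space (GG t)" for w using Y_space[of w t] that t by simp
 show "(%w. size {#x \<in># Y t w. x \<in> A \<times> {0..s}#}) \<in> measurable (GG t) (count_space UNIV)" if A: "A \<in> sets \<nu>" and s: "0 <= s" for A s
 proof -
  have eq: "size {#x \<in># Y t w. x \<in> A \<times> {0..s}#} = size {#x \<in># Y (min s t) w. fst x \<in> A#}" if w: "w \<in> space (GG t)" for w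
  proof -
   have w': "w \<in> space Q" using w by simp
   have "snd x <= t \<and> 0 <= snd x" if x: "x \<in># Y t w" for x
   proof
    have "x \<in> space M0" using x Y_space[OF w' t] by blast
    then show "0 <= snd x" by (simp add: space_mark_time mem_Times_iff)
    show "snd x <= t" using x C_locally_finite[OF w'] N_locally_finite[OF w'] by (auto simp: obs_def points_upto_def)
   qed
   then have "{#x \<in># Y t w. x \<in> A \<times> {0..s}#} = {#x \<in># Y t w. snd x <= min s t \<and> fst x \<in> A#}"
    by (intro filter_mset_cong refl) (auto simp: mem_Times_iff)
   also have "\<dots> = {#x \<in># Y (min s t) w. fst x \<in> A#}"
    unfolding Y_upto(1)[OF w' min.cobounded2] filter_filter_mset by (rule filter_mset_cong) auto
   finally show ?thesis by simp
  qed
  show ?thesis by (subst measurable_cong[OF eq]) (use gen[OF A, of "min s t"] s t in auto)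
 qed
 have eq: "size (Y t w) = size {#x \<in># Y t w. fst x \<in> space \<nu>#}" if "w \<in> space (GG t)" for w
 proof -
  have "{#x \<in># Y t w. fst x \<in> space \<nu>#} = {#x \<in># Y t w. True#}"
   by (rule filter_mset_cong) (use Y_space[of w t] that t in \<open>auto simp: space_mark_time\<close>)
  then show ?thesis by simp
 qed
 show "(%w. size (Y t w)) \<in> measurable (GG t) (count_space UNIV)"
  by (subst measurable_cong[OF eq]) (use gen[of "space \<nu>" t] t in auto)
qed

text \<open>The observations up to \<open>t\<close> are functions of the configuration at time \<open>t\<close>, by deleting later points.\<close>
lemma sets_GG_vimage:
 assumes t: "0 <= t" and H: "H \<in> sets (GG t)" shows "\<exists>B\<in>sets S0. H = Y t -` B \<inter> space Q"
proof -
 have "sets (GG t) \<subseteq> sets (vimage_algebra (space Q) (Y t) S0)"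
  unfolding sets_GG
 proof (rule sets.sigma_sets_subset[of _ "vimage_algebra (space Q) (Y t) S0", simplified])
  show "{{w\<in>space Q. size {#x \<in># Y s w. fst x \<in> A#} = n} | A s n. A \<in> sets \<nu> \<and> 0 <= s \<and> s <= t} \<subseteq> sets (vimage_algebra (space Q) (Y t) S0)"
  proof safe
   fix A s n assume A: "A \<in> sets \<nu>" and s: "0 <= s" "s <= t"
   have m: "(%X. size {#x \<in># X. snd x <= s \<and> fst x \<in> A#}) \<in> measurable S0 (count_space UNIV)"
    by (rule measurable_size_filter_mset_param[where M=M0]) (use A in measurable)
   let ?B = "(%X. size {#x \<in># X. snd x <= s \<and> fst x \<in> A#}) -` {n} \<inter> space S0"
   have B: "?B \<in> sets S0" by (rule measurable_sets[OF m]) simp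
   have "{w\<in>space Q. size {#x \<in># Y s w. fst x \<in> A#} = n} = Y t -` ?B \<inter> space Q"
   proof (rule set_eqI)
    fix w
    show "w \<in> {w\<in>space Q. size {#x \<in># Y s w. fst x \<in> A#} = n} \<longleftrightarrow> w \<in> Y t -` ?B \<inter> space Q"
    proof (cases "w \<in> space Q")
     case True
     have "{#x \<in># Y s w. fst x \<in> A#} = {#x \<in># Y t w. snd x <= s \<and> fst x \<in> A#}"
      unfolding Y_upto(1)[OF True s(2)] filter_filter_mset by (rule refl)
     then show ?thesis using True measurable_space[OF Y_measurable[OF t] True] by simp
    qed simp
   qed
   then show "{w\<in>space Q. size {#x \<in># Y s w. fst x \<in> A#} = n} \<in> sets (vimage_algebra (space Q) (Y t) S0)"
    using in_vimage_algebra[OF B, of "Y t" "space Q"] by simp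
  qed
 qed
 then have "H \<in> sets (vimage_algebra (space Q) (Y t) S0)" using H by blast
 moreover have "Y t \<in> space Q \<rightarrow> space S0" using measurable_space[OF Y_measurable[OF t]] by auto
 ultimately show ?thesis by (auto simp: sets_vimage_algebra2)
qed

lemma Y_measurable_F: "0 <= t ==> Y t \<in> measurable (F t) S0"
 unfolding obs_def by (intro measurable_plus_mset Ns_measurable_F Cs_measurable_F)

lemma sets_GG_F: assumes t: "0 <= t" shows "sets (GG t) \<subseteq> sets (F t)"
proof
 fix H assume "H \<in> sets (GG t)"
 then obtain B where "B \<in> sets S0" "H = Y t -` B \<inter> space Q" using sets_GG_vimage[OF t] by blast
 then show "H \<in> sets (F t)" using measurable_sets[OF Y_measurable_F[OF t]] space_F[OF t] by simp
qed

lemma subalgebra_GG: "0 <= t ==> subalgebra Q (GG t)"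
 using sets_GG_F sets_F by (auto simp: subalgebra_def)

subsection \<open>The filter under the reference measure\<close>

lemma label_event_measurable:
 assumes t: "0 <= t" shows "Measurable.pred Q (label_event t d0 ls)"
proof -
 note Ym[measurable] = Y_measurable[OF t]
 note Cm = Cs_measurable[OF t]
 have D0[measurable]: "Measurable.pred Q (D 0)"
  using measurable_from_subalg[OF subalgebra_F[OF order_refl] D_adapted[OF order_refl]] by simp
 let ?n = "length ls"
 have Dj[measurable]: "Measurable.pred (M0 \<Otimes>\<^sub>M Q) (%p. D (min (snd (fst p)) t) (snd p))"
 proof -
  have "(%w. w) \<in> measurable Q (F t)"
   using measurable_from_subalg[OF subalgebra_F[OF t] measurable_ident] by (simp add: id_def)
  then have "(%p. (fst p, snd p)) \<in> measurable (M0 \<Otimes>\<^sub>M Q) (M0 \<Otimes>\<^sub>M F t)"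
   by (intro measurable_Pair measurable_fst measurable_compose[OF measurable_snd])
  from measurable_compose[OF this D_joint_measurable[OF t]] show ?thesis by simp
 qed
 have rk[measurable]: "(%p. time_rank (Y t (snd p)) (fst p)) \<in> measurable (M0 \<Otimes>\<^sub>M Q) (count_space UNIV)"
  by (rule measurable_rank_snd[OF measurable_compose[OF measurable_snd Ym]]) simp
 define A where "A k a w = (case a of None => size {#x \<in># Cs t w. time_rank (Y t w) x = k#} = 0
   | Some d => 0 < size {#x \<in># Cs t w. time_rank (Y t w) x = k \<and> D (min (snd x) t) w = d#})" for k a w
 have Am: "Measurable.pred Q (A k a)" for k a
 proof (cases a)
  case None
  have [measurable]: "(%w. size {#x \<in># Cs t w. time_rank (Y t w) x = k#}) \<in> measurable Q (count_space UNIV)"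
   by (rule measurable_size_filter_mset_param[OF Cm]) (simp add: case_prod_beta')
  show ?thesis unfolding A_def[abs_def] None option.case by measurable
 next
  case (Some d)
  have [measurable]: "(%w. size {#x \<in># Cs t w. time_rank (Y t w) x = k \<and> D (min (snd x) t) w = d#}) \<in> measurable Q (count_space UNIV)"
   by (rule measurable_size_filter_mset_param[OF Cm]) (simp add: case_prod_beta')
  show ?thesis unfolding A_def[abs_def] Some option.case by measurable
 qed
 have iff: "label_event t d0 ls w \<longleftrightarrow> has_pts t ?n w \<and> D 0 w = d0 \<and> (\<forall>k\<in>{..<?n}. A k (rev ls ! k) w)"
  if w: "w \<in> space Q" for w
 proof (cases "has_pts t ?n w")
  case True
  have "lab t w k = a \<longleftrightarrow> A k a w" if k: "k < ?n" for k a
  proof -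
   have k': "k < size (Y t w)" and g: "good (Y t w)" using True k by simp_all
   have min: "min (snd (pt (Y t w) k)) t = snd (pt (Y t w) k)" using pt_le_horizon[OF w g k'] by simp
   have "{#x \<in># Cs t w. time_rank (Y t w) x = k \<and> D (min (snd x) t) w = d#} = {#x \<in># {#x \<in># Cs t w. time_rank (Y t w) x = k#}. D (min (snd x) t) w = d#}" for d
    by (simp add: filter_filter_mset)
   then show ?thesis
    unfolding A_def lab_def filter_rank_subset[OF g k' Cs_sub_Y] by (cases a) (auto simp: min filter_rank_subset[OF g k' Cs_sub_Y])
  qed
  then show ?thesis using True by (auto simp: label_event_def labels_eq_iff)
 next
  case False
  then show ?thesis by (auto simp: label_event_def)
 qed
 have "Measurable.pred Q (%w. has_pts t ?n w \<and> D 0 w = d0 \<and> (\<forall>k\<in>{..<?n}. A k (rev ls ! k) w))"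
  using Am by measurable
 then show ?thesis using iff by (subst measurable_cong) auto
qed

lemma AE_paths: "AE w in Q. lamint_path w \<and> Leq_path w"
 using lam_integrable L_equation unfolding lamint_path_def Leq_path_def by eventually_elim simp

lemma phiS_nonneg:
 assumes "\<And>y. 0 <= g y" and X: "X \<in> space S0" shows "0 <= phiS t g X"
proof (cases "good X")
 case True
 have x: "pt X k \<in> space M0" if "k < size X" for k
  using pt_in(1)[OF True that] X by (auto simp: space_mset_space)
 have pr: "0 <= prior d0 (pt X) ls" if "length ls <= size X" for d0 ls
  using that
 proof (induction ls)
  case (Cons a ls)
  then show ?case using rr_nonneg[OF x, of "length ls"] tr_nonneg
   by (auto split: option.split intro!: mult_nonneg_nonneg)
 qed (simp add: pD_nonneg)
 have "0 <= g (Gam d0 (pt X) ls) * wt d0 (pt X) ls t" if "length ls = size X" for d0 ls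
  unfolding wt_def using assms(1) pr[of ls d0] lk_nonneg[of ls "pt X" d0 t] x that by (intro mult_nonneg_nonneg) auto
 then show ?thesis using True unfolding phiS_def by (auto intro!: sum_nonneg)
qed (simp add: phiS_def)

text \<open>Split according to the number of observed points and to the true history.  On each part \<open>L\<close> and the
state are functions of the observations, so the law of the labels applies.\<close>
lemma nn_filter_Q:
 assumes t: "0 <= t" and g[measurable]: "g \<in> borel_measurable (state_space \<nu>)" and g0: "\<And>y. 0 <= g y" and B[measurable]: "B \<in> sets S0"
 shows "(\<integral>\<^sup>+w. indicator B (Y t w) * ennreal (g (XX t w) * L t w) \<partial>Q)
  = (\<integral>\<^sup>+w. indicator B (Y t w) * ennreal (phiS t g (Y t w)) \<partial>Q)"
proof -
 \<comment> \<open>the integrand as a function of the observations if \<open>d0, ls\<close> is the true history\<close>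
 let ?K = "%n d0 ls X. if good X \<and> size X = n then ennreal (indicator B X * (g (Gam d0 (pt X) ls) * lk d0 (pt X) ls t)) else 0"
 have Km: "?K n d0 ls \<in> borel_measurable S0" if ls: "length ls <= n" for n d0 ls
 proof (rule borel_measurable_good_space)
  have "(%X. indicator B X :: real) \<in> borel_measurable (good_space \<nu> n)" by (rule measurable_good_space1) simp
  then show "(%X. ennreal (indicator B X * (g (Gam d0 (pt X) ls) * lk d0 (pt X) ls t))) \<in> borel_measurable (good_space \<nu> n)"
   using measurable_compose[OF Gam_measurable[OF ls] g] lk_measurable[OF ls] by simp
 qed
 let ?f = "%w. indicator B (Y t w) * ennreal (g (XX t w) * L t w)"
 let ?h = "%w. indicator B (Y t w) * ennreal (phiS t g (Y t w))"
 note Ym[measurable] = Y_measurable[OF t]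
 have Lm[measurable]: "L t \<in> borel_measurable Q"
  using L_martingale t measurable_from_subalg[OF subalgebra_F[OF t]] by (auto simp: martingale_def)
 note Xm[measurable] = state_measurable_Q[OF t]
 note pm[measurable] = phiS_measurable[OF g, of t]
 have fm: "?f \<in> borel_measurable Q" by measurable
 have hm: "?h \<in> borel_measurable Q" by measurable
 have split: "(\<integral>\<^sup>+w. u w \<partial>Q) = (\<Sum>n. \<integral>\<^sup>+w. (if has_pts t n w then u w else 0) \<partial>Q)"
  if [measurable]: "u \<in> borel_measurable Q" for u :: "'w => ennreal"
 proof -
  have "(\<integral>\<^sup>+w. u w \<partial>Q) = (\<integral>\<^sup>+w. (\<Sum>n. if has_pts t n w then u w else 0) \<partial>Q)"
  proof (rule nn_integral_cong_AE)
   show "AE w in Q. u w = (\<Sum>n. if has_pts t n w then u w else 0)"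
    using AE_good[OF t]
   proof eventually_elim
    case (elim w)
    have "(\<Sum>n. if has_pts t n w then u w else 0) = (\<Sum>n\<in>{size (Y t w)}. if has_pts t n w then u w else 0)"
     by (rule suminf_finite) auto
    then show ?case using elim by simp
   qed
  qed
  also have "\<dots> = (\<Sum>n. \<integral>\<^sup>+w. (if has_pts t n w then u w else 0) \<partial>Q)"
   by (rule nn_integral_suminf) measurable
  finally show ?thesis .
 qed
 have piece: "(\<integral>\<^sup>+w. (if has_pts t n w then ?f w else 0) \<partial>Q)
   = (\<integral>\<^sup>+w. (if has_pts t n w then ?h w else 0) \<partial>Q)" for n
 proof -
  have lem: "(\<integral>\<^sup>+w. (if label_event t d0 ls w then ?K n d0 ls (Y t w) else 0) \<partial>Q)
   = (\<integral>\<^sup>+w. (if has_pts t n w then ennreal (prior d0 (pt (Y t w)) ls) * ?K n d0 ls (Y t w) else 0) \<partial>Q)"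
   if "length ls = n" for d0 ls
   using label_law[OF t Km[of ls n d0], of d0 ls] that by simp
  have lm: "(%w. if label_event t d0 ls w then ?K n d0 ls (Y t w) else 0) \<in> borel_measurable Q" if ls: "length ls = n" for d0 ls
  proof -
   have le: "Measurable.pred Q (label_event t d0 ls)" by (rule label_event_measurable[OF t])
   have [measurable]: "(%w. ?K n d0 ls (Y t w)) \<in> borel_measurable Q"
    by (rule measurable_compose[OF Ym Km]) (use ls in simp)
   show ?thesis by (rule measurable_If[OF _ measurable_const]) (fact, simp, use le in \<open>simp only: pred_def\<close>)
  qed
  have "(\<integral>\<^sup>+w. (if has_pts t n w then ?f w else 0) \<partial>Q)
   = (\<integral>\<^sup>+w. (\<Sum>(d0, ls)\<in>hist n. if label_event t d0 ls w then ?K n d0 ls (Y t w) else 0) \<partial>Q)"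
  proof (rule nn_integral_cong_AE)
   show "AE w in Q. (if has_pts t n w then ?f w else 0) = (\<Sum>(d0, ls)\<in>hist n. if label_event t d0 ls w then ?K n d0 ls (Y t w) else 0)"
    using AE_paths
   proof (rule AE_mp, intro AE_I2 impI)
    fix w assume w: "w \<in> space Q" and path: "lamint_path w \<and> Leq_path w"
    show "(if has_pts t n w then ?f w else 0) = (\<Sum>(d0, ls)\<in>hist n. if label_event t d0 ls w then ?K n d0 ls (Y t w) else 0)"
    proof (cases "has_pts t n w")
     case True
     let ?l = "(D 0 w, labs t w n)"
     have ev: "label_event t d0 ls w \<longleftrightarrow> (d0, ls) = ?l" if "length ls = n" for d0 ls
      using True that by (auto simp: label_event_def)
     have "(\<Sum>(d0, ls)\<in>hist n. if label_event t d0 ls w then ?K n d0 ls (Y t w) else 0)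
      = (\<Sum>l\<in>hist n. if l = ?l then ?K n (fst l) (snd l) (Y t w) else 0)"
     proof (rule sum.cong[OF refl])
      fix l assume "l \<in> hist n"
      then have "length (snd l) = n" by (auto simp: hist_def)
      from ev[OF this, of "fst l"] show "(case l of (d0, ls) => if label_event t d0 ls w then ?K n d0 ls (Y t w) else 0) = (if l = ?l then ?K n (fst l) (snd l) (Y t w) else 0)"
       by (simp only: case_prod_beta prod.collapse)
     qed
     also have "\<dots> = ?K n (D 0 w) (labs t w n) (Y t w)" by (subst sum.delta) simp_all
     also have "\<dots> = ?f w"
     proof -
      have "L t w = lk (D 0 w) (pt (Y t w)) (labs t w n) t" using L_path[OF w t _ conjunct1[OF path] conjunct2[OF path]] True by simp
      moreover have "XX t w = Gam (D 0 w) (pt (Y t w)) (labs t w n)" using state_at_eq_Gam[OF w _ order_refl] True by simp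
      ultimately show ?thesis using True by (simp add: indicator_def)
     qed
     finally show ?thesis using True by simp
    next
     case False
     have "(\<Sum>(d0, ls)\<in>hist n. if label_event t d0 ls w then ?K n d0 ls (Y t w) else 0) = 0"
     proof (rule sum.neutral, rule ballI)
      fix l assume "l \<in> hist n"
      then have "length (snd l) = n" by (auto simp: hist_def)
      then have "\<not> label_event t (fst l) (snd l) w" using False unfolding label_event_def by auto
      then show "(case l of (d0, ls) => if label_event t d0 ls w then ?K n d0 ls (Y t w) else 0) = 0"
       by (simp only: case_prod_beta if_False)
     qed
     then show ?thesis unfolding if_not_P[OF False] by simp
    qed
   qed
  qed
  also have "\<dots> = (\<Sum>(d0, ls)\<in>hist n. \<integral>\<^sup>+w. (if label_event t d0 ls w then ?K n d0 ls (Y t w) else 0) \<partial>Q)"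
   unfolding case_prod_beta' by (rule nn_integral_sum, rule lm, simp add: hist_def mem_Times_iff)
  also have "\<dots> = (\<Sum>(d0, ls)\<in>hist n. \<integral>\<^sup>+w. (if has_pts t n w then ennreal (prior d0 (pt (Y t w)) ls) * ?K n d0 ls (Y t w) else 0) \<partial>Q)"
  proof (rule sum.cong[OF refl])
   fix l assume "l \<in> hist n"
   then have "length (snd l) = n" by (auto simp: hist_def)
   from lem[OF this, of "fst l"] show "(case l of (d0, ls) => \<integral>\<^sup>+w. (if label_event t d0 ls w then ?K n d0 ls (Y t w) else 0) \<partial>Q)
    = (case l of (d0, ls) => \<integral>\<^sup>+w. (if has_pts t n w then ennreal (prior d0 (pt (Y t w)) ls) * ?K n d0 ls (Y t w) else 0) \<partial>Q)"
    by (simp only: case_prod_beta)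
  qed
  also have "\<dots> = (\<integral>\<^sup>+w. (\<Sum>(d0, ls)\<in>hist n. if has_pts t n w then ennreal (prior d0 (pt (Y t w)) ls) * ?K n d0 ls (Y t w) else 0) \<partial>Q)"
   unfolding case_prod_beta'
  proof (rule nn_integral_sum[symmetric])
   fix l assume "l \<in> hist n"
   then have ls: "length (snd l) <= n" by (auto simp: hist_def)
   have "(%X. if good X \<and> size X = n then ennreal (prior (fst l) (pt X) (snd l)) else 0) \<in> borel_measurable S0"
    by (rule borel_measurable_good_space) (use prior_measurable[OF ls] in simp)
   note [measurable] = measurable_compose[OF Ym this] measurable_compose[OF Ym Km[OF ls]]
   have "(%w. (if has_pts t n w then ennreal (prior (fst l) (pt (Y t w)) (snd l)) else 0) * ?K n (fst l) (snd l) (Y t w)) \<in> borel_measurable Q"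
    by measurable
   moreover have "(if has_pts t n w then ennreal (prior (fst l) (pt (Y t w)) (snd l)) else 0) * ?K n (fst l) (snd l) (Y t w)
    = (if has_pts t n w then ennreal (prior (fst l) (pt (Y t w)) (snd l)) * ?K n (fst l) (snd l) (Y t w) else 0)" for w by auto
   ultimately show "(%w. if has_pts t n w then ennreal (prior (fst l) (pt (Y t w)) (snd l)) * ?K n (fst l) (snd l) (Y t w) else 0) \<in> borel_measurable Q"
    by (simp only:)
  qed
  also have "\<dots> = (\<integral>\<^sup>+w. (if has_pts t n w then ?h w else 0) \<partial>Q)"
  proof (rule nn_integral_cong)
   fix w assume w: "w \<in> space Q"
   show "(\<Sum>(d0, ls)\<in>hist n. if has_pts t n w then ennreal (prior d0 (pt (Y t w)) ls) * ?K n d0 ls (Y t w) else 0)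
    = (if has_pts t n w then ?h w else 0)"
   proof (cases "has_pts t n w")
    case True
    let ?X = "Y t w"
    have x: "\<forall>k<n. pt ?X k \<in> space M0" using pt_space[OF w t] True by auto
    have nn: "0 <= g (Gam d0 (pt ?X) ls) * wt d0 (pt ?X) ls t" "0 <= g (Gam d0 (pt ?X) ls) * lk d0 (pt ?X) ls t"
     "0 <= prior d0 (pt ?X) ls" if "length ls = n" for d0 ls
    proof -
     have "0 <= prior d0 (pt ?X) ls"
      unfolding prior_eq_prod using x that pD_nonneg trw_nonneg rr_nonneg by (intro mult_nonneg_nonneg prod_nonneg) auto
     then show "0 <= prior d0 (pt ?X) ls" .
     then show "0 <= g (Gam d0 (pt ?X) ls) * wt d0 (pt ?X) ls t" "0 <= g (Gam d0 (pt ?X) ls) * lk d0 (pt ?X) ls t"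
      using lk_nonneg[of ls "pt ?X" d0 t] x that g0 by (simp_all add: wt_def)
    qed
    have e: "ennreal (prior d0 (pt ?X) ls) * ?K n d0 ls ?X = indicator B ?X * ennreal (g (Gam d0 (pt ?X) ls) * wt d0 (pt ?X) ls t)" if "length ls = n" for d0 ls
    proof -
     have "ennreal (prior d0 (pt ?X) ls) * ennreal (g (Gam d0 (pt ?X) ls) * lk d0 (pt ?X) ls t) = ennreal (prior d0 (pt ?X) ls * (g (Gam d0 (pt ?X) ls) * lk d0 (pt ?X) ls t))"
      by (rule ennreal_mult[OF nn(3)[OF that] nn(2)[OF that], symmetric])
     also have "prior d0 (pt ?X) ls * (g (Gam d0 (pt ?X) ls) * lk d0 (pt ?X) ls t) = g (Gam d0 (pt ?X) ls) * wt d0 (pt ?X) ls t" by (simp add: wt_def)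
     finally show ?thesis using True by (cases "?X \<in> B") simp_all
    qed
    have "(\<Sum>(d0, ls)\<in>hist n. if good ?X \<and> size ?X = n then ennreal (prior d0 (pt ?X) ls) * ?K n d0 ls ?X else 0)
     = (\<Sum>(d0, ls)\<in>hist n. indicator B ?X * ennreal (g (Gam d0 (pt ?X) ls) * wt d0 (pt ?X) ls t))"
    proof (rule sum.cong[OF refl])
     fix l assume "l \<in> hist n"
     then have "length (snd l) = n" by (auto simp: hist_def)
     from e[OF this, of "fst l"] show "(case l of (d0, ls) => if good ?X \<and> size ?X = n then ennreal (prior d0 (pt ?X) ls) * ?K n d0 ls ?X else 0)
      = (case l of (d0, ls) => indicator B ?X * ennreal (g (Gam d0 (pt ?X) ls) * wt d0 (pt ?X) ls t))"
      unfolding case_prod_beta if_P[OF True] .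
    qed
    also have "\<dots> = indicator B ?X * ennreal (\<Sum>(d0, ls)\<in>hist n. g (Gam d0 (pt ?X) ls) * wt d0 (pt ?X) ls t)"
     unfolding case_prod_beta' sum_distrib_left[symmetric]
     by (subst sum_ennreal) (use nn in \<open>auto simp: hist_def\<close>)
    finally show ?thesis using True by (simp add: phiS_def)
   next
    case False
    show ?thesis unfolding if_not_P[OF False] by (simp add: case_prod_beta')
   qed
  qed
  finally show ?thesis .
 qed
 show ?thesis unfolding split[OF fm] split[OF hm] piece by (rule refl)
qed

end

section \<open>Piecewise evolution with jumps\<close>

text \<open>For changing the integrand at the end point of a piece, where the history already has one more
point; the change concerns a null set, but it may destroy measurability.\<close>
lemma primitive_cong_AE:
 assumes P: "primitive \<nu> a b f F" and a: "0 <= a"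
  and m: "(%z. indicator (strip \<nu> a b) z *\<^sub>R v z) \<in> borel_measurable (mark_time \<nu>)"
  and ae: "AE z in mark_time \<nu>. z \<in> strip \<nu> a b \<longrightarrow> f z = v z"
 shows "primitive \<nu> a b v F"
proof (rule primitiveI)
 have fm: "(%z. indicator (strip \<nu> a b) z *\<^sub>R f z) \<in> borel_measurable (mark_time \<nu>)"
  using primitive_integrable[OF P] unfolding set_integrable_def by (rule borel_measurable_integrable)
 show "set_integrable (mark_time \<nu>) (strip \<nu> a b) v"
  unfolding set_integrable_def
 proof (rule integrable_cong_AE_imp[OF _ m])
  show "integrable (mark_time \<nu>) (%z. indicator (strip \<nu> a b) z *\<^sub>R f z)"
   using primitive_integrable[OF P] by (simp add: set_integrable_def)
  show "AE z in mark_time \<nu>. indicator (strip \<nu> a b) z *\<^sub>R f z = indicator (strip \<nu> a b) z *\<^sub>R v z"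
   using ae by eventually_elim (auto simp: indicator_def)
 qed
 fix t assume t: "a <= t" "t <= b"
 have restr: "(%z. indicator (strip \<nu> a t) z *\<^sub>R h z) \<in> borel_measurable (mark_time \<nu>)"
  if h: "(%z. indicator (strip \<nu> a b) z *\<^sub>R h z) \<in> borel_measurable (mark_time \<nu>)" for h :: "_ => real"
 proof -
  have "(%z. indicator (strip \<nu> a t) z *\<^sub>R (indicator (strip \<nu> a b) z *\<^sub>R h z)) \<in> borel_measurable (mark_time \<nu>)"
   using h a by simp
  moreover have "indicator (strip \<nu> a t) z *\<^sub>R (indicator (strip \<nu> a b) z *\<^sub>R h z) = indicator (strip \<nu> a t) z *\<^sub>R h z" for z
   using t by (auto simp: strip_def indicator_def mem_Times_iff)
  ultimately show ?thesis by (simp only:)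
 qed
 have "(LINT z:strip \<nu> a t|mark_time \<nu>. f z) = (LINT z:strip \<nu> a t|mark_time \<nu>. v z)"
  unfolding set_lebesgue_integral_def
 proof (rule integral_cong_AE[OF restr[OF fm] restr[OF m]])
  show "AE z in mark_time \<nu>. indicator (strip \<nu> a t) z *\<^sub>R f z = indicator (strip \<nu> a t) z *\<^sub>R v z"
   using ae by eventually_elim (use t in \<open>auto simp: indicator_def strip_def\<close>)
 qed
 then show "F t = F a + (LINT z:strip \<nu> a t|mark_time \<nu>. v z)" using primitive_eq[OF P t] by (simp only:)
qed

text \<open>The index of the piece that contains the time \<open>s\<close>.\<close>
definition counter :: "('e \<times> real) multiset => real => nat" where
 "counter X s = size {#x \<in># X. snd x <= s#}"

definition piece :: "('e \<times> real) multiset => real => nat => real" where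
 "piece X T k = (if k < size X then snd (pt X k) else T)"

text \<open>A fixed configuration of observed points up to the time horizon \<open>T\<close>.  Piece number \<open>k\<close> extends from
\<open>a k\<close> to \<open>e k\<close>.\<close>
locale horizon =
 fixes \<nu> :: "'e measure" and X :: "('e \<times> real) multiset" and T :: real
 assumes gX: "good X" and X_space: "set_mset X \<subseteq> space (mark_time \<nu>)" and T: "0 <= T" and X_le: "\<And>x. x \<in># X ==> snd x <= T"
begin

abbreviation n where "n \<equiv> size X"
abbreviation a where "a k \<equiv> tau (pt X) k"
abbreviation e where "e k \<equiv> piece X T k"
abbreviation kk where "kk s \<equiv> counter X s"

lemma kk_le: "kk s <= n" by (simp add: counter_def size_filter_mset_lesseq)
lemma a_nonneg: "k <= n ==> 0 <= a k" by (rule tau_nonneg[OF gX])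
lemma pt_le_T: "k < n ==> snd (pt X k) <= T" by (rule X_le[OF pt_in(1)[OF gX]])
lemma pt_spaceX: "k < n ==> pt X k \<in> space (mark_time \<nu>)" using X_space pt_in(1)[OF gX] by blast

lemma e_le_T: "e k <= T" by (simp add: piece_def pt_le_T)

lemma a_less_e: "k < n ==> a k < e k" using pt_tau_less[OF gX] by (simp add: piece_def)

lemma a_le_T: assumes "k <= n" shows "a k <= T"
proof (cases k)
 case 0 show ?thesis unfolding 0 tau_0 by (rule T)
next
 case (Suc j)
 have "j < n" using assms Suc by simp
 from pt_le_T[OF this] show ?thesis unfolding Suc tau_Suc .
qed

lemma a_le_e: assumes "k <= n" shows "a k <= e k"
proof (cases "k < n")
 case True from a_less_e[OF this] show ?thesis by simp
next
 case False then show ?thesis using a_le_T[OF assms] by (simp add: piece_def)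
qed

lemma e_eq_a: "k < n ==> e k = a (Suc k)" by (simp add: piece_def)
lemma e_n: "e n = T" by (simp add: piece_def)

lemma kk_eqI: "k <= n ==> a k <= s ==> (k < n ==> s < e k) ==> kk s = k"
 unfolding counter_def by (rule size_upto_eqI[OF gX]) (auto simp: piece_def)

lemma a_kk: "0 <= s ==> a (kk s) <= s"
 unfolding counter_def by (rule upto_tau[OF gX])

lemma kk_e: "kk s < n ==> s < e (kk s)"
 using upto_next[OF gX, of s] by (simp add: piece_def counter_def)

lemma le_e_kk: "s <= T ==> s <= e (kk s)"
 using kk_e[of s] kk_le[of s] by (cases "kk s < n") (auto simp: piece_def)

lemma kk_eq_iff: "k <= n ==> 0 <= s ==> kk s = k \<longleftrightarrow> a k <= s \<and> (k < n \<longrightarrow> s < e k)"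
 using kk_eqI[of k s] a_kk[of s] kk_e[of s] by auto

lemma kk_0: "kk 0 = 0" by (rule kk_eqI) (use a_less_e[of 0] in auto)

context
 fixes V :: "nat => real => real" and W :: "nat => 'e \<times> real => real" and J :: "nat => real"
 assumes prim: "\<And>k. k <= n ==> primitive \<nu> (a k) (e k) (%z. - W k z) (V k)"
  and slice: "\<And>k. k <= n ==> (%z. indicator (space \<nu> \<times> {a k}) z *\<^sub>R W k z) \<in> borel_measurable (mark_time \<nu>)"
  and jump: "\<And>k. k < n ==> V (Suc k) (e k) = V k (e k) + J k"
begin

abbreviation "v z \<equiv> W (kk (snd z)) z"

text \<open>The integrand of the whole time interval is glued from the integrands of the pieces.  Its values at
the initial points of the pieces are given on null sets only and need the separate hypothesis \<open>slice\<close>.\<close>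
lemma v_measurable: "(%z. indicator (space \<nu> \<times> {0..T}) z *\<^sub>R v z) \<in> borel_measurable (mark_time \<nu>)"
proof -
 define A where "A k = {z \<in> space (mark_time \<nu>). a k < snd z \<and> (k < n \<longrightarrow> snd z < e k) \<and> snd z <= T}" for k
 have Am: "A k \<in> sets (mark_time \<nu>)" for k unfolding A_def by measurable
 have Wm: "(%z. indicator (strip \<nu> (a k) (e k)) z *\<^sub>R W k z) \<in> borel_measurable (mark_time \<nu>)" if "k <= n" for k
 proof -
  have "(%z. indicator (strip \<nu> (a k) (e k)) z *\<^sub>R (- W k z)) \<in> borel_measurable (mark_time \<nu>)"
   using primitive_integrable[OF prim[OF that]] unfolding set_integrable_def by (rule borel_measurable_integrable)
  then have "(%z. - (indicator (strip \<nu> (a k) (e k)) z *\<^sub>R (- W k z))) \<in> borel_measurable (mark_time \<nu>)" by (rule borel_measurable_uminus)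
  then show ?thesis by simp
 qed
 have "(%z. \<Sum>k\<le>n. indicator (space \<nu> \<times> {a k}) z *\<^sub>R W k z + indicator (A k) z * (indicator (strip \<nu> (a k) (e k)) z *\<^sub>R W k z)) \<in> borel_measurable (mark_time \<nu>)"
  by (intro borel_measurable_sum borel_measurable_add slice borel_measurable_times borel_measurable_indicator Am Wm) auto
 moreover have "(\<Sum>k\<le>n. indicator (space \<nu> \<times> {a k}) z *\<^sub>R W k z + indicator (A k) z * (indicator (strip \<nu> (a k) (e k)) z *\<^sub>R W k z)) = indicator (space \<nu> \<times> {0..T}) z *\<^sub>R v z"
  if z: "z \<in> space (mark_time \<nu>)" for z
 proof (cases "snd z <= T")
  case True
  have z0: "0 <= snd z" "fst z \<in> space \<nu>" using z by (auto simp: space_mark_time)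
  have "(\<Sum>k\<le>n. indicator (space \<nu> \<times> {a k}) z *\<^sub>R W k z + indicator (A k) z * (indicator (strip \<nu> (a k) (e k)) z *\<^sub>R W k z)) = (\<Sum>k\<le>n. if k = kk (snd z) then W k z else 0)"
  proof (rule sum.cong[OF refl])
   fix k assume "k \<in> {..n}"
   then have k: "k <= n" by simp
   have iff: "(k = kk (snd z)) \<longleftrightarrow> snd z = a k \<or> (a k < snd z \<and> (k < n \<longrightarrow> snd z < e k))"
    using kk_eq_iff[OF k z0(1)] a_less_e[of k] by auto
   have zA: "z \<in> A k \<longleftrightarrow> a k < snd z \<and> (k < n \<longrightarrow> snd z < e k)" using z True by (simp add: A_def)
   have zS: "z \<in> strip \<nu> (a k) (e k)" if "a k < snd z" "k < n \<longrightarrow> snd z < e k"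
    using that z0 True by (cases "k < n") (auto simp: strip_def mem_Times_iff piece_def)
   have zs: "z \<in> space \<nu> \<times> {a k} \<longleftrightarrow> snd z = a k" using z0 by (auto simp: mem_Times_iff)
   show "indicator (space \<nu> \<times> {a k}) z *\<^sub>R W k z + indicator (A k) z * (indicator (strip \<nu> (a k) (e k)) z *\<^sub>R W k z) = (if k = kk (snd z) then W k z else 0)"
    unfolding iff using zA zs zS by (simp add: indicator_def)
  qed
  also have "\<dots> = W (kk (snd z)) z" using kk_le[of "snd z"] by simp
  finally show ?thesis using z0 True by (simp add: indicator_def mem_Times_iff)
 next
  case False
  have "indicator (space \<nu> \<times> {a k}) z *\<^sub>R W k z + indicator (A k) z * (indicator (strip \<nu> (a k) (e k)) z *\<^sub>R W k z) = 0" if "k \<in> {..n}" for k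
   using False a_le_T[of k] that by (auto simp: A_def indicator_def mem_Times_iff)
  then show ?thesis using False by (simp add: indicator_def mem_Times_iff)
 qed
 ultimately show ?thesis by (subst measurable_cong[symmetric]) auto
qed

lemma indicator_subset_measurable:
 assumes "B \<in> sets (mark_time \<nu>)" "B \<subseteq> space \<nu> \<times> {0..T}"
 shows "(%z. indicator B z *\<^sub>R v z) \<in> borel_measurable (mark_time \<nu>)"
proof -
 have "(%z. indicator B z *\<^sub>R (indicator (space \<nu> \<times> {0..T}) z *\<^sub>R v z)) \<in> borel_measurable (mark_time \<nu>)"
  using v_measurable assms(1) by simp
 moreover have "indicator B z *\<^sub>R (indicator (space \<nu> \<times> {0..T}) z *\<^sub>R v z) = indicator B z *\<^sub>R v z" for z
  using assms(2) by (auto simp: indicator_def)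
 ultimately show ?thesis by (simp only:)
qed

lemma prim_v: assumes k: "k <= n" shows "primitive \<nu> (a k) (e k) (%z. - v z) (V k)"
proof (rule primitive_cong_AE[OF prim[OF k] a_nonneg[OF k]])
 have "strip \<nu> (a k) (e k) \<subseteq> space \<nu> \<times> {0..T}" using a_nonneg[OF k] e_le_T[of k] by (auto simp: strip_def)
 from borel_measurable_uminus[OF indicator_subset_measurable[OF strip_measurable[OF a_nonneg[OF k]] this]]
 show "(%z. indicator (strip \<nu> (a k) (e k)) z *\<^sub>R (- v z)) \<in> borel_measurable (mark_time \<nu>)" by simp
 show "AE z in mark_time \<nu>. z \<in> strip \<nu> (a k) (e k) \<longrightarrow> - W k z = - v z"
  using AE_time_neq[of "e k" \<nu>]
 proof eventually_elim
  case (elim z)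
  have "kk (snd z) = k" if "z \<in> strip \<nu> (a k) (e k)" using that elim by (intro kk_eqI k) (auto simp: strip_def)
  then show ?case by simp
 qed
qed

lemma piecewise_strip:
 assumes "k <= n" "a k <= t" "t <= e k"
 shows "set_integrable (mark_time \<nu>) (strip \<nu> 0 t) v \<and> V k t = V 0 0 - (LINT z:strip \<nu> 0 t|mark_time \<nu>. v z) + (\<Sum>j<k. J j)"
 using assms
proof (induction k arbitrary: t)
 have neg: "set_integrable (mark_time \<nu>) (strip \<nu> (a k) t) v \<and> V k t = V k (a k) - (LINT z:strip \<nu> (a k) t|mark_time \<nu>. v z)"
  if k: "k <= n" and t: "a k <= t" "t <= e k" for k t
 proof
  have "set_integrable (mark_time \<nu>) (strip \<nu> (a k) t) (%z. - v z)"
   by (rule set_integrable_strip_subset[OF primitive_integrable[OF prim_v[OF k]] a_nonneg[OF k] order_refl t(2)])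
  then have "integrable (mark_time \<nu>) (%z. - (indicator (strip \<nu> (a k) t) z *\<^sub>R (- v z)))"
   unfolding set_integrable_def by (rule Bochner_Integration.integrable_minus)
  then show i: "set_integrable (mark_time \<nu>) (strip \<nu> (a k) t) v" unfolding set_integrable_def by simp
  show "V k t = V k (a k) - (LINT z:strip \<nu> (a k) t|mark_time \<nu>. v z)"
   unfolding primitive_eq[OF prim_v[OF k] t] set_integral_uminus[OF i] by simp
 qed
 {
  case 0
  then show ?case using neg[of 0 t] by simp
 next
  case (Suc k)
  have k: "k < n" "k <= n" using Suc(2) by simp_all
  have ek: "e k = a (Suc k)" by (rule e_eq_a[OF k(1)])
  have IH: "set_integrable (mark_time \<nu>) (strip \<nu> 0 (e k)) v" "V k (e k) = V 0 0 - (LINT z:strip \<nu> 0 (e k)|mark_time \<nu>. v z) + (\<Sum>j<k. J j)"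
   using Suc(1)[OF k(2) a_le_e[OF k(2)] order_refl] by blast+
  note N = neg[OF Suc(2-4), folded ek]
  have e0: "0 <= e k" unfolding ek by (rule a_nonneg[OF Suc(2)])
  have et: "e k <= t" unfolding ek by (rule Suc(3))
  have un: "strip \<nu> 0 t = strip \<nu> 0 (e k) \<union> strip \<nu> (e k) t" by (rule strip_split[OF e0 et])
  have I: "set_integrable (mark_time \<nu>) (strip \<nu> 0 t) v"
   unfolding un by (rule set_integrable_Un[OF IH(1) conjunct1[OF N]]) (use e0 in auto)
  have "(LINT z:strip \<nu> 0 t|mark_time \<nu>. v z) = (LINT z:strip \<nu> 0 (e k)|mark_time \<nu>. v z) + (LINT z:strip \<nu> (e k) t|mark_time \<nu>. v z)"
   by (rule set_lebesgue_integral_strip_split[OF I order_refl e0 et order_refl])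
  then show ?case using I IH(2) conjunct2[OF N] jump[OF k(1)] by simp
 }
qed

text \<open>A path that is a primitive on each piece and jumps by \<open>J k\<close> at the point number \<open>k\<close> is an integral
plus a sum of jumps.  Both filtering equations are instances.\<close>
lemma piecewise_equation:
 assumes t: "0 <= t" "t <= T"
 shows "set_integrable (mark_time \<nu>) (space \<nu> \<times> {0..t}) v"
  and "V (kk t) t = V 0 0 - (LINT z:space \<nu> \<times> {0..t}|mark_time \<nu>. v z) + (\<Sum>j<kk t. J j)"
proof -
 note P = piecewise_strip[OF kk_le a_kk[OF t(1)] le_e_kk[OF t(2)]]
 have s0: "(%z. indicator (space \<nu> \<times> {0}) z *\<^sub>R v z) \<in> borel_measurable (mark_time \<nu>)"
 proof (rule indicator_subset_measurable)
  have "space \<nu> \<times> {0} = {z \<in> space (mark_time \<nu>). snd z = 0}" by (auto simp: space_mark_time)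
  also have "\<dots> \<in> sets (mark_time \<nu>)" by measurable
  finally show "space \<nu> \<times> {0::real} \<in> sets (mark_time \<nu>)" .
 qed (use T in auto)
 note S = set_integrable_slice[OF conjunct1[OF P] t(1) s0]
 show "set_integrable (mark_time \<nu>) (space \<nu> \<times> {0..t}) v" by (rule S(1))
 show "V (kk t) t = V 0 0 - (LINT z:space \<nu> \<times> {0..t}|mark_time \<nu>. v z) + (\<Sum>j<kk t. J j)"
  unfolding S(2) by (rule conjunct2[OF P])
qed

end

lemma piecewise_left:
 assumes c: "\<And>k. k <= n ==> continuous_on {a k..e k} (V k)" and k: "k <= n" and s: "a k < s" "s <= e k"
 shows "((%r. V (kk r) r :: real) \<longlongrightarrow> V k s) (at_left s)"
proof -
 have "(V k \<longlongrightarrow> V k s) (at s within {a k..e k})" using c[OF k] s by (simp add: continuous_on_def)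
 then have "(V k \<longlongrightarrow> V k s) (at s within {a k..<s})" by (rule tendsto_within_subset) (use s in auto)
 moreover have "at s within {a k..<s} = at_left s" by (rule at_within_nhd[where S="{a k<..}"]) (use s in auto)
 ultimately have 1: "(V k \<longlongrightarrow> V k s) (at_left s)" by simp
 have "eventually (%r. V k r = V (kk r) r) (at_left s)"
  unfolding eventually_at_left_field
 proof (intro exI[of _ "a k"] conjI allI impI)
  fix r assume r: "a k < r" "r < s"
  have "kk r = k" by (rule kk_eqI[OF k]) (use r s in auto)
  then show "V k r = V (kk r) r" by simp
 qed (rule s(1))
 with 1 show ?thesis by (rule Lim_transform_eventually)
qed

lemma piecewise_right:
 assumes c: "\<And>k. k <= n ==> continuous_on {a k..e k} (V k)" and s: "0 <= s" "s < T"
 shows "((%r. V (kk r) r :: real) \<longlongrightarrow> V (kk s) s) (at_right s)"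
proof -
 let ?k = "kk s"
 have se: "s < e ?k" using kk_e[of s] s kk_le[of s] by (cases "?k < n") (auto simp: piece_def)
 have as: "a ?k <= s" by (rule a_kk[OF s(1)])
 have "(V ?k \<longlongrightarrow> V ?k s) (at s within {a ?k..e ?k})" using c[OF kk_le] se as by (simp add: continuous_on_def)
 then have "(V ?k \<longlongrightarrow> V ?k s) (at s within {s<..e ?k})" by (rule tendsto_within_subset) (use as in auto)
 moreover have "at s within {s<..e ?k} = at_right s" by (rule at_within_nhd[where S="{..<e ?k}"]) (use se in auto)
 ultimately have 1: "(V ?k \<longlongrightarrow> V ?k s) (at_right s)" by simp
 have "eventually (%r. V ?k r = V (kk r) r) (at_right s)"
  unfolding eventually_at_right_field
 proof (intro exI[of _ "e ?k"] conjI allI impI)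
  fix r assume r: "s < r" "r < e ?k"
  have "kk r = ?k" by (rule kk_eqI[OF kk_le]) (use r as in auto)
  then show "V ?k r = V (kk r) r" by simp
 qed (rule se)
 with 1 show ?thesis by (rule Lim_transform_eventually)
qed

end

context cluster_model
begin

text \<open>The product of the exponentials over all complete pieces.  It vanishes exactly if the cumulative
intensity diverges on one of them.\<close>
primrec exprod :: "bool => (nat => 'e \<times> real) => bool option list => real" where
 "exprod d0 x [] = 1"
| "exprod d0 x (b # ls) = exprod d0 x ls * Ex d0 x ls (snd (x (length ls)))"

text \<open>Finite cumulative intensity up to \<open>T\<close> for all histories of positive prior weight, expressed through
the convention that \<open>Ex\<close> is 0 if the intensity is not integrable.\<close>
definition intok :: "real => ('e \<times> real) multiset => bool" where
 "intok T X \<longleftrightarrow> (\<forall>(d0, ls)\<in>hist (size X). prior d0 (pt X) ls \<noteq> 0 \<longrightarrow> exprod d0 (pt X) ls * Ex d0 (pt X) ls T \<noteq> 0)"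

lemma hist_cong:
 assumes "\<forall>k<length ls. x k = x' k"
 shows "Gam d0 x ls = Gam d0 x' ls" "tau x (length ls) = tau x' (length ls)" "lamh d0 x ls = lamh d0 x' ls"
  "Ex d0 x ls s = Ex d0 x' ls s" "wt d0 x ls s = wt d0 x' ls s"
proof -
 have 1: "Gam d0 x ls = Gam d0 x' ls \<and> tau x (length ls) = tau x' (length ls)" if "\<forall>k<length ls. x k = x' k" for ls
  using that
 proof (induction ls)
  case (Cons b ls) then show ?case by (cases b) auto
 qed simp
 then have 2: "lamh d0 x ls = lamh d0 x' ls" if "\<forall>k<length ls. x k = x' k" for ls using that by (simp add: lamh_def[abs_def])
 have 3: "Ex d0 x ls s = Ex d0 x' ls s" if "\<forall>k<length ls. x k = x' k" for ls s using 1[OF that] 2[OF that] by (simp add: Ex_def)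
 have 4: "ell d0 x ls = ell d0 x' ls \<and> prior d0 x ls = prior d0 x' ls" if "\<forall>k<length ls. x k = x' k" for ls
  using that
 proof (induction ls)
  case (Cons b ls)
  then have "\<forall>k<length ls. x k = x' k" "x (length ls) = x' (length ls)" by auto
  then show ?case using Cons.IH 2[of ls] 3[of ls] by (cases b) simp_all
 qed simp
 show "Gam d0 x ls = Gam d0 x' ls" "tau x (length ls) = tau x' (length ls)" "lamh d0 x ls = lamh d0 x' ls"
  "Ex d0 x ls s = Ex d0 x' ls s" "wt d0 x ls s = wt d0 x' ls s"
  using 1[OF assms] 2[OF assms] 3[OF assms] 4[OF assms] by (simp_all add: wt_def lk_def)
qed

end

text \<open>The data of one path of the observations; no randomness is left.\<close>
locale filter_path = cluster_model Q F P \<nu> p gam lamQ N C I D lam L + horizon \<nu> X T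
 for Q :: "'w measure" and F P and \<nu> :: "'e measure" and p gam lamQ N C I D lam L X T +
 assumes ok: "intok T X"
begin

abbreviation "xx \<equiv> pt X"

text \<open>The explicit filter during piece \<open>k\<close>, as a function of time.  \<open>Vl\<close> is the same sum with an additional
factor \<open>lam\<close>, and \<open>Wf\<close> the integrand of the first filtering equation.\<close>
definition V :: "('e state => real) => nat => real => real" where
 "V g k s = (\<Sum>(d0, ls)\<in>hist k. g (Gam d0 xx ls) * wt d0 xx ls s)"

definition Vl :: "('e state => real) => nat => 'e \<times> real => real" where
 "Vl g k z = (\<Sum>(d0, ls)\<in>hist k. g (Gam d0 xx ls) * lamh d0 xx ls z * wt d0 xx ls (snd z))"

definition lq :: "'e \<times> real => real" where "lq z = lamQ (fst z) (snd z)"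

definition Wf :: "('e state => real) => nat => 'e \<times> real => real" where
 "Wf g k z = Vl g k z - lq z * V g k (snd z)"

lemma xx_space: "length ls <= n ==> \<forall>k<length ls. xx k \<in> space M0"
 using pt_spaceX by simp

text \<open>A history of positive prior can be prolonged to one of full length with positive prior, since each
point can be a cluster event; so it inherits finiteness from the longer history.\<close>
lemma exprod_nonzero:
 assumes "length ls <= n" "prior d0 xx ls \<noteq> 0" shows "exprod d0 xx ls * Ex d0 xx ls (e (length ls)) \<noteq> 0"
 using assms
proof (induction "n - length ls" arbitrary: ls)
 case 0
 then have l: "length ls = n" by simp
 have "exprod d0 xx ls * Ex d0 xx ls T \<noteq> 0" using ok 0(3) l unfolding intok_def by (auto simp: hist_def)
 then show ?case unfolding l e_n .
next
 case (Suc m)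
 then have k: "length ls < n" by simp
 have lp: "0 < rr True (xx (length ls))"
  using M0_pos[OF pt_spaceX[OF k]] by (auto simp: rr_def intro!: divide_pos_pos add_pos_nonneg)
 have "\<exists>d. tr p (stat d0 ls) d \<noteq> 0"
  by (cases "p = 0") (auto simp: tr_def)
 then obtain d where d: "tr p (stat d0 ls) d \<noteq> 0" by blast
 have "prior d0 xx (Some d # ls) \<noteq> 0" using Suc(4) lp d by simp
 then have "exprod d0 xx (Some d # ls) * Ex d0 xx (Some d # ls) (e (length (Some d # ls))) \<noteq> 0"
  using Suc(2) k by (intro Suc(1)) auto
 then show ?case using k by (simp add: piece_def)
qed

lemma int_piece:
 assumes "length ls <= n" "prior d0 xx ls \<noteq> 0"
 shows "set_integrable M0 (strip \<nu> (a (length ls)) (e (length ls))) (lamh d0 xx ls)"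
 using exprod_nonzero[OF assms] unfolding Ex_def by (auto split: if_splits)

lemma wt_prim:
 assumes k: "length ls <= n"
 shows "primitive \<nu> (a (length ls)) (e (length ls)) (%z. - (lamh d0 xx ls z - lq z) * wt d0 xx ls (snd z)) (wt d0 xx ls)"
proof (cases "prior d0 xx ls = 0")
 case True
 then have "wt d0 xx ls s = 0" for s by (simp add: wt_def)
 then show ?thesis by (intro primitive_cong[OF primitive_const[of _ _ _ 0]]) simp_all
next
 case False
 from primitive_cmult[OF Ex_primitive(1)[OF xx_space[OF k] a_nonneg[OF k] a_le_e[OF k] int_piece[OF k False]], of "prior d0 xx ls * ell d0 xx ls"]
 show ?thesis by (rule primitive_cong) (simp_all add: wt_def lk_def lq_def)
qed

lemma V_prim:
 assumes k: "k <= n" shows "primitive \<nu> (a k) (e k) (%z. - Wf g k z) (V g k)"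
proof -
 have "primitive \<nu> (a k) (e k) (%z. \<Sum>l\<in>hist k. g (Gam (fst l) xx (snd l)) * (- (lamh (fst l) xx (snd l) z - lq z) * wt (fst l) xx (snd l) (snd z)))
   (%s. \<Sum>l\<in>hist k. g (Gam (fst l) xx (snd l)) * wt (fst l) xx (snd l) s)"
 proof (intro primitive_sum primitive_cmult)
  fix l assume "l \<in> hist k"
  then have l: "length (snd l) = k" by (auto simp: hist_def)
  show "primitive \<nu> (a k) (e k) (%z. - (lamh (fst l) xx (snd l) z - lq z) * wt (fst l) xx (snd l) (snd z)) (wt (fst l) xx (snd l))"
   using wt_prim[of "snd l" "fst l"] l k by simp
 qed (use a_nonneg[OF k] in simp_all)
 then show ?thesis
  by (rule primitive_cong)
    (simp_all add: Wf_def Vl_def V_def case_prod_beta' sum_distrib_left sum_subtractf[symmetric] sum_negf[symmetric] algebra_simps)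
qed

lemma V_continuous: "k <= n ==> continuous_on {a k..e k} (V g k)"
 by (rule primitive_continuous[OF V_prim a_nonneg])

lemma lamh_intensity:
 assumes "length ls <= n" shows "lamh d0 xx ls z = intensity lam (fst z) (snd z) (Gam d0 xx ls)"
 unfolding lamh_def intensity_def status_Gam[OF gX assms] by (rule refl)

lemma Vl_eq: "k <= n ==> Vl g k z = V (%y. g y * intensity lam (fst z) (snd z) y) k (snd z)"
 unfolding Vl_def V_def by (intro sum.cong refl) (auto simp: hist_def lamh_intensity)

lemma V_add: "V (%y. g y + h y) k s = V g k s + V h k s"
 by (simp add: V_def case_prod_beta' sum.distrib[symmetric] distrib_right)

lemma V_diff: "V (%y. g y - h y) k s = V g k s - V h k s"
 by (simp add: V_def case_prod_beta' sum_subtractf[symmetric] left_diff_distrib)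

lemma V_mult: "V (%y. g y * c) k s = V g k s * c"
 by (simp add: V_def case_prod_beta' sum_distrib_left ac_simps)

lemma Wf_eq: "k <= n ==> Wf g k z = V (%y. g y * (intensity lam (fst z) (snd z) y - lamQ (fst z) (snd z))) k (snd z)"
proof -
 assume k: "k <= n"
 have "V (%y. g y * (intensity lam (fst z) (snd z) y - lamQ (fst z) (snd z))) k (snd z)
  = V (%y. g y * intensity lam (fst z) (snd z) y - g y * lamQ (fst z) (snd z)) k (snd z)"
  by (simp add: right_diff_distrib)
 also have "\<dots> = Vl g k z - V g k (snd z) * lamQ (fst z) (snd z)"
  by (simp only: V_diff V_mult[of g "lamQ (fst z) (snd z)"] Vl_eq[OF k])
 finally show "Wf g k z = V (%y. g y * (intensity lam (fst z) (snd z) y - lamQ (fst z) (snd z))) k (snd z)"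
  by (simp add: Wf_def lq_def)
qed

text \<open>At the initial time of a piece, time is constant and only the dependence on marks remains.\<close>
lemma slice_meas:
 assumes k: "k <= n"
 shows "(%z. indicator (space \<nu> \<times> {a k}) z *\<^sub>R Vl g k z) \<in> borel_measurable M0"
  "(%z. indicator (space \<nu> \<times> {a k}) z *\<^sub>R V g k (snd z)) \<in> borel_measurable M0"
  "(%z. indicator (space \<nu> \<times> {a k}) z *\<^sub>R Wf g k z) \<in> borel_measurable M0"
proof -
 have "space \<nu> \<times> {a k} = {z \<in> space M0. snd z = a k}" using a_nonneg[OF k] by (auto simp: space_mark_time)
 also have "\<dots> \<in> sets M0" by measurable
 finally have S[measurable]: "space \<nu> \<times> {a k} \<in> sets M0" .
 have lm: "lamh d0 xx ls \<in> borel_measurable M0" if "(d0, ls) \<in> hist k" for d0 ls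
  using that k by (intro lamh_measurable xx_space) simp
 have "(%z. \<Sum>l\<in>hist k. g (Gam (fst l) xx (snd l)) * lamh (fst l) xx (snd l) z * wt (fst l) xx (snd l) (a k)) \<in> borel_measurable M0"
  by (intro borel_measurable_sum borel_measurable_times borel_measurable_const lm) auto
 then have "(%z. indicator (space \<nu> \<times> {a k}) z *\<^sub>R (\<Sum>l\<in>hist k. g (Gam (fst l) xx (snd l)) * lamh (fst l) xx (snd l) z * wt (fst l) xx (snd l) (a k))) \<in> borel_measurable M0"
  by measurable
 moreover have "indicator (space \<nu> \<times> {a k}) z *\<^sub>R (\<Sum>l\<in>hist k. g (Gam (fst l) xx (snd l)) * lamh (fst l) xx (snd l) z * wt (fst l) xx (snd l) (a k))
  = indicator (space \<nu> \<times> {a k}) z *\<^sub>R Vl g k z" for z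
  by (auto simp: indicator_def Vl_def case_prod_beta')
 ultimately show 1: "(%z. indicator (space \<nu> \<times> {a k}) z *\<^sub>R Vl g k z) \<in> borel_measurable M0" by (simp only:)
 have "(%z. indicator (space \<nu> \<times> {a k}) z *\<^sub>R V g k (a k)) \<in> borel_measurable M0" by measurable
 moreover have "indicator (space \<nu> \<times> {a k}) z *\<^sub>R V g k (a k) = indicator (space \<nu> \<times> {a k}) z *\<^sub>R V g k (snd z)" for z
  by (auto simp: indicator_def)
 ultimately show 2: "(%z. indicator (space \<nu> \<times> {a k}) z *\<^sub>R V g k (snd z)) \<in> borel_measurable M0" by (simp only:)
 have "(%z. indicator (space \<nu> \<times> {a k}) z *\<^sub>R Vl g k z - lq z * (indicator (space \<nu> \<times> {a k}) z *\<^sub>R V g k (snd z))) \<in> borel_measurable M0"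
  unfolding lq_def by (intro borel_measurable_diff borel_measurable_times 1 2 lamQ_meas)
 moreover have "indicator (space \<nu> \<times> {a k}) z *\<^sub>R Vl g k z - lq z * (indicator (space \<nu> \<times> {a k}) z *\<^sub>R V g k (snd z)) = indicator (space \<nu> \<times> {a k}) z *\<^sub>R Wf g k z" for z
  by (auto simp: indicator_def Wf_def)
 ultimately show "(%z. indicator (space \<nu> \<times> {a k}) z *\<^sub>R Wf g k z) \<in> borel_measurable M0" by (simp only:)
qed

text \<open>Splitting the new label: with probability \<open>rr False\<close> the point is a single event and the state stays;
with probability \<open>rr True\<close> it is a cluster event, which contributes the factor \<open>lam / lamQ\<close> and the new
status.  The latter two are what \<open>f_new\<close> collects.\<close>
lemma V_Suc:
 assumes k: "k < n"
 shows "V g (Suc k) (e k) = V g k (e k) * rr False (xx k)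
   + V (%y. f_new p g (fst (xx k)) (snd (xx k)) y * intensity lam (fst (xx k)) (snd (xx k)) y) k (e k) * (rr True (xx k) / lq (xx k))"
proof -
 let ?z = "xx k"
 have ek: "e k = snd ?z" using k by (simp add: piece_def)
 have step: "g (Gam d0 xx (None # ls)) * wt d0 xx (None # ls) (e k) + g (Gam d0 xx (Some True # ls)) * wt d0 xx (Some True # ls) (e k)
    + g (Gam d0 xx (Some False # ls)) * wt d0 xx (Some False # ls) (e k)
  = g (Gam d0 xx ls) * wt d0 xx ls (e k) * rr False ?z
   + f_new p g (fst ?z) (snd ?z) (Gam d0 xx ls) * intensity lam (fst ?z) (snd ?z) (Gam d0 xx ls) * wt d0 xx ls (e k) * (rr True ?z / lq ?z)"
  if l: "length ls = k" for d0 ls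
 proof -
  have E1: "Ex d0 xx (b # ls) (snd ?z) = 1" for b
   using l by (simp add: Ex_def set_integrable_def set_lebesgue_integral_def)
  have al: "alpha (Gam d0 xx ls) = of_bool (stat d0 ls)"
   unfolding alpha_def using status_Gam[OF gX, of ls d0] l k by simp
  have li: "lamh d0 xx ls ?z = intensity lam (fst ?z) (snd ?z) (Gam d0 xx ls)" by (rule lamh_intensity) (use l k in simp)
  have wN: "wt d0 xx (None # ls) (e k) = wt d0 xx ls (e k) * rr False ?z"
   unfolding ek using l E1[of None] by (simp add: wt_def lk_def)
  have wS: "wt d0 xx (Some d # ls) (e k) = wt d0 xx ls (e k) * (rr True ?z / lq ?z) * lamh d0 xx ls ?z * tr p (stat d0 ls) d" for d
   unfolding ek using l E1[of "Some d"] by (simp add: wt_def lk_def lq_def)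
  have fn: "f_new p g (fst ?z) (snd ?z) (Gam d0 xx ls)
   = g (Gam d0 xx (Some True # ls)) * tr p (stat d0 ls) True + g (Gam d0 xx (Some False # ls)) * tr p (stat d0 ls) False"
   using l by (simp add: f_new_def al tr_def algebra_simps)
  show ?thesis unfolding wN wS fn li[symmetric] by (simp add: algebra_simps)
 qed
 have "V g (Suc k) (e k) = (\<Sum>(d0, ls)\<in>hist k. g (Gam d0 xx (None # ls)) * wt d0 xx (None # ls) (e k)
   + g (Gam d0 xx (Some True # ls)) * wt d0 xx (Some True # ls) (e k) + g (Gam d0 xx (Some False # ls)) * wt d0 xx (Some False # ls) (e k))"
  unfolding V_def by (rule sum_hist_Suc)
 also have "\<dots> = (\<Sum>(d0, ls)\<in>hist k. g (Gam d0 xx ls) * wt d0 xx ls (e k) * rr False ?z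
   + f_new p g (fst ?z) (snd ?z) (Gam d0 xx ls) * intensity lam (fst ?z) (snd ?z) (Gam d0 xx ls) * wt d0 xx ls (e k) * (rr True ?z / lq ?z))"
 proof (rule sum.cong[OF refl])
  fix l assume "l \<in> hist k"
  then have "length (snd l) = k" by (auto simp: hist_def)
  from step[OF this, of "fst l"]
  show "(case l of (d0, ls) => g (Gam d0 xx (None # ls)) * wt d0 xx (None # ls) (e k)
   + g (Gam d0 xx (Some True # ls)) * wt d0 xx (Some True # ls) (e k) + g (Gam d0 xx (Some False # ls)) * wt d0 xx (Some False # ls) (e k))
   = (case l of (d0, ls) => g (Gam d0 xx ls) * wt d0 xx ls (e k) * rr False ?z
   + f_new p g (fst ?z) (snd ?z) (Gam d0 xx ls) * intensity lam (fst ?z) (snd ?z) (Gam d0 xx ls) * wt d0 xx ls (e k) * (rr True ?z / lq ?z))"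
   unfolding case_prod_beta .
 qed
 finally show ?thesis unfolding V_def case_prod_beta' sum.distrib sum_distrib_right[symmetric] .
qed

definition Jphi :: "('e state => real) => nat => real" where
 "Jphi g k = V (%y. f_new p g (fst (xx k)) (snd (xx k)) y * (intensity lam (fst (xx k)) (snd (xx k)) y / lamQ (fst (xx k)) (snd (xx k))) - g y) k (e k)
   * (lamQ (fst (xx k)) (snd (xx k)) / (lamQ (fst (xx k)) (snd (xx k)) + gam (fst (xx k)) (snd (xx k))))"

lemma V_jump: assumes k: "k < n" shows "V g (Suc k) (e k) = V g k (e k) + Jphi g k"
proof -
 note pos = M0_pos[OF pt_spaceX[OF k]]
 have rF: "rr False (xx k) = 1 - rr True (xx k)" using pos by (simp add: rr_def field_simps)
 have "Jphi g k = (V (%y. f_new p g (fst (xx k)) (snd (xx k)) y * intensity lam (fst (xx k)) (snd (xx k)) y) k (e k) * (1 / lq (xx k)) - V g k (e k)) * rr True (xx k)"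
 proof -
  have "(%y. f_new p g (fst (xx k)) (snd (xx k)) y * (intensity lam (fst (xx k)) (snd (xx k)) y / lamQ (fst (xx k)) (snd (xx k))) - g y)
   = (%y. f_new p g (fst (xx k)) (snd (xx k)) y * intensity lam (fst (xx k)) (snd (xx k)) y * (1 / lq (xx k)) - g y)"
   by (simp add: lq_def)
  then have "V (%y. f_new p g (fst (xx k)) (snd (xx k)) y * (intensity lam (fst (xx k)) (snd (xx k)) y / lamQ (fst (xx k)) (snd (xx k))) - g y) k (e k)
   = V (%y. f_new p g (fst (xx k)) (snd (xx k)) y * intensity lam (fst (xx k)) (snd (xx k)) y) k (e k) * (1 / lq (xx k)) - V g k (e k)"
   by (simp only: V_diff V_mult[of _ "1 / lq (xx k)"])
  moreover have "rr True (xx k) = lamQ (fst (xx k)) (snd (xx k)) / (lamQ (fst (xx k)) (snd (xx k)) + gam (fst (xx k)) (snd (xx k)))"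
   by (simp add: rr_def)
  ultimately show ?thesis unfolding Jphi_def by (simp only:)
 qed
 then show ?thesis unfolding V_Suc[OF k] rF by (simp add: algebra_simps)
qed

lemma phi_equation:
 assumes t: "0 <= t" "t <= T"
 shows "set_integrable M0 (space \<nu> \<times> {0..t}) (%z. Wf g (kk (snd z)) z)"
  and "V g (kk t) t = V g 0 0 - (LINT z:space \<nu> \<times> {0..t}|M0. Wf g (kk (snd z)) z) + (\<Sum>j<kk t. Jphi g j)"
 by (rule piecewise_equation[OF V_prim slice_meas(3) V_jump t], assumption+)+

subsection \<open>Normalisation\<close>

context
 assumes pos: "V (%_. 1) n T \<noteq> 0"
begin

lemma wt_nonneg: "length ls <= n ==> 0 <= wt d0 xx ls s"
proof -
 assume l: "length ls <= n"
 have "0 <= prior d0 xx ls"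
  unfolding prior_eq_prod using xx_space[OF l] pD_nonneg trw_nonneg rr_nonneg by (intro mult_nonneg_nonneg prod_nonneg) auto
 then show ?thesis unfolding wt_def using lk_nonneg[OF xx_space[OF l]] by simp
qed

text \<open>If the total mass vanished at some time, all weights would vanish.  As exponentials of finite
exponents are positive, each history would then have \<open>prior\<close> or \<open>ell\<close> equal to 0, and so would all its
prolongations: mass that is lost never comes back.\<close>
lemma V1_pos:
 assumes k: "k <= n" and s: "a k <= s" "s <= e k" shows "0 < V (%_. 1) k s"
proof (rule ccontr)
 assume "\<not> 0 < V (%_. 1) k s"
 moreover have nn: "0 <= wt (fst l) xx (snd l) s" if "l \<in> hist k" for l using that k by (intro wt_nonneg) (auto simp: hist_def)
 moreover have "V (%_. 1) k s = (\<Sum>l\<in>hist k. wt (fst l) xx (snd l) s)" by (simp add: V_def case_prod_beta')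
 ultimately have "(\<Sum>l\<in>hist k. wt (fst l) xx (snd l) s) = 0" using sum_nonneg[of "hist k" "%l. wt (fst l) xx (snd l) s"] by simp
 then have z: "wt (fst l) xx (snd l) s = 0" if "l \<in> hist k" for l using that nn by (simp add: sum_nonneg_eq_0_iff)
 have pe: "prior d0 xx ls * ell d0 xx ls = 0" if l: "length ls = k" for d0 ls
 proof (cases "prior d0 xx ls = 0")
  case False
  have "0 < Ex d0 xx ls s"
   using Ex_primitive(3)[OF xx_space a_nonneg a_le_e int_piece[OF _ False], of s] l k s by simp
  then show ?thesis using z[of "(d0, ls)"] l by (simp add: wt_def lk_def)
 qed simp
 have all: "prior d0 xx ls * ell d0 xx ls = 0" if "k <= length ls" for d0 ls
  using that
 proof (induction ls)
  case Nil then show ?case using pe[of "[]"] by simp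
 next
  case (Cons b ls)
  show ?case
  proof (cases "k <= length ls")
   case True
   then have "prior d0 xx ls = 0 \<or> ell d0 xx ls = 0" using Cons by simp
   then show ?thesis by auto
  next
   case False
   then show ?thesis using Cons(2) pe[of "b # ls"] by simp
  qed
 qed
 have "V (%_. 1) n T = 0" unfolding V_def
 proof (rule sum.neutral, rule ballI)
  fix l assume "l \<in> hist n"
  then have "prior (fst l) xx (snd l) * ell (fst l) xx (snd l) = 0" using k by (intro all) (auto simp: hist_def)
  then show "(case l of (d0, ls) => 1 * wt d0 xx ls T) = 0" by (auto simp: wt_def lk_def case_prod_beta')
 qed
 then show False using pos by simp
qed

text \<open>The normalised filter, and below the integrand and the jumps of the second filtering equation.\<close>
definition R :: "('e state => real) => nat => real => real" where
 "R g k s = V g k s / V (%_. 1) k s"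

definition WR :: "('e state => real) => nat => 'e \<times> real => real" where
 "WR g k z = Vl g k z / V (%_. 1) k (snd z) - R g k (snd z) * (Vl (%_. 1) k z / V (%_. 1) k (snd z))"

lemma R_prim:
 assumes k: "k <= n" shows "primitive \<nu> (a k) (e k) (%z. - WR g k z) (R g k)"
proof -
 have p1: "0 < V (%_. 1) k s" if "s \<in> {a k..e k}" for s using V1_pos[OF k] that by simp
 note I = primitive_inverse[OF V_prim[OF k] a_le_e[OF k] a_nonneg[OF k] p1]
 show ?thesis
 proof (rule primitive_cong[OF primitive_mult[OF V_prim[OF k] I a_le_e[OF k] a_nonneg[OF k]]])
  fix z assume "z \<in> strip \<nu> (a k) (e k)"
  then have "0 < V (%_. 1) k (snd z)" by (intro p1) (auto simp: strip_def)
  then show "- Wf g k z * inverse (V (%_. 1) k (snd z)) + V g k (snd z) * (- Wf (%_. 1) k z * (- (1 / (V (%_. 1) k (snd z))\<^sup>2))) = - WR g k z"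
   by (simp add: Wf_def WR_def R_def field_simps power2_eq_square)
 next
  fix t show "V g k t * inverse (V (%_. 1) k t) = R g k t" unfolding R_def by (rule divide_inverse[symmetric])
 qed
qed

lemma R_continuous: "k <= n ==> continuous_on {a k..e k} (R g k)"
 by (rule primitive_continuous[OF R_prim a_nonneg])

lemma WR_slice:
 assumes k: "k <= n" shows "(%z. indicator (space \<nu> \<times> {a k}) z *\<^sub>R WR g k z) \<in> borel_measurable M0"
proof -
 let ?i = "%z. indicator (space \<nu> \<times> {a k}) z :: real"
 note [measurable] = slice_meas(1)[OF k, of g] slice_meas(1)[OF k, of "%_. 1"] slice_meas(2)[OF k, of g] slice_meas(2)[OF k, of "%_. 1"]
 have "(%z. (?i z *\<^sub>R Vl g k z) / (?i z *\<^sub>R V (%_. 1) k (snd z)) - (?i z *\<^sub>R V g k (snd z)) / (?i z *\<^sub>R V (%_. 1) k (snd z)) * ((?i z *\<^sub>R Vl (%_. 1) k z) / (?i z *\<^sub>R V (%_. 1) k (snd z)))) \<in> borel_measurable M0"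
  by measurable
 moreover have "(?i z *\<^sub>R Vl g k z) / (?i z *\<^sub>R V (%_. 1) k (snd z)) - (?i z *\<^sub>R V g k (snd z)) / (?i z *\<^sub>R V (%_. 1) k (snd z)) * ((?i z *\<^sub>R Vl (%_. 1) k z) / (?i z *\<^sub>R V (%_. 1) k (snd z))) = ?i z *\<^sub>R WR g k z" for z
  by (auto simp: indicator_def WR_def R_def)
 ultimately show ?thesis by (simp only:)
qed

definition JR :: "('e state => real) => nat => real" where
 "JR g k = (R (%y. f_new p g (fst (xx k)) (snd (xx k)) y * intensity lam (fst (xx k)) (snd (xx k)) y) k (e k)
   - R (intensity lam (fst (xx k)) (snd (xx k))) k (e k) * R g k (e k))
   / R (%y. intensity lam (fst (xx k)) (snd (xx k)) y + gam (fst (xx k)) (snd (xx k))) k (e k)"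

text \<open>The factor \<open>1 / (lamQ + gam)\<close> of the jump of the unnormalised filter cancels in the quotient; this is
why the reference intensity does not occur in the second filtering equation.\<close>
lemma R_jump: assumes k: "k < n" shows "R g (Suc k) (e k) = R g k (e k) + JR g k"
proof -
 let ?z = "xx k"
 let ?l = "lamQ (fst ?z) (snd ?z)" and ?g = "gam (fst ?z) (snd ?z)"
 let ?S = "?l + ?g"
 let ?I = "intensity lam (fst ?z) (snd ?z)"
 let ?fn = "V (%y. f_new p g (fst ?z) (snd ?z) y * ?I y) k (e k)"
 let ?A = "V g k (e k)" and ?B = "V (%_. 1) k (e k)" and ?L = "V ?I k (e k)"
 note ps = M0_pos[OF pt_spaceX[OF k]]
 have S: "0 < ?S" using ps by simp
 have B: "0 < ?B" by (rule V1_pos) (use k a_le_e[of k] in auto)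
 have B': "0 < V (%_. 1) (Suc k) (e k)"
  by (rule V1_pos) (use k a_le_e[of "Suc k"] e_eq_a[OF k] in auto)
 have f1: "f_new p (%_. 1) u s y = 1" for u s y by (simp add: f_new_def algebra_simps)
 have up: "V h (Suc k) (e k) = (?g * V h k (e k) + V (%y. f_new p h (fst ?z) (snd ?z) y * ?I y) k (e k)) / ?S" for h
  unfolding V_Suc[OF k] using ps S by (simp add: rr_def lq_def add_divide_distrib)
 have one: "V (%_. 1) (Suc k) (e k) = (?g * ?B + ?L) / ?S" unfolding up f1 by simp
 have G: "0 < ?g * ?B + ?L" using B' S unfolding one by (simp add: zero_less_divide_iff)
 have Rg: "R (%y. ?I y + ?g) k (e k) = (?L + ?g * ?B) / ?B"
 proof -
  have "V (%y. ?I y + ?g) k (e k) = ?L + V (%_. 1 * ?g) k (e k)" unfolding V_add by simp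
  also have "V (%_. 1 * ?g) k (e k) = ?B * ?g" by (rule V_mult)
  finally show ?thesis by (simp add: R_def mult.commute)
 qed
 have "R g (Suc k) (e k) = (?g * ?A + ?fn) / (?g * ?B + ?L)"
  unfolding R_def one unfolding up using S by simp
 also have "\<dots> = ?A / ?B + (?fn / ?B - ?L / ?B * (?A / ?B)) / ((?L + ?g * ?B) / ?B)"
 proof -
  have "?fn / ?B - ?L / ?B * (?A / ?B) = (?fn - ?L * (?A / ?B)) / ?B" by (simp only: diff_divide_distrib times_divide_eq_left)
  then have 1: "(?fn / ?B - ?L / ?B * (?A / ?B)) / ((?L + ?g * ?B) / ?B) = (?fn - ?L * (?A / ?B)) / (?g * ?B + ?L)"
   using B by (simp add: add.commute)
  have 2: "?A / ?B + (?fn - ?L * (?A / ?B)) / (?g * ?B + ?L) = ((?A / ?B) * (?g * ?B + ?L) + (?fn - ?L * (?A / ?B))) / (?g * ?B + ?L)"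
   using G by (simp add: add_divide_distrib)
  have 3: "(?A / ?B) * (?g * ?B + ?L) + (?fn - ?L * (?A / ?B)) = ?g * ?A + ?fn"
   using B by (simp add: distrib_left)
  show ?thesis unfolding 1 2 3 by (rule refl)
 qed
 finally show ?thesis unfolding JR_def Rg unfolding R_def .
qed

lemma pi_equation:
 assumes t: "0 <= t" "t <= T"
 shows "set_integrable M0 (space \<nu> \<times> {0..t}) (%z. WR g (kk (snd z)) z)"
  and "R g (kk t) t = R g 0 0 - (LINT z:space \<nu> \<times> {0..t}|M0. WR g (kk (snd z)) z) + (\<Sum>j<kk t. JR g j)"
 by (rule piecewise_equation[OF R_prim WR_slice R_jump t], assumption+)+

end

lemma phiS_V:
 assumes s: "0 <= s" "s <= T" shows "phiS s g {#x \<in># X. snd x <= s#} = V g (kk s) s"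
proof -
 let ?X = "{#x \<in># X. snd x <= s#}"
 have "phiS s g ?X = (\<Sum>(d0, ls)\<in>hist (kk s). g (Gam d0 (pt ?X) ls) * wt d0 (pt ?X) ls s)"
  using good_upto[OF gX, of s] by (simp add: phiS_def counter_def)
 also have "\<dots> = V g (kk s) s" unfolding V_def
 proof (rule sum.cong[OF refl])
  fix l assume "l \<in> hist (kk s)"
  then have "length (snd l) = size ?X" by (auto simp: hist_def counter_def)
  then have "\<forall>k<length (snd l). pt ?X k = xx k" using pt_upto[OF gX] by simp
  note c = hist_cong[OF this]
  show "(case l of (d0, ls) => g (Gam d0 (pt ?X) ls) * wt d0 (pt ?X) ls s) = (case l of (d0, ls) => g (Gam d0 xx ls) * wt d0 xx ls s)"
   unfolding case_prod_beta c(1) c(5) by (rule refl)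
 qed
 finally show ?thesis .
qed

end

section \<open>Existence of the filters\<close>

context cluster_model
begin

lemma prior_nonneg: "\<forall>k<length ls. x k \<in> space M0 ==> 0 <= prior d0 x ls"
 unfolding prior_eq_prod using pD_nonneg trw_nonneg rr_nonneg by (intro mult_nonneg_nonneg prod_nonneg) auto

lemma exprod_measurable: "length ls <= n ==> (%X. exprod d0 (pt X) ls) \<in> borel_measurable (good_space \<nu> n)"
proof (induction ls)
 case (Cons a ls)
 then have k: "length ls < n" by simp
 have [measurable]: "(%X. exprod d0 (pt X) ls) \<in> borel_measurable (good_space \<nu> n)" using Cons by simp
 have [measurable]: "(%X. Ex d0 (pt X) ls (snd (pt X (length ls)))) \<in> borel_measurable (good_space \<nu> n)"
  by (rule Ex_measurable) (use k measurable_compose[OF pt_measurable[OF k, of \<nu>] measurable_snd_mark_time] in simp_all)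
 show ?case by simp
qed simp

lemma label_exprod_nonzero:
 assumes w: "w \<in> space Q" and t: "0 <= t" and li: "lamint_path w" and ev: "label_event t d0 ls w"
 shows "exprod d0 (pt (Y t w)) ls * Ex d0 (pt (Y t w)) ls t \<noteq> 0"
proof -
 let ?x = "pt (Y t w)" and ?n = "size (Y t w)"
 have g: "good (Y t w)" and ls: "labs t w ?n = ls" and d0: "D 0 w = d0"
  using ev by (auto simp: label_event_def)
 have pos: "Ex d0 ?x (labs t w k) (piece_end (Y t w) t k) \<noteq> 0" if "k <= ?n" for k
  using lamh_piece_integrable[OF w t g that li] unfolding d0 by (simp add: Ex_def)
 have "exprod d0 ?x (labs t w k) \<noteq> 0" if "k <= ?n" for k
  using that
 proof (induction k)
  case (Suc k)
  then have "piece_end (Y t w) t k = snd (?x k)" by (simp add: piece_end_def)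
  then show ?case using Suc pos[of k] by simp
 qed simp
 from this[of ?n] pos[of ?n] show ?thesis unfolding ls by (simp add: piece_end_def)
qed

text \<open>Finiteness is assumed for the true history only.  But the conditional law of the true history has
the weights \<open>prior\<close>, so a history with positive prior and divergent intensity would be the true one
with positive probability.\<close>
lemma AE_intok:
 assumes t: "0 <= t" shows "AE w in Q. intok t (Y t w)"
proof -
 \<comment> \<open>indicates the observations for which the intensity along the history \<open>d0, ls\<close> diverges\<close>
 define K where "K d0 ls X = (if good X \<and> size X = length ls then if exprod d0 (pt X) ls * Ex d0 (pt X) ls t = 0 then 1 else 0 else 0 :: ennreal)"
  for d0 ls and X :: "('e \<times> real) multiset"
 have Km[measurable]: "K d0 ls \<in> borel_measurable S0" for d0 ls
  unfolding K_def
 proof (rule borel_measurable_good_space)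
  note [measurable] = exprod_measurable[of ls "length ls" d0] Ex_measurable[of ls "length ls" "%_. t" d0]
  show "(%X. if exprod d0 (pt X) ls * Ex d0 (pt X) ls t = 0 then 1 else 0 :: ennreal) \<in> borel_measurable (good_space \<nu> (length ls))"
   by measurable
 qed
 note Ym[measurable] = Y_measurable[OF t]
 have "AE w in Q. (if has_pts t (length ls) w then ennreal (prior d0 (pt (Y t w)) ls) * K d0 ls (Y t w) else 0) = 0" for d0 ls
 proof -
  have "(\<integral>\<^sup>+w. (if label_event t d0 ls w then K d0 ls (Y t w) else 0) \<partial>Q) = (\<integral>\<^sup>+w. 0 \<partial>Q)"
  proof (rule nn_integral_cong_AE)
   show "AE w in Q. (if label_event t d0 ls w then K d0 ls (Y t w) else 0) = 0"
    using AE_paths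
   proof (rule AE_mp, intro AE_I2 impI)
    fix w assume "w \<in> space Q" "lamint_path w \<and> Leq_path w"
    then show "(if label_event t d0 ls w then K d0 ls (Y t w) else 0) = 0"
     using label_exprod_nonzero[OF _ t] by (auto simp: K_def)
   qed
  qed
  then have z: "(\<integral>\<^sup>+w. (if has_pts t (length ls) w then ennreal (prior d0 (pt (Y t w)) ls) * K d0 ls (Y t w) else 0) \<partial>Q) = 0"
   unfolding label_law[OF t Km] by simp
  have "(%X. if good X \<and> size X = length ls then ennreal (prior d0 (pt X) ls) else 0) \<in> borel_measurable S0"
   by (rule borel_measurable_good_space) (use prior_measurable[of ls "length ls" d0] in simp)
  note [measurable] = measurable_compose[OF Ym this] measurable_compose[OF Ym Km]
  have "(%w. (if has_pts t (length ls) w then ennreal (prior d0 (pt (Y t w)) ls) else 0) * K d0 ls (Y t w)) \<in> borel_measurable Q"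
   by measurable
  moreover have "(if has_pts t (length ls) w then ennreal (prior d0 (pt (Y t w)) ls) else 0) * K d0 ls (Y t w)
   = (if has_pts t (length ls) w then ennreal (prior d0 (pt (Y t w)) ls) * K d0 ls (Y t w) else 0)" for w by auto
  ultimately have "(%w. if has_pts t (length ls) w then ennreal (prior d0 (pt (Y t w)) ls) * K d0 ls (Y t w) else 0) \<in> borel_measurable Q"
   by (simp only:)
  from nn_integral_0_iff_AE[OF this] z show ?thesis by blast
 qed
 then have z: "AE w in Q. \<forall>l. (if good (Y t w) \<and> size (Y t w) = length (snd l) then ennreal (prior (fst l) (pt (Y t w)) (snd l)) * K (fst l) (snd l) (Y t w) else 0) = 0"
  unfolding AE_all_countable by blast
 show ?thesis
 proof (rule AE_mp[OF z], rule AE_mp[OF AE_good[OF t]], intro AE_I2 impI)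
  fix w assume w: "w \<in> space Q" and g: "good (Y t w)"
   and z: "\<forall>l. (if good (Y t w) \<and> size (Y t w) = length (snd l) then ennreal (prior (fst l) (pt (Y t w)) (snd l)) * K (fst l) (snd l) (Y t w) else 0) = 0"
  show "intok t (Y t w)" unfolding intok_def
  proof (intro ballI, clarify)
   fix d0 ls assume ls: "(d0, ls) \<in> hist (size (Y t w))" and p: "prior d0 (pt (Y t w)) ls \<noteq> 0"
    and b: "exprod d0 (pt (Y t w)) ls * Ex d0 (pt (Y t w)) ls t = 0"
   have "0 <= prior d0 (pt (Y t w)) ls" by (rule prior_nonneg) (use ls pt_space[OF w t g] in auto)
   moreover have "ennreal (prior d0 (pt (Y t w)) ls) = 0" using z[rule_format, of "(d0, ls)"] g ls b by (simp add: K_def)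
   ultimately show False using p by (simp add: ennreal_eq_0_iff)
  qed
 qed
qed

lemma pred_intok: "Measurable.pred S0 (%X. good X \<and> intok t X)"
proof -
 let ?b = "%n X. \<forall>l\<in>hist n. prior (fst l) (pt X) (snd l) \<noteq> 0 \<longrightarrow> exprod (fst l) (pt X) (snd l) * Ex (fst l) (pt X) (snd l) t \<noteq> 0"
 have m: "Measurable.pred (good_space \<nu> n) (?b n)" for n
 proof (rule pred_intros_finite(3))
  fix l assume "l \<in> hist n"
  then have l: "length (snd l) <= n" by (auto simp: hist_def)
  note [measurable] = prior_measurable[OF l, of "fst l"] exprod_measurable[OF l, of "fst l"] Ex_measurable[OF l, of "%_. t" "fst l"]
  show "Measurable.pred (good_space \<nu> n) (%X. prior (fst l) (pt X) (snd l) \<noteq> 0 \<longrightarrow> exprod (fst l) (pt X) (snd l) * Ex (fst l) (pt X) (snd l) t \<noteq> 0)"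
   by measurable
 qed simp
 have "(%X. if ?b n X then 1 else 0 :: real) \<in> borel_measurable (good_space \<nu> n)" for n
  by (rule measurable_If[OF measurable_const measurable_const m[unfolded pred_def]]) simp_all
 from borel_measurable_good_space[OF this]
 have "(%X. if good X \<and> size X = n then if ?b n X then 1 else 0 else 0 :: real) \<in> borel_measurable S0" for n .
 from measurable_compose_countable[OF this measurable_size_mset]
 have "(%X. if good X \<and> size X = size X then if ?b (size X) X then 1 else 0 else 0 :: real) \<in> borel_measurable S0" .
 then have "Measurable.pred S0 (%X. (if good X \<and> size X = size X then if ?b (size X) X then 1 else 0 else 0 :: real) = 1)" by measurable
 moreover have "((if good X \<and> size X = size X then if ?b (size X) X then 1 else 0 else 0 :: real) = 1) = (good X \<and> intok t X)" for X
  by (auto simp: intok_def case_prod_beta')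
 ultimately show ?thesis by (simp only:)
qed

subsection \<open>Passing to the model measure\<close>

lemma space_P: "space P = space Q" by (rule sets_eq_imp_space_eq[OF sets_P])

lemma subalgebra_P: "subalgebra Q G ==> subalgebra P G" unfolding subalgebra_def sets_P space_P .

text \<open>The density \<open>L t\<close> is available on \<open>F t\<close> only; \<open>P\<close> need not be absolutely continuous with respect to \<open>Q\<close>
on the whole sigma-algebra.  Hence the measurability assumption here and in the next lemma.\<close>
lemma nn_integral_P:
 assumes t: "0 <= t" and f: "f \<in> borel_measurable (F t)"
 shows "(\<integral>\<^sup>+w. f w \<partial>P) = (\<integral>\<^sup>+w. f w * ennreal (L t w) \<partial>Q)"
proof -
 note sub = subalgebra_F[OF t]
 have Lm: "L t \<in> borel_measurable (F t)" using L_martingale t by (simp add: martingale_def)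
 have "(\<integral>\<^sup>+w. f w \<partial>P) = (\<integral>\<^sup>+w. f w \<partial>restr_to_subalg P (F t))"
  by (rule nn_integral_subalgebra2[OF subalgebra_P[OF sub] f, symmetric])
 also have "\<dots> = (\<integral>\<^sup>+w. ennreal (L t w) * f w \<partial>restr_to_subalg Q (F t))"
  unfolding P_density[OF t]
  by (rule nn_integral_density) (use Lm f in \<open>auto intro!: measurable_in_subalg[OF sub]\<close>)
 also have "\<dots> = (\<integral>\<^sup>+w. ennreal (L t w) * f w \<partial>Q)"
  by (rule nn_integral_subalgebra2[OF sub]) (use Lm f in measurable)
 finally show ?thesis by (simp add: mult.commute)
qed

lemma AE_P_of_Q:
 assumes t: "0 <= t" and R: "Measurable.pred (F t) R" and ae: "AE w in Q. R w"
 shows "AE w in P. R w"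
proof -
 let ?f = "%w. if R w then 0 else 1 :: ennreal"
 have fm: "?f \<in> borel_measurable (F t)"
  by (rule measurable_If[OF measurable_const measurable_const R[unfolded pred_def]]) simp_all
 have "(\<integral>\<^sup>+w. ?f w \<partial>P) = (\<integral>\<^sup>+w. ?f w * ennreal (L t w) \<partial>Q)" by (rule nn_integral_P[OF t fm])
 also have "\<dots> = (\<integral>\<^sup>+w. 0 \<partial>Q)" by (rule nn_integral_cong_AE) (use ae in \<open>eventually_elim, simp\<close>)
 finally have "(\<integral>\<^sup>+w. ?f w \<partial>P) = 0" by simp
 then have "AE w in P. ?f w = 0"
  using nn_integral_0_iff_AE[OF measurable_from_subalg[OF subalgebra_P[OF subalgebra_F[OF t]] fm]] by simp
 then show ?thesis by eventually_elim (auto split: if_splits)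
qed

lemma AE_P_obs:
 assumes t: "0 <= t" and R: "Measurable.pred S0 R" and ae: "AE w in Q. R (Y t w)"
 shows "AE w in P. R (Y t w)"
 by (rule AE_P_of_Q[OF t measurable_compose[OF Y_measurable_F[OF t] R] ae])

lemma AE_L_nonneg: assumes t: "0 <= t" shows "AE w in Q. 0 <= L t w"
proof (rule AE_mp[OF AE_paths], rule AE_mp[OF AE_good[OF t]], intro AE_I2 impI)
 fix w assume w: "w \<in> space Q" and g: "good (Y t w)" and p: "lamint_path w \<and> Leq_path w"
 show "0 <= L t w" unfolding L_path[OF w t g conjunct1[OF p] conjunct2[OF p]]
  by (rule lk_nonneg) (use pt_space[OF w t g] in auto)
qed

text \<open>Countably many observable conditions, which imply that the pathwise calculus works on every bounded
time interval.\<close>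
definition good_path :: "'w => bool" where
 "good_path w \<longleftrightarrow> (\<forall>m::nat. good (Y (real m) w) \<and> intok (real m) (Y (real m) w))"

lemma AE_good_path: "AE w in Q. good_path w" "AE w in P. good_path w"
proof -
 have 1: "AE w in Q. good (Y (real m) w) \<and> intok (real m) (Y (real m) w)" for m
  using AE_good[OF of_nat_0_le_iff] AE_intok[OF of_nat_0_le_iff] by eventually_elim simp
 then show "AE w in Q. good_path w" unfolding good_path_def AE_all_countable by blast
 have "AE w in P. good (Y (real m) w) \<and> intok (real m) (Y (real m) w)" for m
  by (rule AE_P_obs[OF _ pred_intok 1]) simp
 then show "AE w in P. good_path w" unfolding good_path_def AE_all_countable by blast
qed

lemma good_path_filter_path:
 assumes "w \<in> space Q" "good_path w"
 shows "filter_path Q F P \<nu> p gam lamQ N C I D lam L (Y (real m) w) (real m)"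
proof (unfold_locales)
 show "good (Y (real m) w)" "intok (real m) (Y (real m) w)" using assms(2) by (auto simp: good_path_def)
 show "set_mset (Y (real m) w) \<subseteq> space M0" by (rule Y_space[OF assms(1)]) simp
 fix x assume "x \<in># Y (real m) w"
 then have "x \<in># {#x \<in># Y (real m) w. snd x <= real m#}" by (simp only: Y_upto(1)[OF assms(1) order_refl, symmetric])
 then show "snd x <= real m" by simp
qed simp

lemma good_path_upto: assumes "w \<in> space Q" "good_path w" shows "good (Y t w)"
proof -
 obtain m where m: "t <= real m" using real_arch_simple by blast
 show ?thesis unfolding Y_upto(1)[OF assms(1) m] by (rule good_upto) (use assms(2) in \<open>simp add: good_path_def\<close>)
qed

subsection \<open>Algebra of the explicit filter\<close>

lemma phiS_diff: "phiS t (%y. g y - h y) X = phiS t g X - phiS t h X"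
 by (simp add: phiS_def case_prod_beta' sum_subtractf left_diff_distrib)

lemma phiS_pos_neg: "phiS t g X = phiS t (%y. max 0 (g y)) X - phiS t (%y. max 0 (- g y)) X"
proof -
 have "g = (%y. max 0 (g y) - max 0 (- g y))" by (auto simp: max_def)
 then show ?thesis unfolding phiS_diff[symmetric] by simp
qed

text \<open>All weights are non-negative, so a vanishing total mass forces each of them to vanish.\<close>
lemma phiS_eq_0:
 assumes X: "X \<in> space S0" and z: "phiS t (%_. 1) X = 0" shows "phiS t g X = 0"
proof (cases "good X")
 case True
 have "0 <= wt d0 (pt X) ls t" if "length ls = size X" for d0 ls
 proof -
  have "\<forall>k<length ls. pt X k \<in> space M0" using X pt_in(1)[OF True] that by (auto simp: space_mset_space)
  then show ?thesis unfolding wt_def using prior_nonneg lk_nonneg by simp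
 qed
 then have nn: "0 <= wt (fst l) (pt X) (snd l) t" if "l \<in> hist (size X)" for l using that by (auto simp: hist_def)
 have "(\<Sum>l\<in>hist (size X). wt (fst l) (pt X) (snd l) t) = 0" using z True by (simp add: phiS_def case_prod_beta')
 then have "wt (fst l) (pt X) (snd l) t = 0" if "l \<in> hist (size X)" for l using that nn by (simp add: sum_nonneg_eq_0_iff)
 then show ?thesis by (simp add: phiS_def case_prod_beta')
qed (simp add: phiS_def)

text \<open>The points of a history are distinct, so their statuses are a function of the point.\<close>
lemma Gam_compatible:
 assumes g: "good X"
 shows "length ls <= size X ==> Gam d0 (pt X) ls \<in> compatible X"
proof -
 have "\<exists>d \<eta>. Gam d0 (pt X) ls = (add_mset (d0, 0) (image_mset (%x. (d x, snd x)) \<eta>), \<eta>) \<and> \<eta> \<subseteq># image_mset (pt X) (mset_set {..<length ls})"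
  if "length ls <= size X" for ls
  using that
 proof (induction ls)
  case (Cons b ls)
  let ?k = "length ls"
  from Cons obtain d \<eta> where e: "Gam d0 (pt X) ls = (add_mset (d0, 0) (image_mset (%x. (d x, snd x)) \<eta>), \<eta>)"
   and s: "\<eta> \<subseteq># image_mset (pt X) (mset_set {..<?k})" by auto
  have up: "image_mset (pt X) (mset_set {..<length (b # ls)}) = add_mset (pt X ?k) (image_mset (pt X) (mset_set {..<?k}))"
   by (simp add: lessThan_Suc)
  show ?case
  proof (cases b)
   case None
   have "\<eta> \<subseteq># image_mset (pt X) (mset_set {..<length (b # ls)})"
    unfolding up using s by (rule subset_mset.order_trans) simp
   then show ?thesis using e None by auto
  next
   case (Some c)
   have ni: "pt X ?k \<notin># \<eta>"
   proof
    assume "pt X ?k \<in># \<eta>"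
    then have "pt X ?k \<in> pt X ` {..<?k}" using s by (auto dest: mset_subset_eqD)
    then obtain j where "j < ?k" "pt X ?k = pt X j" by auto
    then show False using pt_inj[OF g, of ?k j] Cons(2) by auto
   qed
   have im: "image_mset (%x. ((d(pt X ?k := c)) x, snd x)) \<eta> = image_mset (%x. (d x, snd x)) \<eta>"
    using ni by (intro image_mset_cong) auto
   have "Gam d0 (pt X) (b # ls) = (add_mset (d0, 0) (image_mset (%x. ((d(pt X ?k := c)) x, snd x)) (add_mset (pt X ?k) \<eta>)), add_mset (pt X ?k) \<eta>)"
    using e Some by (simp add: im[simplified])
   moreover have "add_mset (pt X ?k) \<eta> \<subseteq># image_mset (pt X) (mset_set {..<length (b # ls)})"
    unfolding up using s by simp
   ultimately show ?thesis by blast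
  qed
 qed auto
 moreover assume l: "length ls <= size X"
 ultimately obtain d \<eta> where e: "Gam d0 (pt X) ls = (add_mset (d0, 0) (image_mset (%x. (d x, snd x)) \<eta>), \<eta>)"
  and s: "\<eta> \<subseteq># image_mset (pt X) (mset_set {..<length ls})" by blast
 have "image_mset (pt X) (mset_set {..<length ls}) \<subseteq># image_mset (pt X) (mset_set {..<size X})"
  using l by (intro image_mset_subseteq_mono subset_imp_msubset_mset_set) auto
 with s have "\<eta> \<subseteq># X" unfolding good_eq_pts[OF g, symmetric] by (rule subset_mset.order_trans)
 then show ?thesis unfolding compatible_def e by blast
qed

lemma phiX_support: "{y. phiX t X y \<noteq> 0} \<subseteq> compatible X"
proof
 fix y assume "y \<in> {y. phiX t X y \<noteq> 0}"
 then have g: "good X" and "(\<Sum>(d0, ls)\<in>hist (size X). if Gam d0 (pt X) ls = y then wt d0 (pt X) ls t else 0) \<noteq> 0"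
  by (auto simp: phiX_def split: if_splits)
 then obtain l where "l \<in> hist (size X)" "Gam (fst l) (pt X) (snd l) = y"
  by (auto elim!: sum.not_neutral_contains_not_neutral split: if_splits)
 then show "y \<in> compatible X" using Gam_compatible[OF g, of "snd l" "fst l"] by (auto simp: hist_def)
qed

definition phiR :: "real => ('e \<times> real) multiset => 'e state => real" where
 "phiR t X y = phiX t X y / phiS t (%_. 1) X"

lemma weighted_sum_phiR: "weighted_sum (phiR t X) g = phiS t g X / phiS t (%_. 1) X"
proof (cases "phiS t (%_. 1) X = 0")
 case False
 then have "{y. phiR t X y \<noteq> 0} = {y. phiX t X y \<noteq> 0}" by (simp add: phiR_def)
 then have "weighted_sum (phiR t X) g = weighted_sum (phiX t X) g / phiS t (%_. 1) X"
  by (simp add: weighted_sum_def phiR_def sum_divide_distrib)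
 then show ?thesis by (simp add: weighted_sum_phiX)
qed (simp add: phiR_def weighted_sum_def)

lemma phiX_phiS: "phiX t X y = phiS t (%y'. if y' = y then 1 else 0) X"
 unfolding phiX_def phiS_def by (intro if_cong sum.cong refl) auto

end

context horizon
begin

text \<open>With the pieces open on the left: an observed time belongs to the piece that ends there, as is
appropriate for left limits.\<close>
lemma piece_of: assumes "0 < s" "s <= T" obtains k where "k <= n" "a k < s" "s <= e k"
proof (cases "a (kk s) < s")
 case True then show ?thesis using that[OF kk_le _ le_e_kk] assms by simp
next
 case False
 then have as: "a (kk s) = s" using a_kk[of s] assms by simp
 then obtain j where j: "kk s = Suc j" using assms by (cases "kk s") auto
 then have "j < n" using kk_le[of s] by simp
 from a_less_e[OF this] that[of j] e_eq_a[OF this] as j \<open>j < n\<close> show ?thesis by simp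
qed

end

context filter_path
begin

abbreviation "Xup s \<equiv> {#x \<in># X. snd x <= s#}"

lemma phiS_right:
 assumes s: "0 <= s" "s < T" shows "((%r. phiS r g (Xup r)) \<longlongrightarrow> phiS s g (Xup s)) (at_right s)"
proof -
 have "((%r. V g (kk r) r) \<longlongrightarrow> phiS s g (Xup s)) (at_right s)"
  unfolding phiS_V[OF s(1) less_imp_le[OF s(2)]] by (rule piecewise_right[OF V_continuous s])
 moreover have "eventually (%r. V g (kk r) r = phiS r g (Xup r)) (at_right s)"
  unfolding eventually_at_right_field
 proof (intro exI[of _ T] conjI allI impI)
  fix r assume "s < r" "r < T"
  then show "V g (kk r) r = phiS r g (Xup r)" using phiS_V[of r g] s by simp
 qed (rule s(2))
 ultimately show ?thesis by (rule Lim_transform_eventually)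
qed

lemma phiS_left:
 assumes k: "k <= n" and s: "a k < s" "s <= e k" shows "((%r. phiS r g (Xup r)) \<longlongrightarrow> V g k s) (at_left s)"
proof -
 have "((%r. V g (kk r) r) \<longlongrightarrow> V g k s) (at_left s)" by (rule piecewise_left[OF V_continuous k s])
 moreover have "eventually (%r. V g (kk r) r = phiS r g (Xup r)) (at_left s)"
  unfolding eventually_at_left_field
 proof (intro exI[of _ "a k"] conjI allI impI)
  fix r assume "a k < r" "r < s"
  then show "V g (kk r) r = phiS r g (Xup r)" using phiS_V[of r g] s(2) e_le_T[of k] a_nonneg[OF k] by simp
 qed (rule s(1))
 ultimately show ?thesis by (rule Lim_transform_eventually)
qed

end

text \<open>\<^const>\<open>real_cond_exp\<close> is defined through the positive and the negative part separately, and so is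
this characterisation; it covers functions that are not integrable.\<close>
lemma real_cond_exp_charact_pos_neg:
 assumes sub: "sigma_finite_subalgebra M G" and f[measurable]: "f \<in> borel_measurable M"
  and u[measurable]: "u \<in> borel_measurable G" and v[measurable]: "v \<in> borel_measurable G"
  and nn: "\<And>x. x \<in> space M ==> 0 <= u x" "\<And>x. x \<in> space M ==> 0 <= v x"
  and iu: "\<And>A. A \<in> sets G ==> (\<integral>\<^sup>+x\<in>A. ennreal (f x) \<partial>M) = (\<integral>\<^sup>+x\<in>A. ennreal (u x) \<partial>M)"
  and iv: "\<And>A. A \<in> sets G ==> (\<integral>\<^sup>+x\<in>A. ennreal (- f x) \<partial>M) = (\<integral>\<^sup>+x\<in>A. ennreal (v x) \<partial>M)"
 shows "AE x in M. u x - v x = real_cond_exp M G f x"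
proof -
 interpret sigma_finite_subalgebra M G by (rule sub)
 have "AE x in M. ennreal (u x) = nn_cond_exp M G (%x. ennreal (f x)) x" by (rule nn_cond_exp_charact) (use iu in auto)
 moreover have "AE x in M. ennreal (v x) = nn_cond_exp M G (%x. ennreal (- f x)) x" by (rule nn_cond_exp_charact) (use iv in auto)
 ultimately show ?thesis
  by (rule AE_mp[OF AE_conjI], intro AE_I2 impI) (auto simp: real_cond_exp_def nn dest!: sym[of "ennreal _"])
qed

context cluster_model
begin

lemma nn_filter_Q_pos:
 assumes t: "0 <= t" and g[measurable]: "g \<in> borel_measurable (state_space \<nu>)" and A: "A \<in> sets (GG t)"
 shows "(\<integral>\<^sup>+w\<in>A. ennreal (g (XX t w) * L t w) \<partial>Q) = (\<integral>\<^sup>+w\<in>A. ennreal (phiS t (%y. max 0 (g y)) (Y t w)) \<partial>Q)"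
proof -
 obtain B where B: "B \<in> sets S0" "A = Y t -` B \<inter> space Q" using sets_GG_vimage[OF t A] by blast
 have "(\<integral>\<^sup>+w\<in>A. ennreal (g (XX t w) * L t w) \<partial>Q) = (\<integral>\<^sup>+w. indicator B (Y t w) * ennreal (max 0 (g (XX t w)) * L t w) \<partial>Q)"
 proof (rule nn_integral_cong_AE, rule AE_mp[OF AE_L_nonneg[OF t]], intro AE_I2 impI)
  fix w assume w: "w \<in> space Q" and L: "0 <= L t w"
  have "ennreal (g (XX t w) * L t w) = ennreal (max 0 (g (XX t w)) * L t w)"
   using L by (cases "0 <= g (XX t w)") (auto simp: max_def ennreal_neg mult_nonpos_nonneg)
  then show "ennreal (g (XX t w) * L t w) * indicator A w = indicator B (Y t w) * ennreal (max 0 (g (XX t w)) * L t w)"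
   using w by (simp add: B(2) indicator_def)
 qed
 also have "\<dots> = (\<integral>\<^sup>+w. indicator B (Y t w) * ennreal (phiS t (%y. max 0 (g y)) (Y t w)) \<partial>Q)"
  by (rule nn_filter_Q[OF t _ _ B(1)]) simp_all
 also have "\<dots> = (\<integral>\<^sup>+w\<in>A. ennreal (phiS t (%y. max 0 (g y)) (Y t w)) \<partial>Q)"
  by (rule nn_integral_cong) (simp add: B(2) indicator_def)
 finally show ?thesis .
qed

lemma Y_in_S0: "w \<in> space Q ==> 0 <= t ==> Y t w \<in> space S0"
 using measurable_space[OF Y_measurable] .

lemma phiS_Y_measurable_G:
 "0 <= t ==> g \<in> borel_measurable (state_space \<nu>) ==> (%w. phiS t g (Y t w)) \<in> borel_measurable (GG t)"
 by (rule measurable_compose[OF Y_measurable_G phiS_measurable])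

lemma L_measurable: "0 <= t ==> L t \<in> borel_measurable Q"
 using L_martingale measurable_from_subalg[OF subalgebra_F] unfolding martingale_def by blast

lemma sigma_finite_GG: assumes "0 <= t" shows "sigma_finite_subalgebra Q (GG t)" "sigma_finite_subalgebra P (GG t)"
proof -
 interpret P: prob_space P by (rule P_prob_space)
 have "finite_measure_subalgebra Q (GG t)" "finite_measure_subalgebra P (GG t)"
  using subalgebra_GG[OF assms] subalgebra_P[OF subalgebra_GG[OF assms]]
  by (auto intro!: finite_measure_subalgebra.intro finite_measure_subalgebra_axioms.intro finite_measure_axioms P.finite_measure_axioms)
 then show "sigma_finite_subalgebra Q (GG t)" "sigma_finite_subalgebra P (GG t)"
  by (auto intro: finite_measure_subalgebra_is_sigma_finite)
qed

lemma phi_cond_exp: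
 assumes t: "0 <= t" and g[measurable]: "g \<in> borel_measurable (state_space \<nu>)"
 shows "AE w in Q. phiS t g (Y t w) = real_cond_exp Q (GG t) (%w. g (XX t w) * L t w) w"
proof -
 note [measurable] = state_measurable_Q[OF t] L_measurable[OF t]
 have "AE w in Q. phiS t (%y. max 0 (g y)) (Y t w) - phiS t (%y. max 0 (- g y)) (Y t w) = real_cond_exp Q (GG t) (%w. g (XX t w) * L t w) w"
 proof (rule real_cond_exp_charact_pos_neg[OF sigma_finite_GG(1)[OF t]])
  show "(\<integral>\<^sup>+x\<in>A. ennreal (- (g (XX t x) * L t x)) \<partial>Q) = (\<integral>\<^sup>+x\<in>A. ennreal (phiS t (%y. max 0 (- g y)) (Y t x)) \<partial>Q)" if "A \<in> sets (GG t)" for A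
   using nn_filter_Q_pos[OF t _ that, of "%y. - g y"] by simp
  show "0 <= phiS t (%y. max 0 (g y)) (Y t w)" "0 <= phiS t (%y. max 0 (- g y)) (Y t w)" if "w \<in> space Q" for w
   using Y_in_S0[OF that t] by (auto intro: phiS_nonneg)
 qed (use nn_filter_Q_pos[OF t g] in \<open>auto intro!: phiS_Y_measurable_G t\<close>)
 then show ?thesis unfolding phiS_pos_neg[of t g, symmetric] .
qed

text \<open>\<open>phiS t (\<lambda>_. 1)\<close> is the density of \<open>P\<close> with respect to \<open>Q\<close> on the observations.\<close>
lemma nn_phi_one:
 assumes t: "0 <= t" and f[measurable]: "f \<in> borel_measurable (GG t)"
 shows "(\<integral>\<^sup>+w. f w * ennreal (L t w) \<partial>Q) = (\<integral>\<^sup>+w. f w * ennreal (phiS t (%_. 1) (Y t w)) \<partial>Q)"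
proof -
 interpret sigma_finite_subalgebra Q "GG t" by (rule sigma_finite_GG(1)[OF t])
 note [measurable] = L_measurable[OF t]
 note pm = phiS_Y_measurable_G[OF t borel_measurable_const[of 1]]
 have "AE w in Q. ennreal (phiS t (%_. 1) (Y t w)) = nn_cond_exp Q (GG t) (%w. ennreal (L t w)) w"
  by (rule nn_cond_exp_charact) (use nn_filter_Q_pos[OF t borel_measurable_const[of 1]] pm in auto)
 note ae = this
 have "(\<integral>\<^sup>+w. f w * ennreal (phiS t (%_. 1) (Y t w)) \<partial>Q) = (\<integral>\<^sup>+w. f w * nn_cond_exp Q (GG t) (%w. ennreal (L t w)) w \<partial>Q)"
  by (rule nn_integral_cong_AE) (use ae in \<open>eventually_elim, simp\<close>)
 also have "\<dots> = (\<integral>\<^sup>+w. f w * ennreal (L t w) \<partial>Q)" by (rule nn_cond_exp_intg) measurable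
 finally show ?thesis by (rule sym)
qed

lemma measurable_GG_F: "0 <= t ==> f \<in> measurable (GG t) S ==> f \<in> measurable (F t) S"
 by (rule measurable_from_subalg) (auto simp: subalgebra_def space_F sets_GG_F)

text \<open>A density vanishes with probability 0 under the measure that it defines.\<close>
lemma AE_P_phi_one: assumes t: "0 <= t" shows "AE w in P. phiS t (%_. 1) (Y t w) \<noteq> 0"
proof -
 note [measurable] = phiS_Y_measurable_G[OF t borel_measurable_const[of 1]]
 let ?f = "%w. if phiS t (%_. 1) (Y t w) = 0 then 1 else 0 :: ennreal"
 have fm: "?f \<in> borel_measurable (GG t)" by measurable
 have "(\<integral>\<^sup>+w. ?f w \<partial>P) = (\<integral>\<^sup>+w. ?f w * ennreal (L t w) \<partial>Q)" by (rule nn_integral_P[OF t measurable_GG_F[OF t fm]])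
 also have "\<dots> = (\<integral>\<^sup>+w. ?f w * ennreal (phiS t (%_. 1) (Y t w)) \<partial>Q)" by (rule nn_phi_one[OF t fm])
 also have "\<dots> = (\<integral>\<^sup>+w. 0 \<partial>Q)" by (rule nn_integral_cong) simp
 finally have "(\<integral>\<^sup>+w. ?f w \<partial>P) = 0" by simp
 then have "AE w in P. ?f w = 0"
  using nn_integral_0_iff_AE[OF measurable_from_subalg[OF subalgebra_P[OF subalgebra_GG[OF t]] fm]] by simp
 then show ?thesis by eventually_elim (auto split: if_splits)
qed

text \<open>The formula of Bayes: pass to \<open>Q\<close> with the density \<open>L\<close>, project on the observations, and return to \<open>P\<close>
with the density of the observations.  Where that density is 0, the numerator is 0 as well.\<close>
lemma nn_filter_P:
 assumes t: "0 <= t" and g[measurable]: "g \<in> borel_measurable (state_space \<nu>)" and A[measurable]: "A \<in> sets (GG t)"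
 shows "(\<integral>\<^sup>+w\<in>A. ennreal (g (XX t w) * 1) \<partial>P) = (\<integral>\<^sup>+w\<in>A. ennreal (phiS t (%y. max 0 (g y)) (Y t w) / phiS t (%_. 1) (Y t w)) \<partial>P)"
proof -
 let ?p = "%w. phiS t (%y. max 0 (g y)) (Y t w)" and ?o = "%w. phiS t (%_. 1) (Y t w)"
 have [measurable]: "?p \<in> borel_measurable (GG t)" "?o \<in> borel_measurable (GG t)"
  by (auto intro!: phiS_Y_measurable_G t)
 have AF[measurable]: "A \<in> sets (F t)" using sets_GG_F[OF t] A by blast
 note [measurable] = state_measurable_F[OF t]
 have "(\<integral>\<^sup>+w\<in>A. ennreal (g (XX t w) * 1) \<partial>P) = (\<integral>\<^sup>+w. (ennreal (g (XX t w) * 1) * indicator A w) * ennreal (L t w) \<partial>Q)"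
  by (rule nn_integral_P[OF t]) measurable
 also have "\<dots> = (\<integral>\<^sup>+w\<in>A. ennreal (g (XX t w) * L t w) \<partial>Q)"
 proof (rule nn_integral_cong_AE, rule AE_mp[OF AE_L_nonneg[OF t]], intro AE_I2 impI)
  fix w assume "0 <= L t w"
  then show "ennreal (g (XX t w) * 1) * indicator A w * ennreal (L t w) = ennreal (g (XX t w) * L t w) * indicator A w"
   by (simp add: ennreal_mult'' indicator_def)
 qed
 also have "\<dots> = (\<integral>\<^sup>+w\<in>A. ennreal (?p w) \<partial>Q)" by (rule nn_filter_Q_pos[OF t g A])
 also have "\<dots> = (\<integral>\<^sup>+w. (ennreal (?p w / ?o w) * indicator A w) * ennreal (?o w) \<partial>Q)"
 proof (rule nn_integral_cong)
  fix w assume "w \<in> space Q"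
  note Y0 = Y_in_S0[OF this t]
  have o: "0 <= ?o w" by (rule phiS_nonneg) (use Y0 in auto)
  have "ennreal (?p w / ?o w) * ennreal (?o w) = ennreal (?p w)"
   using o phiS_eq_0[OF Y0, of t "%y. max 0 (g y)"] by (cases "?o w = 0") (simp_all add: ennreal_mult''[symmetric])
  then show "ennreal (?p w) * indicator A w = ennreal (?p w / ?o w) * indicator A w * ennreal (?o w)"
   by (simp add: indicator_def)
 qed
 also have "\<dots> = (\<integral>\<^sup>+w. (ennreal (?p w / ?o w) * indicator A w) * ennreal (L t w) \<partial>Q)"
  by (rule nn_phi_one[OF t, symmetric]) measurable
 also have "\<dots> = (\<integral>\<^sup>+w\<in>A. ennreal (?p w / ?o w) \<partial>P)"
  by (rule nn_integral_P[OF t, symmetric], rule measurable_GG_F[OF t]) measurable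
 finally show ?thesis .
qed

lemma pi_cond_exp:
 assumes t: "0 <= t" and g[measurable]: "g \<in> borel_measurable (state_space \<nu>)"
 shows "AE w in P. phiS t g (Y t w) / phiS t (%_. 1) (Y t w) = real_cond_exp P (GG t) (%w. g (XX t w) * 1) w"
proof -
 let ?r = "%g w. phiS t (%y. max 0 (g y)) (Y t w) / phiS t (%_. 1) (Y t w)"
 have rm: "?r g \<in> borel_measurable (GG t)" if "g \<in> borel_measurable (state_space \<nu>)" for g
  by (intro borel_measurable_divide phiS_Y_measurable_G t borel_measurable_max borel_measurable_const that)
 have r0: "0 <= ?r g w" if "w \<in> space P" for g w
  using Y_in_S0[OF _ t, of w] that by (auto simp: space_P intro!: divide_nonneg_nonneg phiS_nonneg)
 have "AE w in P. ?r g w - ?r (%y. - g y) w = real_cond_exp P (GG t) (%w. g (XX t w) * 1) w"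
 proof (rule real_cond_exp_charact_pos_neg[OF sigma_finite_GG(2)[OF t]])
  show "(%w. g (XX t w) * 1) \<in> borel_measurable P"
   by (rule measurable_from_subalg[OF subalgebra_P[OF subalgebra_F[OF t]]]) (use state_measurable_F[OF t] in measurable)
  show "(\<integral>\<^sup>+x\<in>A. ennreal (- (g (XX t x) * 1)) \<partial>P) = (\<integral>\<^sup>+x\<in>A. ennreal (?r (%y. - g y) x) \<partial>P)" if "A \<in> sets (GG t)" for A
   using nn_filter_P[OF t _ that, of "%y. - g y"] by simp
 qed (use nn_filter_P[OF t g] r0 in \<open>auto intro!: rm\<close>)
 then show ?thesis unfolding phiS_pos_neg[of t g] diff_divide_distrib .
qed

subsection \<open>Path regularity\<close>

lemma cadlag_phiS:
 assumes w: "w \<in> space Q" and gp: "good_path w" shows "cadlag (%t. phiS t g (Y t w))"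
 unfolding cadlag_def
proof (intro conjI allI impI)
 fix t :: real assume t: "0 <= t"
 obtain m where m: "t < real m" using reals_Archimedean2 by blast
 interpret filter_path Q F P \<nu> p gam lamQ N C I D lam L "Y (real m) w" "real m" by (rule good_path_filter_path[OF w gp])
 have "eventually (%r. phiS r g (Xup r) = phiS r g (Y r w)) (at_right t)"
  unfolding eventually_at_right_field
 proof (intro exI[of _ "real m"] conjI allI impI)
  fix r assume "t < r" "r < real m"
  then show "phiS r g (Xup r) = phiS r g (Y r w)" using Y_upto(1)[OF w, of r "real m"] by simp
 qed (rule m)
 from Lim_transform_eventually[OF phiS_right[OF t m] this]
 show "((%t. phiS t g (Y t w)) \<longlongrightarrow> phiS t g (Y t w)) (at_right t)"
  unfolding Y_upto(1)[OF w less_imp_le[OF m], symmetric] .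
next
 fix t :: real assume t: "0 < t"
 obtain m where m: "t <= real m" using real_arch_simple by blast
 interpret filter_path Q F P \<nu> p gam lamQ N C I D lam L "Y (real m) w" "real m" by (rule good_path_filter_path[OF w gp])
 obtain k where k: "k <= n" "a k < t" "t <= e k" by (rule piece_of[OF t m])
 have "eventually (%r. phiS r g (Xup r) = phiS r g (Y r w)) (at_left t)"
  unfolding eventually_at_left_field
 proof (intro exI[of _ "0"] conjI allI impI)
  fix r assume "0 < r" "r < t"
  then show "phiS r g (Xup r) = phiS r g (Y r w)" using Y_upto(1)[OF w, of r "real m"] m by simp
 qed (rule t)
 from Lim_transform_eventually[OF phiS_left[OF k] this]
 show "\<exists>l. ((%t. phiS t g (Y t w)) \<longlongrightarrow> l) (at_left t)" by blast
qed

text \<open>Positivity at integer times suffices: by the pathwise calculus the mass cannot have vanished before.\<close>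
definition pos_path :: "'w => bool" where
 "pos_path w \<longleftrightarrow> (\<forall>m::nat. phiS (real m) (%_. 1) (Y (real m) w) \<noteq> 0)"

lemma AE_pos_path: "AE w in P. pos_path w"
 unfolding pos_path_def AE_all_countable using AE_P_phi_one by simp

lemma pos_path_V:
 assumes w: "w \<in> space Q" and gp: "good_path w" and pp: "pos_path w"
 shows "filter_path.V Q \<nu> p gam lamQ D lam (Y (real m) w) (%_. 1) (size (Y (real m) w)) (real m) \<noteq> 0"
proof -
 interpret filter_path Q F P \<nu> p gam lamQ N C I D lam L "Y (real m) w" "real m" by (rule good_path_filter_path[OF w gp])
 have "kk (real m) = n" unfolding counter_def Y_upto(1)[OF w order_refl, symmetric] by (rule refl)
 then have e: "phiS (real m) (%_. 1) (Y (real m) w) = V (%_. 1) n (real m)"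
  using phiS_V[of "real m" "%_. 1"] unfolding Y_upto(1)[OF w order_refl, symmetric] by simp
 show ?thesis using pp[unfolded pos_path_def, rule_format, of m] unfolding e .
qed

lemma cadlag_quotient:
 assumes w: "w \<in> space Q" and gp: "good_path w" and pp: "pos_path w"
 shows "cadlag (%t. phiS t g (Y t w) / phiS t (%_. 1) (Y t w))"
proof -
 note c = cadlag_phiS[OF w gp]
 show ?thesis unfolding cadlag_def
 proof (intro conjI allI impI)
  fix t :: real assume t: "0 <= t"
  obtain m where m: "t <= real m" using real_arch_simple by blast
  interpret filter_path Q F P \<nu> p gam lamQ N C I D lam L "Y (real m) w" "real m" by (rule good_path_filter_path[OF w gp])
  have "0 < V (%_. 1) (kk t) t" by (rule V1_pos[OF pos_path_V[OF w gp pp] kk_le a_kk[OF t] le_e_kk[OF m]])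
  then have "phiS t (%_. 1) (Y t w) \<noteq> 0" unfolding Y_upto(1)[OF w m] phiS_V[OF t m] by simp
  then show "((%t. phiS t g (Y t w) / phiS t (%_. 1) (Y t w)) \<longlongrightarrow> phiS t g (Y t w) / phiS t (%_. 1) (Y t w)) (at_right t)"
   using c t unfolding cadlag_def by (intro tendsto_divide) auto
 next
  fix t :: real assume t: "0 < t"
  obtain m where m: "t <= real m" using real_arch_simple by blast
  interpret filter_path Q F P \<nu> p gam lamQ N C I D lam L "Y (real m) w" "real m" by (rule good_path_filter_path[OF w gp])
  obtain k where k: "k <= n" "a k < t" "t <= e k" by (rule piece_of[OF t m])
  have "((%r. phiS r h (Y r w)) \<longlongrightarrow> V h k t) (at_left t)" for h
  proof (rule Lim_transform_eventually[OF phiS_left[OF k]])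
   show "eventually (%r. phiS r h (Xup r) = phiS r h (Y r w)) (at_left t)"
    unfolding eventually_at_left_field
   proof (intro exI[of _ "0"] conjI allI impI)
    fix r assume "0 < r" "r < t"
    then show "phiS r h (Xup r) = phiS r h (Y r w)" using Y_upto(1)[OF w, of r "real m"] m by simp
   qed (rule t)
  qed
  moreover have "V (%_. 1) k t \<noteq> 0" using V1_pos[OF pos_path_V[OF w gp pp] k(1), of t] k by simp
  ultimately show "\<exists>l. ((%t. phiS t g (Y t w) / phiS t (%_. 1) (Y t w)) \<longlongrightarrow> l) (at_left t)"
   by (intro exI[of _ "V g k t / V (%_. 1) k t"] tendsto_divide)
 qed
qed

lemma is_phi_explicit: "is_phi Q \<nu> N C D L (%t w. phiX t (Y t w))"
 unfolding is_phi_def is_filter_def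
proof (intro conjI allI ballI impI)
 fix t :: real and g :: "'e state => real" assume t: "0 <= t" and g: "g \<in> borel_measurable (state_space \<nu>)"
 show "(%w. weighted_sum (phiX t (Y t w)) g) \<in> borel_measurable (GG t)"
  unfolding weighted_sum_phiX by (rule phiS_Y_measurable_G[OF t g])
 show "AE w in Q. weighted_sum (phiX t (Y t w)) g = real_cond_exp Q (GG t) (%w. g (XX t w) * L t w) w"
  unfolding weighted_sum_phiX by (rule phi_cond_exp[OF t g])
next
 show "AE w in Q. \<forall>y. cadlag (%t. phiX t (Y t w) y)"
  unfolding phiX_phiS by (rule AE_mp[OF AE_good_path(1)]) (auto intro!: cadlag_phiS)
qed (rule phiX_support)

lemma is_pi_explicit: "is_pi P \<nu> N C D (%t w. phiR t (Y t w))"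
 unfolding is_pi_def is_filter_def space_P
proof (intro conjI allI ballI impI)
 fix t :: real and g :: "'e state => real" assume t: "0 <= t" and g: "g \<in> borel_measurable (state_space \<nu>)"
 show "(%w. weighted_sum (phiR t (Y t w)) g) \<in> borel_measurable (GG t)"
  unfolding weighted_sum_phiR by (intro borel_measurable_divide phiS_Y_measurable_G t g borel_measurable_const)
 show "AE w in P. weighted_sum (phiR t (Y t w)) g = real_cond_exp P (GG t) (%w. g (XX t w) * 1) w"
  unfolding weighted_sum_phiR by (rule pi_cond_exp[OF t g])
next
 show "AE w in P. \<forall>y. cadlag (%t. phiR t (Y t w) y)"
  unfolding phiX_phiS phiR_def
  by (rule AE_mp[OF AE_good_path(2)], rule AE_mp[OF AE_pos_path]) (auto simp: space_P intro!: cadlag_quotient)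
next
 fix t :: real and w
 have "{y. phiR t (Y t w) y \<noteq> 0} \<subseteq> {y. phiX t (Y t w) y \<noteq> 0}" by (auto simp: phiR_def)
 then show "{y. phiR t (Y t w) y \<noteq> 0} \<subseteq> compatible (Y t w)" using phiX_support by blast
qed

end

section \<open>Uniqueness of the filters\<close>

text \<open>Only the numbers of jumps in rational time windows enter, through a finite list of conditions; so there
are countably many such functions.\<close>
definition jump_test :: "(bool \<times> rat \<times> rat \<times> nat) list => 'e state => real" where
 "jump_test c y = (if \<forall>(b, q1, q2, m)\<in>set c. size {#z \<in># fst y. z \<in> {b} \<times> ({of_rat q1<..<of_rat q2} \<inter> {0..})#} = m then 1 else 0)"

lemma jump_test_measurable: "jump_test c \<in> borel_measurable (state_space \<nu>)"
proof -
 let ?M = "count_space (UNIV :: bool set) \<Otimes>\<^sub>M restrict_space lborel {0..} :: (bool \<times> real) measure"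
 have A: "{b} \<times> ({of_rat q1<..<of_rat q2} \<inter> {0..}) \<in> sets ?M" for b q1 q2
  by (rule pair_measureI) (simp_all add: sets_restrict_space_iff)
 have f: "fst \<in> measurable (state_space \<nu>) (mset_space ?M)" unfolding state_space_def by (rule measurable_fst)
 have "Measurable.pred (state_space \<nu>) (%y. \<forall>l\<in>set c. size {#z \<in># fst y. z \<in> {fst l} \<times> ({of_rat (fst (snd l))<..<of_rat (fst (snd (snd l)))} \<inter> {0..})#} = snd (snd (snd l)))"
 proof (rule pred_intros_finite(3))
  fix l
  note [measurable] = measurable_compose[OF f measurable_size_filter_mset[OF A]]
  show "Measurable.pred (state_space \<nu>) (%y. size {#z \<in># fst y. z \<in> {fst l} \<times> ({of_rat (fst (snd l))<..<of_rat (fst (snd (snd l)))} \<inter> {0..})#} = snd (snd (snd l)))"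
   by measurable
 qed simp
 then show ?thesis unfolding jump_test_def[abs_def] case_prod_beta'
  by (intro measurable_If measurable_const) (simp_all add: pred_def)
qed

lemma finite_submultisets: "finite {A. A \<subseteq># M}"
proof (induction M)
 case (add x M)
 have "{A. A \<subseteq># add_mset x M} \<subseteq> {A. A \<subseteq># M} \<union> add_mset x ` {A. A \<subseteq># M}"
 proof
  fix A assume "A \<in> {A. A \<subseteq># add_mset x M}"
  then have A: "A \<subseteq># add_mset x M" by simp
  show "A \<in> {A. A \<subseteq># M} \<union> add_mset x ` {A. A \<subseteq># M}"
  proof (cases "x \<in># A")
   case True
   then obtain B where B: "A = add_mset x B" by (blast dest: multi_member_split)
   then show ?thesis using A by simp
  next
   case False
   then have "A \<subseteq># M" using A by (metis diff_single_trivial subset_eq_diff_conv add_mset_add_single)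
   then show ?thesis by simp
  qed
 qed
 then show ?case using add.IH by (meson finite_UnI finite_imageI finite_subset)
qed simp

lemma finite_compatible: "finite (compatible Y)"
proof -
 have "compatible Y \<subseteq> (\<Union>\<eta>\<in>{\<eta>. \<eta> \<subseteq># Y}. (%h. (h, \<eta>)) ` (\<Union>d0\<in>UNIV. (%h. add_mset (d0, 0) h) ` {h. \<exists>d. h = image_mset (%x. (d x, snd x)) \<eta>}))"
  unfolding compatible_def by blast
 moreover have "finite {h. \<exists>d :: _ => bool. h = image_mset (%x. (d x, snd x)) \<eta>}" for \<eta> :: "('e \<times> real) multiset"
 proof (rule finite_subset)
  show "{h. \<exists>d :: _ => bool. h = image_mset (%x. (d x, snd x)) \<eta>} \<subseteq> (%B. image_mset (%x. (x \<in> B, snd x)) \<eta>) ` Pow (set_mset \<eta>)"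
  proof clarify
   fix d :: "'e \<times> real => bool"
   have "image_mset (%x. (d x, snd x)) \<eta> = image_mset (%x. (x \<in> {x \<in> set_mset \<eta>. d x}, snd x)) \<eta>"
    by (intro image_mset_cong) auto
   then show "image_mset (%x. (d x, snd x)) \<eta> \<in> (%B. image_mset (%x. (x \<in> B, snd x)) \<eta>) ` Pow (set_mset \<eta>)" by blast
  qed
 qed simp
 moreover have "finite {\<eta>. \<eta> \<subseteq># Y}" by (rule finite_submultisets)
 ultimately show ?thesis by (elim finite_subset) (intro finite_UN_I finite_imageI; simp)
qed

lemma rational_window:
 fixes s :: real assumes "finite S"
 obtains q1 q2 :: rat where "of_rat q1 < s" "s < of_rat q2" "\<And>r. r \<in> S ==> of_rat q1 < r ==> r < of_rat q2 ==> r = s"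
proof -
 obtain d where d: "0 < d" "\<forall>x\<in>S. x \<noteq> s \<longrightarrow> d <= dist s x" using finite_set_avoid[OF assms, of s] by blast
 obtain q1 where q1: "s - d < of_rat q1" "of_rat q1 < s" using of_rat_dense[of "s - d" s] d by auto
 obtain q2 where q2: "s < of_rat q2" "of_rat q2 < s + d" using of_rat_dense[of s "s + d"] d by auto
 show ?thesis
 proof (rule that[OF q1(2) q2(1)])
  fix r assume "r \<in> S" "of_rat q1 < r" "r < of_rat q2"
  then show "r = s" using d(2) q1 q2 by (force simp: dist_real_def)
 qed
qed

text \<open>Different measures \<open>h\<close> have different numbers of jumps in some window around one of the finitely many
jump times.  Since observed times are distinct, \<open>h\<close> determines \<open>\<eta>\<close>.\<close>
lemma jump_test_separates:
 assumes g: "good Y" and pos: "\<And>x. x \<in># Y ==> 0 <= snd x" and y: "y \<in> compatible Y" and y': "y' \<in> compatible Y" and ne: "y \<noteq> y'"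
 shows "\<exists>l. jump_test [l] y = 1 \<and> jump_test [l] y' = 0"
proof -
 obtain d0 d \<eta> where e: "y = (add_mset (d0, 0) (image_mset (%x. (d x, snd x)) \<eta>), \<eta>)" "\<eta> \<subseteq># Y"
  using y by (auto simp: compatible_def)
 obtain d0' d' \<eta>' where e': "y' = (add_mset (d0', 0) (image_mset (%x. (d' x, snd x)) \<eta>'), \<eta>')" "\<eta>' \<subseteq># Y"
  using y' by (auto simp: compatible_def)
 have "fst y \<noteq> fst y'"
 proof
  \<comment> \<open>the times in \<open>h\<close> determine \<open>\<eta>\<close> because distinct observed points have distinct times\<close>
  assume h: "fst y = fst y'"
  have "image_mset snd (fst y) = image_mset snd (fst y')" using h by simp
  then have "image_mset snd \<eta> = image_mset snd \<eta>'" by (simp add: e(1) e'(1) image_mset.compositionality comp_def)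
  then have i: "image_mset (inv_into (set_mset Y) snd) (image_mset snd \<eta>) = image_mset (inv_into (set_mset Y) snd) (image_mset snd \<eta>')" by simp
  have inj: "inj_on snd (set_mset Y)" using good_inj[OF g] by (auto intro: inj_onI)
  have "image_mset (inv_into (set_mset Y) snd) (image_mset snd \<zeta>) = \<zeta>" if "\<zeta> \<subseteq># Y" for \<zeta>
  proof -
   have "image_mset (inv_into (set_mset Y) snd) (image_mset snd \<zeta>) = image_mset id \<zeta>"
    unfolding image_mset.compositionality
    by (rule image_mset_cong) (use inv_into_f_f[OF inj] mset_subset_eqD[OF that] in auto)
   then show ?thesis by simp
  qed
  then have "\<eta> = \<eta>'" using i e(2) e'(2) by simp
  then show False using ne h e e' by simp
 qed
 then obtain z where z: "count (fst y) z \<noteq> count (fst y') z" by (auto simp: multiset_eq_iff)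
 obtain b s where zb: "z = (b, s)" by (cases z)
 have nonneg: "0 <= snd x" if "x \<in># fst y + fst y'" for x
 proof -
  have "\<forall>x\<in>set_mset \<eta> \<union> set_mset \<eta>'. 0 <= snd x" using pos mset_subset_eqD[OF e(2)] mset_subset_eqD[OF e'(2)] by blast
  then have "0 <= r" if "r \<in> {0} \<union> snd ` set_mset \<eta> \<union> snd ` set_mset \<eta>'" for r using that by blast
  moreover have "snd ` set_mset (fst y + fst y') = {0} \<union> snd ` set_mset \<eta> \<union> snd ` set_mset \<eta>'"
   unfolding e(1) e'(1) by (auto simp: image_Un image_image)
  ultimately show ?thesis using that by blast
 qed
 have "z \<in># fst y + fst y'" using z by (metis count_eq_zero_iff union_iff)
 then have s0: "0 <= s" using nonneg[of z] zb by simp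
 obtain q1 q2 :: rat where q: "of_rat q1 < s" "s < of_rat q2"
  "\<And>r. r \<in> snd ` set_mset (fst y + fst y') ==> of_rat q1 < r ==> r < of_rat q2 ==> r = s"
  by (rule rational_window[of "snd ` set_mset (fst y + fst y')" s]) blast+
 have cnt: "size {#x \<in># h. x \<in> {b} \<times> ({of_rat q1<..<of_rat q2} \<inter> {0..})#} = count h z" if h: "set_mset h \<subseteq> set_mset (fst y + fst y')" for h
 proof -
  have "{#x \<in># h. x \<in> {b} \<times> ({of_rat q1<..<of_rat q2} \<inter> {0..})#} = {#x \<in># h. x = z#}"
  proof (rule filter_mset_cong[OF refl])
   fix x assume "x \<in># h"
   then have "snd x \<in> snd ` set_mset (fst y + fst y')" using h by blast
   from q(3)[OF this] show "(x \<in> {b} \<times> ({of_rat q1<..<of_rat q2} \<inter> {0..})) = (x = z)"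
    using q(1,2) s0 by (cases x) (auto simp: zb)
  qed
  then show ?thesis by (simp add: filter_eq_replicate_mset)
 qed
 have "jump_test [(b, q1, q2, count (fst y) z)] y = 1" unfolding jump_test_def using cnt[of "fst y"] by simp
 moreover have "jump_test [(b, q1, q2, count (fst y) z)] y' = 0" unfolding jump_test_def using cnt[of "fst y'"] z by simp
 ultimately show ?thesis by blast
qed

text \<open>Some list of conditions holds for one of the finitely many compatible states and for no other; testing
with it reads off the weight of this state.\<close>
lemma weights_eqI:
 assumes g: "good Y" and pos: "\<And>x. x \<in># Y ==> 0 <= snd x"
  and w: "{y. w y \<noteq> 0} \<subseteq> compatible Y" and w': "{y. w' y \<noteq> 0} \<subseteq> compatible Y"
  and eq: "\<And>c. weighted_sum w (jump_test c) = weighted_sum w' (jump_test c)"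
 shows "w = w'"
proof
 fix y
 have ws: "weighted_sum v h = (\<Sum>y\<in>compatible Y. h y * v y)" if "{y. v y \<noteq> 0} \<subseteq> compatible Y" for v h
  unfolding weighted_sum_def by (rule sum.mono_neutral_left) (use that finite_compatible in auto)
 show "w y = w' y"
 proof (cases "y \<in> compatible Y")
  case True
  obtain l where l: "\<And>y'. y' \<in> compatible Y ==> y \<noteq> y' ==> jump_test [l y'] y = 1 \<and> jump_test [l y'] y' = 0"
   using jump_test_separates[OF g pos True] by metis
  obtain ys where ys: "set ys = compatible Y - {y}" using finite_list[of "compatible Y - {y}"] finite_compatible by auto
  define c where "c = map l ys"
  have all: "jump_test c z = (if \<forall>y'\<in>set ys. jump_test [l y'] z = 1 then 1 else 0)" for z
   by (auto simp: jump_test_def c_def split: if_splits)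
  have "jump_test c z = (if z = y then 1 else 0)" if "z \<in> compatible Y" for z
  proof (cases "z = y")
   case True then show ?thesis using l ys by (auto simp: all)
  next
   case False
   then have "jump_test [l z] z = 0" "z \<in> set ys" using l[OF that] that ys by auto
   then show ?thesis using False unfolding all by (metis zero_neq_one)
  qed
  then have "(\<Sum>z\<in>compatible Y. jump_test c z * v z) = (\<Sum>z\<in>compatible Y. if z = y then v z else 0)" for v :: "_ => real"
   by (intro sum.cong) auto
  then have "(\<Sum>z\<in>compatible Y. jump_test c z * v z) = v y" for v :: "_ => real"
   using True finite_compatible[of Y] by simp
  then show ?thesis using eq[of c] unfolding ws[OF w] ws[OF w'] by simp
 next
  case False
  then have "w y = 0" "w' y = 0" using w w' by blast+
  then show ?thesis by simp
 qed
qed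

lemma cadlag_eq_on_rationals:
 fixes x x' :: "real => real"
 assumes c: "cadlag x" "cadlag x'" and eq: "\<And>q::rat. 0 <= q ==> x (of_rat q) = x' (of_rat q)" and t: "0 <= t"
 shows "x t = x' t"
proof (rule ccontr)
 assume "x t \<noteq> x' t"
 have "((%r. x r - x' r) \<longlongrightarrow> x t - x' t) (at_right t)"
  using c t unfolding cadlag_def by (intro tendsto_diff) auto
 from tendsto_imp_eventually_ne[OF this, of 0] \<open>x t \<noteq> x' t\<close>
 obtain b where b: "t < b" "\<And>r. t < r ==> r < b ==> x r \<noteq> x' r" unfolding eventually_at_right_field by auto
 obtain q where q: "t < of_rat q" "of_rat q < b" using of_rat_dense[OF b(1)] by auto
 have "0 <= q" using q(1) t by (metis le_less_trans less_imp_le zero_less_of_rat_iff)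
 from eq[OF this] b(2)[OF q] show False by simp
qed

context cluster_model
begin

lemma filter_eq_at_time:
 assumes w: "w \<in> space Q" "good_path w" and t: "0 <= t"
  and v: "{y. v y \<noteq> 0} \<subseteq> compatible (Y t w)" and v': "{y. v' y \<noteq> 0} \<subseteq> compatible (Y t w)"
  and eq: "\<And>c. weighted_sum v (jump_test c) = weighted_sum v' (jump_test c)"
 shows "v = v'"
proof (rule weights_eqI[OF good_path_upto[OF w] _ v v' eq])
 show "0 <= snd x" if "x \<in># Y t w" for x using Y_space[OF w(1) t] that by (auto simp: space_mark_time)
qed

text \<open>At rational times the weights agree because countably many conditional expectations do; both families
of weights are right-continuous.\<close>
lemma filter_unique:
 assumes A: "is_filter M \<nu> (obs_sigma (space M) \<nu> Y) Y XX W \<Phi>" and B: "is_filter M \<nu> (obs_sigma (space M) \<nu> Y) Y XX W \<Phi>'"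
  and sp: "space M = space Q" and gp: "AE w in M. good_path w"
 shows "AE w in M. \<forall>t\<ge>0. \<Phi> t w = \<Phi>' t w"
proof -
 have one: "AE w in M. weighted_sum (\<Phi> t w) g = weighted_sum (\<Phi>' t w) g" if "0 <= t" "g \<in> borel_measurable (state_space \<nu>)" for t g
 proof -
  have "AE w in M. weighted_sum (\<Phi> t w) g = real_cond_exp M (obs_sigma (space M) \<nu> Y t) (%w. g (XX t w) * W t w) w"
   using A that unfolding is_filter_def by blast
  moreover have "AE w in M. weighted_sum (\<Phi>' t w) g = real_cond_exp M (obs_sigma (space M) \<nu> Y t) (%w. g (XX t w) * W t w) w"
   using B that unfolding is_filter_def by blast
  ultimately show ?thesis by eventually_elim simp
 qed
 \<comment> \<open>\<open>max 0\<close> lets \<open>q\<close> range over all rationals, a countable type\<close>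
 have "AE w in M. weighted_sum (\<Phi> (of_rat (max 0 q)) w) (jump_test c) = weighted_sum (\<Phi>' (of_rat (max 0 q)) w) (jump_test c)" for q c
  by (rule one[OF _ jump_test_measurable]) simp
 then have all: "AE w in M. \<forall>q c. weighted_sum (\<Phi> (of_rat (max 0 q)) w) (jump_test c) = weighted_sum (\<Phi>' (of_rat (max 0 q)) w) (jump_test c)"
  unfolding AE_all_countable by blast
 have c: "AE w in M. \<forall>y. cadlag (%t. \<Phi> t w y)" "AE w in M. \<forall>y. cadlag (%t. \<Phi>' t w y)"
  using A B unfolding is_filter_def by blast+
 have supp: "{y. \<Phi> t w y \<noteq> 0} \<subseteq> compatible (Y t w)" "{y. \<Phi>' t w y \<noteq> 0} \<subseteq> compatible (Y t w)" if "0 <= t" "w \<in> space M" for t w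
  using A B that unfolding is_filter_def by blast+
 show ?thesis
 proof (rule AE_mp[OF all], rule AE_mp[OF gp], rule AE_mp[OF c(1)], rule AE_mp[OF c(2)], intro AE_I2 impI allI)
  fix w and t :: real
  assume w: "w \<in> space M" "good_path w" and c: "\<forall>y. cadlag (%t. \<Phi> t w y)" "\<forall>y. cadlag (%t. \<Phi>' t w y)" and t: "0 <= t"
   and eq: "\<forall>q c. weighted_sum (\<Phi> (of_rat (max 0 q)) w) (jump_test c) = weighted_sum (\<Phi>' (of_rat (max 0 q)) w) (jump_test c)"
  have q: "\<Phi> (of_rat q) w = \<Phi>' (of_rat q) w" if "0 <= q" for q
  proof (rule filter_eq_at_time[OF _ w(2), of "of_rat q"])
   show "w \<in> space Q" using w(1) sp by simp
   show "weighted_sum (\<Phi> (of_rat q) w) (jump_test c) = weighted_sum (\<Phi>' (of_rat q) w) (jump_test c)" for c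
    using eq[rule_format, of q c] that by (simp add: max_def)
  qed (use supp w(1) that in auto)
  show "\<Phi> t w = \<Phi>' t w"
  proof
   fix y show "\<Phi> t w y = \<Phi>' t w y"
    by (rule cadlag_eq_on_rationals[OF c(1)[rule_format, of y] c(2)[rule_format, of y] _ t]) (simp only: q)
  qed
 qed
qed

lemma phi_explicit: assumes "is_phi Q \<nu> N C D L \<Phi>" shows "AE w in Q. \<forall>t\<ge>0. \<Phi> t w = phiX t (Y t w)"
 using filter_unique[OF assms[unfolded is_phi_def] is_phi_explicit[unfolded is_phi_def] refl AE_good_path(1)] .

lemma pi_explicit: assumes "is_pi P \<nu> N C D \<Psi>" shows "AE w in P. \<forall>t\<ge>0. \<Psi> t w = phiR t (Y t w)"
 using filter_unique[OF assms[unfolded is_pi_def] is_pi_explicit[unfolded is_pi_def] space_P AE_good_path(2)] .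

text \<open>\<open>P\<close> need not be absolutely continuous with respect to \<open>Q\<close> on the whole sigma-algebra, only
 on each \<open>F t\<close>.  Therefore the identification of \<open>\<Phi>\<close> carries over to \<open>P\<close> at fixed times, through
 countably many observable events.\<close>

lemma phi_explicit_P:
 assumes phi: "is_phi Q \<nu> N C D L \<Phi>" and t: "0 <= t" shows "AE w in P. \<Phi> t w = phiX t (Y t w)"
proof -
 have "AE w in P. weighted_sum (\<Phi> t w) (jump_test c) = weighted_sum (phiX t (Y t w)) (jump_test c)" for c
 proof (rule AE_P_of_Q[OF t])
  have [measurable]: "(%w. weighted_sum (\<Phi> t w) (jump_test c)) \<in> borel_measurable (F t)"
   by (rule measurable_GG_F[OF t]) (use phi t jump_test_measurable[of c \<nu>] in \<open>auto simp: is_phi_def is_filter_def\<close>)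
  have [measurable]: "(%w. weighted_sum (phiX t (Y t w)) (jump_test c)) \<in> borel_measurable (F t)"
   unfolding weighted_sum_phiX by (rule measurable_GG_F[OF t phiS_Y_measurable_G[OF t jump_test_measurable]])
  show "Measurable.pred (F t) (%w. weighted_sum (\<Phi> t w) (jump_test c) = weighted_sum (phiX t (Y t w)) (jump_test c))"
   by measurable
  show "AE w in Q. weighted_sum (\<Phi> t w) (jump_test c) = weighted_sum (phiX t (Y t w)) (jump_test c)"
   using phi_explicit[OF phi] by eventually_elim (use t in simp)
 qed
 then have all: "AE w in P. \<forall>c. weighted_sum (\<Phi> t w) (jump_test c) = weighted_sum (phiX t (Y t w)) (jump_test c)"
  unfolding AE_all_countable by blast
 show ?thesis
 proof (rule AE_mp[OF all], rule AE_mp[OF AE_good_path(2)], intro AE_I2 impI)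
  fix w assume w: "w \<in> space P" "good_path w"
   and eq: "\<forall>c. weighted_sum (\<Phi> t w) (jump_test c) = weighted_sum (phiX t (Y t w)) (jump_test c)"
  have wQ: "w \<in> space Q" using w(1) by (simp only: space_P)
  show "\<Phi> t w = phiX t (Y t w)"
   by (rule filter_eq_at_time[OF wQ w(2) t _ phiX_support])
     (use phi t wQ eq in \<open>auto simp: is_phi_def is_filter_def\<close>)
 qed
qed

end

section \<open>The filtering equations\<close>

lemma set_LINT_cong:
 assumes "\<And>z. z \<in> A ==> f z = g z"
 shows "(LINT z:A|M. f z) = (LINT z:A|M. g z)" "set_integrable M A f \<longleftrightarrow> set_integrable M A g"
proof -
 have "(%z. indicator A z *\<^sub>R f z) = (%z. indicator A z *\<^sub>R g z)"
 proof
  fix z show "indicator A z *\<^sub>R f z = indicator A z *\<^sub>R g z" by (cases "z \<in> A") (simp_all add: assms)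
 qed
 then show "(LINT z:A|M. f z) = (LINT z:A|M. g z)" "set_integrable M A f \<longleftrightarrow> set_integrable M A g"
  unfolding set_lebesgue_integral_def set_integrable_def by simp_all
qed

context cluster_model
begin

text \<open>The filtering equations for a functional \<open>A g s\<close> and the observed points \<open>Z\<close>, so that they can be
stated both for the explicit filter on one path and for a given version.\<close>
abbreviation phi_equation_holds :: "(('e state => real) => real => real) => ('e state => real) => ('e \<times> real) multiset => real => bool" where
 "phi_equation_holds A f Z t \<equiv>
   set_integrable M0 (space \<nu> \<times> {0..t}) (%(u, s). A (%y. f y * (intensity lam u s y - lamQ u s)) s) \<and>
   A f t = A f 0
   - (LINT x:space \<nu> \<times> {0..t}|M0. (case x of (u, s) => A (%y. f y * (intensity lam u s y - lamQ u s)) s))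
   + (\<Sum>(u, s)\<in>#Z. left_lim (A (%y. f_new p f u s y * (intensity lam u s y / lamQ u s) - f y)) s * (lamQ u s / (lamQ u s + gam u s)))"

abbreviation pi_equation_holds :: "(('e state => real) => real => real) => ('e state => real) => ('e \<times> real) multiset => real => bool" where
 "pi_equation_holds A f Z t \<equiv>
   set_integrable M0 (space \<nu> \<times> {0..t}) (%(u, s). A (%y. f y * intensity lam u s y) s - A f s * A (intensity lam u s) s) \<and>
   A f t = A f 0
   + (\<Sum>(u, s)\<in>#Z. (left_lim (A (%y. f_new p f u s y * intensity lam u s y)) s - left_lim (A (intensity lam u s)) s * left_lim (A f) s)
     / left_lim (A (%y. intensity lam u s y + gam u s)) s)
   - (LINT x:space \<nu> \<times> {0..t}|M0. (case x of (u, s) => A (%y. f y * intensity lam u s y) s - A f s * A (intensity lam u s) s))"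

end

context filter_path
begin

lemma sum_upto: "(\<Sum>x\<in>#Xup t. h x) = (\<Sum>k<kk t. h (xx k))"
 unfolding sum_mset_pts[OF good_upto[OF gX]] counter_def[symmetric]
 by (rule sum.cong[OF refl]) (use pt_upto[OF gX] in \<open>simp add: counter_def\<close>)

text \<open>The path to the left of an observed point runs through the piece that ends there, on which it is
continuous.\<close>
lemma left_lim_at_point:
 fixes A :: "real => real" and G :: "nat => real => real"
 assumes A: "\<And>r. 0 <= r ==> r <= T ==> A r = G (kk r) r" and c: "\<And>k. k <= n ==> continuous_on {a k..e k} (G k)" and k: "k < n"
 shows "left_lim A (snd (xx k)) = G k (e k)"
proof -
 have ek: "e k = snd (xx k)" using k by (simp add: piece_def)
 have "((%r. G (kk r) r) \<longlongrightarrow> G k (e k)) (at_left (e k))"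
  by (rule piecewise_left[OF c]) (use k a_less_e[OF k] in auto)
 moreover have "eventually (%r. G (kk r) r = A r) (at_left (e k))"
  unfolding eventually_at_left_field
 proof (intro exI[of _ "a k"] conjI allI impI)
  fix r assume "a k < r" "r < e k"
  then show "G (kk r) r = A r" using A[of r] a_nonneg[of k] k e_le_T[of k] by simp
 qed (rule a_less_e[OF k])
 ultimately have "(A \<longlongrightarrow> G k (e k)) (at_left (e k))" by (rule Lim_transform_eventually)
 then show ?thesis unfolding left_lim_def ek by (intro tendsto_Lim) simp_all
qed

lemma phi_filter_equation:
 assumes A: "\<And>g r. 0 <= r ==> r <= T ==> A g r = V g (kk r) r" and t: "0 <= t" "t <= T"
 shows "phi_equation_holds A f (Xup t) t"
proof -
 have ll: "left_lim (A h) (snd (xx k)) = V h k (e k)" if k: "k < n" for h k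
  by (rule left_lim_at_point[of "A h" "V h", OF A V_continuous k])
 have c: "(case z of (u, s) => A (%y. f y * (intensity lam u s y - lamQ u s)) s) = Wf f (kk (snd z)) z" if "z \<in> space \<nu> \<times> {0..t}" for z
  using that t by (auto simp: Wf_eq[OF kk_le] A)
 have j: "(\<Sum>(u, s)\<in>#Xup t. left_lim (A (%y. f_new p f u s y * (intensity lam u s y / lamQ u s) - f y)) s * (lamQ u s / (lamQ u s + gam u s))) = (\<Sum>j<kk t. Jphi f j)"
  unfolding sum_upto
  by (rule sum.cong[OF refl], unfold case_prod_beta' Jphi_def, subst ll) (use kk_le[of t] in simp_all)
 show ?thesis
 proof
  show "set_integrable M0 (space \<nu> \<times> {0..t}) (%(u, s). A (%y. f y * (intensity lam u s y - lamQ u s)) s)"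
   by (rule set_LINT_cong(2)[THEN iffD2], rule c, assumption, rule phi_equation(1)[OF t])
  have i: "(LINT x:space \<nu> \<times> {0..t}|M0. (case x of (u, s) => A (%y. f y * (intensity lam u s y - lamQ u s)) s)) = (LINT z:space \<nu> \<times> {0..t}|M0. Wf f (kk (snd z)) z)"
   by (rule set_LINT_cong(1), rule c, assumption)
  show "A f t = A f 0
   - (LINT x:space \<nu> \<times> {0..t}|M0. (case x of (u, s) => A (%y. f y * (intensity lam u s y - lamQ u s)) s))
   + (\<Sum>(u, s)\<in>#Xup t. left_lim (A (%y. f_new p f u s y * (intensity lam u s y / lamQ u s) - f y)) s * (lamQ u s / (lamQ u s + gam u s)))"
   unfolding j i using phi_equation(2)[OF t, of f] A[OF order_refl T, of f] A[OF t, of f] by (simp only: kk_0)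
 qed
qed

lemma pi_filter_equation:
 assumes pos: "V (%_. 1) n T \<noteq> 0" and A: "\<And>g r. 0 <= r ==> r <= T ==> A g r = R g (kk r) r" and t: "0 <= t" "t <= T"
 shows "pi_equation_holds A f (Xup t) t"
proof -
 have ll: "left_lim (A h) (snd (xx k)) = R h k (e k)" if k: "k < n" for h k
  by (rule left_lim_at_point[of "A h" "R h", OF A R_continuous[OF pos] k])
 have c: "(case z of (u, s) => A (%y. f y * intensity lam u s y) s - A f s * A (intensity lam u s) s) = WR f (kk (snd z)) z" if "z \<in> space \<nu> \<times> {0..t}" for z
  using that t by (auto simp: WR_def[OF pos] R_def[OF pos] Vl_eq[OF kk_le] A)
 have j: "(\<Sum>(u, s)\<in>#Xup t. (left_lim (A (%y. f_new p f u s y * intensity lam u s y)) s - left_lim (A (intensity lam u s)) s * left_lim (A f) s)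
     / left_lim (A (%y. intensity lam u s y + gam u s)) s) = (\<Sum>j<kk t. JR f j)"
  unfolding sum_upto
 proof (rule sum.cong[OF refl])
  fix k assume "k \<in> {..<kk t}"
  then have k: "k < n" using kk_le[of t] by simp
  show "(case xx k of (u, s) => (left_lim (A (%y. f_new p f u s y * intensity lam u s y)) s - left_lim (A (intensity lam u s)) s * left_lim (A f) s)
     / left_lim (A (%y. intensity lam u s y + gam u s)) s) = JR f k"
   unfolding case_prod_beta' JR_def[OF pos] ll[OF k] by (rule refl)
 qed
 have i: "(LINT x:space \<nu> \<times> {0..t}|M0. (case x of (u, s) => A (%y. f y * intensity lam u s y) s - A f s * A (intensity lam u s) s)) = (LINT z:space \<nu> \<times> {0..t}|M0. WR f (kk (snd z)) z)"
  by (rule set_LINT_cong(1), rule c, assumption)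
 show ?thesis unfolding j i
  using pi_equation(2)[OF pos t, of f] A[OF order_refl T, of f] A[OF t, of f]
  by (intro conjI set_LINT_cong(2)[THEN iffD2, OF c pi_equation(1)[OF pos t]]) (simp_all only: kk_0)
qed

end

context cluster_model
begin

lemma phi_path:
 assumes w: "w \<in> space Q" "good_path w" and \<Phi>: "\<forall>t\<ge>0. \<Phi> t w = phiX t (Y t w)" and t: "0 <= t"
 shows "phi_equation_holds (filt \<Phi> w) f (Y t w) t"
proof -
 obtain m where m: "t <= real m" using real_arch_simple by blast
 interpret filter_path Q F P \<nu> p gam lamQ N C I D lam L "Y (real m) w" "real m" by (rule good_path_filter_path[OF w])
 have A: "filt \<Phi> w g r = V g (kk r) r" if "0 <= r" "r <= real m" for g r
  using \<Phi> that phiS_V[OF that] by (simp add: filt_def weighted_sum_phiX Y_upto(1)[OF w(1) that(2)])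
 show ?thesis unfolding Y_upto(1)[OF w(1) m] by (rule phi_filter_equation[OF A t m])
qed

lemma pi_path:
 assumes w: "w \<in> space Q" "good_path w" "pos_path w" and \<Psi>: "\<forall>t\<ge>0. \<Psi> t w = phiR t (Y t w)" and t: "0 <= t"
 shows "pi_equation_holds (filt \<Psi> w) f (Y t w) t"
proof -
 obtain m where m: "t <= real m" using real_arch_simple by blast
 interpret filter_path Q F P \<nu> p gam lamQ N C I D lam L "Y (real m) w" "real m" by (rule good_path_filter_path[OF w(1,2)])
 have A: "filt \<Psi> w g r = R g (kk r) r" if "0 <= r" "r <= real m" for g r
  using \<Psi> that phiS_V[OF that] by (simp add: filt_def weighted_sum_phiR Y_upto(1)[OF w(1) that(2)] R_def[OF pos_path_V[OF w]])
 show ?thesis unfolding Y_upto(1)[OF w(1) m] by (rule pi_filter_equation[OF pos_path_V[OF w] A t m])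
qed

lemma phi_equation_AE:
 assumes phi: "is_phi Q \<nu> N C D L \<Phi>" shows "AE w in Q. \<forall>t\<ge>0. phi_equation_holds (filt \<Phi> w) f (Y t w) t"
 by (rule AE_mp[OF phi_explicit[OF phi]], rule AE_mp[OF AE_good_path(1)], intro AE_I2 impI allI, rule phi_path)

lemma pi_equation_AE:
 assumes pi: "is_pi P \<nu> N C D \<Psi>" shows "AE w in P. \<forall>t\<ge>0. pi_equation_holds (filt \<Psi> w) f (Y t w) t"
 by (rule AE_mp[OF pi_explicit[OF pi]], rule AE_mp[OF AE_good_path(2)], rule AE_mp[OF AE_pos_path], intro AE_I2 impI allI, rule pi_path)
   (simp_all only: space_P)

end

theorem theorem2p4:
  fixes Q P :: "'w measure" and \<nu> :: "'e measure" and f :: "'e state \<Rightarrow> real"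
  assumes model: "cluster_model Q F P \<nu> p gam lamQ N C I D lam L"
  shows
    "(\<exists>\<Phi>. is_phi Q \<nu> N C D L \<Phi>) \<and> (\<exists>\<Psi>. is_pi P \<nu> N C D \<Psi>) \<and>
     (\<forall>\<Phi> \<Psi>. is_phi Q \<nu> N C D L \<Phi> \<longrightarrow> is_pi P \<nu> N C D \<Psi> \<longrightarrow>
       (\<forall>t\<ge>0. AE \<omega> in P. filt \<Psi> \<omega> f t = filt \<Phi> \<omega> f t / filt \<Phi> \<omega> (\<lambda>_. 1) t) \<and>
       (AE \<omega> in Q. \<forall>t\<ge>0.
          set_integrable (mark_time \<nu>) (space \<nu> \<times> {0..t})
            (\<lambda>(u, s). filt \<Phi> \<omega> (\<lambda>y. f y * (intensity lam u s y - lamQ u s)) s) \<and>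
          filt \<Phi> \<omega> f t = filt \<Phi> \<omega> f 0
            - (LINT x:space \<nu> \<times> {0..t}|mark_time \<nu>. (case x of (u, s) \<Rightarrow>
                 filt \<Phi> \<omega> (\<lambda>y. f y * (intensity lam u s y - lamQ u s)) s))
            + (\<Sum>(u, s) \<in># obs N C t \<omega>.
                 filt_left \<Phi> \<omega> (\<lambda>y. f_new p f u s y * (intensity lam u s y / lamQ u s) - f y) s
                 * (lamQ u s / (lamQ u s + gam u s)))) \<and>
       (AE \<omega> in P. \<forall>t\<ge>0.
          set_integrable (mark_time \<nu>) (space \<nu> \<times> {0..t})
            (\<lambda>(u, s). filt \<Psi> \<omega> (\<lambda>y. f y * intensity lam u s y) s - filt \<Psi> \<omega> f s * filt \<Psi> \<omega> (intensity lam u s) s) \<and>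
          filt \<Psi> \<omega> f t = filt \<Psi> \<omega> f 0
            + (\<Sum>(u, s) \<in># obs N C t \<omega>.
                 (filt_left \<Psi> \<omega> (\<lambda>y. f_new p f u s y * intensity lam u s y) s
                  - filt_left \<Psi> \<omega> (intensity lam u s) s * filt_left \<Psi> \<omega> f s)
                 / filt_left \<Psi> \<omega> (\<lambda>y. intensity lam u s y + gam u s) s)
            - (LINT x:space \<nu> \<times> {0..t}|mark_time \<nu>. (case x of (u, s) \<Rightarrow>
                 filt \<Psi> \<omega> (\<lambda>y. f y * intensity lam u s y) s - filt \<Psi> \<omega> f s * filt \<Psi> \<omega> (intensity lam u s) s))))"
proof -
 interpret cluster_model Q F P \<nu> p gam lamQ N C I D lam L by (rule model)
 show ?thesis unfolding filt_left_def
 proof (intro conjI allI impI)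
  show "\<exists>\<Phi>. is_phi Q \<nu> N C D L \<Phi>" using is_phi_explicit by blast
  show "\<exists>\<Psi>. is_pi P \<nu> N C D \<Psi>" using is_pi_explicit by blast
  fix \<Phi> \<Psi> assume phi: "is_phi Q \<nu> N C D L \<Phi>" and pi: "is_pi P \<nu> N C D \<Psi>"
  show "AE \<omega> in P. filt \<Psi> \<omega> f t = filt \<Phi> \<omega> f t / filt \<Phi> \<omega> (\<lambda>_. 1) t" if "0 \<le> t" for t
   using phi_explicit_P[OF phi that] pi_explicit[OF pi]
   by eventually_elim (use that in \<open>simp add: filt_def weighted_sum_phiX weighted_sum_phiR\<close>)
 qed (erule phi_equation_AE, erule pi_equation_AE)
qed

end
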